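(* Let $N\ge 1$, let $\Omega\subset\mathbb{R}^N$ be a bounded Lipschitz domain, let $s\in(0,1)$ and $\alpha\in(0,1)$. Let $q\in L^\infty(\Omega)$ with $q\ge 0$ in $\Omega$, and assume that there exist an open subset $O$ of $\Omega$ (nonempty) and a constant $q_0>0$ such that $q\ge q_0$ a.e. in $O$. For $T>0$ consider the problem $$(P_T)\qquad \begin{cases} u_t+(-\Delta)^s u=q(x)|u|^{\alpha-1}u & \text{in }(0,T)\times\Omega,\\ u=0 & \text{in }(0,T)\times(\mathbb{R}^N\setminus\Omega),\\ u=0&\text{at }t=0.\end{cases}$$ Then there exists $T>0$ such that $(P_T)$ has a nontrivial nonnegative bounded finite energy solution $u$. Moreover, for any $\tau>0$, the function $\tilde u$ defined by $\tilde u(t,x)=0$ for $t\in(0,\tau]$ and $\tilde u(t,x)=u(t-\tau,x)$ for $t\in(\tau,T+\tau)$ is a nontrivial nonnegative bounded finite energy solution of $(P_{T+\tau})$, i.e. of the same problem with $(0,T)$ replaced by $(0,T+\tau)$.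
   Context: Notation. $X_0^s(\Omega)=\{u\in H^s(\mathbb{R}^N): u=0 \text{ a.e. in }\mathbb{R}^N\setminus\Omega\}$, where $H^s(\mathbb{R}^N)$ is the space of $u\in L^2(\mathbb{R}^N)$ with $\iint_{\mathbb{R}^N\times\mathbb{R}^N}\frac{|u(x)-u(y)|^2}{|x-y|^{N+2s}}\,dx\,dy<+\infty$. It is a separable Hilbert space with scalar product $$\mathcal{E}(u,v)=\frac{c_{N,s}}{2}\iint_{\mathbb{R}^N\times\mathbb{R}^N}\frac{(u(x)-u(y))(v(x)-v(y))}{|x-y|^{N+2s}}\,dx\,dy,\qquad c_{N,s}=\frac{s2^{2s}\Gamma(\frac{N+2s}{2})}{\pi^{N/2}\Gamma(1-s)},$$ and norm $\|u\|_{X_0^s(\Omega)}=\mathcal{E}(u,u)^{1/2}$. $(X_0^s(\Omega))^*$ is its dual, $\langle\cdot,\cdot\rangle$ the duality pairing between $(X_0^s(\Omega))^*$ and $X_0^s(\Omega)$; one uses the Gelfand triple $X_0^s(\Omega)\hookrightarrow L^2(\Omega)\hookrightarrow (X_0^s(\Omega))^*$, so that $\langle u,v\rangle=\int_\Omega uv\,dx$ for $u\in L^2(\Omega)$, $v\in X_0^s(\Omega)$. $L^2((0,T)\to X_0^s(\Omega))$ and $L^2((0,T)\to (X_0^s(\Omega))^* )$ are the usual Bochner spaces. For $u\in L^2((0,T)\to X_0^s(\Omega))$, $u_t$ denotes the distributional time derivative; $u_t\in L^2((0,T)\to(X_0^s(\Omega))^* )$ means that there is an element $u_t$ of this space with $\int_0^T\langle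 u_t(t),v\rangle\varphi(t)\,dt=-\int_0^T\big(\int_\Omega u(t,x)v(x)\,dx\big)\varphi'(t)\,dt$ for all $v\in X_0^s(\Omega)$, $\varphi\in C_0^\infty(0,T)$. In that case $u\in C([0,T]\to L^2(\Omega))$ (after modification on a null set of times). Finite energy solution of $(P_T)$: a function $u$ such that $u\in L^2((0,T)\to X_0^s(\Omega))$, $u_t\in L^2((0,T)\to(X_0^s(\Omega))^* )$, $\|u(t,\cdot)\|_{L^2(\Omega)}\to0$ as $t\to0+$, and $$\int_0^T\langle u_t(t),\varphi(t,\cdot)\rangle\,dt+\int_0^T\mathcal{E}(u(t,\cdot),\varphi(t,\cdot))\,dt=\int_0^T\int_\Omega q(x)|u(t,x)|^{\alpha-1}u(t,x)\varphi(t,x)\,dx\,dt$$ for all $\varphi\in L^2((0,T)\to X_0^s(\Omega))$. The expression $|u|^{\alpha-1}u$ is understood as $0$ where $u=0$. "Bounded" means essentially bounded on $(0,T)\times\Omega$; "nontrivial" means not a.e. equal to zero. *)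

theory Defs
  imports "HOL-Analysis.Analysis"
begin

text \<open>
  Elements of function spaces are represented by functions instead of classes modulo null sets.
\<close>

section \<open>Domains and Lebesgue spaces\<close>

text \<open>
  Near each boundary point, \<open>\<Omega>\<close> is the strict epigraph, in the direction of a unit vector
  \<open>\<nu>\<close>, of a Lipschitz function \<open>g\<close> on the hyperplane orthogonal to \<open>\<nu>\<close>; the point
  \<open>y - (y \<bullet> \<nu>) *\<^sub>R \<nu>\<close> is the orthogonal projection of \<open>y\<close> to that hyperplane.
  It follows that the boundary is locally the graph of \<open>g\<close>.  In dimension one the hyperplane is
  \<open>{0}\<close>, and the domains are the bounded open intervals.
\<close>

definition bounded_lipschitz_domain :: "(real ^ 'n) set \<Rightarrow> bool" where
  "bounded_lipschitz_domain \<Omega> \<longleftrightarrow>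
     open \<Omega> \<and> connected \<Omega> \<and> \<Omega> \<noteq> {} \<and> bounded \<Omega> \<and>
     (\<forall>x\<in>frontier \<Omega>. \<exists>r>0. \<exists>\<nu> g L. norm \<nu> = 1 \<and> L-lipschitz_on {z. z \<bullet> \<nu> = 0} g \<and>
        \<Omega> \<inter> ball x r = {y \<in> ball x r. g (y - (y \<bullet> \<nu>) *\<^sub>R \<nu>) < y \<bullet> \<nu>})"

definition L_inf :: "'a measure \<Rightarrow> ('a \<Rightarrow> real) set" where
  "L_inf M = {f \<in> borel_measurable M. \<exists>C. AE x in M. \<bar>f x\<bar> \<le> C}"

definition L2 :: "'a measure \<Rightarrow> ('a \<Rightarrow> real) set" where
  "L2 M = {f \<in> borel_measurable M. integrable M (\<lambda>x. (f x)\<^sup>2)}"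

definition L2_norm :: "'a measure \<Rightarrow> ('a \<Rightarrow> real) \<Rightarrow> real" where
  "L2_norm M f = sqrt (LINT x|M. (f x)\<^sup>2)"

section \<open>The fractional Sobolev space and its dual\<close>

definition Hs :: "real \<Rightarrow> (real ^ 'n \<Rightarrow> real) set" where
  "Hs s = {u \<in> L2 lebesgue.
     integrable lebesgue
       (\<lambda>(x, y). \<bar>u x - u y\<bar>\<^sup>2 / norm (x - y) powr (real CARD('n) + 2 * s))}"

definition X0s :: "(real ^ 'n) set \<Rightarrow> real \<Rightarrow> (real ^ 'n \<Rightarrow> real) set" where
  "X0s \<Omega> s = {u \<in> Hs s. AE x in lebesgue_on (- \<Omega>). u x = 0}"

definition c_frac :: "nat \<Rightarrow> real \<Rightarrow> real" where
  "c_frac N s = s * 2 powr (2 * s) * Gamma ((real N + 2 * s) / 2)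
                 / (pi powr (real N / 2) * Gamma (1 - s))"

definition energy :: "real \<Rightarrow> (real ^ 'n \<Rightarrow> real) \<Rightarrow> (real ^ 'n \<Rightarrow> real) \<Rightarrow> real" where
  "energy s u v = c_frac CARD('n) s / 2 *
     (LINT (x, y)|lebesgue.
        (u x - u y) * (v x - v y) / norm (x - y) powr (real CARD('n) + 2 * s))"

definition X0s_norm :: "real \<Rightarrow> (real ^ 'n \<Rightarrow> real) \<Rightarrow> real" where
  "X0s_norm s u = sqrt (energy s u u)"

text \<open>
  Functionals are applied to representatives; the bound by the norm forces equal values on
  representatives of the same class.  Values outside \<open>X0s \<Omega> s\<close> are irrelevant.
\<close>

definition X0s_dual :: "(real ^ 'n) set \<Rightarrow> real \<Rightarrow> ((real ^ 'n \<Rightarrow> real) \<Rightarrow> real) set" where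
  "X0s_dual \<Omega> s = {F.
     (\<forall>v\<in>X0s \<Omega> s. \<forall>w\<in>X0s \<Omega> s. F (\<lambda>x. v x + w x) = F v + F w) \<and>
     (\<forall>v\<in>X0s \<Omega> s. \<forall>c. F (\<lambda>x. c * v x) = c * F v) \<and>
     (\<exists>C. \<forall>v\<in>X0s \<Omega> s. \<bar>F v\<bar> \<le> C * X0s_norm s v)}"

definition X0s_dual_norm ::
    "(real ^ 'n) set \<Rightarrow> real \<Rightarrow> ((real ^ 'n \<Rightarrow> real) \<Rightarrow> real) \<Rightarrow> real" where
  "X0s_dual_norm \<Omega> s F = (SUP v \<in> {v \<in> X0s \<Omega> s. X0s_norm s v \<le> 1}. \<bar>F v\<bar>)"

section \<open>Bochner spaces\<close>

text \<open>
  Square-integrable functions with values in a space \<open>V\<close> of real functions with (semi)norm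
  \<open>p\<close>.  Strong measurability is almost everywhere approximability by \<open>V\<close>-valued
  simple functions.  This is instantiated both with \<open>X0s\<close> and with its dual, which are not types.
\<close>

definition strongly_measurable ::
    "'t measure \<Rightarrow> ('b \<Rightarrow> real) set \<Rightarrow> (('b \<Rightarrow> real) \<Rightarrow> real) \<Rightarrow> ('t \<Rightarrow> 'b \<Rightarrow> real) \<Rightarrow> bool" where
  "strongly_measurable M V p f \<longleftrightarrow>
     (\<exists>S :: nat \<Rightarrow> 't \<Rightarrow> 'b \<Rightarrow> real.
        (\<forall>i. simple_function M (S i) \<and> S i ` space M \<subseteq> V) \<and>
        (AE t in M. (\<lambda>i. p (\<lambda>b. S i t b - f t b)) \<longlonglongrightarrow> 0))"

definition bochner_L2 ::
    "'t measure \<Rightarrow> ('b \<Rightarrow> real) set \<Rightarrow> (('b \<Rightarrow> real) \<Rightarrow> real) \<Rightarrow> ('t \<Rightarrow> 'b \<Rightarrow> real) set" where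
  "bochner_L2 M V p = {f. (AE t in M. f t \<in> V) \<and> strongly_measurable M V p f \<and>
                          integrable M (\<lambda>t. (p (f t))\<^sup>2)}"

abbreviation L2_X0s :: "(real ^ 'n) set \<Rightarrow> real \<Rightarrow> real \<Rightarrow> (real \<Rightarrow> real ^ 'n \<Rightarrow> real) set" where
  "L2_X0s \<Omega> s T \<equiv> bochner_L2 (lebesgue_on {0<..<T}) (X0s \<Omega> s) (X0s_norm s)"

abbreviation L2_X0s_dual ::
    "(real ^ 'n) set \<Rightarrow> real \<Rightarrow> real \<Rightarrow> (real \<Rightarrow> (real ^ 'n \<Rightarrow> real) \<Rightarrow> real) set" where
  "L2_X0s_dual \<Omega> s T \<equiv> bochner_L2 (lebesgue_on {0<..<T}) (X0s_dual \<Omega> s) (X0s_dual_norm \<Omega> s)"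

definition test_functions :: "real \<Rightarrow> (real \<Rightarrow> real) set" where
  "test_functions T = {\<phi>. (\<forall>k t. (deriv ^^ k) \<phi> differentiable at t) \<and>
     compact (closure {t. \<phi> t \<noteq> 0}) \<and> closure {t. \<phi> t \<noteq> 0} \<subseteq> {0<..<T}}"

definition is_time_derivative ::
    "(real ^ 'n) set \<Rightarrow> real \<Rightarrow> real \<Rightarrow> (real \<Rightarrow> real ^ 'n \<Rightarrow> real) \<Rightarrow>
     (real \<Rightarrow> (real ^ 'n \<Rightarrow> real) \<Rightarrow> real) \<Rightarrow> bool" where
  "is_time_derivative \<Omega> s T u u\<^sub>t \<longleftrightarrow>
     (\<forall>v\<in>X0s \<Omega> s. \<forall>\<phi>\<in>test_functions T.
        (LINT t|lebesgue_on {0<..<T}. u\<^sub>t t v * \<phi> t) =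
        - (LINT t|lebesgue_on {0<..<T}. (LINT x|lebesgue_on \<Omega>. u t x * v x) * deriv \<phi> t))"

section \<open>Solutions\<close>

text \<open>
  The initial condition is stated pointwise in time; it selects, near \<open>t = 0\<close>, a representative
  of the class of \<open>u\<close>, such as the continuous one.  Membership in \<open>L2\<close> is
  required because \<open>L2_norm\<close> has a junk value outside \<open>L2\<close>.  Since \<open>0 powr a = 0\<close>, the
  nonlinearity vanishes where \<open>u\<close> does.  The time derivative is unique almost everywhere,
  so it may be quantified existentially.
\<close>

definition finite_energy_solution ::
    "(real ^ 'n) set \<Rightarrow> real \<Rightarrow> real \<Rightarrow> (real ^ 'n \<Rightarrow> real) \<Rightarrow> real \<Rightarrow>
     (real \<Rightarrow> real ^ 'n \<Rightarrow> real) \<Rightarrow> bool" where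
  "finite_energy_solution \<Omega> s \<alpha> q T u \<longleftrightarrow>
     u \<in> L2_X0s \<Omega> s T \<and>
     (\<forall>\<^sub>F t in at_right 0. u t \<in> L2 (lebesgue_on \<Omega>)) \<and>
     ((\<lambda>t. L2_norm (lebesgue_on \<Omega>) (u t)) \<longlongrightarrow> 0) (at_right 0) \<and>
     (\<exists>u\<^sub>t\<in>L2_X0s_dual \<Omega> s T. is_time_derivative \<Omega> s T u u\<^sub>t \<and>
        (\<forall>\<phi>\<in>L2_X0s \<Omega> s T.
           (LINT t|lebesgue_on {0<..<T}. u\<^sub>t t (\<phi> t)) +
           (LINT t|lebesgue_on {0<..<T}. energy s (u t) (\<phi> t)) =
           (LINT t|lebesgue_on {0<..<T}. LINT x|lebesgue_on \<Omega>.
              q x * (\<bar>u t x\<bar> powr (\<alpha> - 1) * u t x) * \<phi> t x)))"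

definition nontrivial_nonneg_bounded ::
    "(real ^ 'n) set \<Rightarrow> real \<Rightarrow> (real \<Rightarrow> real ^ 'n \<Rightarrow> real) \<Rightarrow> bool" where
  "nontrivial_nonneg_bounded \<Omega> T u \<longleftrightarrow>
     \<not> (AE (t, x) in lebesgue_on ({0<..<T} \<times> \<Omega>). u t x = 0) \<and>
     (AE (t, x) in lebesgue_on ({0<..<T} \<times> \<Omega>). 0 \<le> u t x) \<and>
     (\<lambda>(t, x). u t x) \<in> L_inf (lebesgue_on ({0<..<T} \<times> \<Omega>))"

definition time_shift :: "real \<Rightarrow> (real \<Rightarrow> 'a \<Rightarrow> real) \<Rightarrow> real \<Rightarrow> 'a \<Rightarrow> real" where
  "time_shift \<tau> u = (\<lambda>t x. if t \<le> \<tau> then 0 else u (t - \<tau>) x)"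

end

theory Submission
  imports Defs "HOL-Library.Function_Algebras"
begin

text \<open>
  The zero function solves the problem, so a nontrivial solution has to come from the failure of
  uniqueness at \<open>u = 0\<close>: since \<open>\<alpha> < 1\<close>, the scalar equation \<open>y' = y powr \<alpha>\<close> leaves the value \<open>0\<close>
  along a multiple of \<open>t powr (1 / (1 - \<alpha>))\<close>.  The solution is obtained by monotone iteration upwards
  from a subsolution that has exactly this growth in time.

  The subsolution is \<open>w t = c * t powr \<beta> * \<phi>\<close> with \<open>\<beta> = 1 / (1 - \<alpha>)\<close>, so that time
  derivative and reaction are both of order \<open>t powr (\<alpha> * \<beta>)\<close>.  The profile \<open>\<phi>\<close> is a
  power \<open>g ^ k\<close> of the function with \<open>g + (-\<Delta>)\<^sup>s g = 1\<close> in the set \<open>O'\<close> where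
  \<open>q\<close> is bounded below, extended by zero.  Convexity of the power gives
  \<open>(-\<Delta>)\<^sup>s (g ^ k) \<le> k * g ^ (k - 1)\<close>, and for large \<open>k\<close> the right-hand side is at most
  \<open>k * \<phi> powr \<alpha>\<close> (\<open>subsolution_profile\<close>).  For small \<open>c\<close> the reaction then dominates
  (\<open>subsolution_rothe\<close>).

  The linear problem with given forcing is solved by the implicit Euler scheme in a Gelfand triple.
  If the forcing is Hoelder continuous in time and vanishes at \<open>t = 0\<close>, halving the step changes
  the scheme by a geometrically small amount in the energy norm (\<open>rothe_refine\<close>).  The limit is
  therefore continuous in time with values in the energy space and satisfies the weak equation at every
  time, with a derivative in the ordinary sense (\<open>sol_derivative\<close>).  Order is preserved because each
  step obeys the maximum principle (\<open>max_principle\<close>), which rests on the fact that truncation is monotone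
  and does not increase differences.

  The Picard operator solves the linear problem with the reaction of a given path as forcing.  It preserves
  order and, because the reaction is sublinear, it maps the paths with suitable bounds on size and on
  time regularity to themselves (\<open>picard_state\<close>).  The iterates of the subsolution increase.
  A bounded increasing sequence converges in \<open>L\<^sup>2\<close>, and equicontinuity in time makes the convergence
  uniform; Hoelder continuity of the reaction upgrades it to uniform convergence in the energy norm
  (\<open>monotone_iteration\<close>).  The limit is a fixed point that lies above the subsolution, hence is
  nontrivial at every positive time.

  It remains to pass to the required notion of solution.  The fixed point is a curve that is continuous
  in the energy space and satisfies the weak equation pointwise in time (\<open>classical\<close>).  For
  such curves the delay by \<open>\<tau>\<close> is elementary, because the equation holds trivially at the junction, where
  both the function and its derivative vanish (\<open>classical_shift\<close>), and integration in time yields a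
  finite energy solution (\<open>classical_finite_energy\<close>).  Joint measurability in \<open>(t, x)\<close> is
  achieved by the choice of a representative (\<open>joint_rep\<close>).
\<close>

section \<open>Semi-inner products on subspaces of function spaces\<close>

instantiation "fun" :: (type, real_vector) real_vector
begin
definition "c *\<^sub>R f = (\<lambda>x. c *\<^sub>R f x)"
instance
  by standard (simp_all add: fun_eq_iff scaleR_fun_def scaleR_add_right scaleR_add_left)
end

lemma scaleR_fun_apply [simp]: "(c *\<^sub>R f) x = c *\<^sub>R f x"
  by (simp add: scaleR_fun_def)

text \<open>
  Functions that agree almost everywhere are different elements of a function type.  The forms met below
  are therefore only positive semidefinite, and only bilinear on a subspace, which is why they are treated
  in a locale and not through the class of inner product spaces.
\<close>
locale semi_inner =
  fixes S :: "'v::real_vector set" and b :: "'v \<Rightarrow> 'v \<Rightarrow> real"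
  assumes subsp: "subspace S"
    and add_left: "\<lbrakk>u \<in> S; v \<in> S; w \<in> S\<rbrakk> \<Longrightarrow> b (u + v) w = b u w + b v w"
    and scale_left: "\<lbrakk>u \<in> S; w \<in> S\<rbrakk> \<Longrightarrow> b (c *\<^sub>R u) w = c * b u w"
    and sym: "\<lbrakk>u \<in> S; w \<in> S\<rbrakk> \<Longrightarrow> b u w = b w u"
    and nonneg: "u \<in> S \<Longrightarrow> 0 \<le> b u u"
begin

definition nrm :: "'v \<Rightarrow> real" where "nrm u = sqrt (b u u)"

lemma S_zero [simp]: "0 \<in> S" using subsp by (rule subspace_0)
lemma S_add [simp]: "\<lbrakk>u \<in> S; v \<in> S\<rbrakk> \<Longrightarrow> u + v \<in> S" using subsp by (rule subspace_add)
lemma S_diff [simp]: "\<lbrakk>u \<in> S; v \<in> S\<rbrakk> \<Longrightarrow> u - v \<in> S" using subsp by (rule subspace_diff)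
lemma S_scale [simp]: "u \<in> S \<Longrightarrow> c *\<^sub>R u \<in> S" using subsp by (rule subspace_scale)
lemma S_minus [simp]: "u \<in> S \<Longrightarrow> - u \<in> S" using subsp by (rule subspace_neg)

lemma S_sum: "(\<And>i. i \<in> I \<Longrightarrow> x i \<in> S) \<Longrightarrow> sum x I \<in> S"
  using subsp by (rule subspace_sum)

lemma add_right: "\<lbrakk>u \<in> S; v \<in> S; w \<in> S\<rbrakk> \<Longrightarrow> b w (u + v) = b w u + b w v"
  by (simp add: sym[of w] add_left)

lemma scale_right: "\<lbrakk>u \<in> S; w \<in> S\<rbrakk> \<Longrightarrow> b w (c *\<^sub>R u) = c * b w u"
  by (simp add: sym[of w] scale_left)

lemma minus_left: "\<lbrakk>u \<in> S; w \<in> S\<rbrakk> \<Longrightarrow> b (- u) w = - b u w"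
  using scale_left[of u w "-1"] by simp

lemma minus_right: "\<lbrakk>u \<in> S; w \<in> S\<rbrakk> \<Longrightarrow> b w (- u) = - b w u"
  using scale_right[of u w "-1"] by simp

lemma diff_left: "\<lbrakk>u \<in> S; v \<in> S; w \<in> S\<rbrakk> \<Longrightarrow> b (u - v) w = b u w - b v w"
  using add_left[of u "- v" w] by (simp add: minus_left)

lemma diff_right: "\<lbrakk>u \<in> S; v \<in> S; w \<in> S\<rbrakk> \<Longrightarrow> b w (u - v) = b w u - b w v"
  by (simp add: sym[of w] diff_left)

lemma zero_left: "w \<in> S \<Longrightarrow> b 0 w = 0"
  using scale_left[of 0 w 0] by simp

lemma zero_right: "w \<in> S \<Longrightarrow> b w 0 = 0"
  using scale_right[of 0 w 0] by simp

lemmas bilin = add_left add_right diff_left diff_right scale_left scale_right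
  minus_left minus_right zero_left zero_right

lemma young:
  assumes "u \<in> S" "v \<in> S" "0 < l"
  shows "2 * b u v \<le> l * b u u + b v v / l"
proof -
  have "0 \<le> b (l *\<^sub>R u - v) (l *\<^sub>R u - v)" using assms by (intro nonneg) simp
  also have "\<dots> = l * (l * b u u) - 2 * (l * b u v) + b v v"
    using assms by (simp add: bilin sym[of v u] algebra_simps)
  finally have "l * (2 * b u v) \<le> l * (l * b u u + b v v / l)" using assms(3) by (simp add: algebra_simps)
  thus ?thesis using assms(3) by (simp only: mult_le_cancel_left_pos)
qed

lemma cauchy_schwarz_sq:
  assumes "u \<in> S" "v \<in> S" shows "(b u v)\<^sup>2 \<le> b u u * b v v"
proof (cases "b v v = 0")
  case True
  have "b u v = 0"
  proof (rule ccontr)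
    assume n: "b u v \<noteq> 0"
    define l where "l = (b u u + 1) / (2 * b u v)"
    have "0 \<le> b (u - l *\<^sub>R v) (u - l *\<^sub>R v)" using assms by (intro nonneg) simp
    also have "\<dots> = b u u - 2 * l * b u v"
      using assms True by (simp add: bilin sym[of v u] algebra_simps)
    also have "2 * l * b u v = b u u + 1" using n by (simp add: l_def)
    finally show False by simp
  qed
  thus ?thesis using True by simp
next
  case False
  hence p: "0 < b v v" using nonneg[OF assms(2)] by simp
  define l where "l = b u v / b v v"
  have "0 \<le> b (u - l *\<^sub>R v) (u - l *\<^sub>R v)" using assms by (intro nonneg) simp
  also have "\<dots> = b u u - 2 * l * b u v + l * (l * b v v)"
    using assms by (simp add: bilin sym[of v u] algebra_simps)
  also have "\<dots> = b u u - (b u v)\<^sup>2 / b v v" using p by (simp add: l_def power2_eq_square)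
  finally show ?thesis using p by (simp add: field_simps)
qed

lemma nrm_nonneg [simp]: "u \<in> S \<Longrightarrow> 0 \<le> nrm u" by (simp add: nrm_def nonneg)
lemma nrm_sq: "u \<in> S \<Longrightarrow> (nrm u)\<^sup>2 = b u u" by (simp add: nrm_def nonneg)

lemma cauchy_schwarz:
  assumes "u \<in> S" "v \<in> S" shows "\<bar>b u v\<bar> \<le> nrm u * nrm v"
  unfolding nrm_def using real_sqrt_le_mono[OF cauchy_schwarz_sq[OF assms]]
  by (simp add: real_sqrt_mult)

lemma nrm_add: assumes "u \<in> S" "v \<in> S" shows "nrm (u + v) \<le> nrm u + nrm v"
proof (rule power2_le_imp_le)
  have "(nrm (u + v))\<^sup>2 = b u u + 2 * b u v + b v v"
    using assms by (simp add: nrm_sq bilin sym[of v u])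
  also have "\<dots> \<le> b u u + 2 * (nrm u * nrm v) + b v v"
    using cauchy_schwarz[OF assms] by simp
  also have "\<dots> = (nrm u + nrm v)\<^sup>2"
    using assms by (simp add: power2_sum nrm_sq algebra_simps)
  finally show "(nrm (u + v))\<^sup>2 \<le> (nrm u + nrm v)\<^sup>2" .
qed (use assms in simp)

lemma nrm_minus: "u \<in> S \<Longrightarrow> nrm (- u) = nrm u" by (simp add: nrm_def bilin)
lemma nrm_zero [simp]: "nrm 0 = 0" by (simp add: nrm_def zero_left)
lemma nrm_diff_commute: "\<lbrakk>u \<in> S; v \<in> S\<rbrakk> \<Longrightarrow> nrm (u - v) = nrm (v - u)"
  using nrm_minus[of "u - v"] by simp
lemma nrm_diff: "\<lbrakk>u \<in> S; v \<in> S\<rbrakk> \<Longrightarrow> nrm (u - v) \<le> nrm u + nrm v"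
  using nrm_add[of u "- v"] by (simp add: nrm_minus)
lemma nrm_triangle: "\<lbrakk>u \<in> S; v \<in> S; w \<in> S\<rbrakk> \<Longrightarrow> nrm (u - w) \<le> nrm (u - v) + nrm (v - w)"
  using nrm_add[of "u - v" "v - w"] by simp
lemma nrm_reverse: "\<lbrakk>u \<in> S; v \<in> S\<rbrakk> \<Longrightarrow> \<bar>nrm u - nrm v\<bar> \<le> nrm (u - v)"
  using nrm_add[of "u - v" v] nrm_add[of "v - u" u] nrm_diff_commute[of u v] by simp

lemma nrm_sum: "(\<And>i. i \<in> I \<Longrightarrow> x i \<in> S) \<Longrightarrow> nrm (sum x I) \<le> (\<Sum>i\<in>I. nrm (x i))"
proof (induction I rule: infinite_finite_induct)
  case (insert i I)
  thus ?case using nrm_add[of "x i" "sum x I"] by (simp add: S_sum)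
qed auto

lemma sq_sum_le:
  assumes "\<And>i. i < n \<Longrightarrow> x i \<in> S"
  shows "b (\<Sum>i<n. x i) (\<Sum>i<n. x i) \<le> real n * (\<Sum>i<n. b (x i) (x i))"
proof -
  have "b (\<Sum>i<n. x i) (\<Sum>i<n. x i) = (nrm (\<Sum>i<n. x i))\<^sup>2"
    by (rule nrm_sq[symmetric], rule S_sum) (use assms in simp)
  also have "\<dots> \<le> (\<Sum>i<n. nrm (x i))\<^sup>2"
    using assms by (intro power_mono nrm_sum nrm_nonneg S_sum) auto
  also have "\<dots> \<le> (\<Sum>i<n. (nrm (x i))\<^sup>2) * real (card {..<n})"
    by (rule sum_squared_le_sum_of_squares)
  finally show ?thesis using assms by (simp add: nrm_sq mult.commute)
qed

lemma b_tendsto: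
  assumes "\<And>n. X n \<in> S" "L \<in> S" "v \<in> S" "(\<lambda>n. nrm (X n - L)) \<longlonglongrightarrow> 0"
  shows "(\<lambda>n. b (X n) v) \<longlonglongrightarrow> b L v"
proof -
  have "(\<lambda>n. b (X n) v - b L v) \<longlonglongrightarrow> 0"
  proof (rule Lim_null_comparison)
    show "\<forall>\<^sub>F n in sequentially. norm (b (X n) v - b L v) \<le> nrm (X n - L) * nrm v"
      using cauchy_schwarz[of "X _ - L" v] assms by (simp add: diff_left)
    show "(\<lambda>n. nrm (X n - L) * nrm v) \<longlonglongrightarrow> 0"
      using tendsto_mult_left_zero[OF assms(4)] by simp
  qed
  thus ?thesis by (simp add: LIM_zero_iff)
qed

lemma nrm_tendsto:
  assumes "\<And>n. X n \<in> S" "L \<in> S" "(\<lambda>n. nrm (X n - L)) \<longlonglongrightarrow> 0"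
  shows "(\<lambda>n. nrm (X n)) \<longlonglongrightarrow> nrm L"
proof -
  have "(\<lambda>n. nrm (X n) - nrm L) \<longlonglongrightarrow> 0"
    by (rule Lim_null_comparison[OF _ assms(3)]) (use nrm_reverse assms in simp)
  thus ?thesis by (simp add: LIM_zero_iff)
qed

lemma sq_tendsto:
  assumes "\<And>n. X n \<in> S" "L \<in> S" "(\<lambda>n. nrm (X n - L)) \<longlonglongrightarrow> 0"
  shows "(\<lambda>n. b (X n) (X n)) \<longlonglongrightarrow> b L L"
  using tendsto_power[OF nrm_tendsto[OF assms], of 2] assms by (simp add: nrm_sq)

end

text \<open>
  Limits are determined only up to elements of zero seminorm.
\<close>
locale complete_semi_inner = semi_inner +
  assumes complete: "\<lbrakk>\<And>n. X n \<in> S; \<And>\<epsilon>. 0 < \<epsilon> \<Longrightarrow> \<exists>N. \<forall>i\<ge>N. \<forall>j\<ge>N. nrm (X i - X j) < \<epsilon>\<rbrakk>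
     \<Longrightarrow> \<exists>L\<in>S. (\<lambda>n. nrm (X n - L)) \<longlonglongrightarrow> 0"
begin

text \<open>
  The functional \<open>J u = b u u - 2 * l u\<close> is bounded below, and by the parallelogram identity its minimising
  sequences are Cauchy.  The vanishing of the first variation at a minimiser is the claimed identity.
\<close>
lemma riesz:
  assumes ladd: "\<And>u v. \<lbrakk>u \<in> S; v \<in> S\<rbrakk> \<Longrightarrow> l (u + v) = l u + l v"
    and lscale: "\<And>c u. u \<in> S \<Longrightarrow> l (c *\<^sub>R u) = c * l u"
    and bound: "\<And>u. u \<in> S \<Longrightarrow> \<bar>l u\<bar> \<le> C * nrm u"
  shows "\<exists>u\<in>S. \<forall>v\<in>S. b u v = l v"
proof -
  define J where "J u = b u u - 2 * l u" for u
  define I where "I = Inf (J ` S)"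
  have low: "- C\<^sup>2 \<le> J u" if "u \<in> S" for u
  proof -
    have "2 * l u \<le> 2 * (C * nrm u)" using bound[OF that] by simp
    also have "\<dots> \<le> (nrm u)\<^sup>2 + C\<^sup>2"
      using zero_le_power2[of "nrm u - C"] by (simp add: power2_eq_square algebra_simps)
    finally show ?thesis using that by (simp add: J_def nrm_sq)
  qed
  have bdd: "bdd_below (J ` S)" using low by (auto intro!: bdd_belowI)
  have I_le: "I \<le> J u" if "u \<in> S" for u unfolding I_def by (rule cInf_lower[OF _ bdd]) (use that in simp)
  have "\<exists>u\<in>S. J u < I + 1 / real (Suc n)" for n
  proof -
    have "Inf (J ` S) < I + 1 / real (Suc n)" by (simp add: I_def)
    hence "\<exists>y\<in>J ` S. y < I + 1 / real (Suc n)"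
      using cInf_lessD[of "J ` S"] S_zero by blast
    thus ?thesis by blast
  qed
  then obtain X where X: "\<And>n. X n \<in> S" "\<And>n. J (X n) < I + 1 / real (Suc n)" by metis
  have par: "b (u - v) (u - v) \<le> 2 * (J u - I) + 2 * (J v - I)" if "u \<in> S" "v \<in> S" for u v
  proof -
    have "4 * I \<le> 4 * J ((1/2) *\<^sub>R (u + v))" using I_le that by simp
    also have "\<dots> = b u u + 2 * b u v + b v v - 4 * (l u + l v)"
      using that by (simp add: J_def bilin lscale ladd sym[of v u] algebra_simps)
    finally show ?thesis using that by (simp add: J_def bilin sym[of v u] algebra_simps)
  qed
  have "\<exists>L\<in>S. (\<lambda>n. nrm (X n - L)) \<longlonglongrightarrow> 0"
  proof (rule complete[OF X(1)])
    fix \<epsilon> :: real assume e: "0 < \<epsilon>"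
    obtain N where N: "4 / \<epsilon>\<^sup>2 < real N" using reals_Archimedean2 by blast
    have "nrm (X i - X j) < \<epsilon>" if "i \<ge> N" "j \<ge> N" for i j
    proof -
      have N0: "0 < real N" using N e by (smt (verit) divide_nonneg_nonneg zero_le_power2)
      have inv: "1 / real (Suc k) \<le> 1 / real N" if "k \<ge> N" for k
        using that N0 by (intro divide_left_mono) auto
      have "b (X i - X j) (X i - X j) \<le> 2 * (J (X i) - I) + 2 * (J (X j) - I)" by (rule par) (auto simp: X)
      also have "\<dots> < 2 * (1 / real (Suc i)) + 2 * (1 / real (Suc j))"
        using X(2)[of i] X(2)[of j] by (intro add_strict_mono mult_strict_left_mono) (auto simp: algebra_simps)
      also have "\<dots> \<le> 2 * (1 / real N) + 2 * (1 / real N)" using inv[OF that(1)] inv[OF that(2)] by linarith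
      also have "\<dots> = 4 / real N" by simp
      also have "\<dots> < \<epsilon>\<^sup>2" using N N0 e by (simp add: field_simps)
      finally show ?thesis unfolding nrm_def using e by (intro real_less_lsqrt) auto
    qed
    thus "\<exists>N. \<forall>i\<ge>N. \<forall>j\<ge>N. nrm (X i - X j) < \<epsilon>" by blast
  qed
  then obtain L where L: "L \<in> S" "(\<lambda>n. nrm (X n - L)) \<longlonglongrightarrow> 0" by blast
  have lL: "(\<lambda>n. l (X n)) \<longlonglongrightarrow> l L"
  proof -
    have "(\<lambda>n. l (X n) - l L) \<longlonglongrightarrow> 0"
    proof (rule Lim_null_comparison)
      have "l (X n) - l L = l (X n - L)" for n
        using ladd[of "X n - L" L] X(1)[of n] L(1) by simp
      thus "\<forall>\<^sub>F n in sequentially. norm (l (X n) - l L) \<le> C * nrm (X n - L)"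
        using bound X L by simp
      show "(\<lambda>n. C * nrm (X n - L)) \<longlonglongrightarrow> 0" using tendsto_mult_right_zero[OF L(2)] by simp
    qed
    thus ?thesis by (simp add: LIM_zero_iff)
  qed
  have JL: "(\<lambda>n. J (X n)) \<longlonglongrightarrow> J L"
    unfolding J_def by (intro tendsto_intros sq_tendsto lL X L)
  have lim1: "(\<lambda>n. I + 1 / real (Suc n)) \<longlonglongrightarrow> I"
    using LIMSEQ_Suc[OF lim_1_over_n] tendsto_add[OF tendsto_const, of _ 0 sequentially I] by fastforce
  have "J L \<le> I" by (rule LIMSEQ_le[OF JL lim1]) (use X(2) less_imp_le in blast)
  have "b L v = l v" if v: "v \<in> S" for v
  proof -
    define d where "d = b L v - l v"
    have "0 \<le> c * (2 * d) + c\<^sup>2 * b v v" for c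
    proof -
      have "J L \<le> J (L + c *\<^sub>R v)" using \<open>J L \<le> I\<close> I_le[of "L + c *\<^sub>R v"] L v by simp
      thus ?thesis using L v
        by (simp add: J_def d_def bilin ladd lscale sym[of v L] algebra_simps power2_eq_square)
    qed
    note * = this
    have "d = 0"
    proof (rule ccontr)
      assume nd: "d \<noteq> 0"
      \<comment> \<open>the quadratic in \<open>c\<close> has nonzero slope \<open>2 * d\<close> at \<open>0\<close>; this \<open>c\<close> makes it negative\<close>
      define c where "c = - d / (b v v + 1)"
      have q: "0 < b v v + 1" using nonneg[OF v] by simp
      have "c * (2 * d) + c\<^sup>2 * b v v = (d\<^sup>2 / (b v v + 1)\<^sup>2) * (- 2 * (b v v + 1) + b v v)"
        using q by (simp add: c_def power2_eq_square divide_simps) (simp add: algebra_simps)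
      also have "\<dots> < 0" using nd q nonneg[OF v] by (intro mult_pos_neg) (auto)
      finally show False using *[of c] by simp
    qed
    thus ?thesis by (simp add: d_def)
  qed
  thus ?thesis using L by blast
qed

lemma geometric_limit:
  assumes X: "\<And>n. X n \<in> S" and r: "0 \<le> r" "r < 1"
    and step: "\<And>n. nrm (X (Suc n) - X n) \<le> C * r ^ n"
  shows "\<exists>L\<in>S. (\<lambda>n. nrm (X n - L)) \<longlonglongrightarrow> 0 \<and> (\<forall>n. nrm (X n - L) \<le> C * r ^ n / (1 - r))"
proof -
  have C: "0 \<le> C" using step[of 0] nrm_nonneg[OF S_diff[OF X[of "Suc 0"] X[of 0]]] by simp
  have tail: "nrm (X (n + k) - X n) \<le> C * r ^ n / (1 - r)" for n k
  proof -
    have "nrm (X (n + k) - X n) \<le> (\<Sum>i<k. C * r ^ (n + i))"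
    proof (induction k)
      case (Suc k)
      have "nrm (X (n + Suc k) - X n) \<le> nrm (X (Suc (n + k)) - X (n + k)) + nrm (X (n + k) - X n)"
        using nrm_triangle[of "X (Suc (n+k))" "X (n+k)" "X n"] X by simp
      thus ?case using Suc step[of "n + k"] by simp
    qed simp
    also have "\<dots> = C * r ^ n * (\<Sum>i<k. r ^ i)" by (simp add: sum_distrib_left power_add mult.assoc)
    also have "\<dots> \<le> C * r ^ n * (1 / (1 - r))"
    proof (rule mult_left_mono)
      have "(\<Sum>i<k. r ^ i) \<le> (\<Sum>i. r ^ i)" using r by (intro sum_le_suminf summable_geometric) auto
      thus "(\<Sum>i<k. r ^ i) \<le> 1 / (1 - r)" using r by (simp add: suminf_geometric)
    qed (use C r in auto)
    finally show ?thesis by simp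
  qed
  have "\<exists>L\<in>S. (\<lambda>n. nrm (X n - L)) \<longlonglongrightarrow> 0"
  proof (rule complete[OF X])
    fix \<epsilon> :: real assume e: "0 < \<epsilon>"
    have "(\<lambda>n. C * r ^ n / (1 - r)) \<longlonglongrightarrow> C * 0 / (1 - r)"
      using r by (intro tendsto_intros LIMSEQ_realpow_zero) auto
    hence "\<forall>\<^sub>F n in sequentially. C * r ^ n / (1 - r) < \<epsilon> / 2"
      using e by (intro order_tendstoD) auto
    then obtain N where N: "C * r ^ N / (1 - r) < \<epsilon> / 2" by (auto simp: eventually_sequentially)
    have "nrm (X i - X j) < \<epsilon>" if "i \<ge> N" "j \<ge> N" for i j
    proof -
      have "nrm (X i - X j) \<le> nrm (X i - X N) + nrm (X N - X j)" by (rule nrm_triangle) (auto simp: X)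
      moreover have "nrm (X N - X j) = nrm (X j - X N)" by (rule nrm_diff_commute) (auto simp: X)
      moreover have "nrm (X i - X N) \<le> C * r ^ N / (1 - r)" "nrm (X j - X N) \<le> C * r ^ N / (1 - r)"
        using tail[of N "i - N"] tail[of N "j - N"] that by simp_all
      ultimately show ?thesis using N by linarith
    qed
    thus "\<exists>N. \<forall>i\<ge>N. \<forall>j\<ge>N. nrm (X i - X j) < \<epsilon>" by blast
  qed
  then obtain L where L: "L \<in> S" "(\<lambda>n. nrm (X n - L)) \<longlonglongrightarrow> 0" by blast
  have "nrm (X n - L) \<le> C * r ^ n / (1 - r)" for n
  proof (rule LIMSEQ_le_const)
    show "(\<lambda>k. C * r ^ n / (1 - r) + nrm (X (k + n) - L)) \<longlonglongrightarrow> C * r ^ n / (1 - r)"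
      using tendsto_add[OF tendsto_const LIMSEQ_ignore_initial_segment[OF L(2), of n]] by simp
    have "nrm (X n - L) \<le> C * r ^ n / (1 - r) + nrm (X (k + n) - L)" for k
    proof -
      have "nrm (X n - L) \<le> nrm (X n - X (k + n)) + nrm (X (k + n) - L)" by (rule nrm_triangle) (auto simp: X L)
      thus ?thesis using tail[of n k] nrm_diff_commute[OF X[of n] X[of "k + n"]] by (simp add: add.commute)
    qed
    thus "\<exists>N. \<forall>k\<ge>N. nrm (X n - L) \<le> C * r ^ n / (1 - r) + nrm (X (k + n) - L)" by blast
  qed
  thus ?thesis using L by blast
qed

end

section \<open>The implicit Euler scheme for an abstract parabolic problem\<close>

text \<open>
  The setting of a Gelfand triple: \<open>m\<close> is the pivot product, \<open>e\<close> the energy, and the assumption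
  \<open>poincare\<close> is the continuity of the embedding.  The problem to be solved is \<open>u' + A u = f\<close> with
  \<open>u 0 = 0\<close>, where \<open>A\<close> is the operator of the form \<open>e\<close>.
\<close>
locale gelfand_pair = M: semi_inner H m + E: complete_semi_inner V e
  for H V :: "'v::real_vector set" and m e :: "'v \<Rightarrow> 'v \<Rightarrow> real" +
  fixes P :: real
  assumes V_sub_H: "V \<subseteq> H" and P_pos: "0 < P"
    and poincare: "u \<in> V \<Longrightarrow> m u u \<le> P * e u u"
begin

lemma V_H [simp]: "u \<in> V \<Longrightarrow> u \<in> H" using V_sub_H by blast

lemma nrm_poincare: "u \<in> V \<Longrightarrow> M.nrm u \<le> sqrt P * E.nrm u"
  unfolding M.nrm_def E.nrm_def using real_sqrt_le_mono[OF poincare] by (simp add: real_sqrt_mult)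

lemma M_tendsto:
  fixes X :: "nat \<Rightarrow> 'v"
  assumes "\<And>n. X n \<in> V" "L \<in> V" "(\<lambda>n. E.nrm (X n - L)) \<longlonglongrightarrow> 0"
  shows "(\<lambda>n. M.nrm (X n - L)) \<longlonglongrightarrow> 0"
proof (rule Lim_null_comparison)
  show "\<forall>\<^sub>F n in sequentially. norm (M.nrm (X n - L)) \<le> sqrt P * E.nrm (X n - L)"
    using assms nrm_poincare by simp
  show "(\<lambda>n. sqrt P * E.nrm (X n - L)) \<longlonglongrightarrow> 0" using tendsto_mult_right_zero[OF assms(3)] by simp
qed

text \<open>
  On \<open>V\<close> the form \<open>m + h * e\<close> defines a seminorm equivalent to that of \<open>e\<close>, so it inherits completeness
  and Riesz representation applies to it.
\<close>
lemma resolvent_exists: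
  assumes h: "0 < h" and g: "g \<in> H"
  shows "\<exists>u\<in>V. \<forall>v\<in>V. m u v + h * e u v = m g v"
proof -
  have sym: "m u w + h * e u w = m w u + h * e w u" if "u \<in> V" "w \<in> V" for u w
    using that by (simp add: M.sym[of u w] E.sym[of u w])
  interpret R: semi_inner V "\<lambda>u v. m u v + h * e u v"
    by standard (use h in \<open>auto simp: E.subsp M.bilin E.bilin M.nonneg E.nonneg algebra_simps sym\<close>)
  have le1: "sqrt h * E.nrm u \<le> R.nrm u" if "u \<in> V" for u
    unfolding E.nrm_def R.nrm_def real_sqrt_mult[symmetric]
    using M.nonneg[of u] that by (intro real_sqrt_le_mono) simp
  have le2: "R.nrm u \<le> sqrt (P + h) * E.nrm u" if "u \<in> V" for u
    unfolding E.nrm_def R.nrm_def real_sqrt_mult[symmetric]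
    using poincare[of u] that by (intro real_sqrt_le_mono) (simp add: algebra_simps)
  have le3: "M.nrm u \<le> R.nrm u" if "u \<in> V" for u
    unfolding M.nrm_def R.nrm_def
    using E.nonneg[of u] that h by (intro real_sqrt_le_mono) simp
  interpret R: complete_semi_inner V "\<lambda>u v. m u v + h * e u v"
  proof
    fix X :: "nat \<Rightarrow> 'v" assume X: "\<And>n. X n \<in> V" and C: "\<And>\<epsilon>. 0 < \<epsilon> \<Longrightarrow> \<exists>N. \<forall>i\<ge>N. \<forall>j\<ge>N. R.nrm (X i - X j) < \<epsilon>"
    have "\<exists>L\<in>V. (\<lambda>n. E.nrm (X n - L)) \<longlonglongrightarrow> 0"
    proof (rule E.complete[OF X])
      fix \<epsilon> :: real assume e: "0 < \<epsilon>"
      then obtain N where N: "\<forall>i\<ge>N. \<forall>j\<ge>N. R.nrm (X i - X j) < sqrt h * \<epsilon>"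
        using C[of "sqrt h * \<epsilon>"] h by auto
      have "E.nrm (X i - X j) < \<epsilon>" if "i \<ge> N" "j \<ge> N" for i j
      proof -
        have "sqrt h * E.nrm (X i - X j) < sqrt h * \<epsilon>"
          using le1[of "X i - X j"] N that X by (smt (verit) E.S_diff)
        thus ?thesis using h by simp
      qed
      thus "\<exists>N. \<forall>i\<ge>N. \<forall>j\<ge>N. E.nrm (X i - X j) < \<epsilon>" by blast
    qed
    then obtain L where L: "L \<in> V" "(\<lambda>n. E.nrm (X n - L)) \<longlonglongrightarrow> 0" by blast
    have "(\<lambda>n. R.nrm (X n - L)) \<longlonglongrightarrow> 0"
    proof (rule Lim_null_comparison)
      show "\<forall>\<^sub>F n in sequentially. norm (R.nrm (X n - L)) \<le> sqrt (P + h) * E.nrm (X n - L)"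
        using X L le2 by simp
      show "(\<lambda>n. sqrt (P + h) * E.nrm (X n - L)) \<longlonglongrightarrow> 0" using tendsto_mult_right_zero[OF L(2)] by simp
    qed
    thus "\<exists>L\<in>V. (\<lambda>n. R.nrm (X n - L)) \<longlonglongrightarrow> 0" using L by blast
  qed
  show ?thesis
  proof (rule R.riesz[where C = "M.nrm g"])
    fix u assume u: "u \<in> V"
    have "\<bar>m g u\<bar> \<le> M.nrm g * M.nrm u" using M.cauchy_schwarz[of g u] g u by simp
    also have "\<dots> \<le> M.nrm g * R.nrm u" using le3[OF u] g by (intro mult_left_mono) auto
    finally show "\<bar>m g u\<bar> \<le> M.nrm g * R.nrm u" .
  qed (use g in \<open>auto simp: M.bilin\<close>)
qed

definition resolvent :: "real \<Rightarrow> 'v \<Rightarrow> 'v" where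
  "resolvent h g = (SOME u. u \<in> V \<and> (\<forall>v\<in>V. m u v + h * e u v = m g v))"

lemma resolvent:
  assumes "0 < h" "g \<in> H"
  shows "resolvent h g \<in> V" "v \<in> V \<Longrightarrow> m (resolvent h g) v + h * e (resolvent h g) v = m g v"
  using someI_ex[of "\<lambda>u. u \<in> V \<and> (\<forall>v\<in>V. m u v + h * e u v = m g v)"] resolvent_exists[OF assms]
  unfolding resolvent_def by blast+

text \<open>
  Rothe's implicit Euler scheme with step \<open>h\<close> for \<open>u' + A u = f\<close>, \<open>u 0 = 0\<close>.
\<close>
primrec rothe :: "real \<Rightarrow> (real \<Rightarrow> 'v) \<Rightarrow> nat \<Rightarrow> 'v" where
  "rothe h f 0 = 0"
| "rothe h f (Suc k) = resolvent h (rothe h f k + h *\<^sub>R f (real (Suc k) * h))"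

declare rothe.simps(2) [simp del]

lemma rothe_V:
  assumes "0 < h" "\<And>t. f t \<in> H" shows "rothe h f k \<in> V"
  by (induction k) (use assms in \<open>simp_all add: rothe.simps(2) resolvent\<close>)

lemma rothe_eq:
  assumes h: "0 < h" and f: "\<And>t. f t \<in> H" and v: "v \<in> V"
  shows "m (rothe h f (Suc k) - rothe h f k) v + h * e (rothe h f (Suc k)) v
          = h * m (f (real (Suc k) * h)) v"
proof -
  have V: "rothe h f j \<in> V" for j by (rule rothe_V[OF h f])
  have "m (rothe h f (Suc k)) v + h * e (rothe h f (Suc k)) v = m (rothe h f k + h *\<^sub>R f (real (Suc k) * h)) v"
    unfolding rothe.simps(2) by (rule resolvent(2)) (use V h f v in auto)
  thus ?thesis using V f v by (simp add: M.bilin)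
qed

text \<open>
  The equation is tested with the increment \<open>D = U' - U\<close>.  Polarisation of \<open>2 * e U' D\<close> leaves a spare
  term \<open>e D D\<close>, which absorbs a perturbation \<open>p\<close> in energy form.  Such a perturbation arises when two
  step sizes are compared, where it is the only part of the error bound without a factor \<open>h\<close>.
\<close>
lemma step_estimate:
  assumes U: "U \<in> V" "U' \<in> V" and g: "g \<in> H" and p: "p \<in> V" and h: "0 < h"
    and eq: "m (U' - U) (U' - U) + h * e U' (U' - U) = h * m g (U' - U) + h * e p (U' - U)"
  shows "m (U' - U) (U' - U) / h + e U' U' \<le> e U U + h * m g g + e p p"
proof -
  define D where "D = U' - U"
  have D: "D \<in> V" using U by (simp add: D_def)
  have 1: "2 * e U' D = e U' U' - e U U + e D D"
    using U by (simp add: D_def E.bilin E.sym[of U' U])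
  have 2: "2 * m g D \<le> h * m g g + m D D / h" by (rule M.young) (use g D h in auto)
  have 3: "2 * e p D \<le> e p p + e D D" using E.young[OF p D, of 1] by simp
  have "m D D + h * e U' D = h * (m g D + e p D)" using eq by (simp add: D_def algebra_simps)
  hence "m D D / h + e U' D = m g D + e p D" using h by (simp add: field_simps)
  hence "2 * (m D D / h) + 2 * e U' D = 2 * m g D + 2 * e p D" by simp
  thus ?thesis using 1 2 3 unfolding D_def[symmetric] by linarith
qed

lemma steps_estimate:
  assumes U: "\<And>k. U k \<in> V" "U 0 = 0" and g: "\<And>k. g k \<in> H" and p: "\<And>k. p k \<in> V" and h: "0 < h"
    and eq: "\<And>k v. v \<in> V \<Longrightarrow> m (U (Suc k) - U k) v + h * e (U (Suc k)) v = h * m (g k) v + h * e (p k) v"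
  shows "(\<Sum>k<N. m (U (Suc k) - U k) (U (Suc k) - U k)) / h + e (U N) (U N)
           \<le> (\<Sum>k<N. h * m (g k) (g k) + e (p k) (p k))"
proof (induction N)
  case 0
  show ?case using U by (simp add: E.bilin)
next
  case (Suc N)
  have "m (U (Suc N) - U N) (U (Suc N) - U N) / h + e (U (Suc N)) (U (Suc N))
          \<le> e (U N) (U N) + h * m (g N) (g N) + e (p N) (p N)"
    by (rule step_estimate[OF U(1) U(1) g p h]) (rule eq, use U in simp)
  thus ?case using Suc.IH by (simp add: add_divide_distrib)
qed

text \<open>
  Hoelder continuous forcings, with exponent \<open>a / 2\<close> in the seminorm of \<open>m\<close>.  Vanishing at time \<open>0\<close>
  makes the initial value \<open>0\<close> compatible: the scheme behaves as if it were continued by \<open>0\<close> to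
  negative times, so its first increment is as small as the others.
\<close>
definition admissible :: "real \<Rightarrow> real \<Rightarrow> (real \<Rightarrow> 'v) \<Rightarrow> bool" where
  "admissible a K f \<longleftrightarrow> 0 < a \<and> 0 \<le> K \<and> (\<forall>t. f t \<in> H) \<and> m (f 0) (f 0) = 0 \<and>
     (\<forall>s t. m (f s - f t) (f s - f t) \<le> K * \<bar>s - t\<bar> powr a)"

lemma admissibleD:
  assumes "admissible a K f"
  shows "0 < a" "0 \<le> K" "f t \<in> H" "m (f 0) (f 0) = 0" "m (f s - f t) (f s - f t) \<le> K * \<bar>s - t\<bar> powr a"
  using assms by (auto simp: admissible_def)

lemma admissible_bound:
  assumes f: "admissible a K f" and t: "0 \<le> t" "t \<le> 1" shows "m (f t) (f t) \<le> K"
proof -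
  note A = admissibleD[OF f]
  have "M.nrm (f t) \<le> M.nrm (f t - f 0) + M.nrm (f 0)" using M.nrm_add[of "f t - f 0" "f 0"] A by simp
  also have "M.nrm (f 0) = 0" using A by (simp add: M.nrm_def)
  finally have "m (f t) (f t) \<le> m (f t - f 0) (f t - f 0)" by (simp add: M.nrm_def)
  also have "\<dots> \<le> K * \<bar>t - 0\<bar> powr a" by (rule A)
  also have "\<dots> \<le> K * 1" using t A by (intro mult_left_mono powr_le1) auto
  finally show ?thesis by simp
qed

lemma admissible_zero:
  assumes f: "admissible a K f" and v: "v \<in> H" shows "m (f 0) v = 0"
  using M.cauchy_schwarz[of "f 0" v] admissibleD[OF f] v by (simp add: M.nrm_def)

lemma rothe_bound:
  assumes h: "0 < h" and f: "\<And>t. f t \<in> H" and F: "\<And>t. \<lbrakk>0 \<le> t; t \<le> 1\<rbrakk> \<Longrightarrow> m (f t) (f t) \<le> F"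
    and N: "real N * h \<le> 1" and F0: "0 \<le> F"
  shows "(\<Sum>k<N. m (rothe h f (Suc k) - rothe h f k) (rothe h f (Suc k) - rothe h f k))
            \<le> h * (real N * h * F)" (is ?a)
    and "e (rothe h f N) (rothe h f N) \<le> F" (is ?b)
proof -
  note V = rothe_V[OF h f]
  have "(\<Sum>k<N. m (rothe h f (Suc k) - rothe h f k) (rothe h f (Suc k) - rothe h f k)) / h
         + e (rothe h f N) (rothe h f N) \<le> (\<Sum>k<N. h * m (f (real (Suc k) * h)) (f (real (Suc k) * h)) + e 0 0)"
    by (rule steps_estimate) (use V f h in \<open>auto simp: rothe_eq[OF h f] E.bilin\<close>)
  also have "\<dots> \<le> (\<Sum>k<N. h * F)"
  proof (rule sum_mono)
    fix k assume "k \<in> {..<N}"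
    hence "real (Suc k) * h \<le> real N * h" using h by (intro mult_right_mono) auto
    hence "real (Suc k) * h \<le> 1" using N by linarith
    hence "m (f (real (Suc k) * h)) (f (real (Suc k) * h)) \<le> F" using h by (intro F) auto
    thus "h * m (f (real (Suc k) * h)) (f (real (Suc k) * h)) + e 0 0 \<le> h * F" using h by (simp add: E.bilin)
  qed
  also have "\<dots> = real N * h * F" by simp
  finally have *: "(\<Sum>k<N. m (rothe h f (Suc k) - rothe h f k) (rothe h f (Suc k) - rothe h f k)) / h
         + e (rothe h f N) (rothe h f N) \<le> real N * h * F" .
  have "0 \<le> (\<Sum>k<N. m (rothe h f (Suc k) - rothe h f k) (rothe h f (Suc k) - rothe h f k)) / h"
    using V h by (intro divide_nonneg_pos sum_nonneg M.nonneg) auto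
  moreover have "real N * h * F \<le> F" using mult_right_mono[OF N F0] by simp
  ultimately show ?b using * by linarith
  have "0 \<le> e (rothe h f N) (rothe h f N)" using V by (rule E.nonneg)
  hence "(\<Sum>k<N. m (rothe h f (Suc k) - rothe h f k) (rothe h f (Suc k) - rothe h f k)) / h \<le> real N * h * F"
    using * by linarith
  thus ?a using h by (simp add: pos_divide_le_eq mult.commute)
qed

text \<open>
  The increments of the scheme satisfy the scheme whose forcing consists of the increments of \<open>f\<close>.
  Testing this with the increments themselves bounds the sum of their energies.
\<close>
lemma rothe_increments:
  assumes h: "0 < h" and f: "admissible a K f" and N: "real N * h \<le> 1"
  shows "(\<Sum>k<N. e (rothe h f (Suc k) - rothe h f k) (rothe h f (Suc k) - rothe h f k)) \<le> K * h powr (a / 2)"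
proof -
  note A = admissibleD[OF f]
  note V = rothe_V[of h f, OF h A(3)] and EQ = rothe_eq[of h f, OF h A(3)]
  define D where "D k = (if k = 0 then 0 else rothe h f k - rothe h f (k - 1))" for k
  \<comment> \<open>weight in Young's inequality: it balances the Hoelder bound \<open>h powr a\<close> of the forcing increments
    against the bound \<open>h * K\<close> for the sum of \<open>m (D k) (D k)\<close>\<close>
  define l where "l = h powr (1 - a / 2)"
  have l: "0 < l" using h by (simp add: l_def)
  have DV: "D k \<in> V" for k using V by (simp add: D_def)
  have eq: "m (D (Suc k) - D k) v + h * e (D (Suc k)) v
      = h * m (f (real (Suc k) * h) - f (real k * h)) v" if v: "v \<in> V" for k v
  proof (cases k)
    case 0
    thus ?thesis using EQ[OF v, of 0] v V A(3) admissible_zero[OF f, of v] by (simp add: D_def M.bilin)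
  next
    case (Suc j)
    show ?thesis
      using EQ[OF v, of k] EQ[OF v, of j] v V A(3)
      by (simp add: D_def Suc M.bilin E.bilin algebra_simps)
  qed
  have step: "m (D (Suc k)) (D (Suc k)) - m (D k) (D k) + 2 * h * e (D (Suc k)) (D (Suc k))
      \<le> h * l * (K * h powr a) + h / l * m (D (Suc k)) (D (Suc k))" for k
  proof -
    define d where "d = f (real (Suc k) * h) - f (real k * h)"
    have d: "d \<in> H" using A by (simp add: d_def)
    have "m d d \<le> K * \<bar>real (Suc k) * h - real k * h\<bar> powr a" unfolding d_def by (rule A)
    also have "\<bar>real (Suc k) * h - real k * h\<bar> = h" using h by (simp add: algebra_simps)
    finally have md: "m d d \<le> K * h powr a" .
    have a1: "2 * m (D k) (D (Suc k)) \<le> m (D k) (D k) + m (D (Suc k)) (D (Suc k))"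
      using M.young[of "D k" "D (Suc k)" 1] DV by simp
    have "2 * m d (D (Suc k)) \<le> l * m d d + m (D (Suc k)) (D (Suc k)) / l"
      using M.young[of d "D (Suc k)" l] DV d l by simp
    also have "\<dots> \<le> l * (K * h powr a) + m (D (Suc k)) (D (Suc k)) / l"
      using md l by simp
    finally have "h * (2 * m d (D (Suc k))) \<le> h * (l * (K * h powr a) + m (D (Suc k)) (D (Suc k)) / l)"
      using h by simp
    moreover have "m (D (Suc k)) (D (Suc k)) - m (D k) (D (Suc k)) + h * e (D (Suc k)) (D (Suc k)) = h * m d (D (Suc k))"
      using eq[OF DV, of k "Suc k"] DV by (simp add: M.bilin d_def)
    ultimately show ?thesis using a1 by (simp add: algebra_simps)
  qed
  have "m (D N) (D N) + 2 * h * (\<Sum>k<N. e (D (Suc k)) (D (Suc k)))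
      \<le> real N * (h * l * (K * h powr a)) + h / l * (\<Sum>k<N. m (D (Suc k)) (D (Suc k)))"
  proof (induction N)
    case 0 thus ?case by (simp add: D_def M.bilin)
  next
    case (Suc N) thus ?case using step[of N] by (simp add: algebra_simps)
  qed
  moreover have "h / l * (\<Sum>k<N. m (D (Suc k)) (D (Suc k))) \<le> h / l * (h * (1 * K))"
  proof (rule mult_left_mono)
    have "(\<Sum>k<N. m (D (Suc k)) (D (Suc k))) \<le> h * (real N * h * K)"
      using rothe_bound(1)[of h f K N, OF h A(3) admissible_bound[OF f] N A(2)] by (simp add: D_def)
    also have "\<dots> \<le> h * (1 * K)" using h N A(2) by (intro mult_left_mono mult_right_mono) auto
    finally show "(\<Sum>k<N. m (D (Suc k)) (D (Suc k))) \<le> h * (1 * K)" .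
  qed (use h l in simp)
  moreover have "0 \<le> m (D N) (D N)" using DV by (simp add: M.nonneg)
  ultimately have "2 * h * (\<Sum>k<N. e (D (Suc k)) (D (Suc k))) \<le> real N * (h * l * (K * h powr a)) + h / l * (h * K)"
    by simp
  also have "\<dots> = h * ((real N * h) * (K * h powr (a/2)) + K * h powr (a/2))"
  proof -
    have 1: "l * h powr a = h * h powr (a/2)" using h by (simp add: l_def powr_add[symmetric] powr_mult_base add.commute)
    have 2: "h / l = h powr (a/2)" using h by (simp add: l_def powr_diff)
    show ?thesis using 1 unfolding 2 by (simp add: algebra_simps)
  qed
  also have "\<dots> \<le> h * (1 * (K * h powr (a/2)) + K * h powr (a/2))"
    using h A(2) N by (intro mult_left_mono add_right_mono mult_right_mono) auto
  finally show ?thesis using h by (simp add: D_def)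
qed

lemma sum_odd_le:
  fixes x :: "nat \<Rightarrow> real"
  assumes "\<And>k. 0 \<le> x k" shows "(\<Sum>k<N. x (Suc (2 * k))) \<le> (\<Sum>k<2 * N. x k)"
proof (induction N)
  case (Suc N) thus ?case using assms[of "2 * N"] by simp
qed simp

text \<open>
  Two steps of size \<open>h\<close> are compared with one step of size \<open>2 * h\<close>.  The difference satisfies the coarse
  scheme with forcing \<open>g\<close>, half an increment of \<open>f\<close>, and with an energy perturbation \<open>p\<close>, half an
  increment of the fine scheme.  The former is small by Hoelder continuity, the latter by
  \<open>rothe_increments\<close>.
\<close>
lemma rothe_refine:
  assumes h: "0 < h" and f: "admissible a K f" and N: "real (2 * N) * h \<le> 1"
  shows "e (rothe h f (2 * N) - rothe (2 * h) f N) (rothe h f (2 * N) - rothe (2 * h) f N) \<le> K * h powr (a / 2)"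
proof (cases "N = 0")
  case True thus ?thesis using admissibleD[OF f] by (simp add: E.bilin)
next
  case False
  hence "1 * h \<le> real (2 * N) * h" using h by (intro mult_right_mono) auto
  hence h1: "h \<le> 1" using N by linarith
  note A = admissibleD[OF f]
  have h2: "0 < 2 * h" using h by simp
  note V = rothe_V[of h f, OF h A(3)] rothe_V[of "2 * h" f, OF h2 A(3)]
    and EQ = rothe_eq[of h f, OF h A(3)] and EQ2 = rothe_eq[of "2 * h" f, OF h2 A(3)]
  define U where "U k = rothe h f (2 * k) - rothe (2 * h) f k" for k
  define g where "g k = (1/2) *\<^sub>R (f (real (Suc (2 * k)) * h) - f (real (Suc (Suc (2 * k))) * h))" for k
  define p where "p k = (1/2) *\<^sub>R (rothe h f (Suc (Suc (2 * k))) - rothe h f (Suc (2 * k)))" for k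
  have "(\<Sum>k<N. m (U (Suc k) - U k) (U (Suc k) - U k)) / (2 * h) + e (U N) (U N)
      \<le> (\<Sum>k<N. 2 * h * m (g k) (g k) + e (p k) (p k))"
  proof (rule steps_estimate)
    fix k v assume v: "v \<in> V"
    have c: "real (Suc k) * (2 * h) = real (Suc (Suc (2 * k))) * h" by (simp add: algebra_simps)
    show "m (U (Suc k) - U k) v + 2 * h * e (U (Suc k)) v = 2 * h * m (g k) v + 2 * h * e (p k) v"
      using EQ[OF v, of "2 * k"] EQ[OF v, of "Suc (2 * k)"]
        EQ2[OF v, of k] v V A(3) unfolding c
      by (simp add: U_def g_def p_def M.bilin E.bilin algebra_simps)
  qed (use V A h in \<open>auto simp: U_def g_def p_def\<close>)
  moreover have "0 \<le> (\<Sum>k<N. m (U (Suc k) - U k) (U (Suc k) - U k)) / (2 * h)"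
    using V h by (intro divide_nonneg_pos sum_nonneg M.nonneg) (auto simp: U_def)
  ultimately have "e (U N) (U N) \<le> (\<Sum>k<N. 2 * h * m (g k) (g k)) + (\<Sum>k<N. e (p k) (p k))"
    by (simp add: sum.distrib)
  also have "(\<Sum>k<N. 2 * h * m (g k) (g k)) \<le> (\<Sum>k<N. h / 2 * (K * h powr a))"
  proof (rule sum_mono)
    fix k
    define d where "d = f (real (Suc (2 * k)) * h) - f (real (Suc (Suc (2 * k))) * h)"
    have "m d d \<le> K * \<bar>real (Suc (2 * k)) * h - real (Suc (Suc (2 * k))) * h\<bar> powr a" unfolding d_def by (rule A)
    also have "\<bar>real (Suc (2 * k)) * h - real (Suc (Suc (2 * k))) * h\<bar> = h" using h by (simp add: algebra_simps)
    finally have "h / 2 * m d d \<le> h / 2 * (K * h powr a)" using h by simp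
    moreover have "d \<in> H" using A by (simp add: d_def)
    ultimately show "2 * h * m (g k) (g k) \<le> h / 2 * (K * h powr a)"
      unfolding g_def d_def[symmetric] by (simp add: M.bilin)
  qed
  also have "\<dots> = (real (2 * N) * h) * (K * h powr a) / 4" by simp
  also have "\<dots> \<le> 1 * (K * h powr a) / 4" using N A(2) by (intro divide_right_mono mult_right_mono) auto
  also have "(\<Sum>k<N. e (p k) (p k)) = (\<Sum>k<N. e (rothe h f (Suc (Suc (2 * k))) - rothe h f (Suc (2 * k)))
       (rothe h f (Suc (Suc (2 * k))) - rothe h f (Suc (2 * k)))) / 4"
    using V unfolding p_def sum_divide_distrib by (simp add: E.scale_left E.scale_right)
  also have "(\<Sum>k<N. e (rothe h f (Suc (Suc (2 * k))) - rothe h f (Suc (2 * k)))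
       (rothe h f (Suc (Suc (2 * k))) - rothe h f (Suc (2 * k)))) \<le> K * h powr (a / 2)"
    by (rule order.trans[OF sum_odd_le[of "\<lambda>k. e (rothe h f (Suc k) - rothe h f k) (rothe h f (Suc k) - rothe h f k)"]
       rothe_increments[OF h f N]]) (use V in \<open>simp add: E.nonneg\<close>)
  also have "h powr a \<le> h powr (a / 2)" using h h1 A(1) by (intro powr_mono') auto
  finally have "e (U N) (U N) \<le> 1 * (K * h powr (a/2)) / 4 + K * h powr (a/2) / 4" using A(2)
    by (simp add: mult_left_mono)
  moreover have "0 \<le> K * h powr (a/2)" using A(2) by simp
  ultimately show ?thesis by (simp add: U_def)
qed

end

section \<open>The solution operator of the abstract problem\<close>

lemma grid_tendsto:
  fixes x :: real assumes "0 \<le> x"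
  shows "(\<lambda>n. real (nat \<lfloor>x * 2 ^ n\<rfloor>) * (1/2)^n) \<longlonglongrightarrow> x"
proof -
  define q where "q n = real (nat \<lfloor>x * 2 ^ n\<rfloor>) * (1/2)^n" for n
  have "(\<lambda>n. q n - x) \<longlonglongrightarrow> 0"
  proof (rule Lim_null_comparison)
    show "(\<lambda>n. (1/2::real)^n) \<longlonglongrightarrow> 0" by (rule LIMSEQ_realpow_zero) auto
    have "norm (q n - x) \<le> (1/2)^n" for n
    proof -
      have e: "q n - x = (real (nat \<lfloor>x * 2 ^ n\<rfloor>) - x * 2 ^ n) * (1/2)^n"
        by (simp add: q_def left_diff_distrib mult.assoc flip: power_mult_distrib)
      have "0 \<le> x * 2 ^ n" using assms by simp
      hence "\<bar>real (nat \<lfloor>x * 2 ^ n\<rfloor>) - x * 2 ^ n\<bar> \<le> 1" by linarith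
      hence "\<bar>real (nat \<lfloor>x * 2 ^ n\<rfloor>) - x * 2 ^ n\<bar> * (1/2)^n \<le> 1 * (1/2)^n" by (intro mult_right_mono) auto
      thus ?thesis unfolding e by (simp add: abs_mult)
    qed
    thus "\<forall>\<^sub>F n in sequentially. norm (q n - x) \<le> (1/2)^n" by simp
  qed
  thus ?thesis by (simp add: LIM_zero_iff q_def)
qed

lemma sq_powr_half:
  fixes K x :: real
  assumes "0 \<le> K" shows "(sqrt K * x powr (a / 2))\<^sup>2 = K * x powr a"
proof -
  have "(x powr (a / 2))\<^sup>2 = x powr a" by (simp add: power2_eq_square flip: powr_add)
  thus ?thesis using assms by (simp add: power_mult_distrib)
qed

lemma (in semi_inner) continuous_on_inner_left:
  fixes I :: "real set"
  assumes X: "\<And>t. t \<in> I \<Longrightarrow> X t \<in> S" and v: "v \<in> S"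
    and c: "\<And>\<epsilon>. 0 < \<epsilon> \<Longrightarrow> \<exists>\<delta>>0. \<forall>s\<in>I. \<forall>t\<in>I. \<bar>s - t\<bar> < \<delta> \<longrightarrow> nrm (X s - X t) < \<epsilon>"
  shows "continuous_on I (\<lambda>t. b (X t) v)"
  unfolding continuous_on_iff
proof (intro ballI allI impI)
  fix t \<epsilon> :: real assume t: "t \<in> I" and e: "0 < \<epsilon>"
  have n: "0 < nrm v + 1" using nrm_nonneg[OF v] by linarith
  obtain \<delta> where d: "0 < \<delta>" "\<And>s. \<lbrakk>s \<in> I; \<bar>s - t\<bar> < \<delta>\<rbrakk> \<Longrightarrow> nrm (X s - X t) < \<epsilon> / (nrm v + 1)"
    using c[of "\<epsilon> / (nrm v + 1)"] e n t by auto
  have "dist (b (X s) v) (b (X t) v) < \<epsilon>" if "s \<in> I" "dist s t < \<delta>" for s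
  proof -
    have "dist (b (X s) v) (b (X t) v) = \<bar>b (X s - X t) v\<bar>" using that t X v by (simp add: dist_real_def diff_left)
    also have "\<dots> \<le> nrm (X s - X t) * nrm v" using that t X v by (intro cauchy_schwarz) auto
    also have "\<dots> \<le> nrm (X s - X t) * (nrm v + 1)" using that t X by (intro mult_left_mono) auto
    also have "\<dots> < \<epsilon>" using d(2)[of s] that n by (simp add: dist_real_def pos_less_divide_eq)
    finally show ?thesis .
  qed
  thus "\<exists>d>0. \<forall>x'\<in>I. dist x' t < d \<longrightarrow> dist (b (X x') v) (b (X t) v) < \<epsilon>" using d(1) by blast
qed

context gelfand_pair
begin

text \<open>
  The scheme with step \<open>(1/2) ^ n\<close>, evaluated at the last grid point up to \<open>t\<close>.
\<close>
definition appr :: "(real \<Rightarrow> 'v) \<Rightarrow> nat \<Rightarrow> real \<Rightarrow> 'v" where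
  "appr f n t = rothe ((1/2) ^ n) f (nat \<lfloor>t * 2 ^ n\<rfloor>)"

definition sol :: "(real \<Rightarrow> 'v) \<Rightarrow> real \<Rightarrow> 'v" where
  "sol f t = (SOME L. L \<in> V \<and> (\<lambda>n. E.nrm (appr f n t - L)) \<longlonglongrightarrow> 0)"

lemma grid_le_one:
  assumes "t \<le> (1::real)" shows "real (nat \<lfloor>t * 2 ^ n\<rfloor>) * (1/2) ^ n \<le> 1"
proof -
  have "real (nat \<lfloor>t * 2 ^ n\<rfloor>) \<le> 2 ^ n"
  proof (cases "0 \<le> t")
    case True
    have "real (nat \<lfloor>t * 2 ^ n\<rfloor>) \<le> t * 2 ^ n" using True by simp
    also have "\<dots> \<le> 1 * 2 ^ n" using assms by (intro mult_right_mono) auto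
    finally show ?thesis by simp
  next
    case False
    hence "t * 2 ^ n \<le> 0" by (simp add: mult_nonpos_nonneg)
    hence "nat \<lfloor>t * 2 ^ n\<rfloor> = 0" by simp
    thus ?thesis by simp
  qed
  thus ?thesis by (simp add: power_one_over field_simps)
qed

lemma appr_V: "(\<And>t. f t \<in> H) \<Longrightarrow> appr f n t \<in> V"
  unfolding appr_def by (rule rothe_V) auto

lemma rothe_increment_nrm:
  assumes f: "admissible a K f" and k: "real (Suc k) * (1/2)^n \<le> 1"
  shows "E.nrm (rothe ((1/2)^n) f (Suc k) - rothe ((1/2)^n) f k) \<le> sqrt K * ((1/2) powr (a / 4)) ^ n"
proof -
  define h :: real where "h = (1/2)^n"
  have h: "0 < h" by (simp add: h_def)
  note V = rothe_V[of h f, OF h admissibleD(3)[OF f]]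
  have "e (rothe h f (Suc k) - rothe h f k) (rothe h f (Suc k) - rothe h f k)
      \<le> (\<Sum>j<Suc k. e (rothe h f (Suc j) - rothe h f j) (rothe h f (Suc j) - rothe h f j))"
    using V by (auto intro!: sum_nonneg E.nonneg)
  also have "\<dots> \<le> K * h powr (a / 2)" by (rule rothe_increments[OF h f]) (use k in \<open>simp add: h_def\<close>)
  also have "\<dots> = (sqrt K * h powr (a / 4))\<^sup>2"
    using sq_powr_half[of K h "a/2"] admissibleD(2)[OF f] by simp
  finally have "E.nrm (rothe h f (Suc k) - rothe h f k) \<le> sqrt K * h powr (a / 4)"
    unfolding E.nrm_def using admissibleD(2)[OF f] by (intro real_le_lsqrt) auto
  also have "h powr (a / 4) = ((1/2) powr (a / 4)) ^ n"
    by (simp add: h_def powr_powr powr_realpow[symmetric] mult.commute)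
  finally show ?thesis by (simp add: h_def)
qed

text \<open>
  Between consecutive levels the step is halved, which \<open>rothe_refine\<close> controls, and the last grid point
  before \<open>t\<close> may advance by one fine step, which \<open>rothe_increments\<close> controls.  Both contributions are
  geometrically small in \<open>n\<close>.
\<close>
lemma appr_step:
  assumes f: "admissible a K f" and t: "0 \<le> t" "t \<le> 1"
  shows "E.nrm (appr f (Suc n) t - appr f n t) \<le> (2 * sqrt K) * ((1/2) powr (a / 4)) ^ n"
proof -
  define k where "k = nat \<lfloor>t * 2 ^ n\<rfloor>"
  define h :: real where "h = (1/2) ^ Suc n"
  have h: "0 < h" "2 * h = (1/2)^n" "h \<le> (1/2)^n" by (auto simp: h_def)
  note A = admissibleD[OF f]
  note V = rothe_V[of h f, OF h(1) A(3)] rothe_V[of "2 * h" f, OF _ A(3)]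
  have ap: "appr f n t = rothe (2 * h) f k" by (simp add: appr_def k_def h)
  have kr: "real k \<le> t * 2 ^ n" "t * 2 ^ n < real k + 1" using t by (auto simp: k_def)
  have k1: "real k * (1/2)^n \<le> 1" unfolding k_def by (rule grid_le_one) (rule t)
  have rho: "((1/2::real) powr (a / 4)) ^ Suc n \<le> ((1/2) powr (a / 4)) ^ n"
    by (rule power_decreasing) (use A(1) powr_mono'[of 0 "a/4" "1/2::real"] in auto)
  have ref: "E.nrm (rothe h f (2 * k) - rothe (2 * h) f k) \<le> sqrt K * ((1/2) powr (a / 4)) ^ n"
  proof -
    have "e (rothe h f (2 * k) - rothe (2 * h) f k) (rothe h f (2 * k) - rothe (2 * h) f k) \<le> K * h powr (a / 2)"
      by (rule rothe_refine[OF h(1) f]) (use k1 in \<open>simp add: algebra_simps flip: h(2)\<close>)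
    also have "\<dots> = (sqrt K * h powr (a / 4))\<^sup>2"
      using sq_powr_half[of K h "a/2"] A(2) by simp
    finally have "E.nrm (rothe h f (2 * k) - rothe (2 * h) f k) \<le> sqrt K * h powr (a / 4)"
      unfolding E.nrm_def using A(2) by (intro real_le_lsqrt) auto
    also have "h powr (a / 4) = ((1/2) powr (a / 4)) ^ Suc n"
      unfolding h_def by (simp add: powr_powr powr_realpow[symmetric] mult.commute del: power_Suc)
    finally show ?thesis using mult_left_mono[OF rho, of "sqrt K"] A(2) by simp
  qed
  define j where "j = nat \<lfloor>t * 2 ^ Suc n\<rfloor>"
  have jr: "real j \<le> 2 * (t * 2 ^ n)" "2 * (t * 2 ^ n) < real j + 1"
  proof -
    have "real j \<le> t * 2 ^ Suc n" "t * 2 ^ Suc n < real j + 1" using t by (auto simp: j_def simp del: power_Suc)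
    thus "real j \<le> 2 * (t * 2 ^ n)" "2 * (t * 2 ^ n) < real j + 1" by (simp_all add: mult.left_commute)
  qed
  have "real j < real (2 * k + 2)" "real (2 * k) < real j + 1" using kr jr by simp_all
  hence "j = 2 * k \<or> j = Suc (2 * k)" by linarith
  thus ?thesis
  proof
    assume j: "j = 2 * k"
    have "appr f (Suc n) t = rothe h f (2 * k)" using j by (simp add: appr_def j_def h_def del: power_Suc)
    moreover have "0 \<le> sqrt K * ((1/2) powr (a / 4)) ^ n" using A by simp
    ultimately show ?thesis using ref unfolding ap by simp
  next
    assume j: "j = Suc (2 * k)"
    have as: "appr f (Suc n) t = rothe h f (Suc (2 * k))" using j by (simp add: appr_def j_def h_def del: power_Suc)
    have "E.nrm (rothe h f (Suc (2 * k)) - rothe h f (2 * k)) \<le> sqrt K * ((1/2) powr (a / 4)) ^ Suc n"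
      unfolding h_def
      by (rule rothe_increment_nrm[OF f])
         (use grid_le_one[of t "Suc n"] t in \<open>unfold j_def[symmetric] j, simp del: power_Suc\<close>)
    also have "\<dots> \<le> sqrt K * ((1/2) powr (a / 4)) ^ n" by (rule mult_left_mono[OF rho]) (use A in simp)
    finally have "E.nrm (rothe h f (Suc (2 * k)) - rothe h f (2 * k)) \<le> sqrt K * ((1/2) powr (a / 4)) ^ n" .
    moreover have "E.nrm (rothe h f (Suc (2 * k)) - rothe (2 * h) f k)
       \<le> E.nrm (rothe h f (Suc (2 * k)) - rothe h f (2 * k)) + E.nrm (rothe h f (2 * k) - rothe (2 * h) f k)"
      by (rule E.nrm_triangle) (use V h in auto)
    ultimately show ?thesis using ref unfolding ap as by linarith
  qed
qed

lemma ratio_bounds: "0 < a \<Longrightarrow> 0 \<le> (1/2::real) powr (a / 4) \<and> (1/2::real) powr (a / 4) < 1"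
  using powr_less_mono'[of "1/2::real" 0 "a/4"] by simp

text \<open>
  The element chosen in the definition of \<open>sol\<close> need not be the limit with a rate that
  \<open>geometric_limit\<close> provides, but both have distance zero.
\<close>
lemma sol_limit:
  assumes f: "admissible a K f" and t: "0 \<le> t" "t \<le> 1"
  shows "sol f t \<in> V" "(\<lambda>n. E.nrm (appr f n t - sol f t)) \<longlonglongrightarrow> 0"
    and "E.nrm (appr f n t - sol f t) \<le> 2 * sqrt K / (1 - (1/2) powr (a / 4)) * ((1/2) powr (a / 4)) ^ n"
proof -
  note A = admissibleD[OF f]
  have V: "appr f n t \<in> V" for n using A by (intro appr_V)
  have ex: "\<exists>L\<in>V. (\<lambda>n. E.nrm (appr f n t - L)) \<longlonglongrightarrow> 0 \<and>
     (\<forall>n. E.nrm (appr f n t - L) \<le> 2 * sqrt K * ((1/2) powr (a / 4)) ^ n / (1 - (1/2) powr (a / 4)))"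
    by (rule E.geometric_limit[OF V _ _ appr_step[OF f t]]) (use ratio_bounds[OF A(1)] in auto)
  then obtain L where L: "L \<in> V" "(\<lambda>n. E.nrm (appr f n t - L)) \<longlonglongrightarrow> 0"
     "\<And>n. E.nrm (appr f n t - L) \<le> 2 * sqrt K * ((1/2) powr (a / 4)) ^ n / (1 - (1/2) powr (a / 4))" by blast
  have S: "sol f t \<in> V \<and> (\<lambda>n. E.nrm (appr f n t - sol f t)) \<longlonglongrightarrow> 0"
    unfolding sol_def by (rule someI_ex) (use L in blast)
  thus "sol f t \<in> V" "(\<lambda>n. E.nrm (appr f n t - sol f t)) \<longlonglongrightarrow> 0" by auto
  have "E.nrm (L - sol f t) \<le> 0"
  proof (rule LIMSEQ_le_const)
    show "(\<lambda>n. E.nrm (appr f n t - L) + E.nrm (appr f n t - sol f t)) \<longlonglongrightarrow> 0"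
      using tendsto_add[OF L(2) S[THEN conjunct2]] by simp
    have "E.nrm (L - sol f t) \<le> E.nrm (appr f n t - L) + E.nrm (appr f n t - sol f t)" for n
      using E.nrm_triangle[of L "appr f n t" "sol f t"] E.nrm_diff_commute[of L "appr f n t"] V L S by simp
    thus "\<exists>N. \<forall>n\<ge>N. E.nrm (L - sol f t) \<le> E.nrm (appr f n t - L) + E.nrm (appr f n t - sol f t)" by blast
  qed
  hence "E.nrm (appr f n t - sol f t) \<le> E.nrm (appr f n t - L)"
    using E.nrm_triangle[of "appr f n t" L "sol f t"] V L S by simp
  also have "\<dots> \<le> 2 * sqrt K / (1 - (1/2) powr (a / 4)) * ((1/2) powr (a / 4)) ^ n" using L(3) by simp
  finally show "E.nrm (appr f n t - sol f t) \<le> 2 * sqrt K / (1 - (1/2) powr (a / 4)) * ((1/2) powr (a / 4)) ^ n" .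
qed

lemma sol_V: "\<lbrakk>admissible a K f; t \<in> {0..1}\<rbrakk> \<Longrightarrow> sol f t \<in> V"
  using sol_limit(1) by simp

lemma sol_zero: assumes f: "admissible a K f" shows "e (sol f 0) (sol f 0) = 0"
proof -
  have V: "sol f 0 \<in> V" using sol_limit(1)[OF f] by simp
  have "(\<lambda>n. E.nrm (sol f 0)) \<longlonglongrightarrow> 0"
    using sol_limit(2)[OF f, of 0] V by (simp add: appr_def E.nrm_minus)
  hence "E.nrm (sol f 0) = 0" using LIMSEQ_const_iff by blast
  thus ?thesis using E.nrm_sq[OF V] by simp
qed

lemma sol_limit_M:
  assumes f: "admissible a K f" and t: "0 \<le> t" "t \<le> 1"
  shows "(\<lambda>n. M.nrm (appr f n t - sol f t)) \<longlonglongrightarrow> 0"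
  using admissibleD[OF f] by (intro M_tendsto appr_V sol_limit[OF f t])

text \<open>
  If \<open>s\<close> and \<open>t\<close> are at most \<open>(1/2) ^ n\<close> apart, their last grid points at level \<open>n\<close> are equal or
  adjacent, so one increment of the scheme and two approximation errors bound the difference.
\<close>
lemma sol_continuous_step:
  assumes f: "admissible a K f" and s: "0 \<le> s" "s \<le> t" "t \<le> 1" and st: "t - s \<le> (1/2)^n"
  shows "E.nrm (sol f t - sol f s) \<le>
     (4 * sqrt K / (1 - (1/2) powr (a / 4)) + sqrt K) * ((1/2) powr (a / 4)) ^ n"
proof -
  note A = admissibleD[OF f]
  define r where "r = (1/2::real) powr (a / 4)"
  define i where "i = nat \<lfloor>s * 2 ^ n\<rfloor>" define j where "j = nat \<lfloor>t * 2 ^ n\<rfloor>"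
  have V: "appr f n x \<in> V" for x using A by (intro appr_V)
  have SV: "sol f s \<in> V" "sol f t \<in> V" using s by (auto intro: sol_limit[OF f])
  have "(t - s) * 2 ^ n \<le> (1/2)^n * 2^n" using st by (intro mult_right_mono) auto
  hence d: "t * 2 ^ n \<le> s * 2 ^ n + 1" by (simp add: algebra_simps flip: power_mult_distrib)
  have m: "s * 2 ^ n \<le> t * 2 ^ n" using s by simp
  have "real i \<le> s * 2 ^ n" "s * 2 ^ n < real i + 1" "real j \<le> t * 2 ^ n" "t * 2 ^ n < real j + 1"
    using s by (auto simp: i_def j_def)
  hence "real i < real (j + 1)" "real j < real (i + 2)" using d m unfolding of_nat_add by linarith+
  hence "j = i \<or> j = Suc i" by linarith
  hence inc: "E.nrm (appr f n t - appr f n s) \<le> sqrt K * r ^ n"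
  proof
    assume "j = i" thus ?thesis using A by (simp add: appr_def i_def j_def r_def)
  next
    assume j: "j = Suc i"
    have "real (Suc i) * (1/2)^n \<le> 1" using grid_le_one[of t n] s unfolding j_def[symmetric] j by simp
    thus ?thesis using rothe_increment_nrm[OF f, of i n] j by (simp add: appr_def i_def j_def r_def)
  qed
  have "E.nrm (sol f t - sol f s) \<le> E.nrm (sol f t - appr f n t) + E.nrm (appr f n t - sol f s)"
    by (rule E.nrm_triangle) (use V SV in auto)
  also have "E.nrm (appr f n t - sol f s) \<le> E.nrm (appr f n t - appr f n s) + E.nrm (appr f n s - sol f s)"
    by (rule E.nrm_triangle) (use V SV in auto)
  also have "E.nrm (sol f t - appr f n t) = E.nrm (appr f n t - sol f t)"
    by (rule E.nrm_diff_commute) (use V SV in auto)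
  finally have tri: "E.nrm (sol f t - sol f s) \<le> E.nrm (appr f n t - sol f t)
      + (E.nrm (appr f n t - appr f n s) + E.nrm (appr f n s - sol f s))" by simp
  define x where "x = 2 * sqrt K / (1 - r) * r ^ n"
  have "E.nrm (appr f n t - sol f t) \<le> x" "E.nrm (appr f n s - sol f s) \<le> x"
    unfolding x_def r_def using sol_limit(3)[OF f, of t n] sol_limit(3)[OF f, of s n] s by auto
  moreover have "(4 * sqrt K / (1 - r) + sqrt K) * r ^ n = x + x + sqrt K * r ^ n"
    by (simp add: x_def distrib_right)
  ultimately show ?thesis using tri inc unfolding r_def[symmetric] by linarith
qed

lemma sol_continuous:
  assumes f: "admissible a K f" and \<epsilon>: "0 < \<epsilon>"
  shows "\<exists>\<delta>>0. \<forall>s\<in>{0..1}. \<forall>t\<in>{0..1}. \<bar>s - t\<bar> < \<delta> \<longrightarrow> E.nrm (sol f s - sol f t) < \<epsilon>"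
proof -
  define r where "r = (1/2::real) powr (a / 4)"
  define C where "C = 4 * sqrt K / (1 - r) + sqrt K"
  have r: "0 \<le> r" "r < 1" using ratio_bounds[OF admissibleD(1)[OF f]] by (auto simp: r_def)
  have "(\<lambda>n. C * r ^ n) \<longlonglongrightarrow> C * 0" using r by (intro tendsto_intros LIMSEQ_realpow_zero)
  hence "\<forall>\<^sub>F n in sequentially. C * r ^ n < \<epsilon>" using \<epsilon> by (intro order_tendstoD) auto
  then obtain n where n: "C * r ^ n < \<epsilon>" by (auto simp: eventually_sequentially)
  have main: "E.nrm (sol f t - sol f s) < \<epsilon>" if "s \<in> {0..1}" "t \<in> {0..1}" "\<bar>s - t\<bar> < (1/2)^n" "s \<le> t" for s t
    using sol_continuous_step[OF f, of s t n] that n unfolding C_def r_def by auto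
  have "E.nrm (sol f s - sol f t) < \<epsilon>" if "s \<in> {0..1}" "t \<in> {0..1}" "\<bar>s - t\<bar> < (1/2)^n" for s t
  proof (cases "s \<le> t")
    case True thus ?thesis using main[of s t] that E.nrm_diff_commute[OF sol_V[OF f] sol_V[OF f], of s t] by simp
  next
    case False thus ?thesis using main[of t s] that by auto
  qed
  thus ?thesis by (intro exI[of _ "(1/2)^n"]) auto
qed

text \<open>
  The discrete equation is summed over the steps between \<open>s\<close> and \<open>t\<close>.  Comparison of the integrand with
  a constant \<open>c\<close> replaces the integral form of the equation: it passes to the limit directly and is
  what differentiation needs.
\<close>
lemma sol_increment:
  assumes f: "admissible a K f" and s: "0 \<le> s" "s \<le> t" "t \<le> 1" and v: "v \<in> V"
    and g: "\<And>r. r \<in> {s..t} \<Longrightarrow> \<bar>m (f r) v - e (sol f r) v - c\<bar> \<le> \<epsilon>"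
  shows "\<bar>m (sol f t - sol f s) v - (t - s) * c\<bar> \<le> \<epsilon> * (t - s)"
proof -
  note A = admissibleD[OF f]
  define r where "r = (1/2::real) powr (a / 4)"
  have r: "0 \<le> r" "r < 1" using ratio_bounds[OF admissibleD(1)[OF f]] by (auto simp: r_def)
  define \<delta> where "\<delta> n = 2 * sqrt K / (1 - r) * r ^ n * E.nrm v" for n
  have V: "appr f n x \<in> V" for n x using A by (intro appr_V)
  have SV: "sol f s \<in> V" "sol f t \<in> V" using s by (auto intro: sol_limit[OF f])
  define q where "q x n = real (nat \<lfloor>x * 2 ^ n\<rfloor>) * (1/2)^n" for x :: real and n
  have ineq: "\<bar>m (appr f n t - appr f n s) v - (q t n - q s n) * c\<bar> \<le> (\<epsilon> + \<delta> n) * (q t n - q s n)" for n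
  proof -
    define h :: real where "h = (1/2)^n"
    have h: "0 < h" by (simp add: h_def)
    have h2: "x * h * 2 ^ n = x" for x by (simp add: h_def mult.assoc flip: power_mult_distrib)
    have h3: "x * 2 ^ n * h = x" for x by (simp add: h_def mult.assoc flip: power_mult_distrib)
    define i where "i = nat \<lfloor>s * 2 ^ n\<rfloor>" define j where "j = nat \<lfloor>t * 2 ^ n\<rfloor>"
    note RV = rothe_V[of h f, OF h A(3)]
    have fl: "real j \<le> t * 2 ^ n" "s * 2 ^ n < real i + 1" using s by (auto simp: i_def j_def)
    have ij: "i \<le> j" unfolding i_def j_def using s by (intro nat_mono floor_mono) auto
    define G where "G k = m (f (real (Suc k) * h)) v - e (rothe h f (Suc k)) v" for k
    have tel: "m (rothe h f (i + k) - rothe h f i) v = (\<Sum>l<k. h * G (i + l))" for k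
    proof (induction k)
      case 0 thus ?case using RV v by (simp add: M.bilin)
    next
      case (Suc k)
      thus ?case using rothe_eq[of h f v "i + k", OF h A(3) v] RV v
        by (simp add: G_def M.bilin algebra_simps)
    qed
    have Gb: "\<bar>G k - c\<bar> \<le> \<epsilon> + \<delta> n" if k: "i \<le> k" "k < j" for k
    proof -
      define x where "x = real (Suc k) * h"
      have "real (Suc k) * h \<le> t * 2 ^ n * h" using k fl h by (intro mult_right_mono) auto
      hence x1: "x \<le> t" by (simp add: x_def h3)
      have "s * 2 ^ n * h \<le> real (Suc k) * h" using k fl h by (intro mult_right_mono) auto
      hence x2: "s \<le> x" by (simp add: x_def h3)
      have ap: "appr f n x = rothe h f (Suc k)" by (simp add: appr_def x_def h2 del: of_nat_Suc) (simp add: h_def)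
      have xV: "sol f x \<in> V" using x1 x2 s by (intro sol_limit[OF f]) auto
      have "\<bar>e (appr f n x) v - e (sol f x) v\<bar> = \<bar>e (appr f n x - sol f x) v\<bar>"
        using V xV v by (simp add: E.bilin)
      also have "\<dots> \<le> E.nrm (appr f n x - sol f x) * E.nrm v"
        by (rule E.cauchy_schwarz) (use V xV v in auto)
      also have "\<dots> \<le> \<delta> n" unfolding \<delta>_def r_def
        by (intro mult_right_mono sol_limit(3)[OF f]) (use x1 x2 s v in auto)
      finally show ?thesis using g[of x] x1 x2 unfolding G_def ap x_def[symmetric] by auto
    qed
    have qd: "q t n - q s n = real (j - i) * h" using ij by (simp add: q_def i_def j_def h_def algebra_simps)
    have "m (appr f n t - appr f n s) v = (\<Sum>l<j - i. h * G (i + l))"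
      using tel[of "j - i"] ij by (simp add: appr_def i_def j_def h_def)
    hence "m (appr f n t - appr f n s) v - (q t n - q s n) * c = (\<Sum>l<j - i. h * (G (i + l) - c))"
      unfolding qd by (simp add: sum_subtractf right_diff_distrib)
    also have "\<bar>\<dots>\<bar> \<le> (\<Sum>l<j - i. \<bar>h * (G (i + l) - c)\<bar>)" by (rule sum_abs)
    also have "\<dots> \<le> (\<Sum>l<j - i. h * (\<epsilon> + \<delta> n))"
      using h Gb by (intro sum_mono) (auto simp: abs_mult intro!: mult_left_mono)
    also have "\<dots> = (\<epsilon> + \<delta> n) * (q t n - q s n)" unfolding qd by simp
    finally show ?thesis .
  qed
  have ql: "(\<lambda>n. q x n) \<longlonglongrightarrow> x" if "0 \<le> x" for x
    using grid_tendsto[OF that] unfolding q_def .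
  have dl: "\<delta> \<longlonglongrightarrow> 0"
  proof -
    have "(\<lambda>n. 2 * sqrt K / (1 - r) * r ^ n * E.nrm v) \<longlonglongrightarrow> 2 * sqrt K / (1 - r) * 0 * E.nrm v"
      by (intro tendsto_mult tendsto_const LIMSEQ_realpow_zero r)
    thus ?thesis unfolding \<delta>_def by simp
  qed
  have ml: "(\<lambda>n. m (appr f n x) v) \<longlonglongrightarrow> m (sol f x) v" if "0 \<le> x" "x \<le> 1" for x
    by (rule M.b_tendsto) (use V v sol_limit_M[OF f that] sol_limit(1)[OF f that] in auto)
  have "(\<lambda>n. m (appr f n t - appr f n s) v) \<longlonglongrightarrow> m (sol f t - sol f s) v"
    using tendsto_diff[OF ml[of t] ml[of s]] s V SV v by (simp add: M.bilin)
  hence l1: "(\<lambda>n. \<bar>m (appr f n t - appr f n s) v - (q t n - q s n) * c\<bar>) \<longlonglongrightarrow> \<bar>m (sol f t - sol f s) v - (t - s) * c\<bar>"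
    using s by (intro tendsto_intros ql) auto
  have l2: "(\<lambda>n. (\<epsilon> + \<delta> n) * (q t n - q s n)) \<longlonglongrightarrow> (\<epsilon> + 0) * (t - s)"
    using s by (intro tendsto_intros ql dl) auto
  show ?thesis using LIMSEQ_le[OF l1 l2] ineq by auto
qed

lemma admissible_nrm:
  assumes "admissible a K f" shows "M.nrm (f s - f t) \<le> sqrt K * \<bar>s - t\<bar> powr (a / 2)"
proof -
  have "m (f s - f t) (f s - f t) \<le> K * \<bar>s - t\<bar> powr a" by (rule admissibleD[OF assms])
  also have "\<dots> = (sqrt K * \<bar>s - t\<bar> powr (a / 2))\<^sup>2"
    using sq_powr_half[of K _ a] admissibleD(2)[OF assms] by simp
  finally show ?thesis unfolding M.nrm_def using admissibleD(2)[OF assms] by (intro real_le_lsqrt) auto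
qed

lemma sol_derivative:
  assumes f: "admissible a K f" and t: "t \<in> {0..1}" and v: "v \<in> V"
    and cont: "continuous_on {0..1} (\<lambda>t. m (f t) v - e (sol f t) v)"
  shows "((\<lambda>t. m (sol f t) v) has_real_derivative m (f t) v - e (sol f t) v) (at t within {0..1})"
proof -
  define c where "c = m (f t) v - e (sol f t) v"
  have "((\<lambda>s. (m (sol f s) v - m (sol f t) v) / (s - t)) \<longlongrightarrow> c) (at t within {0..1})"
  proof (rule tendstoI)
    fix \<epsilon> :: real assume e: "0 < \<epsilon>"
    obtain \<delta> where d: "0 < \<delta>" "\<And>r. \<lbrakk>r \<in> {0..1}; dist r t < \<delta>\<rbrakk> \<Longrightarrow> dist (m (f r) v - e (sol f r) v) c < \<epsilon> / 2"
      using cont t e unfolding continuous_on_iff c_def by (meson half_gt_zero)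
    have main: "dist ((m (sol f s) v - m (sol f t) v) / (s - t)) c < \<epsilon>" if s: "s \<in> {0..1}" "s \<noteq> t" "dist s t < \<delta>" for s
    proof -
      define x y where "x = min s t" and "y = max s t"
      have xy: "0 \<le> x" "x \<le> y" "y \<le> 1" "y - x = \<bar>s - t\<bar>" using s t by (auto simp: x_def y_def)
      have V: "sol f s \<in> V" "sol f t \<in> V" using s t by (auto intro: sol_limit[OF f])
      have b: "\<bar>m (sol f y - sol f x) v - (y - x) * c\<bar> \<le> \<epsilon> / 2 * (y - x)"
      proof (rule sol_increment[OF f xy(1-3) v])
        fix r assume r: "r \<in> {x..y}"
        hence "r \<in> {0..1}" "dist r t < \<delta>" using s xy t by (auto simp: x_def y_def dist_real_def min_def max_def split: if_splits)
        thus "\<bar>m (f r) v - e (sol f r) v - c\<bar> \<le> \<epsilon> / 2" using d(2)[of r] by (simp add: dist_real_def)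
      qed
      have "\<bar>(m (sol f s) v - m (sol f t) v) - (s - t) * c\<bar> \<le> \<epsilon> / 2 * \<bar>s - t\<bar>"
      proof (cases "s \<le> t")
        case True
        hence "\<bar>m (sol f t - sol f s) v - (t - s) * c\<bar> \<le> \<epsilon> / 2 * \<bar>s - t\<bar>" using b by (simp add: x_def y_def)
        moreover have "m (sol f t - sol f s) v - (t - s) * c = - ((m (sol f s) v - m (sol f t) v) - (s - t) * c)"
          using V v by (simp add: M.bilin algebra_simps)
        ultimately show ?thesis by (simp only: abs_minus)
      next
        case False
        thus ?thesis using b V v by (simp add: x_def y_def M.bilin)
      qed
      moreover have "(m (sol f s) v - m (sol f t) v) / (s - t) - c = ((m (sol f s) v - m (sol f t) v) - (s - t) * c) / (s - t)"
        using s by (simp add: field_simps)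
      ultimately have "\<bar>(m (sol f s) v - m (sol f t) v) / (s - t) - c\<bar> \<le> \<epsilon> / 2"
        using s by (simp add: abs_divide pos_divide_le_eq)
      thus ?thesis using e by (simp add: dist_real_def)
    qed
    show "\<forall>\<^sub>F s in at t within {0..1}. dist ((m (sol f s) v - m (sol f t) v) / (s - t)) c < \<epsilon>"
      unfolding eventually_at using d(1) main by (auto simp: dist_commute)
  qed
  thus ?thesis unfolding has_field_derivative_iff c_def .
qed

text \<open>
  The difference of two schemes is the scheme for the difference of the forcings, to which the energy
  estimate applies; the bound survives in the limit.
\<close>
lemma sol_stable:
  assumes f: "admissible a K f" and g: "admissible a' K' g" and t: "0 \<le> t" "t \<le> 1"
    and B: "\<And>s. \<lbrakk>0 \<le> s; s \<le> 1\<rbrakk> \<Longrightarrow> m (f s - g s) (f s - g s) \<le> B"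
  shows "e (sol f t - sol g t) (sol f t - sol g t) \<le> B"
proof -
  note A = admissibleD[OF f] admissibleD[OF g]
  have V: "appr f n t \<in> V" "appr g n t \<in> V" for n using A by (intro appr_V; simp)+
  have SV: "sol f t \<in> V" "sol g t \<in> V" using t by (auto intro: sol_limit[OF f] sol_limit[OF g])
  have B0: "0 \<le> B" using B[of 0] M.nonneg[of "f 0 - g 0"] A by force
  have "e (appr f n t - appr g n t) (appr f n t - appr g n t) \<le> B" for n
  proof -
    define h :: real where "h = (1/2)^n"
    have h: "0 < h" by (simp add: h_def)
    define N where "N = nat \<lfloor>t * 2 ^ n\<rfloor>"
    have N: "real N * h \<le> 1" unfolding N_def h_def by (rule grid_le_one) (rule t)
    note RV = rothe_V[of h f, OF h A(3)] rothe_V[of h g, OF h A(8)]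
    define U where "U k = rothe h f k - rothe h g k" for k
    have "(\<Sum>k<N. m (U (Suc k) - U k) (U (Suc k) - U k)) / h + e (U N) (U N)
        \<le> (\<Sum>k<N. h * m (f (real (Suc k) * h) - g (real (Suc k) * h)) (f (real (Suc k) * h) - g (real (Suc k) * h)) + e 0 0)"
    proof (rule steps_estimate)
      fix k v assume v: "v \<in> V"
      show "m (U (Suc k) - U k) v + h * e (U (Suc k)) v = h * m (f (real (Suc k) * h) - g (real (Suc k) * h)) v + h * e 0 v"
        using rothe_eq[of h f v k, OF h A(3) v] rothe_eq[of h g v k, OF h A(8) v] RV v A(3,8)
        by (simp add: U_def M.bilin E.bilin algebra_simps)
    qed (use RV A h in \<open>auto simp: U_def\<close>)
    also have "\<dots> \<le> (\<Sum>k<N. h * B)"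
    proof (rule sum_mono)
      fix k assume "k \<in> {..<N}"
      hence "real (Suc k) * h \<le> real N * h" using h by (intro mult_right_mono) auto
      hence "real (Suc k) * h \<le> 1" using N by linarith
      thus "h * m (f (real (Suc k) * h) - g (real (Suc k) * h)) (f (real (Suc k) * h) - g (real (Suc k) * h)) + e 0 0 \<le> h * B"
        using h B[of "real (Suc k) * h"] by (simp add: E.bilin)
    qed
    also have "\<dots> = (real N * h) * B" by simp
    also have "\<dots> \<le> 1 * B" by (rule mult_right_mono[OF N B0])
    finally have "(\<Sum>k<N. m (U (Suc k) - U k) (U (Suc k) - U k)) / h + e (U N) (U N) \<le> B" by simp
    moreover have "0 \<le> (\<Sum>k<N. m (U (Suc k) - U k) (U (Suc k) - U k)) / h"
      using RV h by (intro divide_nonneg_pos sum_nonneg M.nonneg) (auto simp: U_def)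
    ultimately show ?thesis by (simp add: U_def appr_def h_def N_def)
  qed
  moreover have "(\<lambda>n. e (appr f n t - appr g n t) (appr f n t - appr g n t)) \<longlonglongrightarrow> e (sol f t - sol g t) (sol f t - sol g t)"
  proof (rule E.sq_tendsto)
    show "(\<lambda>n. E.nrm (appr f n t - appr g n t - (sol f t - sol g t))) \<longlonglongrightarrow> 0"
    proof (rule Lim_null_comparison)
      show "(\<lambda>n. E.nrm (appr f n t - sol f t) + E.nrm (appr g n t - sol g t)) \<longlonglongrightarrow> 0"
        using tendsto_add[OF sol_limit(2)[OF f t] sol_limit(2)[OF g t]] by simp
      have "E.nrm (appr f n t - appr g n t - (sol f t - sol g t)) \<le> E.nrm (appr f n t - sol f t) + E.nrm (appr g n t - sol g t)" for n
      proof -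
        have eq: "appr f n t - appr g n t - (sol f t - sol g t) = (appr f n t - sol f t) - (appr g n t - sol g t)" by simp
        show ?thesis unfolding eq by (rule E.nrm_diff) (use V SV in auto)
      qed
      thus "\<forall>\<^sub>F n in sequentially. norm (E.nrm (appr f n t - appr g n t - (sol f t - sol g t))) \<le> E.nrm (appr f n t - sol f t) + E.nrm (appr g n t - sol g t)"
        using V SV by simp
    qed
  qed (use V SV in auto)
  ultimately show ?thesis by (intro LIMSEQ_le_const2) auto
qed

text \<open>
  Cauchy-Schwarz for the telescoping sum of the increments between \<open>s\<close> and \<open>t\<close>, together with the bound
  of \<open>rothe_bound\<close> for the sum of their squares.
\<close>
lemma sol_lipschitz_sq:
  assumes f: "admissible a K f" and F: "\<And>t. \<lbrakk>0 \<le> t; t \<le> 1\<rbrakk> \<Longrightarrow> m (f t) (f t) \<le> F"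
    and s: "0 \<le> s" "s \<le> t" "t \<le> 1"
  shows "m (sol f t - sol f s) (sol f t - sol f s) \<le> F * (t - s)"
proof -
  note A = admissibleD[OF f]
  have F0: "0 \<le> F" using F[of 0] M.nonneg[of "f 0"] A by force
  define q where "q x n = real (nat \<lfloor>x * 2 ^ n\<rfloor>) * (1/2)^n" for x :: real and n
  have V: "appr f n x \<in> V" for n x using A by (intro appr_V)
  have SV: "sol f s \<in> V" "sol f t \<in> V" using s by (auto intro: sol_limit[OF f])
  have ineq: "m (appr f n t - appr f n s) (appr f n t - appr f n s) \<le> F * (q t n - q s n)" for n
  proof -
    define h :: real where "h = (1/2)^n"
    have h: "0 < h" by (simp add: h_def)
    define i where "i = nat \<lfloor>s * 2 ^ n\<rfloor>" define j where "j = nat \<lfloor>t * 2 ^ n\<rfloor>"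
    note RV = rothe_V[of h f, OF h A(3)]
    define d where "d k = rothe h f (Suc k) - rothe h f k" for k
    have dV: "d k \<in> V" for k using RV by (simp add: d_def)
    have ij: "i \<le> j" unfolding i_def j_def using s by (intro nat_mono floor_mono) auto
    have N: "real j * h \<le> 1" unfolding j_def h_def by (rule grid_le_one) (rule s)
    have tel: "rothe h f (i + k) - rothe h f i = (\<Sum>l<k. d (i + l))" for k
      by (induction k) (auto simp: d_def algebra_simps)
    have "m (appr f n t - appr f n s) (appr f n t - appr f n s) = m (\<Sum>l<j-i. d (i + l)) (\<Sum>l<j-i. d (i + l))"
      using tel[of "j - i"] ij by (simp add: appr_def i_def j_def h_def)
    also have "\<dots> \<le> real (j - i) * (\<Sum>l<j-i. m (d (i + l)) (d (i + l)))"
      using dV by (intro M.sq_sum_le) auto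
    also have "(\<Sum>l<j-i. m (d (i + l)) (d (i + l))) = (\<Sum>l\<in>{i..<j}. m (d l) (d l))"
      by (rule sum.reindex_bij_witness[of _ "\<lambda>l. l - i" "\<lambda>l. i + l"]) (use ij in auto)
    also have "\<dots> \<le> (\<Sum>l<j. m (d l) (d l))"
      using dV by (intro sum_mono2) (auto intro!: M.nonneg)
    also have "\<dots> \<le> h * (real j * h * F)" unfolding d_def
      by (rule rothe_bound(1)[of h f F j, OF h A(3) F N F0])
    also have "\<dots> \<le> h * (1 * F)" using h N F0 by (intro mult_left_mono mult_right_mono) auto
    finally have "m (appr f n t - appr f n s) (appr f n t - appr f n s) \<le> real (j - i) * (h * (1 * F))"
      by (simp add: mult_left_mono)
    also have "\<dots> = F * (q t n - q s n)" using ij by (simp add: q_def i_def j_def h_def algebra_simps)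
    finally show ?thesis .
  qed
  have "(\<lambda>n. F * (q t n - q s n)) \<longlonglongrightarrow> F * (t - s)"
    unfolding q_def using s by (intro tendsto_intros grid_tendsto) auto
  moreover have "(\<lambda>n. m (appr f n t - appr f n s) (appr f n t - appr f n s)) \<longlonglongrightarrow> m (sol f t - sol f s) (sol f t - sol f s)"
  proof (rule M.sq_tendsto)
    show "(\<lambda>n. M.nrm (appr f n t - appr f n s - (sol f t - sol f s))) \<longlonglongrightarrow> 0"
    proof (rule Lim_null_comparison)
      show "(\<lambda>n. M.nrm (appr f n t - sol f t) + M.nrm (appr f n s - sol f s)) \<longlonglongrightarrow> 0"
        using tendsto_add[OF sol_limit_M[OF f, of t] sol_limit_M[OF f, of s]] s by simp
      have "M.nrm (appr f n t - appr f n s - (sol f t - sol f s)) \<le> M.nrm (appr f n t - sol f t) + M.nrm (appr f n s - sol f s)" for n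
      proof -
        have eq: "appr f n t - appr f n s - (sol f t - sol f s) = (appr f n t - sol f t) - (appr f n s - sol f s)" by simp
        show ?thesis unfolding eq by (rule M.nrm_diff) (use V SV in auto)
      qed
      thus "\<forall>\<^sub>F n in sequentially. norm (M.nrm (appr f n t - appr f n s - (sol f t - sol f s))) \<le> M.nrm (appr f n t - sol f t) + M.nrm (appr f n s - sol f s)"
        using V SV by simp
    qed
  qed (use V SV in auto)
  ultimately show ?thesis using ineq by (intro LIMSEQ_le) auto
qed

end

section \<open>Square-integrable functions and difference quotients\<close>

text \<open>
  Lebesgue measure on a product is the completion of the product of the Borel measures, not the product
  of the completions.  Null sets and measurable functions of one factor are therefore lifted through
  Borel representatives.
\<close>
lemma AE_lebesgue_fst:
  assumes "AE x in (lebesgue :: 'a::euclidean_space measure). P x"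
  shows "AE z in (lebesgue :: ('a \<times> 'b::euclidean_space) measure). P (fst z)"
proof -
  obtain N where N: "N \<in> null_sets (lborel :: 'a measure)" "{x. \<not> P x} \<subseteq> N"
    using assms unfolding AE_completion_iff by (auto elim!: AE_E simp: null_sets_def)
  have "N \<times> (UNIV :: 'b set) \<in> null_sets (lborel \<Otimes>\<^sub>M lborel)"
    by (rule lborel.times_in_null_sets1) (use N in auto)
  hence "AE z in (lborel :: ('a \<times> 'b) measure). z \<notin> N \<times> UNIV"
    unfolding lborel_prod by (rule AE_not_in)
  thus ?thesis unfolding AE_completion_iff by eventually_elim (use N in auto)
qed

lemma AE_lebesgue_snd:
  assumes "AE x in (lebesgue :: 'b::euclidean_space measure). P x"
  shows "AE z in (lebesgue :: ('a::euclidean_space \<times> 'b) measure). P (snd z)"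
proof -
  obtain N where N: "N \<in> null_sets (lborel :: 'b measure)" "{x. \<not> P x} \<subseteq> N"
    using assms unfolding AE_completion_iff by (auto elim!: AE_E simp: null_sets_def)
  have "(UNIV :: 'a set) \<times> N \<in> null_sets (lborel \<Otimes>\<^sub>M lborel)"
    by (rule lborel.times_in_null_sets2) (use N in auto)
  hence "AE z in (lborel :: ('a \<times> 'b) measure). z \<notin> UNIV \<times> N"
    unfolding lborel_prod by (rule AE_not_in)
  thus ?thesis unfolding AE_completion_iff by eventually_elim (use N in auto)
qed

lemma borel_measurable_lebesgue_fst:
  fixes u :: "'a::euclidean_space \<Rightarrow> real"
  assumes "u \<in> borel_measurable lebesgue"
  shows "(\<lambda>z. u (fst z)) \<in> borel_measurable (lebesgue :: ('a \<times> 'b::euclidean_space) measure)"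
proof -
  obtain u' where u': "u' \<in> borel_measurable lborel" "AE x in lebesgue. u x = u' x"
    using completion_ex_borel_measurable_real[OF assms] unfolding AE_completion_iff by blast
  have "(\<lambda>z. u' (fst z)) \<in> borel_measurable (borel :: ('a \<times> 'b) measure)"
    by (rule measurable_compose[OF borel_measurable_continuous_onI])
       (use u'(1) in \<open>auto intro: continuous_on_fst continuous_on_id\<close>)
  hence "(\<lambda>z. u' (fst z)) \<in> borel_measurable (lebesgue :: ('a \<times> 'b) measure)"
    by (intro measurable_completion) simp
  moreover have "AE z in (lebesgue :: ('a \<times> 'b) measure). u' (fst z) = u (fst z)"
    using AE_lebesgue_fst[OF u'(2)] by eventually_elim simp
  ultimately show ?thesis by (rule borel_measurable_AE)
qed

lemma borel_measurable_lebesgue_snd: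
  fixes u :: "'b::euclidean_space \<Rightarrow> real"
  assumes "u \<in> borel_measurable lebesgue"
  shows "(\<lambda>z. u (snd z)) \<in> borel_measurable (lebesgue :: ('a::euclidean_space \<times> 'b) measure)"
proof -
  obtain u' where u': "u' \<in> borel_measurable lborel" "AE x in lebesgue. u x = u' x"
    using completion_ex_borel_measurable_real[OF assms] unfolding AE_completion_iff by blast
  have "(\<lambda>z. u' (snd z)) \<in> borel_measurable (borel :: ('a \<times> 'b) measure)"
    by (rule measurable_compose[OF borel_measurable_continuous_onI])
       (use u'(1) in \<open>auto intro: continuous_on_snd continuous_on_id\<close>)
  hence "(\<lambda>z. u' (snd z)) \<in> borel_measurable (lebesgue :: ('a \<times> 'b) measure)"
    by (intro measurable_completion) simp
  moreover have "AE z in (lebesgue :: ('a \<times> 'b) measure). u' (snd z) = u (snd z)"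
    using AE_lebesgue_snd[OF u'(2)] by eventually_elim simp
  ultimately show ?thesis by (rule borel_measurable_AE)
qed

lemma L2D: "f \<in> L2 M \<Longrightarrow> f \<in> borel_measurable M" "f \<in> L2 M \<Longrightarrow> integrable M (\<lambda>x. (f x)\<^sup>2)"
  by (auto simp: L2_def)

lemma L2_integrable_mult:
  assumes "f \<in> L2 M" "g \<in> L2 M" shows "integrable M (\<lambda>x. f x * g x)"
proof (rule Bochner_Integration.integrable_bound)
  show "integrable M (\<lambda>x. (f x)\<^sup>2 + (g x)\<^sup>2)" using assms by (auto simp: L2_def)
  show "(\<lambda>x. f x * g x) \<in> borel_measurable M" using assms by (auto simp: L2_def)
  have "\<bar>f x * g x\<bar> \<le> \<bar>(f x)\<^sup>2 + (g x)\<^sup>2\<bar>" for x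
  proof -
    have "2 * \<bar>f x * g x\<bar> \<le> (f x)\<^sup>2 + (g x)\<^sup>2"
      using sum_squares_bound[of "\<bar>f x\<bar>" "\<bar>g x\<bar>"] by (simp add: abs_mult)
    thus ?thesis using abs_ge_zero[of "f x * g x"] by linarith
  qed
  thus "AE x in M. norm (f x * g x) \<le> norm ((f x)\<^sup>2 + (g x)\<^sup>2)" by simp
qed

lemma L2_dominated:
  assumes "f \<in> L2 M" "g \<in> borel_measurable M" "AE x in M. \<bar>g x\<bar> \<le> \<bar>f x\<bar>"
  shows "g \<in> L2 M"
proof -
  have "integrable M (\<lambda>x. (g x)\<^sup>2)"
  proof (rule Bochner_Integration.integrable_bound)
    show "integrable M (\<lambda>x. (f x)\<^sup>2)" using assms by (auto simp: L2_def)
    show "AE x in M. norm ((g x)\<^sup>2) \<le> norm ((f x)\<^sup>2)"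
      using assms(3) by eventually_elim (simp add: abs_le_square_iff)
  qed (use assms in auto)
  thus ?thesis using assms by (simp add: L2_def)
qed

lemma L2_add: assumes "f \<in> L2 M" "g \<in> L2 M" shows "(\<lambda>x. f x + g x) \<in> L2 M"
proof -
  have "integrable M (\<lambda>x. (f x)\<^sup>2 + 2 * (f x * g x) + (g x)\<^sup>2)"
    using assms L2_integrable_mult[OF assms] by (auto simp: L2_def)
  hence "integrable M (\<lambda>x. (f x + g x)\<^sup>2)" by (simp add: power2_sum algebra_simps)
  thus ?thesis using assms by (auto simp: L2_def)
qed

lemma L2_scale: assumes "f \<in> L2 M" shows "(\<lambda>x. c * f x) \<in> L2 M"
  using assms by (auto simp: L2_def power_mult_distrib)

lemma L2_diff: assumes "f \<in> L2 M" "g \<in> L2 M" shows "(\<lambda>x. f x - g x) \<in> L2 M"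
  using L2_add[OF assms(1) L2_scale[OF assms(2), of "-1"]] by simp

lemma subspace_L2: "subspace (L2 M)"
  unfolding subspace_def
  by (auto simp: L2_add L2_scale plus_fun_def scaleR_fun_def zero_fun_def) (simp add: L2_def)

lemma semi_inner_L2: "semi_inner (L2 M) (\<lambda>f g. LINT x|M. f x * g x)"
proof
  show "subspace (L2 M)" by (rule subspace_L2)
  fix u v w assume a: "u \<in> L2 M" "v \<in> L2 M" "w \<in> L2 M"
  show "(LINT x|M. (u + v) x * w x) = (LINT x|M. u x * w x) + (LINT x|M. v x * w x)"
    using a by (simp add: distrib_right L2_integrable_mult)
  show "(LINT x|M. u x * w x) = (LINT x|M. w x * u x)" by (simp add: mult.commute)
  show "(LINT x|M. (c *\<^sub>R u) x * w x) = c * (LINT x|M. u x * w x)" for c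
    by (simp add: mult.assoc)
qed simp

lemma L2_fatou:
  assumes X: "\<And>n. X n \<in> L2 M" and L: "L \<in> borel_measurable M"
    and lim: "AE x in M. (\<lambda>n. X n x) \<longlonglongrightarrow> L x"
    and B: "\<forall>\<^sub>F n in sequentially. (LINT x|M. (X n x)\<^sup>2) \<le> B" and B0: "0 \<le> B"
  shows "L \<in> L2 M" "(LINT x|M. (L x)\<^sup>2) \<le> B"
proof -
  have [measurable]: "X n \<in> borel_measurable M" for n using X by (auto simp: L2_def)
  note L[measurable]
  have "(\<integral>\<^sup>+ x. ennreal ((L x)\<^sup>2) \<partial>M) = (\<integral>\<^sup>+ x. liminf (\<lambda>n. ennreal ((X n x)\<^sup>2)) \<partial>M)"
  proof (rule nn_integral_cong_AE)
    show "AE x in M. ennreal ((L x)\<^sup>2) = liminf (\<lambda>n. ennreal ((X n x)\<^sup>2))"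
      using lim
    proof eventually_elim
      case (elim x)
      have "(\<lambda>n. ennreal ((X n x)\<^sup>2)) \<longlonglongrightarrow> ennreal ((L x)\<^sup>2)"
        by (intro tendsto_ennrealI tendsto_power elim)
      thus ?case using lim_imp_Liminf[OF sequentially_bot] by metis
    qed
  qed
  also have "\<dots> \<le> liminf (\<lambda>n. \<integral>\<^sup>+ x. ennreal ((X n x)\<^sup>2) \<partial>M)" by (rule nn_integral_liminf) simp
  also have "\<dots> \<le> limsup (\<lambda>n. \<integral>\<^sup>+ x. ennreal ((X n x)\<^sup>2) \<partial>M)" by (rule Liminf_le_Limsup) simp
  also have "\<dots> \<le> ennreal B"
  proof (rule Limsup_bounded)
    show "\<forall>\<^sub>F n in sequentially. (\<integral>\<^sup>+ x. ennreal ((X n x)\<^sup>2) \<partial>M) \<le> ennreal B"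
      using B by eventually_elim (subst nn_integral_eq_integral, use X in \<open>auto simp: L2_def intro: ennreal_leI\<close>)
  qed
  finally have le: "(\<integral>\<^sup>+ x. ennreal ((L x)\<^sup>2) \<partial>M) \<le> ennreal B" .
  have int: "integrable M (\<lambda>x. (L x)\<^sup>2)"
    by (rule integrableI_nonneg) (use le in \<open>auto simp: less_top[symmetric] top_unique le_less_trans[OF _ ennreal_less_top]\<close>)
  thus "L \<in> L2 M" using L by (simp add: L2_def)
  have "ennreal (LINT x|M. (L x)\<^sup>2) = (\<integral>\<^sup>+ x. ennreal ((L x)\<^sup>2) \<partial>M)"
    by (rule nn_integral_eq_integral[symmetric, OF int]) simp
  thus "(LINT x|M. (L x)\<^sup>2) \<le> B" using le ennreal_le_iff[OF B0] by metis
qed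

lemma L2_const: "finite_measure M \<Longrightarrow> (\<lambda>x. c) \<in> L2 M"
  by (simp add: L2_def finite_measure.integrable_const)

text \<open>
  On a finite measure space geometric decay in \<open>L\<^sup>2\<close> implies geometric decay in \<open>L\<^sup>1\<close>.  The series of the
  absolute increments then has finite integral, hence is finite almost everywhere.
\<close>
lemma L2_geometric_AE_convergent:
  assumes fin: "finite_measure M" and Y: "\<And>k. Y k \<in> L2 M" and r: "0 \<le> r" "r < 1"
    and step: "\<And>k. L2_norm M (\<lambda>x. Y (Suc k) x - Y k x) \<le> C * r ^ k"
  shows "AE x in M. convergent (\<lambda>k. Y k x)"
proof -
  interpret finite_measure M by fact
  interpret L: semi_inner "L2 M" "\<lambda>f g. LINT x|M. f x * g x" by (rule semi_inner_L2)
  define Z where "Z k = (\<lambda>x. \<bar>Y (Suc k) x - Y k x\<bar>)" for k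
  have [measurable]: "Y k \<in> borel_measurable M" for k using Y by (auto simp: L2_def)
  have ZL: "Z k \<in> L2 M" for k unfolding Z_def
    by (rule L2_dominated[OF L2_diff[OF Y[of "Suc k"] Y[of k]]]) auto
  have oneL: "(\<lambda>x. 1) \<in> L2 M" by (rule L2_const[OF fin])
  have Zi: "integrable M (Z k)" for k using L2_integrable_mult[OF ZL[of k] oneL] by simp
  define D where "D = L.nrm (\<lambda>x. 1)"
  have D0: "0 \<le> D" using L.nrm_nonneg[OF oneL] by (simp add: D_def)
  have Zb: "(LINT x|M. Z k x) \<le> C * D * r ^ k" for k
  proof -
    have "(LINT x|M. Z k x) \<le> L.nrm (Z k) * D"
      using L.cauchy_schwarz[OF ZL[of k] oneL] by (simp add: D_def)
    also have "L.nrm (Z k) = L2_norm M (\<lambda>x. Y (Suc k) x - Y k x)"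
      by (simp add: L.nrm_def L2_norm_def Z_def power2_eq_square abs_mult[symmetric])
    also have "\<dots> * D \<le> C * r ^ k * D" by (rule mult_right_mono[OF step D0])
    finally show ?thesis by (simp add: mult_ac)
  qed
  have Z0: "0 \<le> (LINT x|M. Z k x)" for k by (simp add: Z_def)
  have [measurable]: "Z k \<in> borel_measurable M" for k using ZL by (auto simp: L2_def)
  have "(\<integral>\<^sup>+ x. (\<Sum>k. ennreal (Z k x)) \<partial>M) = (\<Sum>k. \<integral>\<^sup>+ x. ennreal (Z k x) \<partial>M)"
    by (rule nn_integral_suminf) simp
  also have "\<dots> = (\<Sum>k. ennreal (LINT x|M. Z k x))"
    by (intro suminf_cong nn_integral_eq_integral Zi) (simp add: Z_def)
  also have "\<dots> = ennreal (\<Sum>k. LINT x|M. Z k x)"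
  proof (rule suminf_ennreal2[OF Z0])
    show "summable (\<lambda>k. LINT x|M. Z k x)"
      by (rule summable_comparison_test'[of "\<lambda>k. C * D * r ^ k" 0])
         (use Zb Z0 r in \<open>auto intro!: summable_mult summable_geometric\<close>)
  qed
  finally have "(\<integral>\<^sup>+ x. (\<Sum>k. ennreal (Z k x)) \<partial>M) \<noteq> \<infinity>" by simp
  hence "AE x in M. (\<Sum>k. ennreal (Z k x)) \<noteq> \<infinity>" by (intro nn_integral_PInf_AE) auto
  thus ?thesis
  proof eventually_elim
    case (elim x)
    have "summable (\<lambda>k. Z k x)" by (rule summable_suminf_not_top) (use elim in \<open>auto simp: Z_def\<close>)
    hence "summable (\<lambda>k. Y (Suc k) x - Y k x)" unfolding Z_def by (rule summable_rabs_cancel)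
    hence "convergent (\<lambda>n. \<Sum>k<n. Y (Suc k) x - Y k x)" by (simp add: summable_iff_convergent)
    hence "convergent (\<lambda>n. Y n x - Y 0 x)" unfolding sum_lessThan_telescope[of "\<lambda>k. Y k x"] .
    hence "convergent (\<lambda>n. (Y n x - Y 0 x) + Y 0 x)" by (intro convergent_add convergent_const)
    thus ?case by simp
  qed
qed

text \<open>
  The integrand of the energy is the product of two such weighted difference quotients, so the energy is
  an \<open>L\<^sup>2\<close> product on the space of pairs.
\<close>
definition dq :: "real \<Rightarrow> (real ^ 'n \<Rightarrow> real) \<Rightarrow> (real ^ 'n) \<times> (real ^ 'n) \<Rightarrow> real" where
  "dq s u z = (u (fst z) - u (snd z)) / norm (fst z - snd z) powr ((real CARD('n) + 2 * s) / 2)"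

lemma dq_add [simp]: "dq s (\<lambda>x. u x + v x) z = dq s u z + dq s v z"
  by (simp add: dq_def add_divide_distrib diff_divide_distrib)
lemma dq_diff [simp]: "dq s (\<lambda>x. u x - v x) z = dq s u z - dq s v z"
  by (simp add: dq_def diff_divide_distrib)
lemma dq_scale [simp]: "dq s (\<lambda>x. c * u x) z = c * dq s u z"
  by (simp add: dq_def diff_divide_distrib right_diff_distrib)

lemma dq_mult:
  fixes u v :: "real ^ 'n \<Rightarrow> real"
  shows "dq s u z * dq s v z = (u (fst z) - u (snd z)) * (v (fst z) - v (snd z))
     / norm (fst z - snd z) powr (real CARD('n) + 2 * s)"
  by (simp add: dq_def powr_add[symmetric])

lemma measurable_dq:
  fixes u :: "real ^ 'n \<Rightarrow> real"
  assumes "u \<in> borel_measurable lebesgue" shows "dq s u \<in> borel_measurable lebesgue"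
proof -
  have "(\<lambda>z::(real^'n) \<times> (real^'n). norm (fst z - snd z) powr ((real CARD('n) + 2 * s) / 2)) \<in> borel_measurable lebesgue"
  proof (rule measurable_completion)
    have "(\<lambda>z::(real^'n) \<times> (real^'n). norm (fst z - snd z)) \<in> borel_measurable borel"
      by (intro borel_measurable_continuous_onI continuous_intros)
    thus "(\<lambda>z::(real^'n) \<times> (real^'n). norm (fst z - snd z) powr ((real CARD('n) + 2 * s) / 2)) \<in> borel_measurable lborel"
      by simp
  qed
  thus ?thesis unfolding dq_def[abs_def]
    using borel_measurable_lebesgue_fst[OF assms] borel_measurable_lebesgue_snd[OF assms] by measurable
qed

lemma Hs_iff: "u \<in> Hs s \<longleftrightarrow> u \<in> L2 lebesgue \<and> dq s u \<in> L2 lebesgue"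
proof -
  have "(dq s u z)\<^sup>2 = (case z of (x, y) \<Rightarrow> \<bar>u x - u y\<bar>\<^sup>2 / norm (x - y) powr (real CARD('a) + 2 * s))" for z
    by (cases z) (simp add: power2_eq_square dq_mult)
  thus ?thesis using measurable_dq[of u s] by (auto simp: Hs_def L2_def)
qed

lemma energy_dq: "energy s u v = c_frac CARD('n) s / 2 * (LINT z|lebesgue. dq s u z * dq s (v :: real ^ 'n \<Rightarrow> real) z)"
  unfolding energy_def dq_mult by (simp only: case_prod_unfold)

lemma X0s_iff:
  assumes "\<Omega> \<in> sets lebesgue"
  shows "u \<in> X0s \<Omega> s \<longleftrightarrow> u \<in> L2 lebesgue \<and> dq s u \<in> L2 lebesgue \<and> (AE x in lebesgue. x \<notin> \<Omega> \<longrightarrow> u x = 0)"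
proof -
  have "- \<Omega> \<in> sets lebesgue" using assms by (simp add: Compl_in_sets_lebesgue)
  thus ?thesis by (auto simp: X0s_def Hs_iff AE_restrict_space_iff)
qed

lemma subspace_X0s: "\<Omega> \<in> sets lebesgue \<Longrightarrow> subspace (X0s \<Omega> s)"
  unfolding subspace_def
proof (intro conjI ballI allI)
  assume O: "\<Omega> \<in> sets lebesgue"
  show "0 \<in> X0s \<Omega> s" unfolding X0s_iff[OF O] by (simp add: zero_fun_def L2_def dq_def[abs_def])
  fix u v c assume u: "u \<in> X0s \<Omega> s"
  show "c *\<^sub>R u \<in> X0s \<Omega> s" using u unfolding X0s_iff[OF O] scaleR_fun_def
    by (auto simp: L2_scale dq_scale[abs_def])
  assume v: "v \<in> X0s \<Omega> s"
  show "u + v \<in> X0s \<Omega> s" using u v unfolding X0s_iff[OF O] plus_fun_def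
    by (auto simp: L2_add dq_add[abs_def])
qed

lemma c_frac_pos: assumes "0 < s" "s < 1" shows "0 < c_frac N s"
  unfolding c_frac_def using assms by (intro divide_pos_pos mult_pos_pos Gamma_real_pos) auto

lemma energy_semi_inner:
  assumes O: "\<Omega> \<in> sets lebesgue" and s: "0 < s" "s < 1"
  shows "semi_inner (X0s \<Omega> s :: (real ^ 'n \<Rightarrow> real) set) (energy s)"
proof -
  interpret L: semi_inner "L2 (lebesgue :: ((real ^ 'n) \<times> (real ^ 'n)) measure)" "\<lambda>f g. LINT x|lebesgue. f x * g x"
    by (rule semi_inner_L2)
  note c = c_frac_pos[OF s, of "CARD('n)"]
  show ?thesis
  proof
    show "subspace (X0s \<Omega> s :: (real ^ 'n \<Rightarrow> real) set)" by (rule subspace_X0s[OF O])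
    fix u v w :: "real ^ 'n \<Rightarrow> real" and k
    assume u: "u \<in> X0s \<Omega> s"
    hence du: "dq s u \<in> L2 lebesgue" by (simp add: X0s_iff[OF O])
    show "0 \<le> energy s u u" unfolding energy_dq using c by (intro mult_nonneg_nonneg L.nonneg du) simp
    assume w: "w \<in> X0s \<Omega> s"
    hence dw: "dq s w \<in> L2 lebesgue" by (simp add: X0s_iff[OF O])
    show "energy s u w = energy s w u" unfolding energy_dq by (simp add: mult.commute)
    show "energy s (k *\<^sub>R u) w = k * energy s u w" unfolding energy_dq scaleR_fun_def
      by (simp add: mult.assoc)
    assume v: "v \<in> X0s \<Omega> s"
    hence dv: "dq s v \<in> L2 lebesgue" by (simp add: X0s_iff[OF O])
    show "energy s (u + v) w = energy s u w + energy s v w" unfolding energy_dq plus_fun_def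
      by (simp add: distrib_right distrib_left L2_integrable_mult du dv dw)
  qed
qed

section \<open>The fractional energy space of a bounded open set\<close>

lemma L2_abs: "f \<in> L2 M \<Longrightarrow> (\<lambda>x. \<bar>f x\<bar>) \<in> L2 M"
  by (rule L2_dominated[of f]) (auto simp: L2_def)

locale frac_domain =
  fixes \<Omega> :: "(real ^ 'n) set" and s :: real
  assumes open_dom: "open \<Omega>" and bounded_dom: "bounded \<Omega>" and s_pos: "0 < s" and s_less: "s < 1"
begin

lemma sets_dom [simp, measurable]: "\<Omega> \<in> sets lebesgue" using open_dom by auto

lemma finite_dom: "finite_measure (lebesgue_on \<Omega>)"
proof (rule finite_measureI)
  have "\<Omega> \<in> sets lborel" using open_dom by simp
  thus "emeasure (lebesgue_on \<Omega>) (space (lebesgue_on \<Omega>)) \<noteq> \<infinity>"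
    using emeasure_bounded_finite[OF bounded_dom]
    by (simp add: emeasure_restrict_space space_restrict_space less_top)
qed

abbreviation Hsp :: "(real ^ 'n \<Rightarrow> real) set" where "Hsp \<equiv> L2 (lebesgue_on \<Omega>)"
abbreviation Vsp :: "(real ^ 'n \<Rightarrow> real) set" where "Vsp \<equiv> X0s \<Omega> s"
abbreviation ip :: "(real ^ 'n \<Rightarrow> real) \<Rightarrow> (real ^ 'n \<Rightarrow> real) \<Rightarrow> real" where
  "ip u v \<equiv> LINT x|lebesgue_on \<Omega>. u x * v x"

lemma AE_dom: "(AE x in lebesgue_on \<Omega>. P x) \<longleftrightarrow> (AE x in lebesgue. x \<in> \<Omega> \<longrightarrow> P x)"
  by (rule AE_restrict_space_iff) simp

lemma Vsp_iff: "u \<in> Vsp \<longleftrightarrow> u \<in> L2 lebesgue \<and> dq s u \<in> L2 lebesgue \<and> (AE x in lebesgue. x \<notin> \<Omega> \<longrightarrow> u x = 0)"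
  by (rule X0s_iff) simp

lemma VspD: assumes "u \<in> Vsp"
  shows "u \<in> L2 lebesgue" "dq s u \<in> L2 lebesgue" "AE x in lebesgue. x \<notin> \<Omega> \<longrightarrow> u x = 0" "u \<in> borel_measurable lebesgue"
  using assms L2D(1) by (auto simp: Vsp_iff)

lemma L2_restrict: assumes "u \<in> L2 lebesgue" shows "u \<in> Hsp"
proof -
  have "integrable lebesgue (\<lambda>x. indicator \<Omega> x *\<^sub>R (u x)\<^sup>2)"
    using assms by (intro integrable_mult_indicator) (auto simp: L2_def)
  hence "integrable (lebesgue_on \<Omega>) (\<lambda>x. (u x)\<^sup>2)" by (subst integrable_restrict_space) auto
  thus ?thesis using assms by (auto simp: L2_def intro: measurable_restrict_space1)
qed

lemma Vsp_Hsp: "u \<in> Vsp \<Longrightarrow> u \<in> Hsp" using VspD L2_restrict by blast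

lemma ip_Vsp: assumes "u \<in> Vsp" "v \<in> Vsp" shows "ip u v = (LINT x|lebesgue. u x * v x)"
proof -
  have [measurable]: "u \<in> borel_measurable lebesgue" "v \<in> borel_measurable lebesgue" using assms VspD by auto
  have "ip u v = (LINT x|lebesgue. indicator \<Omega> x *\<^sub>R (u x * v x))" by (rule integral_restrict_space) simp
  also have "\<dots> = (LINT x|lebesgue. u x * v x)"
  proof (rule integral_cong_AE)
    show "AE x in lebesgue. indicator \<Omega> x *\<^sub>R (u x * v x) = u x * v x"
      using VspD(3)[OF assms(1)] by eventually_elim (auto simp: indicator_def)
  qed auto
  finally show ?thesis .
qed

text \<open>
  Truncations, products and modifications on null sets stay in the energy space for this one reason.
\<close>
lemma Vsp_dominated:
  assumes u: "u \<in> Vsp" and v: "v \<in> Vsp" and w: "w \<in> borel_measurable lebesgue"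
    and le: "AE x in lebesgue. \<bar>w x\<bar> \<le> C * (\<bar>u x\<bar> + \<bar>v x\<bar>)"
    and dle: "AE z in lebesgue. \<bar>w (fst z) - w (snd z)\<bar> \<le> C * (\<bar>u (fst z) - u (snd z)\<bar> + \<bar>v (fst z) - v (snd z)\<bar>)"
  shows "w \<in> Vsp"
  unfolding Vsp_iff
proof (intro conjI)
  show "w \<in> L2 lebesgue"
    by (rule L2_dominated[OF L2_scale[OF L2_add[OF L2_abs[OF VspD(1)[OF u]] L2_abs[OF VspD(1)[OF v]]], of C] w])
       (use le in \<open>eventually_elim, linarith\<close>)
  show "dq s w \<in> L2 lebesgue"
  proof (rule L2_dominated[OF L2_scale[OF L2_add[OF L2_abs[OF VspD(2)[OF u]] L2_abs[OF VspD(2)[OF v]]], of C] measurable_dq[OF w]])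
    show "AE z in lebesgue. \<bar>dq s w z\<bar> \<le> \<bar>C * (\<bar>dq s u z\<bar> + \<bar>dq s v z\<bar>)\<bar>"
      using dle
    proof eventually_elim
      case (elim z)
      define k where "k = norm (fst z - snd z) powr ((real CARD('n) + 2 * s) / 2)"
      have "\<bar>w (fst z) - w (snd z)\<bar> / k \<le> C * (\<bar>u (fst z) - u (snd z)\<bar> + \<bar>v (fst z) - v (snd z)\<bar>) / k"
        by (rule divide_right_mono[OF elim]) (simp add: k_def)
      also have "\<dots> = C * (\<bar>u (fst z) - u (snd z)\<bar> / k + \<bar>v (fst z) - v (snd z)\<bar> / k)"
        by (simp add: add_divide_distrib distrib_left)
      finally have "\<bar>dq s w z\<bar> \<le> C * (\<bar>dq s u z\<bar> + \<bar>dq s v z\<bar>)"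
        by (simp add: dq_def abs_divide k_def)
      thus ?case by linarith
    qed
  qed
  show "AE x in lebesgue. x \<notin> \<Omega> \<longrightarrow> w x = 0"
    using le VspD(3)[OF u] VspD(3)[OF v] by eventually_elim auto
qed

lemma AE_pairs: "AE x in (lebesgue :: (real^'n) measure). P x \<Longrightarrow>
    AE z in (lebesgue :: ((real^'n) \<times> (real^'n)) measure). P (fst z) \<and> P (snd z)"
  using AE_lebesgue_fst[of P] AE_lebesgue_snd[of P] by (simp add: eventually_conj_iff)

lemma Vsp_cong_AE:
  assumes u: "u \<in> Vsp" and eq: "AE x in lebesgue. u x = w x"
  shows "w \<in> Vsp"
proof (rule Vsp_dominated[OF u u, of w 1])
  show "w \<in> borel_measurable lebesgue" by (rule borel_measurable_AE[OF VspD(4)[OF u] eq])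
  show "AE x in lebesgue. \<bar>w x\<bar> \<le> 1 * (\<bar>u x\<bar> + \<bar>u x\<bar>)" using eq by eventually_elim auto
  show "AE z in lebesgue. \<bar>w (fst z) - w (snd z)\<bar> \<le> 1 * (\<bar>u (fst z) - u (snd z)\<bar> + \<bar>u (fst z) - u (snd z)\<bar>)"
    using AE_pairs[OF eq] by eventually_elim auto
qed

lemma energy_null:
  fixes w v :: "real ^ 'n \<Rightarrow> real"
  assumes "AE x in lebesgue. w x = 0" shows "energy s w v = 0"
proof -
  have "AE z in lebesgue. dq s w z = 0" using AE_pairs[OF assms] by eventually_elim (simp add: dq_def)
  hence "AE z in lebesgue. dq s w z * dq s v z = 0" by eventually_elim simp
  hence "(LINT z|lebesgue. dq s w z * dq s v z) = 0" by (rule integral_eq_zero_AE)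
  thus ?thesis by (simp add: energy_dq)
qed

sublocale L: semi_inner Hsp ip by (rule semi_inner_L2)
sublocale En: semi_inner Vsp "energy s" by (rule energy_semi_inner) (use s_pos s_less in auto)

lemma En_nrm: "En.nrm u = X0s_norm s u" by (simp add: En.nrm_def X0s_norm_def)
lemma L_nrm: "L.nrm u = L2_norm (lebesgue_on \<Omega>) u" by (simp add: L.nrm_def L2_norm_def power2_eq_square)

definition cN :: real where "cN = c_frac CARD('n) s / 2"

lemma cN_pos: "0 < cN" unfolding cN_def using c_frac_pos[OF s_pos s_less] by simp

lemma energy_eq:
  fixes u v :: "real ^ 'n \<Rightarrow> real"
  shows "energy s u v = cN * (LINT z|lebesgue. dq s u z * dq s v z)"
  by (simp add: energy_dq cN_def)

text \<open>
  The double integral is restricted to \<open>\<Omega> \<times> B\<close> for a ball \<open>B\<close> outside \<open>\<Omega>\<close>.  There \<open>u y = 0\<close>, so the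
  numerator is \<open>(u x)\<^sup>2\<close>, while the denominator is bounded.
\<close>
lemma poincare_exists: "\<exists>P>0. \<forall>u\<in>Vsp. ip u u \<le> P * energy s u u"
proof -
  obtain R where R: "0 < R" "\<Omega> \<subseteq> ball 0 R" using bounded_subset_ballD[OF bounded_dom] by blast
  \<comment> \<open>the ball of radius \<open>R\<close> around such a point misses \<open>ball 0 R\<close> and has distance at most \<open>5 * R\<close> to its points\<close>
  obtain p :: "real ^ 'n" where p: "norm p = 3 * R" using vector_choose_size[of "3 * R"] R by auto
  define B where "B = ball p R"
  define k where "k = real CARD('n) + 2 * s"
  define b where "b = measure lborel B"
  have b: "0 < b" unfolding b_def B_def using R by (intro content_ball_pos)
  have bE: "emeasure lborel B = ennreal b" unfolding b_def B_def
    by (intro emeasure_eq_ennreal_measure) (use emeasure_lborel_ball_finite[of p R] in auto)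
  define c where "c = 1 / (5 * R) powr k"
  have c: "0 < c" using R by (simp add: c_def)
  define P where "P = 1 / (c * b * cN)"
  have P: "0 < P" using b c cN_pos by (simp add: P_def)
  have dist: "norm (x - y) \<le> 5 * R \<and> x \<noteq> y \<and> y \<notin> \<Omega>" if "x \<in> \<Omega>" "y \<in> B" for x y
  proof -
    have x: "norm x < R" using that R by auto
    have y: "norm (p - y) < R" using that by (auto simp: B_def dist_norm)
    have "norm (x - y) \<le> norm x + (norm (p - y) + norm p)"
      using norm_triangle_ineq4[of x y] norm_triangle_ineq4[of p "p - y"] by simp
    moreover have "norm p \<le> norm (p - y) + norm y" using norm_triangle_ineq[of "p - y" y] by simp
    hence "norm y > R" using y p R by linarith
    moreover have "y \<notin> \<Omega>" using calculation R by auto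
    ultimately show ?thesis using x y p by auto
  qed
  have "ip u u \<le> P * energy s u u" if u: "u \<in> Vsp" for u
  proof -
    obtain u' where u': "u' \<in> borel_measurable lborel" "AE x in lebesgue. u x = u' x"
      using completion_ex_borel_measurable_real[OF VspD(4)[OF u]] unfolding AE_completion_iff by blast
    have [measurable]: "u' \<in> borel_measurable borel" "\<Omega> \<in> sets borel" "B \<in> sets borel"
      using u'(1) open_dom by (auto simp: B_def)
    define g where "g x = ennreal (indicator \<Omega> x * (u' x)\<^sup>2 * c)" for x
    have gm[measurable]: "g \<in> borel_measurable borel" unfolding g_def by measurable
    have Dint: "integrable lebesgue (\<lambda>z. (dq s u z)\<^sup>2)" using VspD(2)[OF u] by (simp add: L2_def)
    have uint: "integrable lebesgue (\<lambda>x. (u x)\<^sup>2)" using VspD(1)[OF u] by (simp add: L2_def)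
    have e1: "(\<integral>\<^sup>+ x. g x \<partial>lborel) = ennreal (c * ip u u)"
    proof -
      have "(\<integral>\<^sup>+ x. g x \<partial>lborel) = (\<integral>\<^sup>+ x. g x \<partial>lebesgue)" by (rule nn_integral_completion[symmetric])
      also have "\<dots> = (\<integral>\<^sup>+ x. ennreal (c * (u x)\<^sup>2) \<partial>lebesgue)"
      proof (rule nn_integral_cong_AE)
        show "AE x in lebesgue. g x = ennreal (c * (u x)\<^sup>2)"
          using u'(2) VspD(3)[OF u] by eventually_elim (auto simp: g_def indicator_def mult.commute)
      qed
      also have "\<dots> = ennreal (LINT x|lebesgue. c * (u x)\<^sup>2)"
        by (rule nn_integral_eq_integral) (use uint c in auto)
      finally show ?thesis by (simp add: ip_Vsp[OF u u] power2_eq_square)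
    qed
    have "ennreal (c * ip u u) * ennreal b = (\<integral>\<^sup>+ x. g x * emeasure lborel B \<partial>lborel)"
      unfolding e1[symmetric] bE by (rule nn_integral_multc[symmetric]) simp
    also have "\<dots> = (\<integral>\<^sup>+ x. \<integral>\<^sup>+ y. g x * indicator B y \<partial>lborel \<partial>lborel)"
      by (simp add: nn_integral_cmult)
    also have "\<dots> = (\<integral>\<^sup>+ z. g (fst z) * indicator B (snd z) \<partial>(lborel \<Otimes>\<^sub>M lborel))"
      by (subst lborel.nn_integral_fst[symmetric]) simp_all
    also have "\<dots> = (\<integral>\<^sup>+ z. g (fst z) * indicator B (snd z) \<partial>lebesgue)"
      unfolding lborel_prod by (rule nn_integral_completion[symmetric])
    also have "\<dots> \<le> (\<integral>\<^sup>+ z. ennreal ((dq s u z)\<^sup>2) \<partial>lebesgue)"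
    proof (rule nn_integral_mono_AE)
      show "AE z in lebesgue. g (fst z) * indicator B (snd z) \<le> ennreal ((dq s u z)\<^sup>2)"
        using AE_pairs[OF u'(2)] AE_pairs[OF VspD(3)[OF u]]
      proof eventually_elim
        case (elim z)
        show ?case
        proof (cases "fst z \<in> \<Omega> \<and> snd z \<in> B")
          case True
          note d = dist[of "fst z" "snd z"]
          have "(dq s u z)\<^sup>2 = (u' (fst z))\<^sup>2 / norm (fst z - snd z) powr k"
            using elim d True by (simp add: power2_eq_square dq_mult k_def)
          moreover have "norm (fst z - snd z) powr k \<le> (5 * R) powr k"
            using d True s_pos by (intro powr_mono2) (auto simp: k_def)
          hence "(u' (fst z))\<^sup>2 / (5 * R) powr k \<le> (u' (fst z))\<^sup>2 / norm (fst z - snd z) powr k"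
            using d True R by (intro divide_left_mono mult_pos_pos) auto
          ultimately show ?thesis using True by (auto simp: g_def c_def intro!: ennreal_leI)
        next
          case False
          thus ?thesis by (auto simp: g_def indicator_def)
        qed
      qed
    qed
    also have "\<dots> = ennreal (LINT z|lebesgue. (dq s u z)\<^sup>2)"
      by (rule nn_integral_eq_integral[OF Dint]) simp
    finally have "ennreal (c * ip u u * b) \<le> ennreal (LINT z|lebesgue. (dq s u z)\<^sup>2)"
      using c b L.nonneg[OF Vsp_Hsp[OF u]] by (simp add: ennreal_mult)
    hence "c * ip u u * b \<le> (LINT z|lebesgue. (dq s u z)\<^sup>2)" by (subst (asm) ennreal_le_iff) auto
    hence "c * ip u u * b \<le> energy s u u / cN" using cN_pos by (simp add: energy_eq power2_eq_square)
    thus ?thesis using b c cN_pos by (simp add: P_def field_simps)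
  qed
  thus ?thesis using P by blast
qed

lemma energy_diff:
  fixes u v :: "real ^ 'n \<Rightarrow> real"
  shows "energy s (u - v) (u - v) = cN * (LINT z|lebesgue. (dq s (\<lambda>x. u x - v x) z)\<^sup>2)"
proof -
  have "u - v = (\<lambda>x. u x - v x)" by (rule ext) simp
  thus ?thesis by (simp add: energy_eq power2_eq_square)
qed

definition poincare_const :: real where
  "poincare_const = (SOME P. 0 < P \<and> (\<forall>u\<in>Vsp. ip u u \<le> P * energy s u u))"

lemma poincare_const: "0 < poincare_const" "u \<in> Vsp \<Longrightarrow> ip u u \<le> poincare_const * energy s u u"
proof -
  have "0 < poincare_const \<and> (\<forall>u\<in>Vsp. ip u u \<le> poincare_const * energy s u u)"
    unfolding poincare_const_def by (rule someI_ex) (use poincare_exists in blast)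
  thus "0 < poincare_const" "u \<in> Vsp \<Longrightarrow> ip u u \<le> poincare_const * energy s u u" by auto
qed

lemma nrm_poincare_energy: "u \<in> Vsp \<Longrightarrow> L.nrm u \<le> sqrt poincare_const * En.nrm u"
  unfolding L.nrm_def En.nrm_def using real_sqrt_le_mono[OF poincare_const(2)] by (simp add: real_sqrt_mult)

lemma rapid_subsequence:
  assumes "\<And>\<epsilon>::real. 0 < \<epsilon> \<Longrightarrow> \<exists>N. \<forall>i\<ge>N. \<forall>j\<ge>N. d i j < \<epsilon>"
  shows "\<exists>r::nat\<Rightarrow>nat. strict_mono r \<and> (\<forall>k. \<forall>i\<ge>r k. \<forall>j\<ge>r k. d i j < (1/2)^k)"
proof -
  have "\<exists>N. \<forall>i\<ge>N. \<forall>j\<ge>N. d i j < (1/2)^k" for k by (rule assms) simp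
  then obtain N where N: "\<And>k i j. \<lbrakk>N k \<le> i; N k \<le> j\<rbrakk> \<Longrightarrow> d i j < (1/2)^k" by metis
  define r where "r k = (\<Sum>i\<le>k. N i) + k" for k
  have "N k \<le> r k" for k unfolding r_def by (rule trans_le_add1) (rule member_le_sum, auto)
  moreover have "strict_mono r" by (rule strict_monoI_Suc) (simp add: r_def)
  ultimately show ?thesis using N by (intro exI[of _ r]) (meson order.trans)
qed

text \<open>
  A rapidly Cauchy subsequence converges almost everywhere by the Poincare inequality, and with it
  converge its difference quotients.  Fatou's lemma bounds the energy distance to the pointwise limit.
\<close>
lemma Vsp_complete:
  fixes X :: "nat \<Rightarrow> real ^ 'n \<Rightarrow> real"
  assumes X: "\<And>n. X n \<in> Vsp" and C: "\<And>\<epsilon>. 0 < \<epsilon> \<Longrightarrow> \<exists>N. \<forall>i\<ge>N. \<forall>j\<ge>N. En.nrm (X i - X j) < \<epsilon>"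
  shows "\<exists>L\<in>Vsp. (\<lambda>n. En.nrm (X n - L)) \<longlonglongrightarrow> 0"
proof -
  obtain r :: "nat \<Rightarrow> nat" where r: "strict_mono r" "\<And>k i j. \<lbrakk>r k \<le> i; r k \<le> j\<rbrakk> \<Longrightarrow> En.nrm (X i - X j) < (1/2)^k"
    using rapid_subsequence[of "\<lambda>i j. En.nrm (X i - X j)", OF C] by metis
  define Y where "Y k = X (r k)" for k
  have Y: "Y k \<in> Vsp" for k by (simp add: Y_def X)
  have rm: "r k \<le> r j" if "k \<le> j" for k j using r(1) that by (simp add: strict_mono_less_eq)
  have "AE x in lebesgue_on \<Omega>. convergent (\<lambda>k. Y k x)"
  proof (rule L2_geometric_AE_convergent[OF finite_dom _, where r="1/2" and C="sqrt poincare_const"])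
    show "Y k \<in> Hsp" for k by (rule Vsp_Hsp[OF Y])
    fix k
    have "L2_norm (lebesgue_on \<Omega>) (\<lambda>x. Y (Suc k) x - Y k x) = L.nrm (Y (Suc k) - Y k)"
      by (simp add: L_nrm fun_diff_def)
    also have "\<dots> \<le> sqrt poincare_const * En.nrm (Y (Suc k) - Y k)" by (rule nrm_poincare_energy) (use Y in auto)
    also have "\<dots> \<le> sqrt poincare_const * (1/2)^k"
      using r(2)[of k "r (Suc k)" "r k"] rm[of k "Suc k"] poincare_const(1)
      by (intro mult_left_mono) (auto simp: Y_def)
    finally show "L2_norm (lebesgue_on \<Omega>) (\<lambda>x. Y (Suc k) x - Y k x) \<le> sqrt poincare_const * (1/2)^k" .
  qed auto
  hence conv: "AE x in lebesgue. x \<in> \<Omega> \<longrightarrow> convergent (\<lambda>k. Y k x)" by (simp add: AE_dom)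
  define L where "L x = (if x \<in> \<Omega> then lim (\<lambda>k. Y k x) else 0)" for x
  have [measurable]: "Y k \<in> borel_measurable lebesgue" for k using VspD(4)[OF Y] .
  have Lm[measurable]: "L \<in> borel_measurable lebesgue" unfolding L_def by measurable
  have "AE x in lebesgue. \<forall>k. x \<notin> \<Omega> \<longrightarrow> Y k x = 0" unfolding AE_all_countable using VspD(3)[OF Y] by blast
  hence lim: "AE x in lebesgue. (\<lambda>k. Y k x) \<longlonglongrightarrow> L x"
    using conv by eventually_elim (auto simp: L_def convergent_LIMSEQ_iff)
  have dlim: "AE z in lebesgue. (\<lambda>j. dq s (Y j) z) \<longlonglongrightarrow> dq s L z"
    using AE_pairs[OF lim]
    by eventually_elim (unfold dq_def divide_inverse, intro tendsto_mult tendsto_diff tendsto_const, auto)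
  define D where "D k = ((1/2)^k)\<^sup>2 / cN" for k :: nat
  have YY: "(LINT z|lebesgue. (dq s (\<lambda>x. Y k x - Y j x) z)\<^sup>2) \<le> D k" if "k \<le> j" for k j
  proof -
    have "energy s (Y k - Y j) (Y k - Y j) = (En.nrm (Y k - Y j))\<^sup>2" by (rule En.nrm_sq[symmetric]) (use Y in auto)
    also have "\<dots> \<le> ((1/2)^k)\<^sup>2"
      using r(2)[of k "r k" "r j"] rm[OF that] Y by (intro power_mono) (auto simp: Y_def X)
    finally show ?thesis
      unfolding energy_diff D_def pos_le_divide_eq[OF cN_pos] by (subst mult.commute)
  qed
  have YL: "(\<lambda>x. Y k x - L x) \<in> Vsp" "(LINT z|lebesgue. (dq s (\<lambda>x. Y k x - L x) z)\<^sup>2) \<le> D k" for k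
  proof -
    have D0: "0 \<le> D k" using cN_pos by (simp add: D_def)
    have h1: "dq s (\<lambda>x. Y k x - Y j x) \<in> L2 lebesgue" for j
      using VspD(2)[OF En.S_diff[OF Y[of k] Y[of j]]] by (simp add: fun_diff_def)
    have h2: "dq s (\<lambda>x. Y k x - L x) \<in> borel_measurable lebesgue" by (rule measurable_dq) measurable
    have h3: "AE z in lebesgue. (\<lambda>j. dq s (\<lambda>x. Y k x - Y j x) z) \<longlonglongrightarrow> dq s (\<lambda>x. Y k x - L x) z"
      using dlim by eventually_elim (auto intro!: tendsto_intros)
    have h4: "\<forall>\<^sub>F j in sequentially. (LINT z|lebesgue. (dq s (\<lambda>x. Y k x - Y j x) z)\<^sup>2) \<le> D k"
      using eventually_ge_at_top[of k] by eventually_elim (rule YY)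
    note * = L2_fatou[of "\<lambda>j. dq s (\<lambda>x. Y k x - Y j x)", OF h1 h2 h3 h4 D0]
    have "(\<lambda>x. Y k x - L x) \<in> L2 lebesgue"
    proof (rule L2_fatou[where X="\<lambda>j x. Y k x - Y j x" and B="poincare_const * (cN * D k)"])
      show "(\<lambda>x. Y k x - Y j x) \<in> L2 lebesgue" for j
        using VspD(1)[OF En.S_diff[OF Y[of k] Y[of j]]] by (simp add: fun_diff_def)
      show "AE x in lebesgue. (\<lambda>j. Y k x - Y j x) \<longlonglongrightarrow> Y k x - L x"
        using lim by eventually_elim (auto intro!: tendsto_intros)
      have "(LINT x|lebesgue. (Y k x - Y j x)\<^sup>2) \<le> poincare_const * (cN * D k)" if "k \<le> j" for j
      proof -
        have "(LINT x|lebesgue. (Y k x - Y j x)\<^sup>2) = ip (Y k - Y j) (Y k - Y j)"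
          unfolding ip_Vsp[OF En.S_diff[OF Y[of k] Y[of j]] En.S_diff[OF Y[of k] Y[of j]]]
          by (simp add: power2_eq_square)
        also have "\<dots> \<le> poincare_const * energy s (Y k - Y j) (Y k - Y j)"
          by (rule poincare_const(2)[OF En.S_diff[OF Y[of k] Y[of j]]])
        also have "\<dots> \<le> poincare_const * (cN * D k)"
          unfolding energy_diff using YY[OF that] poincare_const(1) cN_pos by (intro mult_left_mono) auto
        finally show ?thesis .
      qed
      thus "\<forall>\<^sub>F j in sequentially. (LINT x|lebesgue. (Y k x - Y j x)\<^sup>2) \<le> poincare_const * (cN * D k)"
        by (auto simp: eventually_sequentially)
      show "0 \<le> poincare_const * (cN * D k)" using D0 cN_pos poincare_const(1) by simp
    qed simp
    moreover have "AE x in lebesgue. x \<notin> \<Omega> \<longrightarrow> Y k x - L x = 0"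
      using VspD(3)[OF Y[of k]] by eventually_elim (auto simp: L_def)
    ultimately show "(\<lambda>x. Y k x - L x) \<in> Vsp" using *(1) unfolding Vsp_iff by blast
    show "(LINT z|lebesgue. (dq s (\<lambda>x. Y k x - L x) z)\<^sup>2) \<le> D k" by (rule *)
  qed
  have LV: "L \<in> Vsp" using En.S_diff[OF Y[of 0] YL(1)[of 0]] by (simp add: fun_diff_def)
  have Yn: "En.nrm (Y k - L) \<le> (1/2)^k" for k
  proof -
    have "energy s (Y k - L) (Y k - L) \<le> cN * D k"
      unfolding energy_diff using YL(2)[of k] cN_pos by (intro mult_left_mono) auto
    also have "\<dots> = ((1/2)^k)\<^sup>2" using cN_pos by (simp add: D_def)
    finally show ?thesis unfolding En.nrm_def by (intro real_le_lsqrt) auto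
  qed
  have "(\<lambda>n. En.nrm (X n - L)) \<longlonglongrightarrow> 0"
  proof (rule LIMSEQ_I)
    fix \<epsilon> :: real assume e: "0 < \<epsilon>"
    have "(\<lambda>k. (1/2::real)^k) \<longlonglongrightarrow> 0" by (rule LIMSEQ_realpow_zero) auto
    hence "\<forall>\<^sub>F k in sequentially. (1/2::real)^k < \<epsilon> / 2" using e by (intro order_tendstoD) auto
    then obtain k where k: "(1/2::real)^k < \<epsilon> / 2" by (auto simp: eventually_sequentially)
    have "norm (En.nrm (X n - L) - 0) < \<epsilon>" if "n \<ge> r k" for n
    proof -
      have "En.nrm (X n - L) \<le> En.nrm (X n - Y k) + En.nrm (Y k - L)" by (rule En.nrm_triangle) (use X Y LV in auto)
      also have "En.nrm (X n - Y k) < (1/2)^k" using r(2)[of k n "r k"] that by (simp add: Y_def)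
      finally have "En.nrm (X n - L) < \<epsilon>" using Yn[of k] k by linarith
      moreover have "0 \<le> En.nrm (X n - L)" by (rule En.nrm_nonneg[OF En.S_diff[OF X LV]])
      ultimately show ?thesis by simp
    qed
    thus "\<exists>no. \<forall>n\<ge>no. norm (En.nrm (X n - L) - 0) < \<epsilon>" by blast
  qed
  thus ?thesis using LV by blast
qed

sublocale G: gelfand_pair Hsp Vsp ip "energy s" poincare_const
proof
  show "Vsp \<subseteq> Hsp" using Vsp_Hsp by blast
qed (use Vsp_complete poincare_const in auto)

end

section \<open>Maximum principle and comparison\<close>

lemma (in semi_inner) nrm_zero_iff: "u \<in> S \<Longrightarrow> nrm u = 0 \<longleftrightarrow> b u u = 0"
  by (simp add: nrm_def)

lemma grid_point_bounds:
  assumes "k < N" "real N * h \<le> 1" "0 < h" shows "0 \<le> real (Suc k) * h" "real (Suc k) * h \<le> 1"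
proof -
  have "real (Suc k) * h \<le> real N * h" using assms by (intro mult_right_mono) auto
  thus "real (Suc k) * h \<le> 1" using assms by linarith
qed (use assms in simp)

context frac_domain
begin

lemma Vsp_contraction:
  assumes u: "u \<in> Vsp" and p: "\<And>a b. \<bar>p a - p b\<bar> \<le> \<bar>a - b\<bar>" "p 0 = (0::real)"
  shows "(\<lambda>x. p (u x)) \<in> Vsp"
proof (rule Vsp_dominated[OF u u, of _ 1])
  have "continuous_on UNIV p"
    unfolding continuous_on_iff dist_real_def by (meson p(1) le_less_trans UNIV_I)
  hence "p \<in> borel_measurable borel" by (rule borel_measurable_continuous_onI)
  thus "(\<lambda>x. p (u x)) \<in> borel_measurable lebesgue" using VspD(4)[OF u] by (rule measurable_compose[rotated])
  have "\<bar>p (u x)\<bar> \<le> 1 * (\<bar>u x\<bar> + \<bar>u x\<bar>)" for x using p(1)[of "u x" 0] p(2) by simp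
  thus "AE x in lebesgue. \<bar>p (u x)\<bar> \<le> 1 * (\<bar>u x\<bar> + \<bar>u x\<bar>)" by simp
  have "\<bar>p (u x) - p (u y)\<bar> \<le> 1 * (\<bar>u x - u y\<bar> + \<bar>u x - u y\<bar>)" for x y by (rule order.trans[OF p(1)]) simp
  thus "AE z in lebesgue. \<bar>p (u (fst z)) - p (u (snd z))\<bar>
     \<le> 1 * (\<bar>u (fst z) - u (snd z)\<bar> + \<bar>u (fst z) - u (snd z)\<bar>)" by simp
qed

lemma Vsp_mult:
  assumes u: "u \<in> Vsp" and v: "v \<in> Vsp" and B: "AE x in lebesgue. \<bar>u x\<bar> \<le> B" "AE x in lebesgue. \<bar>v x\<bar> \<le> B" "0 \<le> B"
  shows "(\<lambda>x. u x * v x) \<in> Vsp"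
proof (rule Vsp_dominated[OF u v, of _ B])
  show "(\<lambda>x. u x * v x) \<in> borel_measurable lebesgue" using VspD(4)[OF u] VspD(4)[OF v] by simp
  show "AE x in lebesgue. \<bar>u x * v x\<bar> \<le> B * (\<bar>u x\<bar> + \<bar>v x\<bar>)"
    using B(1)
  proof eventually_elim
    case (elim x)
    have "\<bar>u x * v x\<bar> \<le> B * \<bar>v x\<bar>" using elim by (simp add: abs_mult mult_right_mono)
    moreover have "0 \<le> B * \<bar>u x\<bar>" using B(3) by simp
    ultimately show ?case by (simp add: distrib_left)
  qed
  show "AE z in lebesgue. \<bar>u (fst z) * v (fst z) - u (snd z) * v (snd z)\<bar>
      \<le> B * (\<bar>u (fst z) - u (snd z)\<bar> + \<bar>v (fst z) - v (snd z)\<bar>)"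
    using AE_pairs[OF B(1)] AE_pairs[OF B(2)]
  proof eventually_elim
    case (elim z)
    define a a' b b' where "a = u (fst z)" and "a' = u (snd z)" and "b = v (fst z)" and "b' = v (snd z)"
    have "a * b - a' * b' = (a - a') * b + a' * (b - b')" by (simp add: algebra_simps)
    hence "\<bar>a * b - a' * b'\<bar> \<le> \<bar>a - a'\<bar> * \<bar>b\<bar> + \<bar>a'\<bar> * \<bar>b - b'\<bar>" by (metis abs_mult abs_triangle_ineq)
    also have "\<dots> \<le> \<bar>a - a'\<bar> * B + B * \<bar>b - b'\<bar>" using elim
      by (intro add_mono mult_left_mono mult_right_mono) (auto simp: a'_def b_def)
    finally show ?case by (simp add: a_def a'_def b_def b'_def algebra_simps)
  qed
qed

lemma energy_mono:
  assumes V: "u \<in> Vsp" "v \<in> Vsp" "u' \<in> Vsp" "v' \<in> Vsp"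
    and le: "AE z in lebesgue. (u (fst z) - u (snd z)) * (v (fst z) - v (snd z)) \<le> (u' (fst z) - u' (snd z)) * (v' (fst z) - v' (snd z))"
  shows "energy s u v \<le> energy s u' v'"
proof -
  have "(LINT z|lebesgue. dq s u z * dq s v z) \<le> (LINT z|lebesgue. dq s u' z * dq s v' z)"
  proof (rule integral_mono_AE)
    show "AE z in lebesgue. dq s u z * dq s v z \<le> dq s u' z * dq s v' z"
      using le by eventually_elim (simp add: dq_mult divide_right_mono)
  qed (use V VspD in \<open>auto intro!: L2_integrable_mult\<close>)
  thus ?thesis unfolding energy_eq using cN_pos by simp
qed

lemma energy_nonnegI:
  assumes V: "u \<in> Vsp" "v \<in> Vsp"
    and le: "AE z in lebesgue. 0 \<le> (u (fst z) - u (snd z)) * (v (fst z) - v (snd z))"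
  shows "0 \<le> energy s u v"
  using energy_mono[OF En.S_zero En.S_zero V] le by (simp add: En.zero_left)

lemma L2_null_AE:
  assumes p: "p \<in> Hsp" and z: "ip p p = 0" shows "AE x in lebesgue_on \<Omega>. p x = 0"
proof -
  have "AE x in lebesgue_on \<Omega>. p x * p x = 0"
    using z by (subst (asm) integral_nonneg_eq_0_iff_AE) (auto intro!: L2_integrable_mult p)
  thus ?thesis by eventually_elim simp
qed

lemma ip_mono_AE:
  assumes "u \<in> Hsp" "v \<in> Hsp" "u' \<in> Hsp" "v' \<in> Hsp" "AE x in lebesgue_on \<Omega>. u x * v x \<le> u' x * v' x"
  shows "ip u v \<le> ip u' v'"
  by (rule integral_mono_AE) (use assms in \<open>auto intro!: L2_integrable_mult\<close>)

lemma const_Hsp: "(\<lambda>x. c) \<in> Hsp" by (rule L2_const[OF finite_dom])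

text \<open>
  The test function is the excess \<open>w = max (Z - M) 0\<close>.  Since truncation is monotone, \<open>energy s Z w \<ge> 0\<close>
  can be dropped, and what remains says that \<open>w\<close> has zero \<open>L\<^sup>2\<close> norm.  The constant \<open>M\<close> itself is not an
  element of the energy space, hence the form of the assumption.
\<close>
lemma max_principle:
  assumes Z: "Z \<in> Vsp" and M: "0 \<le> M" and h: "0 < h"
    and le: "ip Z (\<lambda>x. max (Z x - M) 0) + h * energy s Z (\<lambda>x. max (Z x - M) 0) \<le> M * ip (\<lambda>x. 1) (\<lambda>x. max (Z x - M) 0)"
  shows "AE x in lebesgue_on \<Omega>. Z x \<le> M"
proof -
  define w where "w = (\<lambda>x. max (Z x - M) 0)"
  have w: "w \<in> Vsp" unfolding w_def by (rule Vsp_contraction[OF Z]) (use M in auto)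
  have "0 \<le> energy s Z w"
  proof (rule energy_nonnegI[OF Z w])
    have "0 \<le> (a - b) * (max (a - M) 0 - max (b - M) 0)" for a b :: real
      by (cases "a \<le> b") (auto simp: max_def intro: mult_nonpos_nonpos mult_nonneg_nonneg)
    thus "AE z in lebesgue. 0 \<le> (Z (fst z) - Z (snd z)) * (w (fst z) - w (snd z))" by (simp add: w_def)
  qed
  hence "0 \<le> h * energy s Z w" using h by simp
  hence "ip Z w - M * ip (\<lambda>x. 1) w \<le> 0" using le unfolding w_def by linarith
  moreover have "ip Z w - M * ip (\<lambda>x. 1) w = (LINT x|lebesgue_on \<Omega>. Z x * w x - M * (1 * w x))"
    using L2_integrable_mult[OF Vsp_Hsp[OF Z] Vsp_Hsp[OF w]] L2_integrable_mult[OF const_Hsp[of 1] Vsp_Hsp[OF w]]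
    by simp
  moreover have "Z x * w x - M * (1 * w x) = w x * w x" for x by (simp add: w_def max_def algebra_simps)
  ultimately have "ip w w \<le> 0" by simp
  hence "ip w w = 0" using L.nonneg[OF Vsp_Hsp[OF w]] by simp
  from L2_null_AE[OF Vsp_Hsp[OF w] this] show ?thesis
    by eventually_elim (simp add: w_def max_def split: if_splits)
qed

text \<open>
  The function that is constant in space and grows like \<open>F * t\<close> is a supersolution.
\<close>
lemma rothe_upper:
  assumes h: "0 < h" and f: "\<And>t. f t \<in> Hsp" and F: "0 \<le> F"
    and le: "\<And>t. \<lbrakk>0 \<le> t; t \<le> 1\<rbrakk> \<Longrightarrow> AE x in lebesgue_on \<Omega>. f t x \<le> F"
    and N: "real N * h \<le> 1"
  shows "AE x in lebesgue_on \<Omega>. G.rothe h f N x \<le> F * (real N * h)"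
  using N
proof (induction N)
  case 0 thus ?case by simp
next
  case (Suc N)
  define U where "U = G.rothe h f"
  have V: "U k \<in> Vsp" for k unfolding U_def by (rule G.rothe_V[OF h f])
  define t where "t = real (Suc N) * h"
  have t: "0 \<le> t" "t \<le> 1" using h Suc.prems by (auto simp: t_def)
  define M where "M = F * t"
  have M: "0 \<le> M" using F t by (simp add: M_def)
  have "real N * h \<le> real (Suc N) * h" using h by simp
  hence IH: "AE x in lebesgue_on \<Omega>. U N x \<le> F * (real N * h)" using Suc.IH Suc.prems unfolding U_def by linarith
  define w where "w = (\<lambda>x. max (U (Suc N) x - M) 0)"
  have w: "w \<in> Vsp" unfolding w_def by (rule Vsp_contraction[OF V]) (use M in auto)
  have w0: "0 \<le> w x" for x by (simp add: w_def)
  have "AE x in lebesgue_on \<Omega>. U (Suc N) x \<le> M"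
  proof (rule max_principle[OF V M h])
    have "ip (U (Suc N) - U N) w + h * energy s (U (Suc N)) w = h * ip (f t) w"
      unfolding U_def t_def by (rule G.rothe_eq[OF h f w])
    hence "ip (U (Suc N)) w + h * energy s (U (Suc N)) w = ip (U N + h *\<^sub>R f t) w"
      using V w f by (simp add: L.bilin Vsp_Hsp del: plus_fun_apply minus_apply scaleR_fun_apply)
    also have "\<dots> \<le> ip (M *\<^sub>R (\<lambda>x. 1)) w"
    proof (rule ip_mono_AE[of "U N + h *\<^sub>R f t" w "M *\<^sub>R (\<lambda>x. 1)" w])
      show "AE x in lebesgue_on \<Omega>. (U N + h *\<^sub>R f t) x * w x \<le> (M *\<^sub>R (\<lambda>x. 1)) x * w x"
        using IH le[OF t]
      proof eventually_elim
        case (elim x)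
        have "h * f t x \<le> h * F" using elim h by simp
        hence "U N x + h * f t x \<le> M" using elim by (simp add: M_def t_def algebra_simps)
        thus ?case using w0[of x] by (simp add: mult_right_mono)
      qed
    qed (use V f w Vsp_Hsp const_Hsp in auto)
    also have "\<dots> = M * ip (\<lambda>x. 1) w" by simp
    finally show "ip (U (Suc N)) (\<lambda>x. max (U (Suc N) x - M) 0) + h * energy s (U (Suc N)) (\<lambda>x. max (U (Suc N) x - M) 0)
      \<le> M * ip (\<lambda>x. 1) (\<lambda>x. max (U (Suc N) x - M) 0)" unfolding w_def .
  qed
  thus ?case unfolding U_def M_def t_def .
qed

text \<open>
  The maximum principle for \<open>w - rothe\<close> uses a single test function in each step, its positive part.
  The subsolution inequality is therefore required only for \<open>v\<close> below this part, which allows it to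
  depend on an upper bound of \<open>v\<close>.
\<close>
lemma rothe_comparison:
  assumes h: "0 < h" and f: "\<And>t. f t \<in> Hsp" and w: "\<And>k. w k \<in> Vsp" and w0: "AE x in lebesgue_on \<Omega>. w 0 x \<le> 0"
    and sub: "\<And>k v. \<lbrakk>k < N; v \<in> Vsp; \<And>x. 0 \<le> v x;
          \<And>x. v x \<le> max (w (Suc k) x - G.rothe h f (Suc k) x) 0\<rbrakk> \<Longrightarrow>
        ip (w (Suc k) - w k) v + h * energy s (w (Suc k)) v \<le> h * ip (f (real (Suc k) * h)) v"
    and k: "k \<le> N"
  shows "AE x in lebesgue_on \<Omega>. w k x \<le> G.rothe h f k x"
  using k
proof (induction k)
  case 0 thus ?case using w0 by simp
next
  case (Suc k)
  define U where "U = G.rothe h f"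
  have V: "U k \<in> Vsp" for k unfolding U_def by (rule G.rothe_V[OF h f])
  define Z where "Z = w (Suc k) - U (Suc k)"
  have Z: "Z \<in> Vsp" using w V by (simp add: Z_def)
  define v where "v = (\<lambda>x. max (Z x - 0) 0)"
  have v: "v \<in> Vsp" unfolding v_def by (rule Vsp_contraction[OF Z]) auto
  have v0: "0 \<le> v x" for x by (simp add: v_def)
  have IH: "AE x in lebesgue_on \<Omega>. w k x \<le> U k x" using Suc unfolding U_def by simp
  have "AE x in lebesgue_on \<Omega>. Z x \<le> 0"
  proof (rule max_principle[OF Z order_refl h])
    have "ip (w (Suc k) - w k) v + h * energy s (w (Suc k)) v \<le> h * ip (f (real (Suc k) * h)) v"
      by (rule sub[OF _ v v0]) (use Suc.prems in \<open>simp_all add: v_def Z_def U_def\<close>)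
    moreover have "ip (U (Suc k) - U k) v + h * energy s (U (Suc k)) v = h * ip (f (real (Suc k) * h)) v"
      unfolding U_def by (rule G.rothe_eq[OF h f v])
    moreover have "ip (w k) v \<le> ip (U k) v"
      by (rule ip_mono_AE) (use IH v0 w V v Vsp_Hsp in \<open>auto elim!: eventually_mono intro!: mult_right_mono\<close>)
    moreover have "ip Z v = ip (w (Suc k)) v - ip (U (Suc k)) v"
      unfolding Z_def by (rule L.diff_left) (use w V v Vsp_Hsp in auto)
    moreover have "ip (w (Suc k) - w k) v = ip (w (Suc k)) v - ip (w k) v"
      by (rule L.diff_left) (use w V v Vsp_Hsp in auto)
    moreover have "ip (U (Suc k) - U k) v = ip (U (Suc k)) v - ip (U k) v"
      by (rule L.diff_left) (use w V v Vsp_Hsp in auto)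
    moreover have "h * energy s Z v = h * energy s (w (Suc k)) v - h * energy s (U (Suc k)) v"
      unfolding Z_def using w V v by (simp add: En.diff_left algebra_simps)
    ultimately have "ip Z v + h * energy s Z v \<le> 0" by linarith
    thus "ip Z (\<lambda>x. max (Z x - 0) 0) + h * energy s Z (\<lambda>x. max (Z x - 0) 0) \<le> 0 * ip (\<lambda>x. 1) (\<lambda>x. max (Z x - 0) 0)"
      unfolding v_def by simp
  qed
  thus ?case by (simp add: Z_def U_def)
qed

text \<open>
  The distance from a nonnegative function to \<open>L\<close> is at least the norm of the negative part of \<open>L\<close>.
\<close>
lemma L2_limit_nonneg:
  fixes X :: "nat \<Rightarrow> real ^ 'n \<Rightarrow> real"
  assumes X: "\<And>n. X n \<in> Hsp" and L: "L \<in> Hsp" and lim: "(\<lambda>n. L.nrm (X n - L)) \<longlonglongrightarrow> 0"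
    and pos: "\<And>n. AE x in lebesgue_on \<Omega>. 0 \<le> X n x"
  shows "AE x in lebesgue_on \<Omega>. 0 \<le> L x"
proof -
  define p where "p = (\<lambda>x. max (- L x) 0)"
  have p: "p \<in> Hsp" unfolding p_def by (rule L2_dominated[OF L]) (use L in \<open>auto simp: L2_def\<close>)
  have "L.nrm p \<le> L.nrm (X n - L)" for n
  proof -
    have "ip p p \<le> ip (X n - L) (X n - L)"
    proof (rule ip_mono_AE[of p p "X n - L" "X n - L"])
      show "AE x in lebesgue_on \<Omega>. p x * p x \<le> (X n - L) x * (X n - L) x"
        using pos[of n]
      proof eventually_elim
        case (elim x)
        show ?case
        proof (cases "0 \<le> L x")
          case True thus ?thesis by (simp add: p_def)
        next
          case False
          hence "p x = - L x" by (simp add: p_def)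
          thus ?thesis using False elim by (intro mult_mono) (auto simp: p_def)
        qed
      qed
    qed (use p X L in auto)
    thus ?thesis unfolding L.nrm_def by (rule real_sqrt_le_mono)
  qed
  hence "L.nrm p \<le> 0" using LIMSEQ_le_const[OF lim] by blast
  hence "ip p p = 0" using L.nrm_nonneg[OF p] L.nrm_zero_iff[OF p] by linarith
  from L2_null_AE[OF p this] show ?thesis
    by eventually_elim (simp add: p_def max_def split: if_splits)
qed

lemma rothe_mono:
  assumes h: "0 < h" and f: "\<And>t. f t \<in> Hsp" and g: "\<And>t. g t \<in> Hsp"
    and le: "\<And>t. \<lbrakk>0 \<le> t; t \<le> 1\<rbrakk> \<Longrightarrow> AE x in lebesgue_on \<Omega>. f t x \<le> g t x"
    and N: "real N * h \<le> 1"
  shows "AE x in lebesgue_on \<Omega>. G.rothe h f N x \<le> G.rothe h g N x"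
proof (rule rothe_comparison[of h g "G.rothe h f" N N, OF h g])
  show "G.rothe h f k \<in> Vsp" for k by (rule G.rothe_V[OF h f])
  fix k v assume k: "k < N" and v: "v \<in> Vsp" and v0: "\<And>x. 0 \<le> v x"
  define t where "t = real (Suc k) * h"
  have t: "0 \<le> t" "t \<le> 1" unfolding t_def by (rule grid_point_bounds[OF k N h])+
  have "ip (G.rothe h f (Suc k) - G.rothe h f k) v + h * energy s (G.rothe h f (Suc k)) v = h * ip (f t) v"
    unfolding t_def by (rule G.rothe_eq[OF h f v])
  also have "ip (f t) v \<le> ip (g t) v"
    by (rule ip_mono_AE) (use le[OF t] v0 f g v Vsp_Hsp in \<open>auto elim!: eventually_mono intro!: mult_right_mono\<close>)
  hence "h * ip (f t) v \<le> h * ip (g t) v" using h by simp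
  finally show "ip (G.rothe h f (Suc k) - G.rothe h f k) v + h * energy s (G.rothe h f (Suc k)) v \<le> h * ip (g (real (Suc k) * h)) v"
    unfolding t_def .
qed auto

lemma rothe_nonneg:
  assumes h: "0 < h" and f: "\<And>t. f t \<in> Hsp"
    and pos: "\<And>t. \<lbrakk>0 \<le> t; t \<le> 1\<rbrakk> \<Longrightarrow> AE x in lebesgue_on \<Omega>. 0 \<le> f t x"
    and N: "real N * h \<le> 1"
  shows "AE x in lebesgue_on \<Omega>. 0 \<le> G.rothe h f N x"
proof -
  have "AE x in lebesgue_on \<Omega>. (0 :: real ^ 'n \<Rightarrow> real) x \<le> G.rothe h f N x"
  proof (rule rothe_comparison[of h f "\<lambda>k. 0" N N, OF h f])
    fix k v assume k: "k < N" and v: "v \<in> Vsp" and v0: "\<And>x. 0 \<le> v x"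
    define t where "t = real (Suc k) * h"
    have t: "0 \<le> t" "t \<le> 1" unfolding t_def by (rule grid_point_bounds[OF k N h])+
    have "0 \<le> ip (f t) v"
      by (rule integral_nonneg_AE) (use pos[OF t] v0 in \<open>auto elim!: eventually_mono\<close>)
    thus "ip (0 - 0) v + h * energy s 0 v \<le> h * ip (f (real (Suc k) * h)) v"
      using h v unfolding t_def by (simp add: En.zero_left)
  qed auto
  thus ?thesis by simp
qed

lemma nonneg_limit_appr:
  assumes X: "\<And>n. X n \<in> Hsp" "L \<in> Hsp" "(\<lambda>n. L.nrm (X n - L)) \<longlonglongrightarrow> 0"
    and f: "G.admissible a K f" and t: "0 \<le> t" "t \<le> 1"
    and le: "\<And>n. AE x in lebesgue_on \<Omega>. X n x \<le> G.appr f n t x"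
  shows "AE x in lebesgue_on \<Omega>. L x \<le> G.sol f t x"
proof -
  note A = G.admissibleD[OF f]
  have V: "G.appr f n t \<in> Hsp" for n by (rule Vsp_Hsp[OF G.appr_V[of f, OF A(3)]])
  have S: "G.sol f t \<in> Hsp" by (intro Vsp_Hsp G.sol_limit(1)[OF f t])
  have "AE x in lebesgue_on \<Omega>. 0 \<le> (G.sol f t - L) x"
  proof (rule L2_limit_nonneg[where X="\<lambda>n. G.appr f n t - X n" and L="G.sol f t - L"])
    show "AE x in lebesgue_on \<Omega>. 0 \<le> (G.appr f n t - X n) x" for n using le[of n] by simp
    show "(\<lambda>n. L.nrm (G.appr f n t - X n - (G.sol f t - L))) \<longlonglongrightarrow> 0"
    proof (rule Lim_null_comparison)
      show "(\<lambda>n. L.nrm (G.appr f n t - G.sol f t) + L.nrm (X n - L)) \<longlonglongrightarrow> 0"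
        using tendsto_add[OF G.sol_limit_M[OF f t] X(3)] by simp
      have "L.nrm (G.appr f n t - X n - (G.sol f t - L)) \<le> L.nrm (G.appr f n t - G.sol f t) + L.nrm (X n - L)" for n
      proof -
        have eq: "G.appr f n t - X n - (G.sol f t - L) = (G.appr f n t - G.sol f t) - (X n - L)" by simp
        show ?thesis unfolding eq by (rule L.nrm_diff) (use V S X in auto)
      qed
      thus "\<forall>\<^sub>F n in sequentially. norm (L.nrm (G.appr f n t - X n - (G.sol f t - L)))
          \<le> L.nrm (G.appr f n t - G.sol f t) + L.nrm (X n - L)" using V S X by simp
    qed
  qed (use V S X in auto)
  thus ?thesis by simp
qed

lemma sol_mono:
  assumes f: "G.admissible a K f" and g: "G.admissible a' K' g" and t: "0 \<le> t" "t \<le> 1"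
    and le: "\<And>t. \<lbrakk>0 \<le> t; t \<le> 1\<rbrakk> \<Longrightarrow> AE x in lebesgue_on \<Omega>. f t x \<le> g t x"
  shows "AE x in lebesgue_on \<Omega>. G.sol f t x \<le> G.sol g t x"
proof (rule nonneg_limit_appr[OF _ _ _ g t])
  note A = G.admissibleD[OF f] G.admissibleD[OF g]
  show "G.appr f n t \<in> Hsp" for n by (rule Vsp_Hsp[OF G.appr_V[of f, OF A(3)]])
  show "G.sol f t \<in> Hsp" by (intro Vsp_Hsp G.sol_limit(1)[OF f t])
  show "(\<lambda>n. L.nrm (G.appr f n t - G.sol f t)) \<longlonglongrightarrow> 0" by (rule G.sol_limit_M[OF f t])
  show "AE x in lebesgue_on \<Omega>. G.appr f n t x \<le> G.appr g n t x" for n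
    unfolding G.appr_def by (rule rothe_mono[of _ f g, OF _ A(3) A(8)]) (rule le G.grid_le_one t | simp)+
qed

lemma sol_bounds:
  assumes f: "G.admissible a K f" and F: "0 \<le> F" and t: "0 \<le> t" "t \<le> 1"
    and bd: "\<And>t. \<lbrakk>0 \<le> t; t \<le> 1\<rbrakk> \<Longrightarrow> AE x in lebesgue_on \<Omega>. 0 \<le> f t x \<and> f t x \<le> F"
  shows "AE x in lebesgue_on \<Omega>. 0 \<le> G.sol f t x \<and> G.sol f t x \<le> F"
proof -
  note A = G.admissibleD[OF f]
  have V: "G.appr f n t \<in> Hsp" for n by (rule Vsp_Hsp[OF G.appr_V[of f, OF A(3)]])
  have S: "G.sol f t \<in> Hsp" by (intro Vsp_Hsp G.sol_limit(1)[OF f t])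
  have b1: "\<lbrakk>0 \<le> t; t \<le> 1\<rbrakk> \<Longrightarrow> AE x in lebesgue_on \<Omega>. 0 \<le> f t x" for t
    using bd[of t] by (auto elim: eventually_mono)
  have b2: "\<lbrakk>0 \<le> t; t \<le> 1\<rbrakk> \<Longrightarrow> AE x in lebesgue_on \<Omega>. f t x \<le> F" for t
    using bd[of t] by (auto elim: eventually_mono)
  have "AE x in lebesgue_on \<Omega>. 0 \<le> G.sol f t x"
  proof (rule L2_limit_nonneg[where X="\<lambda>n. G.appr f n t"])
    show "AE x in lebesgue_on \<Omega>. 0 \<le> G.appr f n t x" for n
      unfolding G.appr_def by (rule rothe_nonneg[of _ f, OF _ A(3)]) (rule b1 G.grid_le_one t | simp)+
  qed (use V S G.sol_limit_M[OF f t] in auto)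
  moreover have "AE x in lebesgue_on \<Omega>. 0 \<le> ((\<lambda>x. F) - G.sol f t) x"
  proof (rule L2_limit_nonneg[where X="\<lambda>n. (\<lambda>x. F) - G.appr f n t" and L="(\<lambda>x. F) - G.sol f t"])
    show "AE x in lebesgue_on \<Omega>. 0 \<le> ((\<lambda>x. F) - G.appr f n t) x" for n
    proof -
      have N: "real (nat \<lfloor>t * 2 ^ n\<rfloor>) * (1/2) ^ n \<le> 1" by (rule G.grid_le_one) (rule t)
      have "AE x in lebesgue_on \<Omega>. G.appr f n t x \<le> F * (real (nat \<lfloor>t * 2 ^ n\<rfloor>) * (1/2) ^ n)"
        unfolding G.appr_def by (rule rothe_upper[of _ f, OF _ A(3)]) (use b2 F N in auto)
      moreover have "F * (real (nat \<lfloor>t * 2 ^ n\<rfloor>) * (1/2) ^ n) \<le> F * 1" using N F by (intro mult_left_mono) auto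
      ultimately show ?thesis by (auto elim!: eventually_mono)
    qed
    have "L.nrm ((\<lambda>x. F) - G.appr f n t - ((\<lambda>x. F) - G.sol f t)) = L.nrm (G.appr f n t - G.sol f t)" for n
    proof -
      have eq: "(\<lambda>x. F) - G.appr f n t - ((\<lambda>x. F) - G.sol f t) = G.sol f t - G.appr f n t" by simp
      show ?thesis unfolding eq by (rule L.nrm_diff_commute) (use V S in auto)
    qed
    thus "(\<lambda>n. L.nrm ((\<lambda>x. F) - G.appr f n t - ((\<lambda>x. F) - G.sol f t))) \<longlonglongrightarrow> 0"
      using G.sol_limit_M[OF f t] by simp
  qed (use V S const_Hsp in auto)
  ultimately show ?thesis by eventually_elim auto
qed

end

section \<open>Lipschitz bumps have finite energy\<close>

lemma power_tangent:
  fixes a b :: real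
  assumes "0 \<le> a" "0 \<le> b"
  shows "real k * a ^ (k - 1) * (b - a) \<le> b ^ k - a ^ k"
proof (induction k)
  case (Suc k)
  show ?case
  proof (cases k)
    case (Suc j)
    have "b ^ Suc k - a ^ Suc k = b * (b ^ k - a ^ k) + a ^ k * (b - a)" by (simp add: algebra_simps)
    moreover have "b * (real k * a ^ (k - 1) * (b - a)) \<le> b * (b ^ k - a ^ k)"
      using Suc.IH assms by (intro mult_left_mono)
    moreover have "b * (real k * a ^ (k - 1) * (b - a)) = real k * a ^ k * (b - a) + real k * a ^ (k - 1) * (b - a)\<^sup>2"
      by (simp add: Suc power2_eq_square algebra_simps)
    moreover have "0 \<le> real k * a ^ (k - 1) * (b - a)\<^sup>2" using assms by simp
    ultimately show ?thesis by (simp add: algebra_simps)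
  qed simp
qed simp

lemma dyadic_shell_near:
  assumes "0 < r" "r \<le> (1::real)" shows "\<exists>j. (1/2) ^ Suc j < r \<and> r \<le> (1/2) ^ j"
proof -
  have "(\<lambda>n. (1/2::real) ^ n) \<longlonglongrightarrow> 0" by (rule LIMSEQ_realpow_zero) auto
  hence "\<forall>\<^sub>F n in sequentially. (1/2::real) ^ n < r" using assms(1) by (rule order_tendstoD)
  hence ex: "\<exists>n. (1/2::real) ^ n < r" by (auto simp: eventually_sequentially)
  define n where "n = (LEAST n. (1/2::real) ^ n < r)"
  have n: "(1/2::real) ^ n < r" unfolding n_def using ex by (rule LeastI_ex)
  hence "n \<noteq> 0" using assms by (cases n) auto
  then obtain j where j: "n = Suc j" by (cases n) auto
  have "\<not> (1/2::real) ^ j < r" using j unfolding n_def by (intro not_less_Least) simp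
  thus ?thesis using n j by auto
qed

lemma dyadic_shell_far:
  assumes "1 < (r::real)" shows "\<exists>j. 2 ^ j < r \<and> r \<le> 2 ^ Suc j"
proof -
  obtain n where "r < 2 ^ n" using real_arch_pow[of 2 r] by auto
  hence ex: "\<exists>n. r \<le> 2 ^ n" by (auto intro: less_imp_le)
  define n where "n = (LEAST n. r \<le> 2 ^ n)"
  have n: "r \<le> 2 ^ n" unfolding n_def using ex by (rule LeastI_ex)
  hence "n \<noteq> 0" using assms by (cases n) auto
  then obtain j where j: "n = Suc j" by (cases n) auto
  have "\<not> r \<le> 2 ^ j" using j unfolding n_def by (intro not_less_Least) simp
  thus ?thesis using n j by (intro exI[of _ j]) auto
qed

lemma half_powr: "2 powr (- t) = (1/2::real) powr t"
  unfolding powr_minus_divide by (subst powr_divide) simp_all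

lemma ennreal_le_suminf: "(f j :: ennreal) \<le> suminf f"
  using sum_le_suminf[of f "{j}"] by simp

lemma nn_integral_sum_balls_finite:
  fixes c \<rho> :: "nat \<Rightarrow> real"
  assumes c: "\<And>j. 0 \<le> c j" and \<rho>: "\<And>j. 0 \<le> \<rho> j" and S: "summable (\<lambda>j. c j * \<rho> j ^ CARD('n))"
  shows "(\<integral>\<^sup>+ z. (\<Sum>j. ennreal (c j) * indicator (cball 0 (\<rho> j)) z) \<partial>(lborel :: (real ^ 'n) measure)) < \<infinity>"
proof -
  define v where "v = unit_ball_vol (real CARD('n))"
  have v: "0 \<le> v" by (simp add: v_def)
  have "(\<integral>\<^sup>+ z. (\<Sum>j. ennreal (c j) * indicator (cball 0 (\<rho> j)) z) \<partial>(lborel :: (real ^ 'n) measure))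
     = (\<Sum>j. \<integral>\<^sup>+ z. ennreal (c j) * indicator (cball 0 (\<rho> j)) z \<partial>(lborel :: (real ^ 'n) measure))"
    by (rule nn_integral_suminf) (auto intro!: borel_measurable_times_ennreal borel_measurable_indicator)
  also have "\<dots> = (\<Sum>j. ennreal (v * (c j * \<rho> j ^ CARD('n))))"
  proof (rule suminf_cong)
    fix j
    have "(\<integral>\<^sup>+ z. ennreal (c j) * indicator (cball 0 (\<rho> j)) z \<partial>(lborel :: (real ^ 'n) measure))
       = ennreal (c j) * emeasure lborel (cball (0::real ^ 'n) (\<rho> j))"
      by (rule nn_integral_cmult_indicator) simp
    also have "\<dots> = ennreal (v * (c j * \<rho> j ^ CARD('n)))"
      using c[of j] \<rho>[of j] v by (simp add: emeasure_cball v_def ennreal_mult[symmetric] mult_ac)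
    finally show "(\<integral>\<^sup>+ z. ennreal (c j) * indicator (cball 0 (\<rho> j)) z \<partial>(lborel :: (real ^ 'n) measure))
       = ennreal (v * (c j * \<rho> j ^ CARD('n)))" .
  qed
  also have "\<dots> = ennreal (\<Sum>j. v * (c j * \<rho> j ^ CARD('n)))"
    by (rule suminf_ennreal2) (use c \<rho> v S in \<open>auto intro: summable_mult\<close>)
  finally show ?thesis by simp
qed

text \<open>
  On the dyadic shells the kernel is bounded by constants that, multiplied by the volumes of balls, form
  geometric series: with ratio \<open>(1/2) powr (2 - 2 * s)\<close> towards the origin and \<open>(1/2) powr (2 * s)\<close> towards
  infinity.  The two ends use \<open>s < 1\<close> and \<open>s > 0\<close>.
\<close>
lemma levy_kernel_integrable:
  assumes s: "0 < s" "s < 1"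
  shows "(\<integral>\<^sup>+ z. ennreal (min 1 ((norm z)\<^sup>2) / norm z powr (real CARD('n) + 2 * s)) \<partial>(lborel :: (real ^ 'n) measure)) < \<infinity>"
proof -
  define k where "k = real CARD('n) + 2 * s"
  have k: "0 < k" using s by (simp add: k_def)
  define c1 where "c1 j = ((1/2) ^ j)\<^sup>2 / ((1/2::real) ^ Suc j) powr k" for j :: nat
  define c2 where "c2 j = 1 / (2 ^ j :: real) powr k" for j :: nat
  define A where "A z = (\<Sum>j. ennreal (c1 j) * indicator (cball 0 ((1/2)^j)) (z :: real ^ 'n))" for z
  define B where "B z = (\<Sum>j. ennreal (c2 j) * indicator (cball 0 (2 ^ Suc j)) (z :: real ^ 'n))" for z
  have c0: "0 \<le> c1 j" "0 \<le> c2 j" for j by (auto simp: c1_def c2_def)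
  have le: "ennreal (min 1 ((norm z)\<^sup>2) / norm z powr k) \<le> A z + B z" for z :: "real ^ 'n"
  proof -
    consider "norm z = 0" | "0 < norm z" "norm z \<le> 1" | "1 < norm z" by force
    thus ?thesis
    proof cases
      case 1 thus ?thesis by simp
    next
      case 2
      then obtain j where j: "(1/2) ^ Suc j < norm z" "norm z \<le> (1/2) ^ j" using dyadic_shell_near by blast
      have "min 1 ((norm z)\<^sup>2) / norm z powr k \<le> ((1/2) ^ j)\<^sup>2 / ((1/2::real) ^ Suc j) powr k"
      proof (rule frac_le)
        show "min 1 ((norm z)\<^sup>2) \<le> ((1/2) ^ j)\<^sup>2" using j(2) by (intro min.coboundedI2 power_mono) auto
        show "((1/2::real) ^ Suc j) powr k \<le> norm z powr k" using j k by (intro powr_mono2) auto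
      qed auto
      hence "ennreal (min 1 ((norm z)\<^sup>2) / norm z powr k) \<le> ennreal (c1 j) * indicator (cball 0 ((1/2)^j)) z"
        using j(2) by (simp add: c1_def ennreal_leI)
      also have "\<dots> \<le> A z"
        unfolding A_def by (rule ennreal_le_suminf)
      finally show ?thesis by (simp add: add_increasing2)
    next
      case 3
      then obtain j where j: "2 ^ j < norm z" "norm z \<le> 2 ^ Suc j" using dyadic_shell_far by blast
      have "min 1 ((norm z)\<^sup>2) / norm z powr k \<le> 1 / (2 ^ j :: real) powr k"
      proof (rule frac_le)
        show "(2 ^ j) powr k \<le> norm z powr k" using j k by (intro powr_mono2) auto
      qed auto
      hence "ennreal (min 1 ((norm z)\<^sup>2) / norm z powr k) \<le> ennreal (c2 j) * indicator (cball 0 (2 ^ Suc j)) z"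
        using j(2) by (simp add: c2_def ennreal_leI)
      also have "\<dots> \<le> B z"
        unfolding B_def by (rule ennreal_le_suminf)
      finally show ?thesis by (simp add: add_increasing)
    qed
  qed
  have A: "(\<integral>\<^sup>+ z. A z \<partial>lborel) < \<infinity>" unfolding A_def
  proof (rule nn_integral_sum_balls_finite[OF c0(1)])
    have "c1 j * ((1/2) ^ j) ^ CARD('n) = 2 powr k * ((1/2) powr (2 - 2 * s)) ^ j" for j
    proof -
      have p: "(1/2::real) ^ m = 2 powr (- real m)" for m
      proof -
        have "2 powr (- real m) = inverse (2 powr real m)" by (rule powr_minus)
        also have "2 powr real m = 2 ^ m" by (rule powr_realpow) simp
        finally show ?thesis by (simp add: power_divide inverse_eq_divide)
      qed
      have e1: "((1/2::real) ^ j)\<^sup>2 = 2 powr (- 2 * real j)"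
        by (subst power_mult[symmetric], subst p) (simp add: mult.commute)
      have e2: "((1/2::real) ^ Suc j) powr k = 2 powr (- (real j + 1) * k)"
        unfolding p powr_powr by (simp add: add.commute)
      have e3: "((1/2::real) ^ j) ^ CARD('n) = 2 powr (- (real j * real CARD('n)))"
        by (subst power_mult[symmetric], subst p) simp
      have "c1 j * ((1/2) ^ j) ^ CARD('n) = 2 powr (- 2 * real j - (- (real j + 1) * k) + - (real j * real CARD('n)))"
        unfolding c1_def e1 e2 e3 powr_add powr_diff ..
      also have "- 2 * real j - (- (real j + 1) * k) + - (real j * real CARD('n)) = k + - (2 - 2 * s) * real j"
        by (simp add: k_def algebra_simps)
      also have "2 powr (k + - (2 - 2 * s) * real j) = 2 powr k * (2 powr (- (2 - 2 * s))) powr real j"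
        by (simp only: powr_add powr_powr)
      also have "2 powr (- (2 - 2 * s)) = (1/2) powr (2 - 2 * s)" by (rule half_powr)
      also have "((1/2) powr (2 - 2 * s)) powr real j = ((1/2::real) powr (2 - 2 * s)) ^ j" by (rule powr_realpow) simp
      finally show ?thesis .
    qed
    moreover have "summable (\<lambda>j. 2 powr k * ((1/2::real) powr (2 - 2 * s)) ^ j)"
      using powr_less_mono'[of "1/2::real" 0 "2 - 2 * s"] s by (intro summable_mult summable_geometric) simp
    ultimately show "summable (\<lambda>j. c1 j * ((1/2) ^ j) ^ CARD('n))" by simp
  qed simp
  have B: "(\<integral>\<^sup>+ z. B z \<partial>lborel) < \<infinity>" unfolding B_def
  proof (rule nn_integral_sum_balls_finite[OF c0(2)])
    have "c2 j * (2 ^ Suc j) ^ CARD('n) = 2 ^ CARD('n) * ((1/2) powr (2 * s)) ^ j" for j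
    proof -
      have p: "(2::real) ^ m = 2 powr (real m)" for m by (simp add: powr_realpow)
      have e1: "1 / (2 ^ j :: real) powr k = 2 powr (- (real j * k))"
        unfolding p powr_powr by (simp add: powr_minus_divide)
      have e2: "((2::real) ^ Suc j) ^ CARD('n) = 2 powr ((real j + 1) * real CARD('n))"
        by (subst power_mult[symmetric], subst p) (simp add: algebra_simps)
      have "c2 j * (2 ^ Suc j) ^ CARD('n) = 2 powr (- (real j * k) + (real j + 1) * real CARD('n))"
        unfolding c2_def e1 e2 powr_add ..
      also have "- (real j * k) + (real j + 1) * real CARD('n) = real CARD('n) + - (2 * s) * real j"
        by (simp add: k_def algebra_simps)
      also have "2 powr (real CARD('n) + - (2 * s) * real j) = 2 powr real CARD('n) * (2 powr (- (2 * s))) powr real j"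
        by (simp only: powr_add powr_powr)
      also have "2 powr (- (2 * s)) = (1/2) powr (2 * s)" by (rule half_powr)
      also have "((1/2) powr (2 * s)) powr real j = ((1/2::real) powr (2 * s)) ^ j" by (rule powr_realpow) simp
      finally show ?thesis by (simp only: p)
    qed
    moreover have "summable (\<lambda>j. 2 ^ CARD('n) * ((1/2::real) powr (2 * s)) ^ j)"
      using powr_less_mono'[of "1/2::real" 0 "2 * s"] s by (intro summable_mult summable_geometric) simp
    ultimately show "summable (\<lambda>j. c2 j * (2 ^ Suc j) ^ CARD('n))" by (simp only:)
  qed simp
  have "(\<integral>\<^sup>+ z. ennreal (min 1 ((norm z)\<^sup>2) / norm z powr k) \<partial>(lborel :: (real ^ 'n) measure))
     \<le> (\<integral>\<^sup>+ z. A z + B z \<partial>lborel)" by (rule nn_integral_mono) (rule le)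
  also have "\<dots> = (\<integral>\<^sup>+ z. A z \<partial>lborel) + (\<integral>\<^sup>+ z. B z \<partial>lborel)"
    unfolding A_def B_def
    by (rule nn_integral_add)
       (auto intro!: borel_measurable_suminf_order borel_measurable_times_ennreal borel_measurable_indicator)
  also have "\<dots> < \<infinity>" using A B by simp
  finally show ?thesis unfolding k_def .
qed

context frac_domain
begin

text \<open>
  The bump is 1-Lipschitz with values between \<open>0\<close> and \<open>1\<close>, so its squared difference quotient is at most
  the kernel \<open>K\<close> of \<open>levy_kernel_integrable\<close> at the distance of the points, and it vanishes unless one of the points lies in the ball.
  By translation invariance the integral of its square is at most twice the volume of the ball times the integral of
  \<open>K\<close>.
\<close>
lemma bump_Vsp:
  assumes r: "0 < r" "r \<le> 1" and B: "ball x0 r \<subseteq> \<Omega>"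
  shows "(\<lambda>x. max 0 (r - dist x0 x)) \<in> Vsp"
proof -
  define b :: "real ^ 'n \<Rightarrow> real" where "b = (\<lambda>x. max 0 (r - dist x0 x))"
  define k where "k = real CARD('n) + 2 * s"
  define K where "K z = ennreal (min 1 ((norm z)\<^sup>2) / norm z powr k)" for z :: "real ^ 'n"
  have bc: "continuous_on UNIV b" unfolding b_def by (intro continuous_intros)
  have bm[measurable]: "b \<in> borel_measurable borel" using bc by (rule borel_measurable_continuous_onI)
  hence bl: "b \<in> borel_measurable lebesgue" by (intro measurable_completion) simp
  have b01: "0 \<le> b x" "b x \<le> 1" "x \<notin> ball x0 r \<Longrightarrow> b x = 0" for x
  proof -
    have "r - dist x0 x \<le> 1" using r zero_le_dist[of x0 x] by linarith
    thus "0 \<le> b x" "b x \<le> 1" "x \<notin> ball x0 r \<Longrightarrow> b x = 0" by (auto simp: b_def)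
  qed
  have Km[measurable]: "K \<in> borel_measurable borel" unfolding K_def by measurable
  have md: "(\<lambda>z. fst z - snd z) \<in> measurable (lborel \<Otimes>\<^sub>M lborel) (borel :: (real ^ 'n) measure)"
    by (intro borel_measurable_diff) (auto intro: measurable_compose[OF measurable_fst] measurable_compose[OF measurable_snd])
  have mK[measurable]: "(\<lambda>z. K (fst z - snd z)) \<in> borel_measurable (lborel \<Otimes>\<^sub>M lborel)"
    by (rule measurable_compose[OF md Km])
  have mi: "(indicator (ball x0 r) :: _ \<Rightarrow> ennreal) \<in> borel_measurable lborel"
    by (rule borel_measurable_indicator) simp
  have mi1[measurable]: "(\<lambda>z. indicator (ball x0 r) (fst z) :: ennreal) \<in> borel_measurable (lborel \<Otimes>\<^sub>M (lborel :: (real ^ 'n) measure))"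
    by (rule measurable_compose[OF measurable_fst mi])
  have mi2[measurable]: "(\<lambda>z. indicator (ball x0 r) (snd z) :: ennreal) \<in> borel_measurable ((lborel :: (real ^ 'n) measure) \<Otimes>\<^sub>M lborel)"
    by (rule measurable_compose[OF measurable_snd mi])
  have m1: "(\<lambda>z. indicator (ball x0 r) (fst z) * K (fst z - snd z)) \<in> borel_measurable (lborel \<Otimes>\<^sub>M lborel)"
    using mi1 mK by (rule borel_measurable_times_ennreal)
  have m2: "(\<lambda>z. indicator (ball x0 r) (snd z) * K (fst z - snd z)) \<in> borel_measurable (lborel \<Otimes>\<^sub>M lborel)"
    using mi2 mK by (rule borel_measurable_times_ennreal)
  have KI: "(\<integral>\<^sup>+ z. K z \<partial>lborel) < \<infinity>" unfolding K_def k_def by (rule levy_kernel_integrable) (use s_pos s_less in auto)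
  have shift: "(\<integral>\<^sup>+ y. K (x - y) \<partial>lborel) = (\<integral>\<^sup>+ z. K z \<partial>lborel)" for x
  proof -
    have "(\<integral>\<^sup>+ z. K z \<partial>lborel) = (\<integral>\<^sup>+ z. K z \<partial>(distr lborel borel ((+) (- x))))"
      by (simp add: lborel_distr_plus)
    also have "\<dots> = (\<integral>\<^sup>+ y. K (- x + y) \<partial>lborel)" by (rule nn_integral_distr) auto
    also have "\<dots> = (\<integral>\<^sup>+ y. K (x - y) \<partial>lborel)" by (simp add: K_def norm_minus_commute)
    finally show ?thesis by simp
  qed
  define I where "I = (\<integral>\<^sup>+ z. K z \<partial>lborel)"
  define J where "J = emeasure lborel (ball x0 r)"
  have J: "J < \<infinity>" unfolding J_def by (rule emeasure_lborel_ball_finite)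
  have dqb: "ennreal ((dq s b z)\<^sup>2) \<le> indicator (ball x0 r) (fst z) * K (fst z - snd z) + indicator (ball x0 r) (snd z) * K (fst z - snd z)" for z
  proof -
    obtain x y where z: "z = (x, y)" by (cases z)
    have "\<bar>b x - b y\<bar> \<le> norm (x - y)"
    proof -
      have "\<bar>b x - b y\<bar> \<le> \<bar>dist x0 x - dist x0 y\<bar>" by (auto simp: b_def max_def)
      also have "\<dots> \<le> dist x y" by (metis abs_dist_diff_le dist_commute)
      finally show ?thesis by (simp add: dist_norm)
    qed
    hence "(b x - b y)\<^sup>2 \<le> (norm (x - y))\<^sup>2" by (simp add: abs_le_square_iff[symmetric])
    moreover have "\<bar>b x - b y\<bar> \<le> 1" using b01(1,2)[of x] b01(1,2)[of y] by linarith
    hence "(b x - b y)\<^sup>2 \<le> 1" by (simp add: abs_square_le_1)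
    ultimately have "(b x - b y)\<^sup>2 / norm (x - y) powr k \<le> min 1 ((norm (x - y))\<^sup>2) / norm (x - y) powr k"
      by (intro divide_right_mono) auto
    hence le: "ennreal ((dq s b z)\<^sup>2) \<le> K (x - y)"
      unfolding K_def by (intro ennreal_leI) (simp add: z power2_eq_square dq_mult k_def)
    show ?thesis
    proof (cases "x \<in> ball x0 r \<or> y \<in> ball x0 r")
      case True
      thus ?thesis using le by (auto simp: z intro: add_increasing add_increasing2)
    next
      case False
      hence "dq s b z = 0" using b01(3) by (simp add: z dq_def)
      thus ?thesis by simp
    qed
  qed
  have int1: "(\<integral>\<^sup>+ z. indicator (ball x0 r) (fst z) * K (fst z - snd z) \<partial>(lborel \<Otimes>\<^sub>M lborel)) = J * I"
  proof -
    have "(\<integral>\<^sup>+ z. indicator (ball x0 r) (fst z) * K (fst z - snd z) \<partial>(lborel \<Otimes>\<^sub>M lborel))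
        = (\<integral>\<^sup>+ x. \<integral>\<^sup>+ y. indicator (ball x0 r) x * K (x - y) \<partial>lborel \<partial>lborel)"
      using lborel.nn_integral_fst[OF m1] by simp
    also have "\<dots> = (\<integral>\<^sup>+ x. I * indicator (ball x0 r) x \<partial>lborel)"
    proof (rule nn_integral_cong)
      fix x :: "real ^ 'n"
      have m: "(\<lambda>y. K (x - y)) \<in> borel_measurable lborel"
        by (rule measurable_compose[OF _ Km]) simp
      show "(\<integral>\<^sup>+ y. indicator (ball x0 r) x * K (x - y) \<partial>lborel) = I * indicator (ball x0 r) x"
        unfolding nn_integral_cmult[OF m] shift I_def by (rule mult.commute)
    qed
    also have "\<dots> = J * I" unfolding J_def by (subst nn_integral_cmult_indicator) (simp_all add: mult.commute)
    finally show ?thesis .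
  qed
  have int2: "(\<integral>\<^sup>+ z. indicator (ball x0 r) (snd z) * K (fst z - snd z) \<partial>(lborel \<Otimes>\<^sub>M lborel)) = J * I"
  proof -
    have "(\<integral>\<^sup>+ z. indicator (ball x0 r) (snd z) * K (fst z - snd z) \<partial>(lborel \<Otimes>\<^sub>M lborel))
        = (\<integral>\<^sup>+ y. \<integral>\<^sup>+ x. indicator (ball x0 r) y * K (x - y) \<partial>lborel \<partial>lborel)"
      using lborel_pair.nn_integral_snd[OF m2] by simp
    also have "\<dots> = (\<integral>\<^sup>+ y. I * indicator (ball x0 r) y \<partial>lborel)"
    proof (rule nn_integral_cong)
      fix y :: "real ^ 'n"
      have "(\<integral>\<^sup>+ x. K (x - y) \<partial>lborel) = I" using shift[of y] by (simp add: I_def K_def norm_minus_commute)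
      moreover have m: "(\<lambda>x. K (x - y)) \<in> borel_measurable lborel"
        by (rule measurable_compose[OF _ Km]) simp
      ultimately show "(\<integral>\<^sup>+ x. indicator (ball x0 r) y * K (x - y) \<partial>lborel) = I * indicator (ball x0 r) y"
        by (subst nn_integral_cmult[OF m]) (simp add: mult.commute)
    qed
    also have "\<dots> = J * I" unfolding J_def by (subst nn_integral_cmult_indicator) (simp_all add: mult.commute)
    finally show ?thesis .
  qed
  have "(\<integral>\<^sup>+ z. ennreal ((dq s b z)\<^sup>2) \<partial>lebesgue) = (\<integral>\<^sup>+ z. ennreal ((dq s b z)\<^sup>2) \<partial>(lborel \<Otimes>\<^sub>M lborel))"
    unfolding lborel_prod by (rule nn_integral_completion)
  also have "\<dots> \<le> (\<integral>\<^sup>+ z. indicator (ball x0 r) (fst z) * K (fst z - snd z) + indicator (ball x0 r) (snd z) * K (fst z - snd z) \<partial>(lborel \<Otimes>\<^sub>M lborel))"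
    by (rule nn_integral_mono) (rule dqb)
  also have "\<dots> = J * I + J * I"
    by (simp only: nn_integral_add[OF m1 m2] int1 int2)
  also have "\<dots> < \<infinity>" using J KI by (simp add: I_def ennreal_mult_less_top)
  finally have fin: "(\<integral>\<^sup>+ z. ennreal ((dq s b z)\<^sup>2) \<partial>lebesgue) < \<infinity>" .
  have dm: "dq s b \<in> borel_measurable lebesgue" by (rule measurable_dq[OF bl])
  have "dq s b \<in> L2 lebesgue"
    using fin dm unfolding L2_def by (auto intro!: integrableI_nonneg)
  moreover have "b \<in> L2 lebesgue"
  proof (rule L2_dominated[where f="indicator (ball x0 r)"])
    have "integrable lebesgue (indicator (ball x0 r) :: real ^ 'n \<Rightarrow> real)"
      using J by (intro integrable_real_indicator) (auto simp: J_def)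
    moreover have "(\<lambda>x. (indicator (ball x0 r) x)\<^sup>2) = (indicator (ball x0 r) :: real ^ 'n \<Rightarrow> real)"
      by (auto simp: indicator_def fun_eq_iff)
    ultimately show "indicator (ball x0 r) \<in> L2 (lebesgue :: (real ^ 'n) measure)" by (simp add: L2_def)
    have "\<bar>b x\<bar> \<le> \<bar>indicator (ball x0 r) x\<bar>" for x using b01[of x] by (auto simp: indicator_def)
    thus "AE x in lebesgue. \<bar>b x\<bar> \<le> \<bar>indicator (ball x0 r) x\<bar>" by simp
  qed (rule bl)
  moreover have "x \<notin> \<Omega> \<Longrightarrow> b x = 0" for x using b01(3) B by blast
  ultimately show ?thesis unfolding Vsp_iff b_def[symmetric] by auto
qed

end

section \<open>A stationary profile supported in a subdomain\<close>

context frac_domain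
begin

lemma ip_one_Vsp: assumes "w \<in> Vsp" shows "ip (\<lambda>x. 1) w = (LINT x|lebesgue. w x)"
proof -
  have [measurable]: "w \<in> borel_measurable lebesgue" using assms VspD by auto
  have "ip (\<lambda>x. 1) w = (LINT x|lebesgue. indicator \<Omega> x *\<^sub>R (1 * w x))" by (rule integral_restrict_space) simp
  also have "\<dots> = (LINT x|lebesgue. w x)"
  proof (rule integral_cong_AE)
    show "AE x in lebesgue. indicator \<Omega> x *\<^sub>R (1 * w x) = w x"
      using VspD(3)[OF assms] by eventually_elim (auto simp: indicator_def)
  qed auto
  finally show ?thesis .
qed

lemma Vsp_exists_pos:
  assumes "\<Omega> \<noteq> {}" shows "\<exists>b\<in>Vsp. ip (\<lambda>x. 1) b \<noteq> 0"
proof -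
  obtain x0 where "x0 \<in> \<Omega>" using assms by blast
  then obtain r' where r': "0 < r'" "ball x0 r' \<subseteq> \<Omega>" using open_dom by (meson open_contains_ball)
  define r where "r = min r' 1"
  have r: "0 < r" "r \<le> 1" "ball x0 r \<subseteq> \<Omega>" using r' by (auto simp: r_def)
  define b where "b = (\<lambda>x. max 0 (r - dist x0 x))"
  have b: "b \<in> Vsp" unfolding b_def by (rule bump_Vsp[OF r])
  have "ip (\<lambda>x. 1) b \<noteq> 0"
  proof
    assume z: "ip (\<lambda>x. 1) b = 0"
    have bi: "integrable (lebesgue_on \<Omega>) b"
      using L2_integrable_mult[OF const_Hsp[of 1] Vsp_Hsp[OF b]] by simp
    have "AE x in lebesgue_on \<Omega>. 0 \<le> b x" by (simp add: b_def)
    hence "AE x in lebesgue_on \<Omega>. b x = 0"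
      using z integral_nonneg_eq_0_iff_AE[OF bi] by simp
    hence "AE x in lebesgue. x \<in> \<Omega> \<longrightarrow> b x = 0" by (simp add: AE_dom)
    hence "AE x in lborel. x \<notin> ball x0 r" unfolding AE_completion_iff
      by eventually_elim (use r in \<open>auto simp: b_def\<close>)
    hence "emeasure lborel (ball x0 r) = 0" by (subst (asm) AE_iff_null_sets[symmetric]) auto
    thus False using r using unit_ball_vol_pos[of "real CARD('n)"] by (simp add: emeasure_ball)
  qed
  thus ?thesis using b by blast
qed

text \<open>
  A relative of the torsion function.  The solution \<open>u\<close> of \<open>u + (-\<Delta>)\<^sup>s u = 1\<close> is one implicit Euler step; the
  maximum principle gives \<open>0 \<le> u \<le> 1\<close>, hence \<open>(-\<Delta>)\<^sup>s u = 1 - u \<le> 1\<close>.  The zeroth order term provides the upper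
  bound \<open>1\<close> without any estimate of the torsion function itself.
\<close>
lemma torsion:
  assumes ne: "\<Omega> \<noteq> {}"
  shows "\<exists>g\<in>Vsp. (\<forall>x. 0 \<le> g x \<and> g x \<le> 1) \<and> \<not> (AE x in lebesgue. g x = 0) \<and>
           (\<forall>v\<in>Vsp. (\<forall>x. 0 \<le> v x) \<longrightarrow> energy s g v \<le> ip (\<lambda>x. 1) v)"
proof -
  define u where "u = G.resolvent 1 (\<lambda>x. 1)"
  have u: "u \<in> Vsp" unfolding u_def by (rule G.resolvent(1)) (auto intro: const_Hsp)
  have eq: "ip u v + energy s u v = ip (\<lambda>x. 1) v" if "v \<in> Vsp" for v
    using G.resolvent(2)[OF _ const_Hsp that, of 1 1] unfolding u_def by simp
  have up: "AE x in lebesgue_on \<Omega>. u x \<le> 1"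
  proof (rule max_principle[OF u])
    have "(\<lambda>x. max (u x - 1) 0) \<in> Vsp" by (rule Vsp_contraction[OF u]) auto
    thus "ip u (\<lambda>x. max (u x - 1) 0) + 1 * energy s u (\<lambda>x. max (u x - 1) 0) \<le> 1 * ip (\<lambda>x. 1) (\<lambda>x. max (u x - 1) 0)"
      using eq by simp
  qed auto
  have "AE x in lebesgue_on \<Omega>. (- u) x \<le> 0"
  proof (rule max_principle[of "- u" 0 1])
    define w where "w = (\<lambda>x. max ((- u) x - 0) 0)"
    have w: "w \<in> Vsp" unfolding w_def
      by (rule Vsp_contraction[OF En.S_minus[OF u], of "\<lambda>a. max (a - 0) 0"]) auto
    have "0 \<le> ip (\<lambda>x. 1) w" by (simp add: w_def)
    moreover have "ip (- u) w = - ip u w" by (rule L.minus_left) (use u w Vsp_Hsp in auto)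
    moreover have "energy s (- u) w = - energy s u w" by (rule En.minus_left) (use u w in auto)
    ultimately have "ip (- u) w + energy s (- u) w \<le> 0" using eq[OF w] by linarith
    thus "ip (- u) (\<lambda>x. max ((- u) x - 0) 0) + 1 * energy s (- u) (\<lambda>x. max ((- u) x - 0) 0)
       \<le> 0 * ip (\<lambda>x. 1) (\<lambda>x. max ((- u) x - 0) 0)"
      unfolding w_def by (simp only: mult_1 mult_zero_left)
  qed (use u in auto)
  \<comment> \<open>a representative that obeys the bounds everywhere, not only almost everywhere\<close>
  define g where "g = (\<lambda>x. min 1 (max 0 (u x)))"
  have g: "g \<in> Vsp" unfolding g_def by (rule Vsp_contraction[OF u]) (auto simp: min_def max_def abs_if)
  have gu: "AE x in lebesgue. u x = g x"
  proof -
    have "AE x in lebesgue. x \<in> \<Omega> \<longrightarrow> u x \<le> 1" "AE x in lebesgue. x \<in> \<Omega> \<longrightarrow> (- u) x \<le> 0"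
      using up \<open>AE x in lebesgue_on \<Omega>. (- u) x \<le> 0\<close> unfolding AE_dom by blast+
    thus ?thesis using VspD(3)[OF u] by eventually_elim (auto simp: g_def min_def max_def)
  qed
  have eg: "energy s g v = energy s u v" if "v \<in> Vsp" for v
  proof -
    have "energy s (u - g) v = 0" by (rule energy_null) (use gu in \<open>auto elim: eventually_mono\<close>)
    thus ?thesis using u g that by (simp add: En.diff_left)
  qed
  show ?thesis
  proof (intro bexI[OF _ g] conjI ballI impI allI)
    show "0 \<le> g x" "g x \<le> 1" for x by (auto simp: g_def)
    show "\<not> (AE x in lebesgue. g x = 0)"
    proof
      assume "AE x in lebesgue. g x = 0"
      hence u0: "AE x in lebesgue. u x = 0" using gu by eventually_elim simp
      obtain b where b: "b \<in> Vsp" "ip (\<lambda>x. 1) b \<noteq> 0" using Vsp_exists_pos[OF ne] by blast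
      have "energy s u b = 0" by (rule energy_null[OF u0])
      moreover have "ip u b = 0"
        by (rule integral_eq_zero_AE) (use u0 in \<open>auto simp: AE_dom elim: eventually_mono\<close>)
      ultimately show False using eq[OF b(1)] b(2) by simp
    qed
    fix v assume v: "v \<in> Vsp" and v0: "\<forall>x. 0 \<le> v x"
    have "0 \<le> ip u v"
    proof (rule integral_nonneg_AE)
      have "AE x in lebesgue. x \<in> \<Omega> \<longrightarrow> 0 \<le> u x * v x"
        using gu by eventually_elim (use v0 in \<open>auto simp: g_def\<close>)
      thus "AE x in lebesgue_on \<Omega>. 0 \<le> u x * v x" by (simp add: AE_dom)
    qed
    thus "energy s g v \<le> ip (\<lambda>x. 1) v" using eq[OF v] eg[OF v] by simp
  qed
qed

lemma Vsp_power:
  assumes g: "g \<in> Vsp" and g01: "\<And>x. 0 \<le> g x \<and> g x \<le> 1"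
  shows "(\<lambda>x. g x ^ Suc j) \<in> Vsp"
proof (induction j)
  case (Suc j)
  have "(\<lambda>x. g x * g x ^ Suc j) \<in> Vsp"
    by (rule Vsp_mult[OF g Suc.IH, of 1]) (use g01 in \<open>auto simp: power_le_one abs_mult mult_le_one simp del: power_Suc\<close>)
  thus ?case by simp
qed (use g in simp)

text \<open>
  The profile is \<open>\<phi> = g ^ k\<close> with the function \<open>g\<close> of \<open>torsion\<close> for \<open>O'\<close>.  The tangent inequality for the
  power gives \<open>energy s (g ^ k) v \<le> energy s g (k * g ^ (k - 1) * v)\<close> for \<open>v \<ge> 0\<close>.  The new test
  function lives in \<open>O'\<close>, so the right-hand side is at most the integral of \<open>k * g ^ (k - 1) * v\<close>.
  Boundedness of \<open>v\<close> ensures that the product belongs to the energy space.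
\<close>
lemma subsolution_profile:
  assumes O: "open O'" "O' \<noteq> {}" "O' \<subseteq> \<Omega>" and a: "0 < \<alpha>" "\<alpha> < 1"
  shows "\<exists>\<phi> C. \<phi> \<in> Vsp \<and> (\<forall>x. 0 \<le> \<phi> x \<and> \<phi> x \<le> 1) \<and> 0 \<le> C \<and>
     (AE x in lebesgue. x \<notin> O' \<longrightarrow> \<phi> x = 0) \<and> \<not> (AE x in lebesgue. \<phi> x = 0) \<and>
     (\<forall>v B. v \<in> Vsp \<longrightarrow> (\<forall>x. 0 \<le> v x) \<longrightarrow> (AE x in lebesgue. v x \<le> B) \<longrightarrow>
        energy s \<phi> v \<le> C * ip (\<lambda>x. \<phi> x powr \<alpha>) v)"
proof -
  interpret D: frac_domain O' s
    using O s_pos s_less bounded_subset[OF bounded_dom O(3)] by unfold_locales auto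
  obtain g where g: "g \<in> D.Vsp" "\<And>x. 0 \<le> g x \<and> g x \<le> 1" "\<not> (AE x in lebesgue. g x = 0)"
    "\<And>v. v \<in> D.Vsp \<Longrightarrow> (\<And>x. 0 \<le> v x) \<Longrightarrow> energy s g v \<le> D.ip (\<lambda>x. 1) v"
    using D.torsion[OF O(2)] by blast
  have sub: "w \<in> Vsp" if "w \<in> D.Vsp" for w
    using that O(3) unfolding Vsp_iff D.Vsp_iff by (auto elim: eventually_mono)
  \<comment> \<open>the choice ensures \<open>k * \<alpha> \<le> k - 1\<close>, hence \<open>g ^ (k - 1) \<le> \<phi> powr \<alpha>\<close> as \<open>g \<le> 1\<close>\<close>
  obtain j :: nat where "1 / (1 - \<alpha>) \<le> real j" using real_arch_simple by blast
  hence j: "1 / (1 - \<alpha>) \<le> real (Suc j)" by simp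
  define k where "k = Suc (Suc j)"
  have ka: "real k * \<alpha> \<le> real (Suc j)"
  proof -
    have "1 \<le> real (Suc j) * (1 - \<alpha>)" using j a by (simp add: pos_divide_le_eq)
    hence "(real (Suc j) + 1) * \<alpha> \<le> real (Suc j)" using a by (simp add: algebra_simps)
    thus ?thesis by (simp add: k_def add.commute)
  qed
  define \<phi> where "\<phi> = (\<lambda>x. g x ^ k)"
  have phiD: "\<phi> \<in> D.Vsp" unfolding \<phi>_def k_def by (rule D.Vsp_power) (use g in auto)
  have phi: "\<phi> \<in> Vsp" by (rule sub[OF phiD])
  have p01: "0 \<le> \<phi> x" "\<phi> x \<le> 1" for x using g(2)[of x] by (auto simp: \<phi>_def power_le_one)
  have gp: "(\<lambda>x. g x ^ Suc j) \<in> Vsp" by (rule Vsp_power[OF sub[OF g(1)] g(2)])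
  have pa: "g x ^ Suc j \<le> \<phi> x powr \<alpha>" for x
  proof (cases "g x = 0")
    case True thus ?thesis by (simp add: \<phi>_def)
  next
    case False
    hence gx: "0 < g x" "g x \<le> 1" using g(2)[of x] by auto
    have "g x ^ Suc j = g x powr real (Suc j)" using gx by (simp only: powr_realpow)
    also have "\<dots> \<le> g x powr (real k * \<alpha>)" by (rule powr_mono'[OF ka]) (use gx in auto)
    also have "\<dots> = \<phi> x powr \<alpha>" using gx by (simp add: \<phi>_def powr_powr[symmetric] powr_realpow)
    finally show ?thesis .
  qed
  have [measurable]: "\<phi> \<in> borel_measurable lebesgue" using VspD[OF phi] by auto
  have paH: "(\<lambda>x. \<phi> x powr \<alpha>) \<in> Hsp"
    by (rule L2_dominated[OF const_Hsp[of 1]])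
       (use p01 a in \<open>auto intro!: measurable_restrict_space1 simp: powr_le1\<close>)
  have main: "energy s \<phi> v \<le> real k * ip (\<lambda>x. \<phi> x powr \<alpha>) v"
    if v: "v \<in> Vsp" and v0: "\<And>x. 0 \<le> v x" and vB: "AE x in lebesgue. v x \<le> B" for v B
  proof -
    define B' where "B' = max B 1"
    define w where "w = (\<lambda>x. real k * (g x ^ Suc j * v x))"
    have gv: "(\<lambda>x. g x ^ Suc j * v x) \<in> Vsp"
    proof (rule Vsp_mult[OF gp v, of B'])
      have "\<bar>g x ^ Suc j\<bar> \<le> 1" for x using g(2)[of x] by (simp add: power_le_one del: power_Suc)
      thus "AE x in lebesgue. \<bar>g x ^ Suc j\<bar> \<le> B'" by (simp add: B'_def max.coboundedI2 del: power_Suc)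
      show "AE x in lebesgue. \<bar>v x\<bar> \<le> B'" using vB by eventually_elim (use v0 in \<open>auto simp: B'_def\<close>)
    qed (simp add: B'_def)
    have "AE x in lebesgue. x \<notin> O' \<longrightarrow> g x ^ Suc j * v x = 0"
      using D.VspD(3)[OF g(1)] by eventually_elim auto
    hence gvD: "(\<lambda>x. g x ^ Suc j * v x) \<in> D.Vsp" using gv unfolding Vsp_iff D.Vsp_iff by blast
    have wD: "w \<in> D.Vsp" using D.En.S_scale[OF gvD, of "real k"] by (simp add: w_def scaleR_fun_def)
    have w0: "0 \<le> w x" for x using g(2)[of x] v0[of x] by (simp add: w_def)
    have "energy s \<phi> v \<le> energy s g w"
    proof (rule energy_mono[OF phi v sub[OF g(1)] sub[OF wD]])
      have "(g x ^ k - g y ^ k) * (v x - v y) \<le> (g x - g y) * (w x - w y)" for x y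
      proof -
        have 1: "(g x ^ k - g y ^ k) * v x \<le> (real k * g x ^ Suc j * (g x - g y)) * v x"
          using power_tangent[of "g x" "g y" k] g(2)[of x] g(2)[of y] v0[of x]
          by (intro mult_right_mono) (auto simp: k_def algebra_simps simp del: power_Suc)
        have 2: "(g y ^ k - g x ^ k) * v y \<le> (real k * g y ^ Suc j * (g y - g x)) * v y"
          using power_tangent[of "g y" "g x" k] g(2)[of x] g(2)[of y] v0[of y]
          by (intro mult_right_mono) (auto simp: k_def algebra_simps simp del: power_Suc)
        have "(g x ^ k - g y ^ k) * (v x - v y) = (g x ^ k - g y ^ k) * v x + (g y ^ k - g x ^ k) * v y"
          by (simp add: algebra_simps)
        also have "\<dots> \<le> (real k * g x ^ Suc j * (g x - g y)) * v x + (real k * g y ^ Suc j * (g y - g x)) * v y"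
          using 1 2 by (rule add_mono)
        also have "\<dots> = (g x - g y) * (w x - w y)" by (simp add: w_def algebra_simps del: power_Suc)
        finally show ?thesis .
      qed
      thus "AE z in lebesgue. (\<phi> (fst z) - \<phi> (snd z)) * (v (fst z) - v (snd z)) \<le> (g (fst z) - g (snd z)) * (w (fst z) - w (snd z))"
        unfolding \<phi>_def by simp
    qed
    also have "\<dots> \<le> D.ip (\<lambda>x. 1) w" by (rule g(4)[OF wD w0])
    also have "\<dots> = ip (\<lambda>x. 1) w" by (simp only: D.ip_one_Vsp[OF wD] ip_one_Vsp[OF sub[OF wD]])
    also have "\<dots> = real k * ip (\<lambda>x. g x ^ Suc j) v" by (simp add: w_def del: power_Suc)
    also have "\<dots> \<le> real k * ip (\<lambda>x. \<phi> x powr \<alpha>) v"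
      by (intro mult_left_mono ip_mono_AE) (use gp v paH Vsp_Hsp pa v0 in \<open>auto intro!: mult_right_mono simp del: power_Suc\<close>)
    finally show ?thesis .
  qed
  have "\<not> (AE x in lebesgue. \<phi> x = 0)"
  proof -
    have "\<phi> x = 0 \<longleftrightarrow> g x = 0" for x by (auto simp: \<phi>_def k_def)
    thus ?thesis using g(3) by simp
  qed
  moreover have "AE x in lebesgue. x \<notin> O' \<longrightarrow> \<phi> x = 0" by (rule D.VspD(3)[OF phiD])
  ultimately show ?thesis
    using phi p01 main by (intro exI[of _ \<phi>] exI[of _ "real k"]) auto
qed

end

section \<open>The sublinear reaction term and the Picard operator\<close>

lemma powr_diff_tangent:
  fixes s t :: real
  assumes "0 \<le> s" "s \<le> t" "1 \<le> \<beta>"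
  shows "t powr \<beta> - s powr \<beta> \<le> \<beta> * t powr (\<beta> - 1) * (t - s)"
proof -
  consider "s = t" | "s = 0" "0 < t" | "0 < s" "s < t" using assms by fastforce
  thus ?thesis
  proof cases
    case 2
    have "t powr \<beta> = t powr (\<beta> - 1) * t" using 2 by (simp add: powr_diff)
    moreover have "1 * (t powr (\<beta> - 1) * t) \<le> \<beta> * (t powr (\<beta> - 1) * t)" using assms 2 by (intro mult_right_mono) auto
    ultimately show ?thesis using 2 by (simp add: mult.assoc)
  next
    case 3
    have "\<exists>z>s. z < t \<and> t powr \<beta> - s powr \<beta> = (t - s) * (\<beta> * z powr (\<beta> - 1))"
      by (rule MVT2[OF 3(2)]) (use 3 in \<open>auto intro!: has_real_derivative_powr\<close>)
    then obtain z where z: "s < z" "z < t" "t powr \<beta> - s powr \<beta> = (t - s) * (\<beta> * z powr (\<beta> - 1))" by blast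
    have "z powr (\<beta> - 1) \<le> t powr (\<beta> - 1)" using z 3 assms by (intro powr_mono2) auto
    hence "(t - s) * (\<beta> * z powr (\<beta> - 1)) \<le> (t - s) * (\<beta> * t powr (\<beta> - 1))"
      using 3 assms by (intro mult_left_mono) auto
    thus ?thesis using z by (simp add: mult_ac)
  qed simp
qed

lemma powr_holder:
  fixes a b :: real
  assumes "0 \<le> a" "0 \<le> b" "0 < \<alpha>" "\<alpha> \<le> 1"
  shows "\<bar>a powr \<alpha> - b powr \<alpha>\<bar> \<le> \<bar>a - b\<bar> powr \<alpha>"
proof -
  have main: "a powr \<alpha> \<le> b powr \<alpha> + (a - b) powr \<alpha>" if "0 \<le> b" "b < a" for a b :: real
  proof -
    have a: "0 < a" using that by simp
    have frac: "x \<le> x powr \<alpha>" if "0 \<le> x" "x \<le> 1" for x :: real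
      using powr_mono'[of \<alpha> 1 x] assms that by (cases "x = 0") auto
    have "1 = b / a + (a - b) / a" using a by (simp add: field_simps)
    also have "\<dots> \<le> (b / a) powr \<alpha> + ((a - b) / a) powr \<alpha>"
      using that a by (intro add_mono frac) auto
    also have "\<dots> = (b powr \<alpha> + (a - b) powr \<alpha>) / a powr \<alpha>"
      using that a by (simp add: powr_divide add_divide_distrib)
    finally show ?thesis using a by (simp add: pos_le_divide_eq)
  qed
  consider "a = b" | "a < b" | "b < a" by linarith
  thus ?thesis
  proof cases
    case 2
    have "a powr \<alpha> \<le> b powr \<alpha>" using 2 assms by (intro powr_mono2) auto
    thus ?thesis using main[of a b] 2 assms by simp
  next
    case 3
    have "b powr \<alpha> \<le> a powr \<alpha>" using 3 assms by (intro powr_mono2) auto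
    thus ?thesis using main[of b a] 3 assms by simp
  qed simp
qed

text \<open>
  Integrated with \<open>\<delta>\<^sup>2\<close> equal to the integral of \<open>z\<^sup>2\<close>, this inequality is a substitute for Jensen's
  inequality for the concave power.
\<close>
lemma powr_le_young:
  fixes z \<delta> :: real
  assumes "0 < \<delta>" "0 < \<alpha>" "\<alpha> \<le> 1"
  shows "(\<bar>z\<bar> powr \<alpha>)\<^sup>2 \<le> \<delta>\<^sup>2 powr \<alpha> + \<delta>\<^sup>2 powr (\<alpha> - 1) * z\<^sup>2"
proof -
  have eq: "(\<bar>z\<bar> powr \<alpha>)\<^sup>2 = z\<^sup>2 powr \<alpha>"
    by (simp add: power2_eq_square powr_mult[symmetric] flip: abs_mult)
  show ?thesis
  proof (cases "z\<^sup>2 \<le> \<delta>\<^sup>2")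
    case True
    have "z\<^sup>2 powr \<alpha> \<le> \<delta>\<^sup>2 powr \<alpha>" using True assms by (intro powr_mono2) auto
    thus ?thesis unfolding eq by (simp add: add_increasing2)
  next
    case False
    hence z: "0 < z\<^sup>2" "\<delta>\<^sup>2 \<le> z\<^sup>2" using zero_le_power2[of \<delta>] by linarith+
    have "z\<^sup>2 powr \<alpha> = z\<^sup>2 powr (\<alpha> - 1) * z\<^sup>2" using z by (simp add: powr_diff)
    also have "z\<^sup>2 powr (\<alpha> - 1) \<le> \<delta>\<^sup>2 powr (\<alpha> - 1)" using z assms by (intro powr_mono2') auto
    hence "z\<^sup>2 powr (\<alpha> - 1) * z\<^sup>2 \<le> \<delta>\<^sup>2 powr (\<alpha> - 1) * z\<^sup>2" by (intro mult_right_mono) auto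
    finally show ?thesis unfolding eq by (simp add: add_increasing)
  qed
qed

text \<open>
  Because \<open>A * M powr \<alpha>\<close> is of lower order than \<open>M\<close>, bounds of this kind reproduce themselves under the
  Picard operator, however large the coefficient is.
\<close>
lemma sublinear_bound:
  fixes A B \<alpha> :: real
  assumes "0 \<le> A" "0 < \<alpha>" "\<alpha> < 1"
  shows "\<exists>M\<ge>B. 1 \<le> M \<and> A * M powr \<alpha> \<le> M"
proof -
  define M where "M = max (max B 1) (A powr (1 / (1 - \<alpha>)))"
  have M: "B \<le> M" "1 \<le> M" "A powr (1 / (1 - \<alpha>)) \<le> M" by (auto simp: M_def)
  have "A = (A powr (1 / (1 - \<alpha>))) powr (1 - \<alpha>)" using assms by (simp add: powr_powr)
  also have "\<dots> \<le> M powr (1 - \<alpha>)" using M assms by (intro powr_mono2) auto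
  finally have "A * M powr \<alpha> \<le> M powr (1 - \<alpha>) * M powr \<alpha>" by (intro mult_right_mono) auto
  also have "\<dots> = M" using M by (simp add: powr_add[symmetric])
  finally show ?thesis using M by blast
qed

definition clamp01 :: "real \<Rightarrow> real" where "clamp01 t = max 0 (min 1 t)"

lemma clamp01: "clamp01 t \<in> {0..1}" "t \<in> {0..1} \<Longrightarrow> clamp01 t = t" "\<bar>clamp01 s - clamp01 t\<bar> \<le> \<bar>s - t\<bar>"
  by (auto simp: clamp01_def)

locale frac_problem = frac_domain \<Omega> s for \<Omega> :: "(real ^ 'n) set" and s :: real +
  fixes \<alpha> :: real and q :: "real ^ 'n \<Rightarrow> real" and Q :: real
  assumes alpha: "0 < \<alpha>" "\<alpha> < 1" and q_meas: "q \<in> borel_measurable (lebesgue_on \<Omega>)"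
    and q_nonneg: "AE x in lebesgue_on \<Omega>. 0 \<le> q x" and q_le: "AE x in lebesgue_on \<Omega>. q x \<le> Q" and Q: "0 \<le> Q"
begin

definition nl :: "(real ^ 'n \<Rightarrow> real) \<Rightarrow> real ^ 'n \<Rightarrow> real" where
  "nl u = (\<lambda>x. q x * (\<bar>u x\<bar> powr (\<alpha> - 1) * u x))"

lemma nl_nonneg_eq: "0 \<le> u x \<Longrightarrow> nl u x = q x * u x powr \<alpha>"
  by (cases "u x = 0") (auto simp: nl_def powr_diff)

definition bstate :: "real \<Rightarrow> (real ^ 'n \<Rightarrow> real) \<Rightarrow> bool" where
  "bstate M u \<longleftrightarrow> u \<in> Hsp \<and> (AE x in lebesgue_on \<Omega>. 0 \<le> u x \<and> u x \<le> M)"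

lemma nl_measurable: "u \<in> Hsp \<Longrightarrow> nl u \<in> borel_measurable (lebesgue_on \<Omega>)"
  unfolding nl_def using q_meas L2D(1)[of u] by measurable

lemma nl_bounds:
  assumes "bstate M u" shows "AE x in lebesgue_on \<Omega>. 0 \<le> nl u x \<and> nl u x \<le> Q * M powr \<alpha>"
proof -
  have "AE x in lebesgue_on \<Omega>. 0 \<le> u x \<and> u x \<le> M" using assms by (simp add: bstate_def)
  thus ?thesis using q_nonneg q_le
  proof eventually_elim
    case (elim x)
    have "u x powr \<alpha> \<le> M powr \<alpha>" using elim alpha by (intro powr_mono2) auto
    thus ?case using elim Q by (auto simp: nl_nonneg_eq intro!: mult_mono)
  qed
qed

lemma nl_Hsp: assumes "bstate M u" shows "nl u \<in> Hsp"
proof (rule L2_dominated[OF const_Hsp[of "Q * M powr \<alpha>"]])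
  show "nl u \<in> borel_measurable (lebesgue_on \<Omega>)" using assms by (intro nl_measurable) (simp add: bstate_def)
  show "AE x in lebesgue_on \<Omega>. \<bar>nl u x\<bar> \<le> \<bar>Q * M powr \<alpha>\<bar>"
    using nl_bounds[OF assms] by eventually_elim auto
qed

lemma nl_mono:
  assumes "bstate M u" "bstate M v" "AE x in lebesgue_on \<Omega>. u x \<le> v x"
  shows "AE x in lebesgue_on \<Omega>. nl u x \<le> nl v x"
proof -
  have "AE x in lebesgue_on \<Omega>. 0 \<le> u x \<and> u x \<le> M" using assms by (simp add: bstate_def)
  thus ?thesis using assms(3) q_nonneg
    by eventually_elim (use alpha in \<open>auto simp: nl_nonneg_eq intro!: mult_left_mono powr_mono2\<close>)
qed

text \<open>
  The integral is the measure of \<open>\<Omega>\<close>.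
\<close>
definition holder_const :: real where "holder_const = Q\<^sup>2 * (ip (\<lambda>x. 1) (\<lambda>x. 1) + 1)"

lemma holder_const: "0 \<le> holder_const" unfolding holder_const_def using L.nonneg[OF const_Hsp[of 1]] by (intro mult_nonneg_nonneg) auto

text \<open>
  The reaction is not Lipschitz at \<open>0\<close>, but Hoelder continuous with the same exponent \<open>\<alpha>\<close> in
  \<open>L\<^sup>2\<close>; this follows by integration of \<open>powr_le_young\<close> with \<open>\<delta>\<^sup>2 = ip (u - v) (u - v)\<close>.
\<close>
lemma nl_holder:
  assumes u: "bstate M u" and v: "bstate M v"
  shows "ip (nl u - nl v) (nl u - nl v) \<le> holder_const * ip (u - v) (u - v) powr \<alpha>"
proof -
  have H: "u \<in> Hsp" "v \<in> Hsp" using u v by (auto simp: bstate_def)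
  have nH: "nl u \<in> Hsp" "nl v \<in> Hsp" using nl_Hsp u v by auto
  have ae: "AE x in lebesgue_on \<Omega>. \<bar>nl u x - nl v x\<bar> \<le> Q * \<bar>u x - v x\<bar> powr \<alpha>"
  proof -
    have "AE x in lebesgue_on \<Omega>. 0 \<le> u x \<and> u x \<le> M" "AE x in lebesgue_on \<Omega>. 0 \<le> v x \<and> v x \<le> M"
      using u v by (auto simp: bstate_def)
    thus ?thesis using q_nonneg q_le
    proof eventually_elim
      case (elim x)
      have "\<bar>nl u x - nl v x\<bar> = q x * \<bar>u x powr \<alpha> - v x powr \<alpha>\<bar>"
        using elim by (simp add: nl_nonneg_eq abs_mult flip: right_diff_distrib)
      also have "\<dots> \<le> Q * \<bar>u x - v x\<bar> powr \<alpha>"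
        using elim alpha by (intro mult_mono powr_holder) auto
      finally show ?case .
    qed
  qed
  define m where "m = ip (u - v) (u - v)"
  have m0: "0 \<le> m" unfolding m_def by (rule L.nonneg[OF L.S_diff[OF H]])
  show ?thesis
  proof (cases "m = 0")
    case True
    have "AE x in lebesgue_on \<Omega>. (u - v) x = 0" by (rule L2_null_AE[OF L.S_diff[OF H]]) (use True m_def in simp)
    hence "AE x in lebesgue_on \<Omega>. (nl u - nl v) x * (nl u - nl v) x = 0"
      by eventually_elim (simp add: nl_def)
    hence "ip (nl u - nl v) (nl u - nl v) = 0" by (rule integral_eq_zero_AE)
    thus ?thesis using holder_const by simp
  next
    case False
    hence m: "0 < m" using m0 by simp
    define \<delta> where "\<delta> = sqrt m"
    have d: "0 < \<delta>" "\<delta>\<^sup>2 = m" using m by (auto simp: \<delta>_def)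
    have i1: "integrable (lebesgue_on \<Omega>) (\<lambda>x. (u - v) x * (u - v) x)" by (intro L2_integrable_mult L.S_diff H)
    have i2: "integrable (lebesgue_on \<Omega>) (\<lambda>x. 1 * (1::real))" by (intro L2_integrable_mult const_Hsp)
    have "ip (nl u - nl v) (nl u - nl v) \<le> (LINT x|lebesgue_on \<Omega>. Q\<^sup>2 * (m powr \<alpha> * (1 * 1) + m powr (\<alpha> - 1) * ((u - v) x * (u - v) x)))"
    proof (rule integral_mono_AE)
      show "integrable (lebesgue_on \<Omega>) (\<lambda>x. (nl u - nl v) x * (nl u - nl v) x)"
        by (intro L2_integrable_mult L.S_diff nH)
      show "integrable (lebesgue_on \<Omega>) (\<lambda>x. Q\<^sup>2 * (m powr \<alpha> * (1 * 1) + m powr (\<alpha> - 1) * ((u - v) x * (u - v) x)))"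
        by (intro integrable_mult_right Bochner_Integration.integrable_add i1 i2)
      show "AE x in lebesgue_on \<Omega>. (nl u - nl v) x * (nl u - nl v) x \<le> Q\<^sup>2 * (m powr \<alpha> * (1 * 1) + m powr (\<alpha> - 1) * ((u - v) x * (u - v) x))"
        using ae
      proof eventually_elim
        case (elim x)
        have "(nl u x - nl v x)\<^sup>2 \<le> (Q * \<bar>u x - v x\<bar> powr \<alpha>)\<^sup>2"
          using elim by (metis abs_ge_zero power2_abs power_mono)
        also have "\<dots> = Q\<^sup>2 * (\<bar>u x - v x\<bar> powr \<alpha>)\<^sup>2" by (rule power_mult_distrib)
        also have "\<dots> \<le> Q\<^sup>2 * (m powr \<alpha> + m powr (\<alpha> - 1) * (u x - v x)\<^sup>2)"
          using powr_le_young[OF d(1) alpha(1), of "u x - v x"] alpha unfolding d(2) by (intro mult_left_mono) auto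
        finally show ?case by (simp add: power2_eq_square)
      qed
    qed
    also have "\<dots> = Q\<^sup>2 * (m powr \<alpha> * ip (\<lambda>x. 1) (\<lambda>x. 1) + m powr (\<alpha> - 1) * m)"
    proof -
      have a1: "integrable (lebesgue_on \<Omega>) (\<lambda>x. m powr \<alpha> * (1 * (1::real)))"
        and a2: "integrable (lebesgue_on \<Omega>) (\<lambda>x. m powr (\<alpha> - 1) * ((u - v) x * (u - v) x))"
        by (intro integrable_mult_right i1 i2)+
      show ?thesis
        unfolding integral_mult_right_zero Bochner_Integration.integral_add[OF a1 a2] by (simp only: m_def)
    qed
    also have "m powr (\<alpha> - 1) * m = m powr \<alpha>" using m by (simp add: powr_diff)
    finally show ?thesis by (simp add: holder_const_def m_def algebra_simps)
  qed
qed

text \<open>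
  Paths with values between \<open>0\<close> and \<open>M\<close> that start at \<open>0\<close> and are Hoelder continuous in \<open>L\<^sup>2\<close> with
  exponent \<open>1/2\<close>, the regularity that the Euler scheme yields for bounded forcings.
\<close>
definition state :: "real \<Rightarrow> real \<Rightarrow> (real \<Rightarrow> real ^ 'n \<Rightarrow> real) \<Rightarrow> bool" where
  "state M K u \<longleftrightarrow> 0 \<le> K \<and> (\<forall>t\<in>{0..1}. bstate M (u t)) \<and> ip (u 0) (u 0) = 0 \<and>
     (\<forall>s\<in>{0..1}. \<forall>t\<in>{0..1}. ip (u s - u t) (u s - u t) \<le> K * \<bar>s - t\<bar>)"

text \<open>
  Forcings are defined for all real times; clamping extends a path on \<open>{0..1}\<close> without loss of
  Hoelder continuity.
\<close>
definition forcing :: "(real \<Rightarrow> real ^ 'n \<Rightarrow> real) \<Rightarrow> real \<Rightarrow> real ^ 'n \<Rightarrow> real" where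
  "forcing u t = nl (u (clamp01 t))"

lemma forcing_eq: "t \<in> {0..1} \<Longrightarrow> forcing u t = nl (u t)" by (simp add: forcing_def clamp01)

lemma forcing_admissible:
  assumes u: "state M K u" shows "G.admissible \<alpha> (holder_const * K powr \<alpha>) (forcing u)"
  unfolding G.admissible_def
proof (intro conjI allI)
  have b: "bstate M (u (clamp01 t))" for t using u clamp01(1)[of t] by (auto simp: state_def)
  show "forcing u t \<in> Hsp" for t unfolding forcing_def by (rule nl_Hsp[OF b])
  show "0 \<le> holder_const * K powr \<alpha>" using holder_const by simp
  show "ip (forcing u 0) (forcing u 0) = 0"
  proof -
    have H: "u 0 \<in> Hsp" using u by (auto simp: state_def bstate_def)
    have "AE x in lebesgue_on \<Omega>. u 0 x = 0" by (rule L2_null_AE[OF H]) (use u in \<open>simp add: state_def\<close>)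
    hence "AE x in lebesgue_on \<Omega>. forcing u 0 x * forcing u 0 x = 0"
      by eventually_elim (simp add: forcing_def nl_def clamp01)
    thus ?thesis by (rule integral_eq_zero_AE)
  qed
  fix s t
  have "ip (forcing u s - forcing u t) (forcing u s - forcing u t)
      \<le> holder_const * ip (u (clamp01 s) - u (clamp01 t)) (u (clamp01 s) - u (clamp01 t)) powr \<alpha>"
    unfolding forcing_def by (rule nl_holder[OF b b])
  also have "\<dots> \<le> holder_const * (K * \<bar>s - t\<bar>) powr \<alpha>"
  proof (intro mult_left_mono powr_mono2 holder_const)
    have "ip (u (clamp01 s) - u (clamp01 t)) (u (clamp01 s) - u (clamp01 t)) \<le> K * \<bar>clamp01 s - clamp01 t\<bar>"
      using u clamp01(1)[of s] clamp01(1)[of t] unfolding state_def by blast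
    also have "\<dots> \<le> K * \<bar>s - t\<bar>" using u clamp01(3)[of s t] by (intro mult_left_mono) (auto simp: state_def)
    finally show "ip (u (clamp01 s) - u (clamp01 t)) (u (clamp01 s) - u (clamp01 t)) \<le> K * \<bar>s - t\<bar>" .
    show "0 \<le> ip (u (clamp01 s) - u (clamp01 t)) (u (clamp01 s) - u (clamp01 t))"
      using b[of s] b[of t] unfolding bstate_def by (intro L.nonneg L.S_diff) auto
  qed (use alpha in auto)
  also have "\<dots> = holder_const * K powr \<alpha> * \<bar>s - t\<bar> powr \<alpha>" using u by (simp add: powr_mult state_def)
  finally show "ip (forcing u s - forcing u t) (forcing u s - forcing u t) \<le> holder_const * K powr \<alpha> * \<bar>s - t\<bar> powr \<alpha>" .
qed (use alpha in auto)

definition picard :: "(real \<Rightarrow> real ^ 'n \<Rightarrow> real) \<Rightarrow> real \<Rightarrow> real ^ 'n \<Rightarrow> real" where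
  "picard u = G.sol (forcing u)"

lemma picard_Vsp: "state M K u \<Longrightarrow> t \<in> {0..1} \<Longrightarrow> picard u t \<in> Vsp"
  unfolding picard_def by (rule G.sol_V[OF forcing_admissible])

text \<open>
  The maximum principle bounds the image by the bound of the forcing, and \<open>sol_lipschitz_sq\<close> bounds its
  time increments; the conditions on \<open>M\<close> and \<open>K\<close> say that these bounds are not larger than the original ones.
\<close>
lemma picard_state:
  assumes u: "state M K u" and M: "Q * M powr \<alpha> \<le> M" "0 \<le> M" and K: "holder_const * K powr \<alpha> \<le> K"
  shows "state M K (picard u)"
proof -
  note A = forcing_admissible[OF u]
  have V: "picard u t \<in> Vsp" if "t \<in> {0..1}" for t by (rule picard_Vsp[OF u that])
  have K0: "0 \<le> K" using u by (simp add: state_def)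
  have b: "bstate M (picard u t)" if t: "t \<in> {0..1}" for t
  proof -
    have "AE x in lebesgue_on \<Omega>. 0 \<le> picard u t x \<and> picard u t x \<le> Q * M powr \<alpha>"
      unfolding picard_def
    proof (rule sol_bounds[OF A])
      fix t :: real assume "0 \<le> t" "t \<le> 1"
      hence "bstate M (u t)" using u by (auto simp: state_def)
      thus "AE x in lebesgue_on \<Omega>. 0 \<le> forcing u t x \<and> forcing u t x \<le> Q * M powr \<alpha>"
        using nl_bounds \<open>0 \<le> t\<close> \<open>t \<le> 1\<close> by (simp add: forcing_eq)
    qed (use t Q in auto)
    hence "AE x in lebesgue_on \<Omega>. 0 \<le> picard u t x \<and> picard u t x \<le> M"
      by eventually_elim (use M in auto)
    thus ?thesis using Vsp_Hsp[OF V[OF t]] by (simp add: bstate_def)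
  qed
  have lip: "ip (picard u t - picard u s) (picard u t - picard u s) \<le> K * (t - s)" if "0 \<le> s" "s \<le> t" "t \<le> 1" for s t
    unfolding picard_def
    by (rule G.sol_lipschitz_sq[OF A _ that]) (use G.admissible_bound[OF A] K in \<open>auto intro: order.trans\<close>)
  have lip2: "ip (picard u s - picard u t) (picard u s - picard u t) \<le> K * \<bar>s - t\<bar>" if "s \<in> {0..1}" "t \<in> {0..1}" for s t
  proof (cases "s \<le> t")
    case True
    have "ip (picard u s - picard u t) (picard u s - picard u t) = ip (picard u t - picard u s) (picard u t - picard u s)"
      by (simp add: power2_commute flip: power2_eq_square)
    thus ?thesis using lip[of s t] True that by simp
  next
    case False
    thus ?thesis using lip[of t s] that by simp
  qed
  have "0 \<in> {0..1::real}" by simp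
  have "energy s (picard u 0) (picard u 0) = 0" unfolding picard_def by (rule G.sol_zero[OF A])
  hence "ip (picard u 0) (picard u 0) \<le> 0" using poincare_const(2)[OF V[of 0]] by simp
  moreover have "0 \<le> ip (picard u 0) (picard u 0)" by simp
  ultimately have "ip (picard u 0) (picard u 0) = 0" by linarith
  thus ?thesis using b lip2 K0 unfolding state_def by blast
qed

lemma picard_mono:
  assumes u: "state M K u" and v: "state M K v" and t: "t \<in> {0..1}"
    and le: "\<And>t. t \<in> {0..1} \<Longrightarrow> AE x in lebesgue_on \<Omega>. u t x \<le> v t x"
  shows "AE x in lebesgue_on \<Omega>. picard u t x \<le> picard v t x"
  unfolding picard_def
proof (rule sol_mono[OF forcing_admissible[OF u] forcing_admissible[OF v]])
  fix r :: real assume r: "0 \<le> r" "r \<le> 1"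
  have "bstate M (u r)" "bstate M (v r)" using u v r by (auto simp: state_def)
  from nl_mono[OF this le] r show "AE x in lebesgue_on \<Omega>. forcing u r x \<le> forcing v r x"
    by (simp add: forcing_eq)
qed (use t in auto)

text \<open>
  Closeness in \<open>L\<^sup>2\<close> uniformly in time is turned into closeness in the energy norm.
\<close>
lemma picard_stable:
  assumes u: "state M K u" and v: "state M K v" and t: "t \<in> {0..1}"
    and B: "\<And>t. t \<in> {0..1} \<Longrightarrow> ip (u t - v t) (u t - v t) \<le> B"
  shows "energy s (picard u t - picard v t) (picard u t - picard v t) \<le> holder_const * B powr \<alpha>"
  unfolding picard_def
proof (rule G.sol_stable[OF forcing_admissible[OF u] forcing_admissible[OF v]])
  fix r :: real assume r: "0 \<le> r" "r \<le> 1"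
  have b: "bstate M (u r)" "bstate M (v r)" using u v r by (auto simp: state_def)
  have "ip (nl (u r) - nl (v r)) (nl (u r) - nl (v r)) \<le> holder_const * ip (u r - v r) (u r - v r) powr \<alpha>"
    by (rule nl_holder[OF b])
  also have "\<dots> \<le> holder_const * B powr \<alpha>"
    using B[of r] r holder_const alpha b unfolding bstate_def by (intro mult_left_mono powr_mono2 L.nonneg L.S_diff) auto
  finally show "ip (forcing u r - forcing v r) (forcing u r - forcing v r) \<le> holder_const * B powr \<alpha>"
    using r by (simp add: forcing_eq)
qed (use t in auto)

end

section \<open>A separated subsolution\<close>

context frac_problem
begin

text \<open>
  With \<open>\<beta> - 1 = \<alpha> * \<beta>\<close> the time increment, the energy and the reaction of \<open>w\<close> all carry the factor
  \<open>T = t powr (\<alpha> * \<beta>)\<close> (for the energy because \<open>t \<le> 1\<close>), and the condition on \<open>c\<close> compares their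
  coefficients.  The convex function \<open>t powr \<beta>\<close> grows over a step by at most \<open>h\<close> times its derivative at the
  end of the step, so the inequality holds for the scheme exactly and not only in the limit.
\<close>
lemma subsolution_rothe:
  assumes phi: "\<phi> \<in> Vsp" "\<And>x. 0 \<le> \<phi> x \<and> \<phi> x \<le> 1" and C: "0 \<le> C"
    and off: "AE x in lebesgue. x \<notin> O' \<longrightarrow> \<phi> x = 0"
    and en: "\<And>v B. v \<in> Vsp \<Longrightarrow> (\<And>x. 0 \<le> v x) \<Longrightarrow> AE x in lebesgue. v x \<le> B \<Longrightarrow>
        energy s \<phi> v \<le> C * ip (\<lambda>x. \<phi> x powr \<alpha>) v"
    and q0: "0 < q0" "AE x in lebesgue. x \<in> O' \<longrightarrow> q0 \<le> q x" and O: "O' \<subseteq> \<Omega>"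
    and \<beta>: "\<beta> = 1 / (1 - \<alpha>)" and c: "0 < c" "c * (\<beta> + C) \<le> q0 * c powr \<alpha>"
    and w: "\<And>t. w t = (\<lambda>x. (c * t powr \<beta>) * \<phi> x)"
    and f: "\<And>t. f t \<in> Hsp" "\<And>t. t \<in> {0..1} \<Longrightarrow> f t = nl (w t)"
    and h: "0 < h" and N: "real N * h \<le> 1"
  shows "AE x in lebesgue_on \<Omega>. w (real N * h) x \<le> G.rothe h f N x"
proof -
  have b1: "1 \<le> \<beta>" using alpha by (simp add: \<beta> field_simps)
  have ba: "\<beta> - 1 = \<alpha> * \<beta>" using alpha by (simp add: \<beta> field_simps)
  have phim [measurable]: "\<phi> \<in> borel_measurable lebesgue" using VspD[OF phi(1)] by auto
  define \<psi> where "\<psi> = (\<lambda>x. \<phi> x powr \<alpha>)"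
  have psiH: "\<psi> \<in> Hsp" unfolding \<psi>_def
    by (rule L2_dominated[OF const_Hsp[of 1]])
       (use phi(2) alpha in \<open>auto intro!: measurable_restrict_space1 simp: powr_le1\<close>)
  have wV: "w t \<in> Vsp" for t using En.S_scale[OF phi(1), of "c * t powr \<beta>"] by (simp add: w scaleR_fun_def)
  have w0: "0 \<le> w t x" for t x using c phi(2)[of x] by (simp add: w)
  have w1: "w t x \<le> c" if "0 \<le> t" "t \<le> 1" for t x
  proof -
    have "t powr \<beta> \<le> 1" using that b1 by (intro powr_le1) auto
    hence "(c * t powr \<beta>) * \<phi> x \<le> (c * 1) * 1" using c phi(2)[of x] by (intro mult_mono) auto
    thus ?thesis by (simp add: w)
  qed
  have wbs: "bstate c (w t)" if "0 \<le> t" "t \<le> 1" for t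
    unfolding bstate_def using Vsp_Hsp[OF wV] w0 w1[OF that] by auto
  show ?thesis
  proof (rule rothe_comparison[of h f "\<lambda>k. w (real k * h)" N N, OF h f(1) wV])
    show "AE x in lebesgue_on \<Omega>. w (real 0 * h) x \<le> 0" by (simp add: w)
  next
    fix k v assume k: "k < N" and v: "v \<in> Vsp" and v0: "\<And>x. 0 \<le> v x"
      and vle: "\<And>x. v x \<le> max (w (real (Suc k) * h) x - G.rothe h f (Suc k) x) 0"
    define t where "t = real (Suc k) * h"
    define r where "r = real k * h"
    have t: "0 \<le> t" "t \<le> 1" unfolding t_def by (rule grid_point_bounds[OF k N h])+
    have tr: "0 \<le> r" "r \<le> t" "t - r = h" using h by (auto simp: t_def r_def algebra_simps)
    have t0: "0 < t" unfolding t_def using h by (intro mult_pos_pos) auto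
    have vH: "v \<in> Hsp" by (rule Vsp_Hsp[OF v])
    have "AE x in lebesgue_on \<Omega>. 0 \<le> G.rothe h f (Suc k) x"
    proof (rule rothe_nonneg[of h f, OF h f(1)])
      fix t :: real assume t: "0 \<le> t" "t \<le> 1"
      show "AE x in lebesgue_on \<Omega>. 0 \<le> f t x"
        using nl_bounds[OF wbs[OF t]] t f(2)[of t] by (auto elim!: eventually_mono)
    qed (use t in \<open>simp add: t_def\<close>)
    hence "AE x in lebesgue. x \<in> \<Omega> \<longrightarrow> v x \<le> c"
      unfolding AE_dom
    proof eventually_elim
      case (elim x)
      show ?case using vle[of x] elim w1[OF t, of x] c unfolding t_def by auto
    qed
    hence vB: "AE x in lebesgue. v x \<le> c" using VspD(3)[OF v] by eventually_elim (use c in auto)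
    define I where "I = ip \<psi> v"
    have I0: "0 \<le> I" unfolding I_def using v0 by (auto simp: \<psi>_def)
    have phipsi: "ip \<phi> v \<le> I" unfolding I_def
    proof (rule ip_mono_AE[OF Vsp_Hsp[OF phi(1)] vH psiH vH])
      have "\<phi> x \<le> \<psi> x" for x unfolding \<psi>_def
        using phi(2)[of x] alpha powr_mono'[of \<alpha> 1 "\<phi> x"] by (cases "\<phi> x = 0") auto
      thus "AE x in lebesgue_on \<Omega>. \<phi> x * v x \<le> \<psi> x * v x" using v0 by (auto intro!: mult_right_mono)
    qed
    have phi0: "0 \<le> ip \<phi> v" using v0 phi(2) by simp
    define T where "T = t powr (\<alpha> * \<beta>)"
    have T0: "0 \<le> T" by (simp add: T_def)
    have e1: "ip (w t - w r) v \<le> h * (c * \<beta> * T * I)"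
    proof -
      have "ip (w t - w r) v = c * (t powr \<beta> - r powr \<beta>) * ip \<phi> v"
      proof -
        have eq: "(w t - w r) x * v x = c * (t powr \<beta> - r powr \<beta>) * (\<phi> x * v x)" for x
          by (simp add: w algebra_simps)
        show ?thesis by (simp only: eq integral_mult_right_zero)
      qed
      also have "\<dots> \<le> c * (\<beta> * T * h) * I"
      proof (rule mult_mono)
        have "t powr \<beta> - r powr \<beta> \<le> \<beta> * t powr (\<beta> - 1) * (t - r)" by (rule powr_diff_tangent) (use tr b1 in auto)
        thus "c * (t powr \<beta> - r powr \<beta>) \<le> c * (\<beta> * T * h)" using c tr ba by (simp add: T_def)
        show "0 \<le> c * (\<beta> * T * h)" using c b1 T0 h by simp
      qed (use phipsi phi0 in auto)
      finally show ?thesis by (simp add: mult_ac)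
    qed
    have e2: "h * energy s (w t) v \<le> h * (c * C * T * I)"
    proof -
      have "energy s (w t) v = (c * t powr \<beta>) * energy s \<phi> v"
        using En.scale_left[OF phi(1) v, of "c * t powr \<beta>"] by (simp add: w scaleR_fun_def)
      also have "\<dots> \<le> (c * t powr \<beta>) * (C * I)"
        unfolding I_def \<psi>_def using c by (intro mult_left_mono en[OF v v0 vB]) auto
      also have "\<dots> \<le> (c * T) * (C * I)"
      proof (rule mult_right_mono)
        have "t powr \<beta> \<le> t powr (\<alpha> * \<beta>)" using t0 t alpha b1 by (intro powr_mono') (auto simp: mult_le_cancel_right2)
        thus "c * t powr \<beta> \<le> c * T" using c by (simp add: T_def)
      qed (use C I0 in auto)
      finally show ?thesis using h by (simp add: mult_ac)
    qed
    have e3: "h * (q0 * c powr \<alpha> * T * I) \<le> h * ip (f t) v"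
    proof -
      have fe: "f t = nl (w t)" using t by (intro f(2)) auto
      have "AE x in lebesgue_on \<Omega>. ((q0 * c powr \<alpha> * T) *\<^sub>R \<psi>) x * v x \<le> f t x * v x"
      proof -
        have "AE x in lebesgue. x \<in> \<Omega> \<longrightarrow> 0 \<le> q x" using q_nonneg by (simp add: AE_dom)
        hence "AE x in lebesgue. x \<in> \<Omega> \<longrightarrow> ((q0 * c powr \<alpha> * T) *\<^sub>R \<psi>) x * v x \<le> f t x * v x"
          using q0(2) off
        proof eventually_elim
          case (elim x)
          show ?case
          proof
            assume x: "x \<in> \<Omega>"
            have nw: "nl (w t) x = q x * (c powr \<alpha> * T * \<psi> x)"
              using w0[of t x] c phi(2)[of x]
              by (simp add: nl_nonneg_eq w powr_mult powr_powr T_def \<psi>_def mult.commute)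
            have "q0 * (c powr \<alpha> * T * \<psi> x) \<le> q x * (c powr \<alpha> * T * \<psi> x)"
            proof (cases "x \<in> O'")
              case True
              thus ?thesis using elim T0 by (intro mult_right_mono) (auto simp: \<psi>_def)
            next
              case False
              thus ?thesis using elim alpha by (simp add: \<psi>_def)
            qed
            hence "q0 * (c powr \<alpha> * T * \<psi> x) * v x \<le> f t x * v x"
              unfolding fe nw using v0[of x] by (rule mult_right_mono)
            thus "((q0 * c powr \<alpha> * T) *\<^sub>R \<psi>) x * v x \<le> f t x * v x" by (simp add: mult.assoc)
          qed
        qed
        thus ?thesis by (simp add: AE_dom)
      qed
      from ip_mono_AE[OF L.S_scale[OF psiH] vH f(1) vH this]
      have "(q0 * c powr \<alpha> * T) * I \<le> ip (f t) v"
        using L.scale_left[OF psiH vH, of "q0 * c powr \<alpha> * T"] by (simp only: I_def)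
      thus ?thesis using h by simp
    qed
    have "c * \<beta> * T * I + c * C * T * I = (c * (\<beta> + C)) * (T * I)" by (simp add: algebra_simps)
    also have "\<dots> \<le> (q0 * c powr \<alpha>) * (T * I)" using c(2) T0 I0 by (intro mult_right_mono) auto
    finally have "h * (c * \<beta> * T * I) + h * (c * C * T * I) \<le> h * (q0 * c powr \<alpha> * T * I)"
      using h by (simp add: mult.assoc flip: distrib_left)
    thus "ip (w (real (Suc k) * h) - w (real k * h)) v + h * energy s (w (real (Suc k) * h)) v
       \<le> h * ip (f (real (Suc k) * h)) v"
      using e1 e2 e3 unfolding t_def r_def by linarith
  qed simp
qed

lemma subsolution_state:
  assumes phi: "\<phi> \<in> Vsp" "\<And>x. 0 \<le> \<phi> x \<and> \<phi> x \<le> 1" and \<beta>: "1 \<le> \<beta>" and c: "0 < c" "c \<le> M"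
    and K: "c\<^sup>2 * \<beta>\<^sup>2 * ip \<phi> \<phi> \<le> K"
    and w: "\<And>t. w t = (\<lambda>x. (c * t powr \<beta>) * \<phi> x)"
  shows "state M K w"
proof -
  have wV: "w t \<in> Vsp" for t using En.S_scale[OF phi(1), of "c * t powr \<beta>"] by (simp add: w scaleR_fun_def)
  have pp: "0 \<le> ip \<phi> \<phi>" by simp
  have K0: "0 \<le> K" using K pp by (intro order.trans[OF _ K]) auto
  have bs: "bstate M (w t)" if t: "t \<in> {0..1}" for t
  proof -
    have "t powr \<beta> \<le> 1" using t \<beta> by (intro powr_le1) auto
    hence wc: "(c * t powr \<beta>) * \<phi> x \<le> (c * 1) * 1" for x using c phi(2)[of x] by (intro mult_mono) auto
    have "w t x \<le> M" for x unfolding w using wc[of x] c by linarith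
    moreover have "0 \<le> w t x" for x using c phi(2)[of x] by (simp add: w)
    ultimately show ?thesis unfolding bstate_def using Vsp_Hsp[OF wV] by auto
  qed
  have lip: "ip (w r - w t) (w r - w t) \<le> K * \<bar>r - t\<bar>" if "r \<in> {0..1}" "t \<in> {0..1}" for r t
  proof -
    define d where "d = c * (r powr \<beta> - t powr \<beta>)"
    have main: "\<bar>x powr \<beta> - y powr \<beta>\<bar> \<le> \<beta> * \<bar>x - y\<bar>" if "x \<in> {0..1}" "y \<in> {0..1}" "x \<le> y" for x y
    proof -
      have "x powr \<beta> \<le> y powr \<beta>" using that \<beta> by (intro powr_mono2) auto
      moreover have "y powr \<beta> - x powr \<beta> \<le> \<beta> * y powr (\<beta> - 1) * (y - x)" using that \<beta> by (intro powr_diff_tangent) auto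
      moreover have "\<beta> * y powr (\<beta> - 1) * (y - x) \<le> \<beta> * 1 * (y - x)"
        using that \<beta> by (intro mult_right_mono mult_left_mono powr_le1) auto
      ultimately show ?thesis using that by simp
    qed
    have "\<bar>r powr \<beta> - t powr \<beta>\<bar> \<le> \<beta> * \<bar>r - t\<bar>"
      using main[of r t] main[of t r] that by (cases "r \<le> t") (auto simp: abs_minus_commute)
    hence "\<bar>d\<bar> \<le> c * (\<beta> * \<bar>r - t\<bar>)" using c by (simp add: d_def abs_mult)
    hence "\<bar>d\<bar>\<^sup>2 \<le> (c * (\<beta> * \<bar>r - t\<bar>))\<^sup>2" by (intro power_mono) auto
    hence d2: "d\<^sup>2 \<le> c\<^sup>2 * \<beta>\<^sup>2 * \<bar>r - t\<bar>\<^sup>2" by (simp add: power_mult_distrib)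
    have "(w r - w t) x * (w r - w t) x = d\<^sup>2 * (\<phi> x * \<phi> x)" for x
      by (simp add: w d_def algebra_simps power2_eq_square)
    hence "ip (w r - w t) (w r - w t) = d\<^sup>2 * ip \<phi> \<phi>" by (simp del: minus_apply)
    also have "\<dots> \<le> (c\<^sup>2 * \<beta>\<^sup>2 * \<bar>r - t\<bar>\<^sup>2) * ip \<phi> \<phi>" by (rule mult_right_mono[OF d2 pp])
    also have "\<dots> = (c\<^sup>2 * \<beta>\<^sup>2 * ip \<phi> \<phi>) * \<bar>r - t\<bar>\<^sup>2" by simp
    also have "\<dots> \<le> K * \<bar>r - t\<bar>"
    proof (rule mult_mono[OF K])
      have "\<bar>r - t\<bar> * \<bar>r - t\<bar> \<le> \<bar>r - t\<bar> * 1" using that by (intro mult_left_mono) auto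
      thus "\<bar>r - t\<bar>\<^sup>2 \<le> \<bar>r - t\<bar>" by (simp add: power2_eq_square)
    qed (use K0 in auto)
    finally show ?thesis .
  qed
  have "ip (w 0) (w 0) = 0" by (simp add: w)
  thus ?thesis unfolding state_def using K0 bs lip by blast
qed

text \<open>
  The comparison of \<open>subsolution_rothe\<close> at the dyadic grid points passes to the limit.
\<close>
lemma subsolution_picard:
  assumes phi: "\<phi> \<in> Vsp" "\<And>x. 0 \<le> \<phi> x \<and> \<phi> x \<le> 1" and C: "0 \<le> C"
    and off: "AE x in lebesgue. x \<notin> O' \<longrightarrow> \<phi> x = 0"
    and en: "\<And>v B. v \<in> Vsp \<Longrightarrow> (\<And>x. 0 \<le> v x) \<Longrightarrow> AE x in lebesgue. v x \<le> B \<Longrightarrow>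
        energy s \<phi> v \<le> C * ip (\<lambda>x. \<phi> x powr \<alpha>) v"
    and q0: "0 < q0" "AE x in lebesgue. x \<in> O' \<longrightarrow> q0 \<le> q x" and O: "O' \<subseteq> \<Omega>"
    and \<beta>: "\<beta> = 1 / (1 - \<alpha>)" and c: "0 < c" "c * (\<beta> + C) \<le> q0 * c powr \<alpha>"
    and w: "\<And>t. w t = (\<lambda>x. (c * t powr \<beta>) * \<phi> x)"
    and st: "state M K w" and t: "t \<in> {0..1}"
  shows "AE x in lebesgue_on \<Omega>. w t x \<le> picard w t x"
  unfolding picard_def
proof (rule nonneg_limit_appr[where X="\<lambda>n. w (real (nat \<lfloor>t * 2 ^ n\<rfloor>) * (1/2) ^ n)" and L="w t", OF _ _ _ forcing_admissible[OF st]])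
  have b1: "1 \<le> \<beta>" using alpha by (simp add: \<beta> field_simps)
  have wV: "w t \<in> Hsp" for t using En.S_scale[OF phi(1), of "c * t powr \<beta>"] by (intro Vsp_Hsp) (simp add: w scaleR_fun_def)
  show "w (real (nat \<lfloor>t * 2 ^ n\<rfloor>) * (1/2) ^ n) \<in> Hsp" "w t \<in> Hsp" for n by (rule wV)+
  show "0 \<le> t" "t \<le> 1" using t by auto
  have gr: "real (nat \<lfloor>t * 2 ^ n\<rfloor>) * (1/2) ^ n \<le> 1" for n by (rule G.grid_le_one) (use t in simp)
  show "AE x in lebesgue_on \<Omega>. w (real (nat \<lfloor>t * 2 ^ n\<rfloor>) * (1/2) ^ n) x \<le> G.appr (forcing w) n t x" for n
    unfolding G.appr_def
    by (rule subsolution_rothe[OF phi C off en q0 O \<beta> c w _ _ _ gr])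
       (use G.admissibleD(3)[OF forcing_admissible[OF st]] forcing_eq in auto)
  show "(\<lambda>n. L.nrm (w (real (nat \<lfloor>t * 2 ^ n\<rfloor>) * (1/2) ^ n) - w t)) \<longlonglongrightarrow> 0"
  proof -
    define g where "g n = real (nat \<lfloor>t * 2 ^ n\<rfloor>) * (1/2) ^ n" for n
    have gl: "g \<longlonglongrightarrow> t" unfolding g_def using t by (intro grid_tendsto) simp
    have g01: "g n \<in> {0..1}" for n using gr[of n] by (simp add: g_def)
    have "(\<lambda>n. sqrt (K * \<bar>g n - t\<bar>)) \<longlonglongrightarrow> sqrt (K * \<bar>t - t\<bar>)" by (intro tendsto_intros gl)
    hence l0: "(\<lambda>n. sqrt (K * \<bar>g n - t\<bar>)) \<longlonglongrightarrow> 0" by simp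
    have le: "L.nrm (w (g n) - w t) \<le> sqrt (K * \<bar>g n - t\<bar>)" for n
      unfolding L.nrm_def using st g01[of n] t by (intro real_sqrt_le_mono) (simp add: state_def)
    have "(\<lambda>n. L.nrm (w (g n) - w t)) \<longlonglongrightarrow> 0"
    proof (rule Lim_null_comparison[OF _ l0], rule always_eventually, rule allI)
      fix n
      have "0 \<le> L.nrm (w (g n) - w t)" by (rule L.nrm_nonneg[OF L.S_diff[OF wV wV]])
      thus "norm (L.nrm (w (g n) - w t)) \<le> sqrt (K * \<bar>g n - t\<bar>)"
        unfolding real_norm_def using le[of n] by linarith
    qed
    thus ?thesis by (simp only: g_def)
  qed
qed

end

section \<open>Convergence of the monotone iteration\<close>

context frac_domain
begin

lemma L2_limit_ge:
  fixes X :: "nat \<Rightarrow> real ^ 'n \<Rightarrow> real"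
  assumes X: "\<And>n. X n \<in> Hsp" and L: "L \<in> Hsp" and lim: "(\<lambda>n. L.nrm (X n - L)) \<longlonglongrightarrow> 0"
    and l: "l \<in> Hsp" and le: "\<And>n. AE x in lebesgue_on \<Omega>. l x \<le> X n x"
  shows "AE x in lebesgue_on \<Omega>. l x \<le> L x"
proof -
  have "AE x in lebesgue_on \<Omega>. 0 \<le> (L - l) x"
  proof (rule L2_limit_nonneg[where X="\<lambda>n. X n - l" and L="L - l"])
    have "X n - l - (L - l) = X n - L" for n by simp
    thus "(\<lambda>n. L.nrm (X n - l - (L - l))) \<longlonglongrightarrow> 0" using lim by (simp only:)
    show "AE x in lebesgue_on \<Omega>. 0 \<le> (X n - l) x" for n using le[of n] by simp
  qed (use X L l in auto)
  thus ?thesis by simp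
qed

lemma L2_limit_le:
  fixes X :: "nat \<Rightarrow> real ^ 'n \<Rightarrow> real"
  assumes X: "\<And>n. X n \<in> Hsp" and L: "L \<in> Hsp" and lim: "(\<lambda>n. L.nrm (X n - L)) \<longlonglongrightarrow> 0"
    and l: "l \<in> Hsp" and le: "\<And>n. AE x in lebesgue_on \<Omega>. X n x \<le> l x"
  shows "AE x in lebesgue_on \<Omega>. L x \<le> l x"
proof -
  have "AE x in lebesgue_on \<Omega>. (- l) x \<le> (- L) x"
  proof (rule L2_limit_ge[where X="\<lambda>n. - X n" and L="- L" and l="- l"])
    have "L.nrm (- X n - (- L)) = L.nrm (X n - L)" for n
    proof -
      have eq: "- X n - (- L) = L - X n" by simp
      show ?thesis unfolding eq by (rule L.nrm_diff_commute) (use X L in auto)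
    qed
    thus "(\<lambda>n. L.nrm (- X n - (- L))) \<longlonglongrightarrow> 0" using lim by (simp only:)
    show "AE x in lebesgue_on \<Omega>. (- l) x \<le> (- X n) x" for n using le[of n] by simp
  qed (use X L l in auto)
  thus ?thesis by simp
qed

end

context frac_problem
begin

lemma small_powr: assumes "0 < \<epsilon>" shows "\<exists>B>0. holder_const * B powr \<alpha> < \<epsilon>"
proof -
  define B where "B = (\<epsilon> / (2 * (holder_const + 1))) powr (1 / \<alpha>)"
  have p: "0 < \<epsilon> / (2 * (holder_const + 1))" using assms holder_const by simp
  have "(d powr (1 / \<alpha>)) powr \<alpha> = d" if "0 < d" for d :: real
  proof -
    have "(d powr (1 / \<alpha>)) powr \<alpha> = d powr (1 / \<alpha> * \<alpha>)" by (rule powr_powr)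
    also have "1 / \<alpha> * \<alpha> = 1" using alpha by simp
    finally show ?thesis using that by simp
  qed
  hence "B powr \<alpha> = \<epsilon> / (2 * (holder_const + 1))" unfolding B_def using p by blast
  hence "holder_const * B powr \<alpha> = (holder_const / (holder_const + 1)) * (\<epsilon> / 2)" by simp
  also have "\<dots> \<le> 1 * (\<epsilon> / 2)" using holder_const assms by (intro mult_right_mono) (auto simp: field_simps)
  also have "\<dots> < \<epsilon>" using assms by simp
  finally have "holder_const * B powr \<alpha> < \<epsilon>" .
  moreover have "0 < B" unfolding B_def using p by (metis powr_gt_zero less_irrefl)
  ultimately show ?thesis by blast
qed

lemma stateD:
  assumes "state M K u"
  shows "0 \<le> K" "t \<in> {0..1} \<Longrightarrow> bstate M (u t)" "t \<in> {0..1} \<Longrightarrow> u t \<in> Hsp" "ip (u 0) (u 0) = 0"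
    "\<lbrakk>r \<in> {0..1}; t \<in> {0..1}\<rbrakk> \<Longrightarrow> ip (u r - u t) (u r - u t) \<le> K * \<bar>r - t\<bar>"
  using assms unfolding state_def bstate_def by blast+

lemma state_nrm:
  assumes "state M K u" "r \<in> {0..1}" "t \<in> {0..1}" "\<bar>r - t\<bar> \<le> d"
  shows "L.nrm (u r - u t) \<le> sqrt (K * d)"
  unfolding L.nrm_def
  by (intro real_sqrt_le_mono order.trans[OF stateD(5)[OF assms(1-3)]] mult_left_mono assms(4) stateD(1)[OF assms(1)])

text \<open>
  For \<open>0 \<le> X n \<le> X m \<le> M\<close> the square \<open>(X m - X n)\<^sup>2\<close> is at most \<open>M * (X m - X n)\<close>, and the integrals of
  the \<open>X n\<close> form a bounded increasing sequence of real numbers.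
\<close>
lemma monotone_bounded_cauchy:
  assumes X: "\<And>n. bstate M (X n)" and mono: "\<And>n. AE x in lebesgue_on \<Omega>. X n x \<le> X (Suc n) x"
    and e: "0 < \<epsilon>"
  shows "\<exists>N. \<forall>m\<ge>N. \<forall>n\<ge>N. L.nrm (X m - X n) \<le> \<epsilon>"
proof -
  have H: "X n \<in> Hsp" for n using X by (simp add: bstate_def)
  have b: "AE x in lebesgue_on \<Omega>. 0 \<le> X n x \<and> X n x \<le> M" for n using X by (simp add: bstate_def)
  have le: "AE x in lebesgue_on \<Omega>. X n x \<le> X (n + k) x" for n k
  proof (induction k)
    case (Suc k)
    show ?case using Suc mono[of "n + k"] by eventually_elim simp
  qed simp
  define a where "a n = ip (\<lambda>x. 1) (X n)" for n
  have amono: "a n \<le> a (Suc n)" for n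
    unfolding a_def by (rule ip_mono_AE[OF const_Hsp H const_Hsp H]) (use mono[of n] in simp)
  have abound: "a n \<le> ip (\<lambda>x. 1) (\<lambda>x. M)" for n
    unfolding a_def by (rule ip_mono_AE[OF const_Hsp H const_Hsp const_Hsp]) (use b[of n] in \<open>auto elim: eventually_mono\<close>)
  have "convergent a"
  proof (rule Bseq_mono_convergent)
    show "\<forall>m n. m \<le> n \<longrightarrow> a m \<le> a n" using lift_Suc_mono_le[of a] amono by blast
    show "Bseq a"
    proof (rule BseqI')
      fix n
      have "a 0 \<le> a n" using lift_Suc_mono_le[of a 0 n] amono by simp
      thus "norm (a n) \<le> \<bar>a 0\<bar> + \<bar>ip (\<lambda>x. 1) (\<lambda>x. M)\<bar>" using abound[of n] unfolding real_norm_def by linarith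
    qed
  qed
  hence "Cauchy a" by (rule convergent_Cauchy)
  have M0: "0 \<le> \<bar>M\<bar>" by simp
  have p: "0 < \<epsilon>\<^sup>2 / (\<bar>M\<bar> + 1)" using e by simp
  obtain N where N: "\<And>m n. \<lbrakk>N \<le> m; N \<le> n\<rbrakk> \<Longrightarrow> dist (a m) (a n) < \<epsilon>\<^sup>2 / (\<bar>M\<bar> + 1)"
    using \<open>Cauchy a\<close> p unfolding Cauchy_def by blast
  have main: "L.nrm (X m - X n) \<le> \<epsilon>" if mn: "N \<le> n" "n \<le> m" for m n
  proof -
    have "ip (X m - X n) (X m - X n) \<le> ip (\<bar>M\<bar> *\<^sub>R (\<lambda>x. 1)) (X m - X n)"
    proof (rule ip_mono_AE[of "X m - X n" "X m - X n" "\<bar>M\<bar> *\<^sub>R (\<lambda>x. 1)" "X m - X n"])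
      have "AE x in lebesgue_on \<Omega>. X n x \<le> X m x" using le[of n "m - n"] mn by simp
      thus "AE x in lebesgue_on \<Omega>. (X m - X n) x * (X m - X n) x \<le> (\<bar>M\<bar> *\<^sub>R (\<lambda>x. 1)) x * (X m - X n) x"
        using b[of m] b[of n] by eventually_elim (auto intro!: mult_right_mono)
    qed (use H const_Hsp in auto)
    also have "\<dots> = \<bar>M\<bar> * (a m - a n)"
      unfolding a_def using L.scale_left[OF const_Hsp[of 1] L.S_diff[OF H[of m] H[of n]], of "\<bar>M\<bar>"]
        L.diff_right[OF H[of m] H[of n] const_Hsp[of 1]] by (simp only:)
    also have "\<dots> \<le> (\<bar>M\<bar> + 1) * (\<epsilon>\<^sup>2 / (\<bar>M\<bar> + 1))"
    proof (rule mult_mono)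
      have "dist (a m) (a n) < \<epsilon>\<^sup>2 / (\<bar>M\<bar> + 1)" by (rule N) (use mn in auto)
      moreover have "a m - a n \<le> dist (a m) (a n)" by (simp add: dist_real_def)
      ultimately show "a m - a n \<le> \<epsilon>\<^sup>2 / (\<bar>M\<bar> + 1)" by linarith
      show "0 \<le> a m - a n" using lift_Suc_mono_le[of a n m] amono mn by simp
    qed auto
    also have "\<dots> = \<epsilon>\<^sup>2" using M0 by (simp add: add_nonneg_eq_0_iff)
    finally show ?thesis unfolding L.nrm_def using e by (intro real_le_lsqrt) auto
  qed
  have "L.nrm (X m - X n) \<le> \<epsilon>" if "N \<le> n" "N \<le> m" for m n
    using main[of n m] main[of m n] that L.nrm_diff_commute[OF H[of m] H[of n]] by (cases "n \<le> m") auto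
  thus ?thesis by blast
qed

text \<open>
  Equicontinuity in time reduces uniform convergence to convergence at finitely many grid points.
\<close>
lemma equi_cauchy:
  fixes U :: "nat \<Rightarrow> real \<Rightarrow> real ^ 'n \<Rightarrow> real"
  assumes U: "\<And>n. state M K (U n)"
    and pc: "\<And>t \<epsilon>. \<lbrakk>t \<in> {0..1}; 0 < \<epsilon>\<rbrakk> \<Longrightarrow> \<exists>N. \<forall>m\<ge>N. \<forall>n\<ge>N. L.nrm (U m t - U n t) \<le> \<epsilon>"
    and e: "0 < \<epsilon>"
  shows "\<exists>N. \<forall>m\<ge>N. \<forall>n\<ge>N. \<forall>t\<in>{0..1}. L.nrm (U m t - U n t) \<le> \<epsilon>"
proof -
  have K0: "0 \<le> K" by (rule stateD(1)[OF U])
  obtain p :: nat where p: "0 < p" "K / (\<epsilon> / 3)\<^sup>2 \<le> real p"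
  proof -
    obtain p' :: nat where "K / (\<epsilon> / 3)\<^sup>2 \<le> real p'" using real_arch_simple by blast
    thus ?thesis using that[of "Suc p'"] by simp
  qed
  have sq: "sqrt (K * (1 / real p)) \<le> \<epsilon> / 3"
  proof (rule real_le_lsqrt)
    have "K \<le> real p * (\<epsilon> / 3)\<^sup>2" using p e by (simp add: pos_divide_le_eq)
    thus "K * (1 / real p) \<le> (\<epsilon> / 3)\<^sup>2" using p by (simp add: divide_le_eq mult.commute)
  qed (use e in simp)
  have "\<forall>j. \<exists>N. j \<le> p \<longrightarrow> (\<forall>m\<ge>N. \<forall>n\<ge>N. L.nrm (U m (real j / real p) - U n (real j / real p)) \<le> \<epsilon> / 3)"
    using pc[of "real _ / real p" "\<epsilon> / 3"] e p by auto
  from choice[OF this] obtain Nj where Nj: "\<And>j m n. \<lbrakk>j \<le> p; Nj j \<le> m; Nj j \<le> n\<rbrakk> \<Longrightarrow> L.nrm (U m (real j / real p) - U n (real j / real p)) \<le> \<epsilon> / 3"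
    by blast
  define N where "N = (\<Sum>j\<le>p. Nj j)"
  have NN: "Nj j \<le> N" if "j \<le> p" for j unfolding N_def by (rule member_le_sum) (use that in auto)
  have "L.nrm (U m t - U n t) \<le> \<epsilon>" if mn: "N \<le> m" "N \<le> n" and t: "t \<in> {0..1}" for m n t
  proof -
    define j where "j = nat \<lfloor>t * real p\<rfloor>"
    define r where "r = real j / real p"
    have fl: "real j \<le> t * real p" "t * real p < real j + 1" using t p by (auto simp: j_def)
    have "t * real p \<le> 1 * real p" using t by (intro mult_right_mono) auto
    hence jp: "j \<le> p" using fl by linarith
    have r: "r \<in> {0..1}" using jp p by (simp add: r_def)
    have "r \<le> t" using fl p by (simp add: r_def pos_divide_le_eq)
    moreover have "t \<le> (real j + 1) / real p" using fl p by (simp add: pos_le_divide_eq)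
    hence "t - r \<le> 1 / real p" by (simp add: r_def add_divide_distrib)
    ultimately have tr: "\<bar>t - r\<bar> \<le> 1 / real p" "\<bar>r - t\<bar> \<le> 1 / real p" by auto
    have H: "U k t \<in> Hsp" "U k r \<in> Hsp" for k using stateD(3)[OF U] t r by auto
    have "L.nrm (U m t - U n t) \<le> L.nrm (U m t - U m r) + L.nrm (U m r - U n t)"
      by (rule L.nrm_triangle) (use H in auto)
    also have "L.nrm (U m r - U n t) \<le> L.nrm (U m r - U n r) + L.nrm (U n r - U n t)"
      by (rule L.nrm_triangle) (use H in auto)
    also have "L.nrm (U m t - U m r) \<le> sqrt (K * (1 / real p))" by (rule state_nrm[OF U t r tr(1)])
    also have "L.nrm (U n r - U n t) \<le> sqrt (K * (1 / real p))" by (rule state_nrm[OF U r t tr(2)])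
    also have "L.nrm (U m r - U n r) \<le> \<epsilon> / 3"
      unfolding r_def by (rule Nj[OF jp]) (use mn NN[OF jp] in auto)
    finally show ?thesis using sq by linarith
  qed
  thus ?thesis by blast
qed

text \<open>
  The iterates \<open>U n\<close> of the Picard operator increase and share their bounds, so they converge in
  \<open>L\<^sup>2\<close> uniformly in time, and by \<open>picard_stable\<close> also in the energy norm.  Because limits are only
  determined up to null sets, the fixed point equation holds in the form of a vanishing energy distance.
\<close>
lemma monotone_iteration:
  assumes w: "state M K w" and M: "Q * M powr \<alpha> \<le> M" "0 \<le> M" and K: "holder_const * K powr \<alpha> \<le> K"
    and le: "\<And>t. t \<in> {0..1} \<Longrightarrow> AE x in lebesgue_on \<Omega>. w t x \<le> picard w t x"
  shows "\<exists>u. state M K u \<and> (\<forall>t\<in>{0..1}. u t \<in> Vsp \<and> energy s (u t - picard u t) (u t - picard u t) = 0 \<and>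
            (AE x in lebesgue_on \<Omega>. w t x \<le> u t x))"
proof -
  define U where "U n = (picard ^^ n) w" for n
  have U0: "U 0 = w" and US: "U (Suc n) = picard (U n)" for n by (auto simp: U_def)
  have st: "state M K (U n)" for n
    by (induction n) (use w picard_state[OF _ M K] in \<open>auto simp: U0 US\<close>)
  have UV: "U (Suc n) t \<in> Vsp" if "t \<in> {0..1}" for n t unfolding US by (rule picard_Vsp[OF st that])
  have UH: "U n t \<in> Hsp" if "t \<in> {0..1}" for n t using stateD(3)[OF st that] .
  have mono: "AE x in lebesgue_on \<Omega>. U n t x \<le> U (Suc n) t x" if "t \<in> {0..1}" for n t
    using that
  proof (induction n arbitrary: t)
    case 0 thus ?case using le by (simp add: U0 US)
  next
    case (Suc n)
    show ?case unfolding US[of "Suc n"] unfolding US[of n]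
      by (rule picard_mono[OF st st[of "Suc n", unfolded US] Suc.prems]) (use Suc.IH in \<open>simp add: US\<close>)
  qed
  have wle: "AE x in lebesgue_on \<Omega>. w t x \<le> U n t x" if "t \<in> {0..1}" for n t
  proof (induction n)
    case (Suc n) show ?case using Suc mono[OF that, of n] by eventually_elim simp
  qed (simp add: U0)
  have uc: "\<exists>N. \<forall>m\<ge>N. \<forall>n\<ge>N. \<forall>t\<in>{0..1}. L.nrm (U m t - U n t) \<le> \<epsilon>" if "0 < \<epsilon>" for \<epsilon>
  proof (rule equi_cauchy[OF st _ that])
    fix t \<epsilon> :: real assume "t \<in> {0..1}" "0 < \<epsilon>"
    thus "\<exists>N. \<forall>m\<ge>N. \<forall>n\<ge>N. L.nrm (U m t - U n t) \<le> \<epsilon>"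
      using monotone_bounded_cauchy[of M "\<lambda>n. U n t" \<epsilon>] stateD(2)[OF st] mono by blast
  qed
  have "\<exists>L. t \<in> {0..1} \<longrightarrow> L \<in> Vsp \<and> (\<lambda>n. En.nrm (U (Suc n) t - L)) \<longlonglongrightarrow> 0" for t
  proof (cases "t \<in> {0..1}")
    case True
    have "\<exists>L\<in>Vsp. (\<lambda>n. En.nrm (U (Suc n) t - L)) \<longlonglongrightarrow> 0"
    proof (rule Vsp_complete[OF UV[OF True]])
      fix \<epsilon> :: real assume e: "0 < \<epsilon>"
      obtain B where B: "0 < B" "holder_const * B powr \<alpha> < \<epsilon>\<^sup>2" using small_powr[of "\<epsilon>\<^sup>2"] e by auto
      obtain N where N: "\<And>m n t. \<lbrakk>N \<le> m; N \<le> n; t \<in> {0..1}\<rbrakk> \<Longrightarrow> L.nrm (U m t - U n t) \<le> sqrt B"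
      proof -
        have "0 < sqrt B" using B by simp
        from uc[OF this] show ?thesis using that by blast
      qed
      have "En.nrm (U (Suc i) t - U (Suc j) t) < \<epsilon>" if "N \<le> i" "N \<le> j" for i j
      proof -
        have "energy s (U (Suc i) t - U (Suc j) t) (U (Suc i) t - U (Suc j) t) \<le> holder_const * B powr \<alpha>"
          unfolding US
        proof (rule picard_stable[OF st st True])
          fix r :: real assume r: "r \<in> {0..1}"
          have "L.nrm (U i r - U j r) \<le> sqrt B" by (rule N) (use that r in auto)
          thus "ip (U i r - U j r) (U i r - U j r) \<le> B" unfolding L.nrm_def by simp
        qed
        also have "\<dots> < \<epsilon>\<^sup>2" by (rule B)
        finally show ?thesis unfolding En.nrm_def using e by (intro real_less_lsqrt) auto
      qed
      thus "\<exists>N. \<forall>i\<ge>N. \<forall>j\<ge>N. En.nrm (U (Suc i) t - U (Suc j) t) < \<epsilon>" by blast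
    qed
    thus ?thesis by blast
  next
    case False
    thus ?thesis by blast
  qed
  then obtain u where u: "\<And>t. t \<in> {0..1} \<Longrightarrow> u t \<in> Vsp" "\<And>t. t \<in> {0..1} \<Longrightarrow> (\<lambda>n. En.nrm (U (Suc n) t - u t)) \<longlonglongrightarrow> 0"
    by metis
  have uH: "u t \<in> Hsp" if "t \<in> {0..1}" for t using Vsp_Hsp[OF u(1)[OF that]] .
  have lim: "(\<lambda>n. L.nrm (U (Suc n) t - u t)) \<longlonglongrightarrow> 0" if "t \<in> {0..1}" for t
    by (rule G.M_tendsto[OF UV[OF that] u(1)[OF that] u(2)[OF that]])
  have bs: "bstate M (u t)" if t: "t \<in> {0..1}" for t
  proof -
    have b: "AE x in lebesgue_on \<Omega>. 0 \<le> U (Suc n) t x \<and> U (Suc n) t x \<le> M" for n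
      using stateD(2)[OF st t] by (simp add: bstate_def)
    have "AE x in lebesgue_on \<Omega>. 0 \<le> u t x"
      by (rule L2_limit_nonneg[OF UH[OF t] uH[OF t] lim[OF t]]) (use b in \<open>auto elim: eventually_mono\<close>)
    moreover have "AE x in lebesgue_on \<Omega>. u t x \<le> (\<lambda>x. M) x"
      by (rule L2_limit_le[OF UH[OF t] uH[OF t] lim[OF t] const_Hsp]) (use b in \<open>auto elim: eventually_mono\<close>)
    ultimately show ?thesis using uH[OF t] by (simp add: bstate_def eventually_conj)
  qed
  have lip: "ip (u r - u t) (u r - u t) \<le> K * \<bar>r - t\<bar>" if r: "r \<in> {0..1}" and t: "t \<in> {0..1}" for r t
  proof -
    have "(\<lambda>n. ip (U (Suc n) r - U (Suc n) t) (U (Suc n) r - U (Suc n) t)) \<longlonglongrightarrow> ip (u r - u t) (u r - u t)"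
    proof (rule L.sq_tendsto[where X="\<lambda>n. U (Suc n) r - U (Suc n) t" and L="u r - u t"])
      show "(\<lambda>n. L.nrm (U (Suc n) r - U (Suc n) t - (u r - u t))) \<longlonglongrightarrow> 0"
      proof (rule Lim_null_comparison)
        show "(\<lambda>n. L.nrm (U (Suc n) r - u r) + L.nrm (U (Suc n) t - u t)) \<longlonglongrightarrow> 0"
          using tendsto_add[OF lim[OF r] lim[OF t]] by simp
        have "norm (L.nrm (U (Suc n) r - U (Suc n) t - (u r - u t))) \<le> L.nrm (U (Suc n) r - u r) + L.nrm (U (Suc n) t - u t)" for n
        proof -
          have eq: "U (Suc n) r - U (Suc n) t - (u r - u t) = (U (Suc n) r - u r) - (U (Suc n) t - u t)" by simp
          have D: "U (Suc n) r - u r \<in> Hsp" "U (Suc n) t - u t \<in> Hsp" using UH uH r t by (auto intro!: L.S_diff)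
          show ?thesis unfolding eq real_norm_def abs_of_nonneg[OF L.nrm_nonneg[OF L.S_diff[OF D]]]
            by (rule L.nrm_diff[OF D])
        qed
        thus "\<forall>\<^sub>F n in sequentially. norm (L.nrm (U (Suc n) r - U (Suc n) t - (u r - u t))) \<le> L.nrm (U (Suc n) r - u r) + L.nrm (U (Suc n) t - u t)"
          by (intro always_eventually allI)
      qed
    qed (use UH uH r t in \<open>auto intro!: L.S_diff\<close>)
    thus ?thesis by (rule LIMSEQ_le_const2) (use stateD(5)[OF st r t] in blast)
  qed
  have z: "(0::real) \<in> {0..1}" by simp
  have "L.nrm (u 0) \<le> 0"
  proof (rule LIMSEQ_le_const[OF lim[OF z]])
    have "L.nrm (u 0) \<le> L.nrm (U (Suc n) 0 - u 0)" for n
    proof -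
      have "L.nrm (U (Suc n) 0) = 0" using stateD(4)[OF st] by (simp add: L.nrm_def)
      thus ?thesis using L.nrm_triangle[OF uH[OF z] UH[OF z, of "Suc n"] L.S_zero]
          L.nrm_diff_commute[OF uH[OF z] UH[OF z, of "Suc n"]] by simp
    qed
    thus "\<exists>N. \<forall>n\<ge>N. L.nrm (u 0) \<le> L.nrm (U (Suc n) 0 - u 0)" by blast
  qed
  hence "ip (u 0) (u 0) = 0" using L.nrm_nonneg[OF uH[OF z]] L.nrm_zero_iff[OF uH[OF z]] by linarith
  hence su: "state M K u" unfolding state_def using stateD(1)[OF st] bs lip by blast
  have fixpt: "energy s (u t - picard u t) (u t - picard u t) = 0" if t: "t \<in> {0..1}" for t
  proof -
    have pV: "picard u t \<in> Vsp" by (rule picard_Vsp[OF su t])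
    have "En.nrm (u t - picard u t) \<le> 0"
    proof (rule field_le_epsilon)
      fix \<epsilon> :: real assume e: "0 < \<epsilon>"
      obtain B where B: "0 < B" "holder_const * B powr \<alpha> < (\<epsilon> / 2)\<^sup>2" using small_powr[of "(\<epsilon> / 2)\<^sup>2"] e by auto
      obtain N where N: "\<And>m n t. \<lbrakk>N \<le> m; N \<le> n; t \<in> {0..1}\<rbrakk> \<Longrightarrow> L.nrm (U m t - U n t) \<le> sqrt B"
      proof -
        have "0 < sqrt B" using B by simp
        from uc[OF this] show ?thesis using that by blast
      qed
      have dB: "L.nrm (U n r - u r) \<le> sqrt B" if n: "N \<le> n" and r: "r \<in> {0..1}" for n r
      proof (rule LIMSEQ_le_const)
        show "(\<lambda>k. sqrt B + L.nrm (U (Suc k) r - u r)) \<longlonglongrightarrow> sqrt B"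
          using tendsto_add[OF tendsto_const lim[OF r], of "sqrt B"] by simp
        have "L.nrm (U n r - u r) \<le> sqrt B + L.nrm (U (Suc k) r - u r)" if "N \<le> k" for k
          using L.nrm_triangle[OF UH[OF r, of n] UH[OF r, of "Suc k"] uH[OF r]] N[of n "Suc k" r] n r that by simp
        thus "\<exists>N. \<forall>k\<ge>N. L.nrm (U n r - u r) \<le> sqrt B + L.nrm (U (Suc k) r - u r)" by blast
      qed
      have "\<forall>\<^sub>F n in sequentially. En.nrm (U (Suc n) t - u t) < \<epsilon> / 2"
        by (rule order_tendstoD(2)[OF u(2)[OF t]]) (use e in simp)
      then obtain n where n: "N \<le> n" "En.nrm (U (Suc n) t - u t) < \<epsilon> / 2"
        unfolding eventually_sequentially by (metis le_add1 le_add2)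
      have "energy s (U (Suc n) t - picard u t) (U (Suc n) t - picard u t) \<le> holder_const * B powr \<alpha>"
        unfolding US
      proof (rule picard_stable[OF st su t])
        fix r :: real assume r: "r \<in> {0..1}"
        show "ip (U n r - u r) (U n r - u r) \<le> B" using dB[OF n(1) r] unfolding L.nrm_def by simp
      qed
      hence "energy s (U (Suc n) t - picard u t) (U (Suc n) t - picard u t) \<le> (\<epsilon> / 2)\<^sup>2" using B by linarith
      hence "En.nrm (U (Suc n) t - picard u t) \<le> \<epsilon> / 2" unfolding En.nrm_def using e by (intro real_le_lsqrt) auto
      moreover have "En.nrm (u t - picard u t) \<le> En.nrm (u t - U (Suc n) t) + En.nrm (U (Suc n) t - picard u t)"
        by (rule En.nrm_triangle[OF u(1)[OF t] UV[OF t] pV])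
      moreover have "En.nrm (u t - U (Suc n) t) = En.nrm (U (Suc n) t - u t)"
        by (rule En.nrm_diff_commute[OF u(1)[OF t] UV[OF t]])
      ultimately show "En.nrm (u t - picard u t) \<le> 0 + \<epsilon>" using n(2) by linarith
    qed
    hence "En.nrm (u t - picard u t) = 0" using En.nrm_nonneg[OF En.S_diff[OF u(1)[OF t] pV]] by linarith
    thus ?thesis using En.nrm_zero_iff[OF En.S_diff[OF u(1)[OF t] pV]] by blast
  qed
  have "AE x in lebesgue_on \<Omega>. w t x \<le> u t x" if t: "t \<in> {0..1}" for t
    by (rule L2_limit_ge[OF UH[OF t] uH[OF t] lim[OF t] stateD(3)[OF w t] wle[OF t]])
  thus ?thesis using su u(1) fixpt by blast
qed

end

section \<open>Classical solutions and their time shifts\<close>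

context frac_domain
begin

lemma ip_cong_AE:
  assumes "u \<in> Hsp" "v \<in> Hsp" "AE x in lebesgue_on \<Omega>. u x = u' x" "u' \<in> Hsp"
  shows "ip u' v = ip u v"
proof -
  have [measurable]: "u \<in> borel_measurable (lebesgue_on \<Omega>)" "v \<in> borel_measurable (lebesgue_on \<Omega>)"
    "u' \<in> borel_measurable (lebesgue_on \<Omega>)" using assms L2D(1) by auto
  show ?thesis by (rule integral_cong_AE) (use assms(3) in \<open>auto elim!: eventually_mono\<close>)
qed

lemma AE_dom_of_AE: "AE x in lebesgue. P x \<Longrightarrow> AE x in lebesgue_on \<Omega>. P x"
  unfolding AE_dom by (auto elim: eventually_mono)

lemma energy_cong_AE:
  assumes "u \<in> Vsp" "u' \<in> Vsp" "v \<in> Vsp" "AE x in lebesgue. u x = u' x"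
  shows "energy s u' v = energy s u v"
proof -
  have "energy s (u - u') v = 0" by (rule energy_null) (use assms(4) in \<open>auto elim: eventually_mono\<close>)
  thus ?thesis using assms by (simp add: En.diff_left)
qed

end

context frac_problem
begin

lemma bstate_cong_AE:
  assumes "bstate M u" "u \<in> Vsp" "AE x in lebesgue. u x = u' x" shows "bstate M u'"
proof -
  have "u' \<in> Hsp" by (rule Vsp_Hsp[OF Vsp_cong_AE[OF assms(2,3)]])
  moreover have "AE x in lebesgue_on \<Omega>. 0 \<le> u x \<and> u x \<le> M" using assms(1) by (simp add: bstate_def)
  hence "AE x in lebesgue_on \<Omega>. 0 \<le> u' x \<and> u' x \<le> M"
    using AE_dom_of_AE[OF assms(3)] by eventually_elim auto
  ultimately show ?thesis by (simp add: bstate_def)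
qed

lemma ip_nl_cong_AE:
  assumes "bstate M u" "bstate M u'" "v \<in> Hsp" "AE x in lebesgue_on \<Omega>. u x = u' x"
  shows "ip (nl u') v = ip (nl u) v"
  by (rule ip_cong_AE[OF nl_Hsp[OF assms(1)] assms(3) _ nl_Hsp[OF assms(2)]])
     (use assms(4) in \<open>auto simp: nl_def elim: eventually_mono\<close>)

text \<open>
  Curves that are continuous in the energy norm and satisfy the tested equation at each time, with an
  ordinary derivative.  This notion is stable under delays and is stronger than being a finite
  energy solution.
\<close>
definition classical :: "real \<Rightarrow> real \<Rightarrow> (real \<Rightarrow> real ^ 'n \<Rightarrow> real) \<Rightarrow> bool" where
  "classical M T u \<longleftrightarrow>
     (\<forall>t\<in>{0..T}. u t \<in> Vsp \<and> bstate M (u t)) \<and>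
     (\<forall>\<epsilon>>0. \<exists>\<delta>>0. \<forall>r\<in>{0..T}. \<forall>t\<in>{0..T}. \<bar>r - t\<bar> < \<delta> \<longrightarrow> En.nrm (u r - u t) < \<epsilon>) \<and>
     ip (u 0) (u 0) = 0 \<and>
     (\<forall>v\<in>Vsp. \<forall>t\<in>{0..T}. ((\<lambda>t. ip (u t) v) has_real_derivative ip (nl (u t)) v - energy s (u t) v) (at t within {0..T}))"

lemma classicalD:
  assumes "classical M T u"
  shows "t \<in> {0..T} \<Longrightarrow> u t \<in> Vsp" "t \<in> {0..T} \<Longrightarrow> bstate M (u t)"
    "0 < \<epsilon> \<Longrightarrow> \<exists>\<delta>>0. \<forall>r\<in>{0..T}. \<forall>t\<in>{0..T}. \<bar>r - t\<bar> < \<delta> \<longrightarrow> En.nrm (u r - u t) < \<epsilon>"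
    "ip (u 0) (u 0) = 0"
    "v \<in> Vsp \<Longrightarrow> t \<in> {0..T} \<Longrightarrow> ((\<lambda>t. ip (u t) v) has_real_derivative ip (nl (u t)) v - energy s (u t) v) (at t within {0..T})"
  using assms unfolding classical_def by blast+

lemma classical_cong_AE:
  assumes u: "classical M T u" and T: "0 \<le> T" and eq: "\<And>t. t \<in> {0..T} \<Longrightarrow> AE x in lebesgue. u t x = u' t x"
  shows "classical M T u'"
proof -
  note C = classicalD[OF u]
  have V: "u' t \<in> Vsp" if "t \<in> {0..T}" for t by (rule Vsp_cong_AE[OF C(1)[OF that] eq[OF that]])
  have b: "bstate M (u' t)" if "t \<in> {0..T}" for t by (rule bstate_cong_AE[OF C(2)[OF that] C(1)[OF that] eq[OF that]])
  have ipe: "ip (u' t) v = ip (u t) v" if "t \<in> {0..T}" "v \<in> Hsp" for t v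
    by (rule ip_cong_AE[OF Vsp_Hsp[OF C(1)[OF that(1)]] that(2) AE_dom_of_AE[OF eq[OF that(1)]] Vsp_Hsp[OF V[OF that(1)]]])
  have nre: "En.nrm (u' r - u' t) = En.nrm (u r - u t)" if "r \<in> {0..T}" "t \<in> {0..T}" for r t
  proof -
    have d: "AE x in lebesgue. (u r - u t) x = (u' r - u' t) x"
      using eq[OF that(1)] eq[OF that(2)] by eventually_elim simp
    have dV: "u r - u t \<in> Vsp" "u' r - u' t \<in> Vsp" using C(1) V that by (auto intro!: En.S_diff)
    have "energy s (u' r - u' t) (u' r - u' t) = energy s (u r - u t) (u' r - u' t)"
      by (rule energy_cong_AE[OF dV dV(2) d])
    also have "\<dots> = energy s (u' r - u' t) (u r - u t)" by (rule En.sym[OF dV])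
    also have "\<dots> = energy s (u r - u t) (u r - u t)" by (rule energy_cong_AE[OF dV dV(1) d])
    finally show ?thesis by (simp only: En.nrm_def)
  qed
  have z: "0 \<in> {0..T}" using T by simp
  have "ip (u' 0) (u' 0) = ip (u 0) (u' 0)" by (rule ipe[OF z Vsp_Hsp[OF V[OF z]]])
  also have "\<dots> = ip (u' 0) (u 0)" by (rule L.sym[OF Vsp_Hsp[OF C(1)[OF z]] Vsp_Hsp[OF V[OF z]]])
  also have "\<dots> = ip (u 0) (u 0)" by (rule ipe[OF z Vsp_Hsp[OF C(1)[OF z]]])
  finally have i0: "ip (u' 0) (u' 0) = 0" using C(4) by simp
  have "((\<lambda>t. ip (u' t) v) has_real_derivative ip (nl (u' t)) v - energy s (u' t) v) (at t within {0..T})"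
    if v: "v \<in> Vsp" and t: "t \<in> {0..T}" for v t
  proof -
    have "((\<lambda>t. ip (u' t) v) has_real_derivative ip (nl (u t)) v - energy s (u t) v) (at t within {0..T})"
      by (rule has_field_derivative_transform_within[OF C(5)[OF v t] zero_less_one t])
         (rule ipe[OF _ Vsp_Hsp[OF v], symmetric])
    moreover have "ip (nl (u' t)) v = ip (nl (u t)) v"
      by (rule ip_nl_cong_AE[OF C(2)[OF t] b[OF t] Vsp_Hsp[OF v] AE_dom_of_AE[OF eq[OF t]]])
    moreover have "energy s (u' t) v = energy s (u t) v"
      by (rule energy_cong_AE[OF C(1)[OF t] V[OF t] v eq[OF t]])
    ultimately show ?thesis by simp
  qed
  moreover have "\<exists>\<delta>>0. \<forall>r\<in>{0..T}. \<forall>t\<in>{0..T}. \<bar>r - t\<bar> < \<delta> \<longrightarrow> En.nrm (u' r - u' t) < \<epsilon>" if "0 < \<epsilon>" for \<epsilon>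
    using C(3)[OF that] by (simp add: nre)
  ultimately show ?thesis unfolding classical_def using V b i0 by blast
qed

lemma classical_zero_AE:
  assumes "classical M T u" "0 \<le> T" shows "AE x in lebesgue. u 0 x = 0"
proof -
  have z: "0 \<in> {0..T}" using assms by simp
  have V: "u 0 \<in> Vsp" by (rule classicalD(1)[OF assms(1) z])
  have "AE x in lebesgue_on \<Omega>. u 0 x = 0" by (rule L2_null_AE[OF Vsp_Hsp[OF V] classicalD(4)[OF assms(1)]])
  hence "AE x in lebesgue. x \<in> \<Omega> \<longrightarrow> u 0 x = 0" by (simp add: AE_dom)
  thus ?thesis using VspD(3)[OF V] by eventually_elim auto
qed

lemma deriv_within_alt:
  fixes F :: "real \<Rightarrow> real"
  shows "(F has_real_derivative D) (at t within S) \<longleftrightarrow>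
     (\<forall>\<epsilon>>0. \<exists>\<delta>>0. \<forall>r\<in>S. \<bar>r - t\<bar> < \<delta> \<longrightarrow> \<bar>F r - F t - D * (r - t)\<bar> \<le> \<epsilon> * \<bar>r - t\<bar>)"
  unfolding has_field_derivative_def has_derivative_within_alt
  by (auto simp: bounded_linear_mult_right)

text \<open>
  Up to a null set at the junction, the delayed curve is \<open>u (max 0 (t - \<tau>))\<close>.  As \<open>u 0\<close> vanishes almost
  everywhere, so does the right-hand side of the equation at time \<open>0\<close>; the one-sided derivatives at the
  junction therefore agree.
\<close>
lemma classical_shift:
  assumes u: "classical M T u" and T: "0 \<le> T" and \<tau>: "0 \<le> \<tau>"
  shows "classical M (T + \<tau>) (time_shift \<tau> u)"
proof (rule classical_cong_AE[where u="\<lambda>t. u (max 0 (t - \<tau>))"])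
  note C = classicalD[OF u]
  define p where "p t = max 0 (t - \<tau>)" for t :: real
  have pT: "p t \<in> {0..T}" if "t \<in> {0..T + \<tau>}" for t using that T by (auto simp: p_def)
  have pl: "\<bar>p r - p t\<bar> \<le> \<bar>r - t\<bar>" for r t by (auto simp: p_def)
  have z: "0 \<in> {0..T}" using T by simp
  have u0: "AE x in lebesgue. u 0 x = 0" by (rule classical_zero_AE[OF u T])
  show "classical M (T + \<tau>) (\<lambda>t. u (max 0 (t - \<tau>)))"
    unfolding classical_def p_def[symmetric]
  proof (intro conjI ballI allI impI)
    fix t assume t: "t \<in> {0..T + \<tau>}"
    show "u (p t) \<in> Vsp" "bstate M (u (p t))" using C pT[OF t] by auto
  next
    fix \<epsilon> :: real assume "0 < \<epsilon>"
    from C(3)[OF this] obtain \<delta> where d: "0 < \<delta>" "\<And>r t. \<lbrakk>r \<in> {0..T}; t \<in> {0..T}; \<bar>r - t\<bar> < \<delta>\<rbrakk> \<Longrightarrow> En.nrm (u r - u t) < \<epsilon>"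
      by blast
    have "En.nrm (u (p r) - u (p t)) < \<epsilon>" if "r \<in> {0..T + \<tau>}" "t \<in> {0..T + \<tau>}" "\<bar>r - t\<bar> < \<delta>" for r t
      by (rule d(2)[OF pT[OF that(1)] pT[OF that(2)] le_less_trans[OF pl that(3)]])
    thus "\<exists>\<delta>>0. \<forall>r\<in>{0..T + \<tau>}. \<forall>t\<in>{0..T + \<tau>}. \<bar>r - t\<bar> < \<delta> \<longrightarrow> En.nrm (u (p r) - u (p t)) < \<epsilon>"
      using d(1) by blast
  next
    show "ip (u (p 0)) (u (p 0)) = 0" using C(4) \<tau> by (simp add: p_def)
  next
    fix v t assume v: "v \<in> Vsp" and t: "t \<in> {0..T + \<tau>}"
    define F where "F r = ip (u r) v" for r
    define D where "D r = ip (nl (u r)) v - energy s (u r) v" for r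
    have D0: "D 0 = 0"
    proof -
      have "ip (nl (u 0)) v = 0"
        by (rule integral_eq_zero_AE) (use AE_dom_of_AE[OF u0] in \<open>auto simp: nl_def elim: eventually_mono\<close>)
      moreover have "energy s (u 0) v = 0" by (rule energy_null[OF u0])
      ultimately show ?thesis by (simp add: D_def)
    qed
    have der: "(F has_real_derivative D (p t)) (at (p t) within {0..T})"
      unfolding F_def D_def by (rule C(5)[OF v pT[OF t]])
    have "((\<lambda>t. F (p t)) has_real_derivative D (p t)) (at t within {0..T + \<tau>})"
      unfolding deriv_within_alt
    proof (intro allI impI)
      fix \<epsilon> :: real assume e: "0 < \<epsilon>"
      obtain \<delta> where d: "0 < \<delta>" "\<And>r. \<lbrakk>r \<in> {0..T}; \<bar>r - p t\<bar> < \<delta>\<rbrakk> \<Longrightarrow> \<bar>F r - F (p t) - D (p t) * (r - p t)\<bar> \<le> \<epsilon> * \<bar>r - p t\<bar>"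
        using der e unfolding deriv_within_alt by blast
      show "\<exists>\<delta>>0. \<forall>r\<in>{0..T + \<tau>}. \<bar>r - t\<bar> < \<delta> \<longrightarrow> \<bar>F (p r) - F (p t) - D (p t) * (r - t)\<bar> \<le> \<epsilon> * \<bar>r - t\<bar>"
      \<comment> \<open>up to the junction the derivative to be matched is \<open>0\<close>, so it suffices that \<open>p\<close> does not increase distances\<close>
      proof (cases "t \<le> \<tau>")
        case True
        hence pt: "p t = 0" by (simp add: p_def)
        have "\<bar>F (p r) - F (p t) - D (p t) * (r - t)\<bar> \<le> \<epsilon> * \<bar>r - t\<bar>" if r: "r \<in> {0..T + \<tau>}" "\<bar>r - t\<bar> < \<delta>" for r
        proof -
          have "\<bar>p r - p t\<bar> < \<delta>" using pl[of r t] r(2) by linarith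
          from d(2)[OF pT[OF r(1)] this] have "\<bar>F (p r) - F (p t)\<bar> \<le> \<epsilon> * \<bar>p r - p t\<bar>"
            unfolding pt D0 by simp
          also have "\<dots> \<le> \<epsilon> * \<bar>r - t\<bar>" using pl e by (intro mult_left_mono) auto
          finally show ?thesis unfolding pt D0 by simp
        qed
        thus ?thesis using d(1) by blast
      next
        case False
        have "\<bar>F (p r) - F (p t) - D (p t) * (r - t)\<bar> \<le> \<epsilon> * \<bar>r - t\<bar>" if r: "r \<in> {0..T + \<tau>}" "\<bar>r - t\<bar> < min \<delta> (t - \<tau>)" for r
        proof -
          have "p r - p t = r - t" using r False by (auto simp: p_def)
          moreover have "\<bar>p r - p t\<bar> < \<delta>" using pl[of r t] r(2) by linarith
          ultimately show ?thesis using d(2)[OF pT[OF r(1)]] by metis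
        qed
        thus ?thesis using d(1) False by (intro exI[of _ "min \<delta> (t - \<tau>)"]) auto
      qed
    qed
    thus "((\<lambda>t. ip (u (p t)) v) has_real_derivative ip (nl (u (p t))) v - energy s (u (p t)) v) (at t within {0..T + \<tau>})"
      unfolding F_def D_def .
  qed
  show "0 \<le> T + \<tau>" using T \<tau> by simp
  show "AE x in lebesgue. u (max 0 (t - \<tau>)) x = time_shift \<tau> u t x" for t
    using u0 by eventually_elim (auto simp: time_shift_def max_def)
qed

lemma admissible_continuous:
  assumes f: "G.admissible a K f" and e: "0 < \<epsilon>"
  shows "\<exists>\<delta>>0. \<forall>r t. \<bar>r - t\<bar> < \<delta> \<longrightarrow> L.nrm (f r - f t) < \<epsilon>"
proof -
  note A = G.admissibleD[OF f]
  define \<eta> where "\<eta> = \<epsilon> / (sqrt K + 1)"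
  have s0: "0 < sqrt K + 1" using A(2) by (simp add: add_nonneg_pos)
  have eta: "0 < \<eta>" using e s0 by (simp add: \<eta>_def)
  define \<delta> where "\<delta> = \<eta> powr (2 / a)"
  have "0 < \<delta>" unfolding \<delta>_def using eta by (metis powr_gt_zero less_irrefl)
  moreover have "L.nrm (f r - f t) < \<epsilon>" if "\<bar>r - t\<bar> < \<delta>" for r t
  proof -
    have "\<bar>r - t\<bar> powr (a / 2) \<le> \<delta> powr (a / 2)" using that A(1) by (intro powr_mono2) auto
    also have "\<dots> = \<eta> powr (2 / a * (a / 2))" unfolding \<delta>_def by (rule powr_powr)
    also have "2 / a * (a / 2) = 1" using A(1) by simp
    finally have "\<bar>r - t\<bar> powr (a / 2) \<le> \<eta>" using eta by simp
    hence "sqrt K * \<bar>r - t\<bar> powr (a / 2) \<le> sqrt K * \<eta>" using A(2) by (intro mult_left_mono) auto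
    also have "\<dots> < (sqrt K + 1) * \<eta>" using eta by simp
    also have "\<dots> = \<epsilon>" using s0 by (simp add: \<eta>_def)
    finally show ?thesis using G.admissible_nrm[OF f, of r t] by linarith
  qed
  ultimately show ?thesis by blast
qed

text \<open>
  A fixed point \<open>u\<close> agrees with \<open>picard u\<close> only almost everywhere at each time.  The latter is the exact
  solution of a linear problem, and its forcing may be rewritten as its own reaction.
\<close>
lemma picard_classical:
  assumes u: "state M K u" and M: "Q * M powr \<alpha> \<le> M" "0 \<le> M" and K: "holder_const * K powr \<alpha> \<le> K"
    and fp: "\<And>t. t \<in> {0..1} \<Longrightarrow> u t \<in> Vsp" "\<And>t. t \<in> {0..1} \<Longrightarrow> energy s (u t - picard u t) (u t - picard u t) = 0"
  shows "classical M 1 (picard u)" "state M K (picard u)" "\<And>t. t \<in> {0..1} \<Longrightarrow> AE x in lebesgue_on \<Omega>. u t x = picard u t x"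
proof -
  note A = forcing_admissible[OF u]
  show su: "state M K (picard u)" by (rule picard_state[OF u M K])
  have V: "picard u t \<in> Vsp" if "t \<in> {0..1}" for t by (rule picard_Vsp[OF u that])
  show eq: "AE x in lebesgue_on \<Omega>. u t x = picard u t x" if t: "t \<in> {0..1}" for t
  proof -
    have d: "u t - picard u t \<in> Vsp" using fp(1)[OF t] V[OF t] by (rule En.S_diff)
    have "ip (u t - picard u t) (u t - picard u t) \<le> 0" using poincare_const(2)[OF d] fp(2)[OF t] by simp
    hence "ip (u t - picard u t) (u t - picard u t) = 0" using L.nonneg[OF Vsp_Hsp[OF d]] by linarith
    from L2_null_AE[OF Vsp_Hsp[OF d] this] show ?thesis by eventually_elim simp
  qed
  have econt: "\<exists>\<delta>>0. \<forall>r\<in>{0..1}. \<forall>t\<in>{0..1}. \<bar>r - t\<bar> < \<delta> \<longrightarrow> En.nrm (picard u r - picard u t) < \<epsilon>" if "0 < \<epsilon>" for \<epsilon>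
    unfolding picard_def by (rule G.sol_continuous[OF A that])
  have "((\<lambda>t. ip (picard u t) v) has_real_derivative ip (nl (picard u t)) v - energy s (picard u t) v) (at t within {0..1})"
    if v: "v \<in> Vsp" and t: "t \<in> {0..1}" for v t
  proof -
    have "continuous_on {0..1} (\<lambda>t. ip (forcing u t) v)"
    proof (rule L.continuous_on_inner_left[OF G.admissibleD(3)[OF A] Vsp_Hsp[OF v]])
      fix \<epsilon> :: real assume "0 < \<epsilon>"
      from admissible_continuous[OF A this]
      show "\<exists>\<delta>>0. \<forall>r\<in>{0..1}. \<forall>t\<in>{0..1}. \<bar>r - t\<bar> < \<delta> \<longrightarrow> L.nrm (forcing u r - forcing u t) < \<epsilon>" by blast
    qed
    moreover have "continuous_on {0..1} (\<lambda>t. energy s (G.sol (forcing u) t) v)"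
      by (rule En.continuous_on_inner_left[OF V[unfolded picard_def] v econt[unfolded picard_def]])
    ultimately have "continuous_on {0..1} (\<lambda>t. ip (forcing u t) v - energy s (G.sol (forcing u) t) v)"
      by (rule continuous_on_diff)
    from G.sol_derivative[OF A t v this]
    have "((\<lambda>t. ip (picard u t) v) has_real_derivative ip (forcing u t) v - energy s (picard u t) v) (at t within {0..1})"
      unfolding picard_def .
    moreover have "ip (forcing u t) v = ip (nl (picard u t)) v"
      unfolding forcing_eq[OF t]
      by (rule ip_nl_cong_AE[OF stateD(2)[OF u t] stateD(2)[OF su t] Vsp_Hsp[OF v] eq[OF t], symmetric])
    ultimately show ?thesis by simp
  qed
  thus "classical M 1 (picard u)"
    unfolding classical_def using V stateD(2)[OF su] econt stateD(4)[OF su] by blast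
qed

text \<open>
  The constant \<open>c\<close> solves \<open>c * (\<beta> + C) = q0 * c powr \<alpha>\<close>, while \<open>M\<close> and \<open>K\<close> are large enough both for the
  subsolution and for invariance under the Picard operator.  Nontriviality at each positive time is
  inherited from the subsolution.
\<close>
theorem classical_solution_exists:
  assumes O: "open O'" "O' \<noteq> {}" "O' \<subseteq> \<Omega>" and q0: "0 < q0" "AE x in lebesgue. x \<in> O' \<longrightarrow> q0 \<le> q x"
  shows "\<exists>M K u. 0 \<le> M \<and> state M K u \<and> classical M 1 u \<and>
           (\<forall>t\<in>{0<..1}. \<not> (AE x in lebesgue_on \<Omega>. u t x = 0))"
proof -
  obtain \<phi> C where phi: "\<phi> \<in> Vsp" "\<And>x. 0 \<le> \<phi> x \<and> \<phi> x \<le> 1" and C: "0 \<le> C"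
    and off: "AE x in lebesgue. x \<notin> O' \<longrightarrow> \<phi> x = 0" and nt: "\<not> (AE x in lebesgue. \<phi> x = 0)"
    and en: "\<And>v B. v \<in> Vsp \<Longrightarrow> (\<And>x. 0 \<le> v x) \<Longrightarrow> AE x in lebesgue. v x \<le> B \<Longrightarrow>
        energy s \<phi> v \<le> C * ip (\<lambda>x. \<phi> x powr \<alpha>) v"
    using subsolution_profile[OF O alpha] by blast
  define \<beta> where "\<beta> = 1 / (1 - \<alpha>)"
  have b1: "1 \<le> \<beta>" using alpha by (simp add: \<beta>_def field_simps)
  define c where "c = (q0 / (\<beta> + C)) powr \<beta>"
  have bC: "0 < \<beta> + C" using b1 C by simp
  have c0: "0 < c" unfolding c_def using q0(1) bC by (metis powr_gt_zero divide_pos_pos less_irrefl)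
  have cq: "c * (\<beta> + C) \<le> q0 * c powr \<alpha>"
  proof -
    have "c powr (1 - \<alpha>) = (q0 / (\<beta> + C)) powr (\<beta> * (1 - \<alpha>))" unfolding c_def by (rule powr_powr)
    also have "\<beta> * (1 - \<alpha>) = 1" using alpha by (simp add: \<beta>_def)
    finally have "c powr (1 - \<alpha>) * (\<beta> + C) = q0" using q0(1) bC by simp
    moreover have "c = c powr (1 - \<alpha>) * c powr \<alpha>" using c0 by (simp add: powr_add[symmetric])
    ultimately have "c * (\<beta> + C) = q0 * c powr \<alpha>" by (metis mult.assoc mult.commute)
    thus ?thesis by simp
  qed
  obtain M where M: "c \<le> M" "1 \<le> M" "Q * M powr \<alpha> \<le> M" using sublinear_bound[OF Q alpha, of c] by blast
  obtain K where K: "c\<^sup>2 * \<beta>\<^sup>2 * ip \<phi> \<phi> \<le> K" "1 \<le> K" "holder_const * K powr \<alpha> \<le> K"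
    using sublinear_bound[OF holder_const alpha, of "c\<^sup>2 * \<beta>\<^sup>2 * ip \<phi> \<phi>"] by blast
  define w where "w t = (\<lambda>x. (c * t powr \<beta>) * \<phi> x)" for t
  have ws: "state M K w" by (rule subsolution_state[OF phi b1 c0 M(1) K(1) w_def])
  have M0: "0 \<le> M" using M by simp
  have "AE x in lebesgue_on \<Omega>. w t x \<le> picard w t x" if "t \<in> {0..1}" for t
    by (rule subsolution_picard[OF phi C off en q0 O(3) \<beta>_def c0 cq w_def ws that])
  from monotone_iteration[OF ws M(3) M0 K(3) this] obtain u where u: "state M K u"
    "\<And>t. t \<in> {0..1} \<Longrightarrow> u t \<in> Vsp" "\<And>t. t \<in> {0..1} \<Longrightarrow> energy s (u t - picard u t) (u t - picard u t) = 0"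
    "\<And>t. t \<in> {0..1} \<Longrightarrow> AE x in lebesgue_on \<Omega>. w t x \<le> u t x" by blast
  have P: "classical M 1 (picard u)" "state M K (picard u)"
    by (rule picard_classical[OF u(1) M(3) M0 K(3)]; use u(2,3) in blast)+
  have P3: "AE x in lebesgue_on \<Omega>. u t x = picard u t x" if "t \<in> {0..1}" for t
    by (rule picard_classical(3)[OF u(1) M(3) M0 K(3) _ _ that]) (use u(2,3) in blast)+
  have "\<not> (AE x in lebesgue_on \<Omega>. picard u t x = 0)" if t: "t \<in> {0<..1}" for t
  proof
    assume z: "AE x in lebesgue_on \<Omega>. picard u t x = 0"
    have t': "t \<in> {0..1}" using t by auto
    have "AE x in lebesgue_on \<Omega>. \<phi> x = 0"
      using z P3[OF t'] u(4)[OF t']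
    proof eventually_elim
      case (elim x)
      hence "(c * t powr \<beta>) * \<phi> x \<le> 0" by (simp add: w_def)
      moreover have "0 < t powr \<beta>" using t by (metis powr_gt_zero greaterThanAtMost_iff less_irrefl)
      hence "0 < c * t powr \<beta>" using c0 by simp
      ultimately have "\<phi> x \<le> 0" by (metis mult_pos_pos not_le)
      thus ?case using phi(2)[of x] by simp
    qed
    hence "AE x in lebesgue. x \<in> \<Omega> \<longrightarrow> \<phi> x = 0" by (simp add: AE_dom)
    hence "AE x in lebesgue. \<phi> x = 0" using VspD(3)[OF phi(1)] by eventually_elim auto
    thus False using nt by simp
  qed
  thus ?thesis using P M0 by blast
qed

end

section \<open>A jointly measurable representative\<close>

lemma AE_lebesgue_prod:
  assumes "AE z in (lebesgue :: ('a::euclidean_space \<times> 'b::euclidean_space) measure). P z"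
  shows "AE x in (lebesgue :: 'a measure). AE y in (lebesgue :: 'b measure). P (x, y)"
proof -
  have "AE z in lborel \<Otimes>\<^sub>M lborel. P z" using assms unfolding AE_completion_iff lborel_prod .
  from lborel_pair.AE_pair[OF this] show ?thesis by (simp only: AE_completion_iff)
qed

text \<open>
  By Fubini, a function that vanishes almost everywhere on the cylinder has vanishing slices at almost
  all times.
\<close>
lemma nontrivial_nonneg_boundedI:
  fixes \<Omega> :: "(real ^ 'n) set"
  assumes O: "open \<Omega>" and m: "(\<lambda>z. u (fst z) (snd z)) \<in> borel_measurable (lebesgue :: (real \<times> (real ^ 'n)) measure)"
    and b: "\<And>t x. 0 \<le> u t x \<and> u t x \<le> M"
    and ab: "0 \<le> a" "a < b" "b \<le> T" and nt: "\<And>t. t \<in> {a<..<b} \<Longrightarrow> \<not> (AE x in lebesgue_on \<Omega>. u t x = 0)"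
  shows "nontrivial_nonneg_bounded \<Omega> T u"
proof -
  have S: "{0<..<T} \<times> \<Omega> \<in> sets lebesgue"
  proof -
    have "open ({0<..<T} \<times> \<Omega>)" by (intro open_Times open_greaterThanLessThan O)
    thus ?thesis by auto
  qed
  have "\<not> (AE (t, x) in lebesgue_on ({0<..<T} \<times> \<Omega>). u t x = 0)"
  proof
    assume "AE (t, x) in lebesgue_on ({0<..<T} \<times> \<Omega>). u t x = 0"
    hence "AE z in lebesgue. z \<in> {0<..<T} \<times> \<Omega> \<longrightarrow> u (fst z) (snd z) = 0"
      using S by (simp add: AE_restrict_space_iff case_prod_beta)
    from AE_lebesgue_prod[OF this]
    have "AE t in lebesgue. AE x in lebesgue. t \<in> {0<..<T} \<and> x \<in> \<Omega> \<longrightarrow> u t x = 0" by simp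
    hence "AE t in lebesgue. t \<notin> {a<..<b}"
    proof eventually_elim
      case (elim t)
      show ?case
      proof
        assume t: "t \<in> {a<..<b}"
        hence "AE x in lebesgue. x \<in> \<Omega> \<longrightarrow> u t x = 0" using elim ab by (auto elim!: eventually_mono)
        hence "AE x in lebesgue_on \<Omega>. u t x = 0" using O by (subst AE_restrict_space_iff) auto
        thus False using nt[OF t] by blast
      qed
    qed
    hence "AE t in lborel. t \<notin> {a<..<b}" unfolding AE_completion_iff .
    hence "emeasure lborel {a<..<b} = 0" by (subst (asm) AE_iff_null_sets[symmetric]) auto
    thus False using ab by simp
  qed
  moreover have "(\<lambda>(t, x). u t x) \<in> L_inf (lebesgue_on ({0<..<T} \<times> \<Omega>))"
    unfolding L_inf_def
  proof (intro CollectI conjI exI[of _ M])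
    show "(\<lambda>(t, x). u t x) \<in> borel_measurable (lebesgue_on ({0<..<T} \<times> \<Omega>))"
      using m by (intro measurable_restrict_space1) (simp add: case_prod_beta')
    have "\<bar>case z of (t, x) \<Rightarrow> u t x\<bar> \<le> M" for z using b[of "fst z" "snd z"] by (simp add: case_prod_beta)
    thus "AE z in lebesgue_on ({0<..<T} \<times> \<Omega>). \<bar>case z of (t, x) \<Rightarrow> u t x\<bar> \<le> M" by simp
  qed
  ultimately show ?thesis unfolding nontrivial_nonneg_bounded_def using b by auto
qed

context frac_problem
begin

definition dyad :: "nat \<Rightarrow> real \<Rightarrow> real" where
  "dyad m t = real (nat \<lfloor>clamp01 t * 2 ^ m\<rfloor>) * (1/2) ^ m"

lemma dyad_bounds: "dyad m t \<in> {0..1}" "t \<in> {0..1} \<Longrightarrow> dyad m t \<le> t" "t \<in> {0..1} \<Longrightarrow> t - dyad m t \<le> (1/2) ^ m"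
proof -
  show "dyad m t \<in> {0..1}" unfolding dyad_def using G.grid_le_one[of "clamp01 t" m] clamp01(1)[of t] by simp
  assume t: "t \<in> {0..1}"
  have eq: "t = t * 2 ^ m * (1/2) ^ m" by (simp add: mult.assoc flip: power_mult_distrib)
  have fl: "real (nat \<lfloor>t * 2 ^ m\<rfloor>) \<le> t * 2 ^ m" "t * 2 ^ m \<le> real (nat \<lfloor>t * 2 ^ m\<rfloor>) + 1" using t by auto
  have "real (nat \<lfloor>t * 2 ^ m\<rfloor>) * (1/2) ^ m \<le> t * 2 ^ m * (1/2) ^ m" by (rule mult_right_mono[OF fl(1)]) simp
  thus "dyad m t \<le> t" unfolding dyad_def clamp01(2)[OF t] using eq by linarith
  have "t * 2 ^ m * (1/2) ^ m \<le> (real (nat \<lfloor>t * 2 ^ m\<rfloor>) + 1) * (1/2) ^ m" by (rule mult_right_mono[OF fl(2)]) simp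
  thus "t - dyad m t \<le> (1/2) ^ m" unfolding dyad_def clamp01(2)[OF t] using eq by (simp add: distrib_right)
qed

text \<open>
  A path prescribes each time slice only up to a null set, so nothing makes it measurable in both variables.
  Evaluated at the dyadic time before \<open>t\<close> it takes countably many values and is jointly measurable.  The
  pointwise limit over the dyadic levels keeps this property and reproduces each slice almost
  everywhere; truncation enforces the bounds everywhere.
\<close>
definition joint_rep :: "real \<Rightarrow> (real \<Rightarrow> real ^ 'n \<Rightarrow> real) \<Rightarrow> real \<Rightarrow> real ^ 'n \<Rightarrow> real" where
  "joint_rep M u t x = indicator \<Omega> x * min M (max 0 (lim (\<lambda>m. u (dyad m t) x)))"

lemma joint_rep_bounds: "0 \<le> M \<Longrightarrow> 0 \<le> joint_rep M u t x \<and> joint_rep M u t x \<le> M"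
  by (auto simp: joint_rep_def indicator_def)

text \<open>
  The parameter \<open>\<tau>\<close> covers the delayed solution as well.
\<close>
lemma joint_rep_measurable:
  assumes u: "\<And>t. t \<in> {0..1} \<Longrightarrow> u t \<in> Vsp"
  shows "(\<lambda>z. joint_rep M u (fst z - \<tau>) (snd z)) \<in> borel_measurable (lebesgue :: (real \<times> (real ^ 'n)) measure)"
proof -
  have f: "(\<lambda>z. fst z) \<in> borel_measurable (lebesgue :: (real \<times> (real ^ 'n)) measure)"
    by (intro borel_measurable_lebesgue_fst measurable_completion) simp
  have [measurable]: "(\<lambda>z. u (dyad m (fst z - \<tau>)) (snd z)) \<in> borel_measurable (lebesgue :: (real \<times> (real ^ 'n)) measure)" for m
  proof -
    define g where "g z = nat \<lfloor>clamp01 (fst z - \<tau>) * 2 ^ m\<rfloor>" for z :: "real \<times> (real ^ 'n)"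
    \<comment> \<open>\<open>F\<close> has to be measurable for every \<open>k\<close>, hence the value \<open>0\<close> at grid points outside \<open>{0..1}\<close>, which \<open>g\<close> never selects\<close>
    define F where "F k z = (if real k * (1/2) ^ m \<in> {0..1} then u (real k * (1/2) ^ m) (snd z) else 0)" for k :: nat and z :: "real \<times> (real ^ 'n)"
    have g: "g \<in> measurable lebesgue (count_space UNIV)"
      unfolding g_def clamp01_def using f by measurable
    have F: "F k \<in> borel_measurable lebesgue" for k
      unfolding F_def using borel_measurable_lebesgue_snd[OF VspD(4)[OF u[of "real k * (1/2) ^ m"]]]
      by (cases "real k * (1/2) ^ m \<in> {0..1}") auto
    have "(\<lambda>z. F (g z) z) \<in> borel_measurable lebesgue" by (rule measurable_compose_countable[OF F g])
    moreover have "F (g z) z = u (dyad m (fst z - \<tau>)) (snd z)" for z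
      using dyad_bounds(1)[of m "fst z - \<tau>"] unfolding F_def g_def dyad_def by simp
    ultimately show ?thesis by simp
  qed
  have [measurable]: "(\<lambda>z. indicator \<Omega> (snd z) :: real) \<in> borel_measurable (lebesgue :: (real \<times> (real ^ 'n)) measure)"
    by (rule borel_measurable_lebesgue_snd) (rule borel_measurable_indicator, simp)
  show ?thesis unfolding joint_rep_def by measurable
qed

text \<open>
  By the Hoelder bound in \<open>state\<close> the increments between dyadic levels decay geometrically in \<open>L\<^sup>2\<close>, so
  the values at the dyadic times converge almost everywhere; Fatou's lemma identifies the limit.
\<close>
lemma joint_rep_AE:
  assumes st: "state M K u" and uV: "\<And>t. t \<in> {0..1} \<Longrightarrow> u t \<in> Vsp" and t: "t \<in> {0..1}"
  shows "AE x in lebesgue. u t x = joint_rep M u t x"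
proof -
  define Y where "Y m = u (dyad m t)" for m
  have YV: "Y m \<in> Vsp" for m unfolding Y_def by (rule uV[OF dyad_bounds(1)])
  have YH: "Y m \<in> Hsp" for m by (rule Vsp_Hsp[OF YV])
  have uH: "u t \<in> Hsp" by (rule Vsp_Hsp[OF uV[OF t]])
  have K0: "0 \<le> K" by (rule stateD(1)[OF st])
  have pw: "sqrt (K * (1/2) ^ m) = sqrt K * (sqrt (1/2)) ^ m" for m
    by (simp add: real_sqrt_mult real_sqrt_power)
  have dn: "L.nrm (Y m - u t) \<le> sqrt (K * (1/2) ^ m)" for m
    unfolding Y_def by (rule state_nrm[OF st dyad_bounds(1) t]) (use dyad_bounds(2,3)[OF t, of m] in simp)
  have conv: "AE x in lebesgue_on \<Omega>. convergent (\<lambda>m. Y m x)"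
  proof (rule L2_geometric_AE_convergent[OF finite_dom YH, where r="sqrt (1/2)" and C="2 * sqrt K"])
    fix m
    have "L2_norm (lebesgue_on \<Omega>) (\<lambda>x. Y (Suc m) x - Y m x) = L.nrm (Y (Suc m) - Y m)"
      by (simp add: L_nrm fun_diff_def)
    also have "\<dots> \<le> L.nrm (Y (Suc m) - u t) + L.nrm (u t - Y m)" by (rule L.nrm_triangle[OF YH uH YH])
    also have "L.nrm (u t - Y m) = L.nrm (Y m - u t)" by (rule L.nrm_diff_commute[OF uH YH])
    also have "L.nrm (Y (Suc m) - u t) + L.nrm (Y m - u t) \<le> sqrt (K * (1/2) ^ m) + sqrt (K * (1/2) ^ m)"
    proof (rule add_mono[OF order.trans[OF dn] dn])
      have "(1/2::real) ^ Suc m \<le> (1/2) ^ m" by simp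
      thus "sqrt (K * (1/2) ^ Suc m) \<le> sqrt (K * (1/2) ^ m)"
        using K0 by (intro real_sqrt_le_mono mult_left_mono)
    qed
    also have "\<dots> = 2 * sqrt K * sqrt (1/2) ^ m" by (simp add: pw)
    finally show "L2_norm (lebesgue_on \<Omega>) (\<lambda>x. Y (Suc m) x - Y m x) \<le> 2 * sqrt K * sqrt (1/2) ^ m" .
  qed (auto simp: real_less_lsqrt)
  define l where "l x = lim (\<lambda>m. Y m x)" for x
  have [measurable]: "Y m \<in> borel_measurable (lebesgue_on \<Omega>)" for m using YH L2D(1) by blast
  have [measurable]: "u t \<in> borel_measurable (lebesgue_on \<Omega>)" using uH L2D(1) by blast
  have lm: "l \<in> borel_measurable (lebesgue_on \<Omega>)" unfolding l_def by measurable
  have lim0: "(\<lambda>m. sqrt (K * (1/2) ^ m)) \<longlonglongrightarrow> 0"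
  proof -
    have "(\<lambda>m. sqrt (K * (1/2) ^ m)) \<longlonglongrightarrow> sqrt (K * 0)" by (intro tendsto_intros LIMSEQ_realpow_zero) auto
    thus ?thesis by simp
  qed
  have h1: "(\<lambda>x. Y m x - u t x) \<in> Hsp" for m by (rule L2_diff[OF YH uH])
  have h2: "(\<lambda>x. l x - u t x) \<in> borel_measurable (lebesgue_on \<Omega>)" using lm by measurable
  have h3: "AE x in lebesgue_on \<Omega>. (\<lambda>m. Y m x - u t x) \<longlonglongrightarrow> l x - u t x"
    using conv by eventually_elim (auto simp: l_def convergent_LIMSEQ_iff intro!: tendsto_intros)
  have small: "\<forall>\<^sub>F m in sequentially. (LINT x|lebesgue_on \<Omega>. (Y m x - u t x)\<^sup>2) \<le> \<epsilon>\<^sup>2" if e: "0 < \<epsilon>" for \<epsilon> :: real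
  proof -
    have "\<forall>\<^sub>F m in sequentially. sqrt (K * (1/2) ^ m) < \<epsilon>" by (rule order_tendstoD(2)[OF lim0 e])
    thus ?thesis
    proof eventually_elim
      case (elim m)
      have "L.nrm (Y m - u t) \<le> \<epsilon>" using dn[of m] elim by linarith
      hence "(L.nrm (Y m - u t))\<^sup>2 \<le> \<epsilon>\<^sup>2" by (rule power_mono) (rule L.nrm_nonneg[OF L.S_diff[OF YH uH]])
      thus ?case unfolding L.nrm_sq[OF L.S_diff[OF YH uH]] by (simp add: power2_eq_square)
    qed
  qed
  have "(LINT x|lebesgue_on \<Omega>. (l x - u t x)\<^sup>2) \<le> 0"
  proof (rule field_le_epsilon)
    fix \<epsilon> :: real assume "0 < \<epsilon>"
    hence "0 < sqrt \<epsilon>" "(sqrt \<epsilon>)\<^sup>2 = \<epsilon>" by auto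
    thus "(LINT x|lebesgue_on \<Omega>. (l x - u t x)\<^sup>2) \<le> 0 + \<epsilon>"
      using L2_fatou(2)[OF h1 h2 h3 small[of "sqrt \<epsilon>"]] by simp
  qed
  moreover have lH: "(\<lambda>x. l x - u t x) \<in> Hsp" by (rule L2_fatou(1)[OF h1 h2 h3 small[of 1]]) auto
  ultimately have "ip (\<lambda>x. l x - u t x) (\<lambda>x. l x - u t x) = 0"
    using L.nonneg[OF lH] by (simp add: power2_eq_square)
  from L2_null_AE[OF lH this] have "AE x in lebesgue_on \<Omega>. l x - u t x = 0" .
  moreover have "AE x in lebesgue_on \<Omega>. 0 \<le> u t x \<and> u t x \<le> M" using stateD(2)[OF st t] by (simp add: bstate_def)
  ultimately have "AE x in lebesgue_on \<Omega>. u t x = min M (max 0 (l x))" by eventually_elim auto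
  hence "AE x in lebesgue. x \<in> \<Omega> \<longrightarrow> u t x = min M (max 0 (l x))" by (simp add: AE_dom)
  thus ?thesis using VspD(3)[OF uV[OF t]]
    by eventually_elim (auto simp: joint_rep_def l_def Y_def indicator_def)
qed

end

section \<open>Continuous curves in Bochner spaces\<close>

lemma measurable_nat_floor_lebesgue_on:
  "(\<lambda>t::real. nat \<lfloor>t * c\<rfloor>) \<in> measurable (lebesgue_on S) (count_space UNIV)"
  by (intro measurable_restrict_space1 measurable_completion) measurable

lemma continuous_integrable_open_interval:
  fixes h :: "real \<Rightarrow> real"
  assumes c: "continuous_on {0..T} h"
  shows "integrable (lebesgue_on {0<..<T}) h" "(LINT t|lebesgue_on {0<..<T}. h t) = integral {0..T} h"
proof -
  have "integrable (lebesgue_on {0..T}) h" by (rule continuous_imp_integrable_real[OF c])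
  hence "integrable lebesgue (\<lambda>t. indicator {0..T} t *\<^sub>R h t)" by (subst (asm) integrable_restrict_space) auto
  hence "integrable lebesgue (\<lambda>t. indicator {0<..<T} t *\<^sub>R (indicator {0..T} t *\<^sub>R h t))"
    by (rule integrable_mult_indicator[rotated]) simp
  moreover have "indicator {0<..<T} t *\<^sub>R (indicator {0..T} t *\<^sub>R h t) = indicator {0<..<T} t *\<^sub>R h t" for t
    by (auto simp: indicator_def)
  ultimately have "integrable lebesgue (\<lambda>t. indicator {0<..<T} t *\<^sub>R h t)" by (simp only:)
  thus i: "integrable (lebesgue_on {0<..<T}) h" by (subst integrable_restrict_space) auto
  have "(LINT t|lebesgue_on {0<..<T}. h t) = integral {0<..<T} h" by (rule lebesgue_integral_eq_integral[OF i]) simp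
  thus "(LINT t|lebesgue_on {0<..<T}. h t) = integral {0..T} h" by (simp add: integral_open_interval_real)
qed

lemma finite_measure_open_interval: "finite_measure (lebesgue_on {0<..<(T::real)})"
  by (rule finite_measure_lebesgue_on) (rule bounded_set_imp_lmeasurable, auto)

text \<open>
  Sampling a uniformly continuous curve at the dyadic grid points gives simple functions that converge to it.
\<close>
lemma continuous_bochner_L2:
  fixes f :: "real \<Rightarrow> 'b \<Rightarrow> real"
  assumes V: "\<And>t. t \<in> {0..T} \<Longrightarrow> f t \<in> V"
    and p: "\<And>r t. \<lbrakk>r \<in> {0..T}; t \<in> {0..T}\<rbrakk> \<Longrightarrow> 0 \<le> p (\<lambda>b. f r b - f t b)"
    and rev: "\<And>r t. \<lbrakk>r \<in> {0..T}; t \<in> {0..T}\<rbrakk> \<Longrightarrow> \<bar>p (f r) - p (f t)\<bar> \<le> p (\<lambda>b. f r b - f t b)"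
    and cont: "\<And>\<epsilon>. 0 < \<epsilon> \<Longrightarrow> \<exists>\<delta>>0. \<forall>r\<in>{0..T}. \<forall>t\<in>{0..T}. \<bar>r - t\<bar> < \<delta> \<longrightarrow> p (\<lambda>b. f r b - f t b) < \<epsilon>"
  shows "f \<in> bochner_L2 (lebesgue_on {0<..<T}) V p"
proof -
  define g where "g i t = real (nat \<lfloor>t * 2 ^ i\<rfloor>) * (1/2) ^ i" for i :: nat and t :: real
  have g: "g i t \<in> {0..T}" "\<bar>g i t - t\<bar> \<le> (1/2) ^ i" if t: "t \<in> {0<..<T}" for i t
  proof -
    have eq: "t = t * 2 ^ i * (1/2) ^ i" by (simp add: mult.assoc flip: power_mult_distrib)
    have fl: "real (nat \<lfloor>t * 2 ^ i\<rfloor>) \<le> t * 2 ^ i" "t * 2 ^ i \<le> real (nat \<lfloor>t * 2 ^ i\<rfloor>) + 1" using t by auto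
    have "real (nat \<lfloor>t * 2 ^ i\<rfloor>) * (1/2) ^ i \<le> t * 2 ^ i * (1/2) ^ i" by (rule mult_right_mono[OF fl(1)]) simp
    hence a: "g i t \<le> t" unfolding g_def using eq by linarith
    have "t * 2 ^ i * (1/2) ^ i \<le> (real (nat \<lfloor>t * 2 ^ i\<rfloor>) + 1) * (1/2) ^ i" by (rule mult_right_mono[OF fl(2)]) simp
    hence b: "t - g i t \<le> (1/2) ^ i" unfolding g_def using eq by (simp add: distrib_right)
    have "0 \<le> g i t" by (simp add: g_def)
    thus "g i t \<in> {0..T}" "\<bar>g i t - t\<bar> \<le> (1/2) ^ i" using a b t by auto
  qed
  have "strongly_measurable (lebesgue_on {0<..<T}) V p f"
    unfolding strongly_measurable_def
  proof (intro exI[of _ "\<lambda>i t. f (g i t)"] conjI allI)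
    fix i
    show "(\<lambda>t. f (g i t)) ` space (lebesgue_on {0<..<T}) \<subseteq> V" using g(1) V by (auto simp: space_restrict_space)
    have "simple_function (lebesgue_on {0<..<T}) (\<lambda>t. nat \<lfloor>t * 2 ^ i\<rfloor>)"
      unfolding simple_function_def
    proof (intro conjI ballI)
      have "(\<lambda>t. nat \<lfloor>t * 2 ^ i\<rfloor>) ` space (lebesgue_on {0<..<T}) \<subseteq> {..nat \<lfloor>T * 2 ^ i\<rfloor>}"
        by (auto simp: space_restrict_space intro!: nat_mono floor_mono mult_right_mono)
      thus "finite ((\<lambda>t. nat \<lfloor>t * 2 ^ i\<rfloor>) ` space (lebesgue_on {0<..<T}))" by (rule finite_subset) simp
      fix k
      show "(\<lambda>t. nat \<lfloor>t * 2 ^ i\<rfloor>) -` {k} \<inter> space (lebesgue_on {0<..<T}) \<in> sets (lebesgue_on {0<..<T})"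
        by (rule measurable_sets[OF measurable_nat_floor_lebesgue_on]) simp
    qed
    from simple_function_compose1[OF this, of "\<lambda>k. f (real k * (1/2) ^ i)"]
    show "simple_function (lebesgue_on {0<..<T}) (\<lambda>t. f (g i t))" unfolding g_def .
  next
    have "(\<lambda>i. p (\<lambda>b. f (g i t) b - f t b)) \<longlonglongrightarrow> 0" if t: "t \<in> {0<..<T}" for t
    proof (rule LIMSEQ_I)
      fix \<epsilon> :: real assume "0 < \<epsilon>"
      from cont[OF this] obtain \<delta> where d: "0 < \<delta>" "\<And>r t. \<lbrakk>r \<in> {0..T}; t \<in> {0..T}; \<bar>r - t\<bar> < \<delta>\<rbrakk> \<Longrightarrow> p (\<lambda>b. f r b - f t b) < \<epsilon>"
        by blast
      have "(\<lambda>i. (1/2::real) ^ i) \<longlonglongrightarrow> 0" by (rule LIMSEQ_realpow_zero) auto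
      hence "\<forall>\<^sub>F i in sequentially. (1/2::real) ^ i < \<delta>" using d(1) by (rule order_tendstoD(2))
      then obtain N where N: "\<And>i. i \<ge> N \<Longrightarrow> (1/2::real) ^ i < \<delta>" by (auto simp: eventually_sequentially)
      have t': "t \<in> {0..T}" using t by simp
      have "norm (p (\<lambda>b. f (g i t) b - f t b) - 0) < \<epsilon>" if "i \<ge> N" for i
        using d(2)[OF g(1)[OF t] t' le_less_trans[OF g(2)[OF t] N[OF that]]] p[OF g(1)[OF t, of i] t'] by simp
      thus "\<exists>N. \<forall>i\<ge>N. norm (p (\<lambda>b. f (g i t) b - f t b) - 0) < \<epsilon>" by blast
    qed
    thus "AE t in lebesgue_on {0<..<T}. (\<lambda>i. p (\<lambda>b. f (g i t) b - f t b)) \<longlonglongrightarrow> 0"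
      by (intro AE_I2) (auto simp: space_restrict_space)
  qed
  moreover have "AE t in lebesgue_on {0<..<T}. f t \<in> V"
    by (intro AE_I2) (use V in \<open>auto simp: space_restrict_space\<close>)
  moreover have "integrable (lebesgue_on {0<..<T}) (\<lambda>t. (p (f t))\<^sup>2)"
  proof (rule continuous_integrable_open_interval(1))
    have "continuous_on {0..T} (\<lambda>t. p (f t))"
      unfolding continuous_on_iff
    proof (intro ballI allI impI)
      fix t \<epsilon> :: real assume t: "t \<in> {0..T}" and "0 < \<epsilon>"
      from cont[OF this(2)] obtain \<delta> where d: "0 < \<delta>" "\<And>r t. \<lbrakk>r \<in> {0..T}; t \<in> {0..T}; \<bar>r - t\<bar> < \<delta>\<rbrakk> \<Longrightarrow> p (\<lambda>b. f r b - f t b) < \<epsilon>"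
        by blast
      have "dist (p (f r)) (p (f t)) < \<epsilon>" if "r \<in> {0..T}" "dist r t < \<delta>" for r
        using d(2)[OF that(1) t] rev[OF that(1) t] that(2) unfolding dist_real_def by linarith
      thus "\<exists>d>0. \<forall>x'\<in>{0..T}. dist x' t < d \<longrightarrow> dist (p (f x')) (p (f t)) < \<epsilon>" using d(1) by blast
    qed
    thus "continuous_on {0..T} (\<lambda>t. (p (f t))\<^sup>2)" by (intro continuous_intros)
  qed
  ultimately show ?thesis unfolding bochner_L2_def by blast
qed

lemma borel_measurable_lebesgue_on_AE:
  fixes f g :: "real \<Rightarrow> real"
  assumes f: "f \<in> borel_measurable (lebesgue_on S)" and S: "S \<in> sets lebesgue"
    and ae: "AE t in lebesgue_on S. f t = g t"
  shows "g \<in> borel_measurable (lebesgue_on S)"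
proof -
  have "AE t in lebesgue. t \<in> S \<longrightarrow> f t = g t" using ae S by (simp add: AE_restrict_space_iff)
  hence "AE t in lebesgue. (if t \<in> S then f t else 0) = (if t \<in> S then g t else 0)" by eventually_elim auto
  from borel_measurable_AE[OF borel_measurable_if_I[OF f S] this] show ?thesis by (rule borel_measurable_if_D)
qed

text \<open>
  Along the simple functions that approximate \<open>\<phi>\<close> the map \<open>t \<mapsto> F t (S i t)\<close> is piecewise of the form
  \<open>t \<mapsto> F t v\<close>, hence measurable, and continuity of \<open>F t\<close> passes this to the limit.
\<close>
lemma functional_integrable:
  fixes \<phi> :: "real \<Rightarrow> 'b \<Rightarrow> real" and F :: "real \<Rightarrow> ('b \<Rightarrow> real) \<Rightarrow> real"
  assumes phi: "\<phi> \<in> bochner_L2 (lebesgue_on {0<..<T}) V p"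
    and Fc: "\<And>v. v \<in> V \<Longrightarrow> continuous_on {0..T} (\<lambda>t. F t v)"
    and Fd: "\<And>t v w. \<lbrakk>t \<in> {0..T}; v \<in> V; w \<in> V\<rbrakk> \<Longrightarrow> \<bar>F t v - F t w\<bar> \<le> C * p (\<lambda>b. v b - w b)"
    and Fb: "\<And>t v. \<lbrakk>t \<in> {0..T}; v \<in> V\<rbrakk> \<Longrightarrow> \<bar>F t v\<bar> \<le> C * p v" and C: "0 \<le> C"
  shows "integrable (lebesgue_on {0<..<T}) (\<lambda>t. F t (\<phi> t))"
proof -
  let ?M = "lebesgue_on {0<..<T}"
  obtain S where S: "\<And>i. simple_function ?M (S i)" "\<And>i. S i ` space ?M \<subseteq> V"
      "AE t in ?M. (\<lambda>i. p (\<lambda>b. S i t b - \<phi> t b)) \<longlonglongrightarrow> 0"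
    using phi unfolding bochner_L2_def strongly_measurable_def by blast
  have phiV: "AE t in ?M. \<phi> t \<in> V" and int: "integrable ?M (\<lambda>t. (p (\<phi> t))\<^sup>2)"
    using phi unfolding bochner_L2_def by auto
  have sp: "space ?M = {0<..<T}" by (simp add: space_restrict_space)
  have Fm: "(\<lambda>t. F t v) \<in> borel_measurable ?M" if "v \<in> V" for v
    by (rule borel_measurable_integrable[OF continuous_integrable_open_interval(1)[OF Fc[OF that]]])
  have Sm[measurable]: "(\<lambda>t. F t (S i t)) \<in> borel_measurable ?M" for i
  proof (rule measurable_compose_countable'[where I="S i ` space ?M" and g="S i"])
    show "(\<lambda>t. F t v) \<in> borel_measurable ?M" if "v \<in> S i ` space ?M" for v using Fm S(2) that by blast
    have fin: "finite (S i ` space ?M)" using S(1)[of i] by (simp add: simple_function_def)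
    thus "countable (S i ` space ?M)" by (rule countable_finite)
    show "S i \<in> measurable ?M (count_space (S i ` space ?M))"
      unfolding measurable_count_space_eq2[OF fin] using S(1)[of i] by (auto simp: simple_function_def)
  qed
  have in_space: "AE t in ?M. t \<in> {0<..<T}" using AE_space[of ?M] unfolding sp .
  have lim: "AE t in ?M. (\<lambda>i. F t (S i t)) \<longlonglongrightarrow> F t (\<phi> t)"
    using S(3) phiV in_space
  proof eventually_elim
    case (elim t)
    have SV: "S i t \<in> V" for i using S(2)[of i] elim(3) sp by blast
    have "(\<lambda>i. F t (S i t) - F t (\<phi> t)) \<longlonglongrightarrow> 0"
    proof (rule Lim_null_comparison)
      show "\<forall>\<^sub>F i in sequentially. norm (F t (S i t) - F t (\<phi> t)) \<le> C * p (\<lambda>b. S i t b - \<phi> t b)"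
        using Fd[of t "S _ t" "\<phi> t"] elim SV by (intro always_eventually) auto
      show "(\<lambda>i. C * p (\<lambda>b. S i t b - \<phi> t b)) \<longlonglongrightarrow> 0" using tendsto_mult_right_zero[OF elim(1)] by simp
    qed
    thus ?case by (simp add: LIM_zero_iff)
  qed
  have lm: "(\<lambda>t. lim (\<lambda>i. F t (S i t))) \<in> borel_measurable ?M" by measurable
  have la: "AE t in ?M. lim (\<lambda>i. F t (S i t)) = F t (\<phi> t)"
    using lim by eventually_elim (rule limI)
  have m: "(\<lambda>t. F t (\<phi> t)) \<in> borel_measurable ?M"
    by (rule borel_measurable_lebesgue_on_AE[OF lm _ la]) simp
  show ?thesis
  proof (rule Bochner_Integration.integrable_bound[OF _ m])
    show "integrable ?M (\<lambda>t. C * (1 + (p (\<phi> t))\<^sup>2))"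
      using int finite_measure.integrable_const[OF finite_measure_open_interval, of T "1::real"]
      by (intro integrable_mult_right Bochner_Integration.integrable_add) auto
    show "AE t in ?M. norm (F t (\<phi> t)) \<le> norm (C * (1 + (p (\<phi> t))\<^sup>2))"
      using phiV in_space
    proof eventually_elim
      case (elim t)
      have "2 * p (\<phi> t) \<le> 1 + (p (\<phi> t))\<^sup>2"
        using zero_le_power2[of "p (\<phi> t) - 1"] by (simp add: power2_eq_square algebra_simps)
      hence "p (\<phi> t) \<le> 1 + (p (\<phi> t))\<^sup>2" using zero_le_power2[of "p (\<phi> t)"] by linarith
      hence "C * p (\<phi> t) \<le> C * (1 + (p (\<phi> t))\<^sup>2)" using C by (rule mult_left_mono)
      moreover have "\<bar>F t (\<phi> t)\<bar> \<le> C * p (\<phi> t)" using Fb elim by simp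
      moreover have "0 \<le> C * (1 + (p (\<phi> t))\<^sup>2)" using C by simp
      ultimately show ?case by simp
    qed
  qed
qed

context frac_domain
begin

lemma dual_norm_le:
  assumes "\<And>v. v \<in> Vsp \<Longrightarrow> \<bar>F v\<bar> \<le> C * X0s_norm s v" and C: "0 \<le> C"
  shows "X0s_dual_norm \<Omega> s F \<le> C"
  unfolding X0s_dual_norm_def
proof (rule cSUP_least)
  have "X0s_norm s (0 :: real ^ 'n \<Rightarrow> real) = 0" using En.nrm_zero by (simp only: En_nrm)
  hence "(0 :: real ^ 'n \<Rightarrow> real) \<in> {v \<in> Vsp. X0s_norm s v \<le> 1}" using En.S_zero by simp
  thus "{v \<in> Vsp. X0s_norm s v \<le> 1} \<noteq> {}" by blast
  fix v assume v: "v \<in> {v \<in> Vsp. X0s_norm s v \<le> 1}"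
  have "\<bar>F v\<bar> \<le> C * X0s_norm s v" using assms(1) v by blast
  also have "\<dots> \<le> C * 1" using v C by (intro mult_left_mono) auto
  finally show "\<bar>F v\<bar> \<le> C" by simp
qed

lemma dual_norm_ge:
  assumes "\<And>v. v \<in> Vsp \<Longrightarrow> \<bar>F v\<bar> \<le> C * X0s_norm s v" and C: "0 \<le> C"
    and v: "v \<in> Vsp" "X0s_norm s v \<le> 1"
  shows "\<bar>F v\<bar> \<le> X0s_dual_norm \<Omega> s F"
  unfolding X0s_dual_norm_def
proof (rule cSUP_upper)
  show "v \<in> {v \<in> Vsp. X0s_norm s v \<le> 1}" using v by simp
  show "bdd_above ((\<lambda>v. \<bar>F v\<bar>) ` {v \<in> Vsp. X0s_norm s v \<le> 1})"
  proof (rule bdd_aboveI2)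
    fix w assume w: "w \<in> {v \<in> Vsp. X0s_norm s v \<le> 1}"
    have "\<bar>F w\<bar> \<le> C * X0s_norm s w" using assms(1) w by blast
    also have "\<dots> \<le> C * 1" using w C by (intro mult_left_mono) auto
    finally show "\<bar>F w\<bar> \<le> C" by simp
  qed
qed

lemma dual_norm_triangle:
  assumes F: "\<And>v. v \<in> Vsp \<Longrightarrow> \<bar>F v\<bar> \<le> C * X0s_norm s v" and G: "\<And>v. v \<in> Vsp \<Longrightarrow> \<bar>G v\<bar> \<le> C * X0s_norm s v" and C: "0 \<le> C"
  shows "X0s_dual_norm \<Omega> s F \<le> X0s_dual_norm \<Omega> s G + X0s_dual_norm \<Omega> s (\<lambda>v. F v - G v)"
  unfolding X0s_dual_norm_def[of \<Omega> s F]
proof (rule cSUP_least)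
  have "X0s_norm s (0 :: real ^ 'n \<Rightarrow> real) = 0" using En.nrm_zero by (simp only: En_nrm)
  hence "(0 :: real ^ 'n \<Rightarrow> real) \<in> {v \<in> Vsp. X0s_norm s v \<le> 1}" using En.S_zero by simp
  thus "{v \<in> Vsp. X0s_norm s v \<le> 1} \<noteq> {}" by blast
  fix v assume v: "v \<in> {v \<in> Vsp. X0s_norm s v \<le> 1}"
  have "\<bar>G v\<bar> \<le> X0s_dual_norm \<Omega> s G" by (rule dual_norm_ge[OF G C]) (use v in auto)
  moreover have "\<bar>F v - G v\<bar> \<le> X0s_dual_norm \<Omega> s (\<lambda>v. F v - G v)"
  proof (rule dual_norm_ge[where C="2 * C"])
    fix w assume w: "w \<in> Vsp"
    show "\<bar>F w - G w\<bar> \<le> 2 * C * X0s_norm s w" using F[OF w] G[OF w] by linarith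
  qed (use v C in auto)
  ultimately show "\<bar>F v\<bar> \<le> X0s_dual_norm \<Omega> s G + X0s_dual_norm \<Omega> s (\<lambda>v. F v - G v)" by linarith
qed

end

section \<open>From classical to finite energy solutions\<close>

context frac_problem
begin

lemma classical_H_continuous:
  assumes u: "classical M T u" and e: "0 < \<epsilon>"
  shows "\<exists>\<delta>>0. \<forall>r\<in>{0..T}. \<forall>t\<in>{0..T}. \<bar>r - t\<bar> < \<delta> \<longrightarrow> L.nrm (u r - u t) < \<epsilon>"
proof -
  have P: "0 < sqrt poincare_const" using poincare_const(1) by simp
  obtain \<delta> where d: "0 < \<delta>" "\<And>r t. \<lbrakk>r \<in> {0..T}; t \<in> {0..T}; \<bar>r - t\<bar> < \<delta>\<rbrakk> \<Longrightarrow> En.nrm (u r - u t) < \<epsilon> / sqrt poincare_const"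
    using classicalD(3)[OF u divide_pos_pos[OF e P]] by blast
  have "L.nrm (u r - u t) < \<epsilon>" if "r \<in> {0..T}" "t \<in> {0..T}" "\<bar>r - t\<bar> < \<delta>" for r t
  proof -
    have "L.nrm (u r - u t) \<le> sqrt poincare_const * En.nrm (u r - u t)"
      using classicalD(1)[OF u] that by (intro nrm_poincare_energy En.S_diff) auto
    also have "\<dots> < sqrt poincare_const * (\<epsilon> / sqrt poincare_const)"
      by (rule mult_strict_left_mono[OF d(2)[OF that] P])
    also have "\<dots> = \<epsilon>" using P by simp
    finally show ?thesis .
  qed
  thus ?thesis using d(1) by (intro exI[of _ \<delta>]) simp
qed

lemma classical_nl_continuous:
  assumes u: "classical M T u" and e: "0 < \<epsilon>"
  shows "\<exists>\<delta>>0. \<forall>r\<in>{0..T}. \<forall>t\<in>{0..T}. \<bar>r - t\<bar> < \<delta> \<longrightarrow> L.nrm (nl (u r) - nl (u t)) < \<epsilon>"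
proof -
  obtain B where B: "0 < B" "holder_const * B powr \<alpha> < \<epsilon>\<^sup>2" using small_powr[of "\<epsilon>\<^sup>2"] e by auto
  have sB: "0 < sqrt B" using B by simp
  obtain \<delta> where d: "0 < \<delta>" "\<And>r t. \<lbrakk>r \<in> {0..T}; t \<in> {0..T}; \<bar>r - t\<bar> < \<delta>\<rbrakk> \<Longrightarrow> L.nrm (u r - u t) < sqrt B"
    using classical_H_continuous[OF u sB] by blast
  have "L.nrm (nl (u r) - nl (u t)) < \<epsilon>" if rt: "r \<in> {0..T}" "t \<in> {0..T}" "\<bar>r - t\<bar> < \<delta>" for r t
  proof -
    have b: "bstate M (u r)" "bstate M (u t)" using classicalD(2)[OF u] rt by auto
    have H: "u r - u t \<in> Hsp" using b by (intro L.S_diff) (auto simp: bstate_def)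
    have "ip (u r - u t) (u r - u t) \<le> B" using d(2)[OF rt] unfolding L.nrm_def by simp
    hence "holder_const * ip (u r - u t) (u r - u t) powr \<alpha> \<le> holder_const * B powr \<alpha>"
      using holder_const alpha L.nonneg[OF H] by (intro mult_left_mono powr_mono2) auto
    hence "ip (nl (u r) - nl (u t)) (nl (u r) - nl (u t)) < \<epsilon>\<^sup>2" using nl_holder[OF b] B(2) by linarith
    thus ?thesis unfolding L.nrm_def using e by (intro real_less_lsqrt) auto
  qed
  thus ?thesis using d(1) by blast
qed

text \<open>
  The right-hand side of the equation as a functional on the energy space.
\<close>
definition time_deriv :: "(real \<Rightarrow> real ^ 'n \<Rightarrow> real) \<Rightarrow> real \<Rightarrow> (real ^ 'n \<Rightarrow> real) \<Rightarrow> real" where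
  "time_deriv u t v = ip (nl (u t)) v - energy s (u t) v"

lemma ip_bound_X0s: assumes "f \<in> Hsp" "v \<in> Vsp" shows "\<bar>ip f v\<bar> \<le> (L.nrm f * sqrt poincare_const) * X0s_norm s v"
proof -
  have "\<bar>ip f v\<bar> \<le> L.nrm f * L.nrm v" by (rule L.cauchy_schwarz[OF assms(1) Vsp_Hsp[OF assms(2)]])
  also have "\<dots> \<le> L.nrm f * (sqrt poincare_const * En.nrm v)"
    by (rule mult_left_mono[OF nrm_poincare_energy[OF assms(2)] L.nrm_nonneg[OF assms(1)]])
  finally show ?thesis by (simp add: En_nrm mult.assoc)
qed

lemma energy_bound_X0s: assumes "f \<in> Vsp" "v \<in> Vsp" shows "\<bar>energy s f v\<bar> \<le> En.nrm f * X0s_norm s v"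
  using En.cauchy_schwarz[OF assms] by (simp only: En_nrm)

lemma classical_bounds:
  assumes u: "classical M T u" and T: "0 \<le> T"
  shows "\<exists>C\<ge>0. \<forall>t\<in>{0..T}. L.nrm (nl (u t)) * sqrt poincare_const \<le> C \<and> En.nrm (u t) \<le> C"
proof -
  have c1: "continuous_on {0..T} (\<lambda>t. En.nrm (u t))" unfolding continuous_on_iff
  proof (intro ballI allI impI)
    fix t \<epsilon> :: real assume t: "t \<in> {0..T}" and e: "0 < \<epsilon>"
    obtain \<delta> where d: "0 < \<delta>" "\<And>r t. \<lbrakk>r \<in> {0..T}; t \<in> {0..T}; \<bar>r - t\<bar> < \<delta>\<rbrakk> \<Longrightarrow> En.nrm (u r - u t) < \<epsilon>"
      using classicalD(3)[OF u e] by blast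
    have "dist (En.nrm (u r)) (En.nrm (u t)) < \<epsilon>" if "r \<in> {0..T}" "dist r t < \<delta>" for r
      using d(2)[OF that(1) t] En.nrm_reverse[OF classicalD(1)[OF u that(1)] classicalD(1)[OF u t]] that(2)
      unfolding dist_real_def by linarith
    thus "\<exists>d>0. \<forall>x'\<in>{0..T}. dist x' t < d \<longrightarrow> dist (En.nrm (u x')) (En.nrm (u t)) < \<epsilon>" using d(1) by blast
  qed
  have c2: "continuous_on {0..T} (\<lambda>t. L.nrm (nl (u t)))" unfolding continuous_on_iff
  proof (intro ballI allI impI)
    fix t \<epsilon> :: real assume t: "t \<in> {0..T}" and e: "0 < \<epsilon>"
    obtain \<delta> where d: "0 < \<delta>" "\<And>r t. \<lbrakk>r \<in> {0..T}; t \<in> {0..T}; \<bar>r - t\<bar> < \<delta>\<rbrakk> \<Longrightarrow> L.nrm (nl (u r) - nl (u t)) < \<epsilon>"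
      using classical_nl_continuous[OF u e] by blast
    have "dist (L.nrm (nl (u r))) (L.nrm (nl (u t))) < \<epsilon>" if "r \<in> {0..T}" "dist r t < \<delta>" for r
      using d(2)[OF that(1) t] L.nrm_reverse[OF nl_Hsp[OF classicalD(2)[OF u that(1)]] nl_Hsp[OF classicalD(2)[OF u t]]] that(2)
      unfolding dist_real_def by linarith
    thus "\<exists>d>0. \<forall>x'\<in>{0..T}. dist x' t < d \<longrightarrow> dist (L.nrm (nl (u x'))) (L.nrm (nl (u t))) < \<epsilon>" using d(1) by blast
  qed
  define h where "h t = L.nrm (nl (u t)) * sqrt poincare_const + En.nrm (u t)" for t
  have "continuous_on {0..T} h" unfolding h_def by (intro continuous_intros c1 c2)
  then obtain x where x: "x \<in> {0..T}" "\<And>t. t \<in> {0..T} \<Longrightarrow> h t \<le> h x"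
    using continuous_attains_sup[of "{0..T}" h] T by auto
  have p: "0 \<le> L.nrm (nl (u t)) * sqrt poincare_const" "0 \<le> En.nrm (u t)" if "t \<in> {0..T}" for t
    using L.nrm_nonneg[OF nl_Hsp[OF classicalD(2)[OF u that]]] En.nrm_nonneg[OF classicalD(1)[OF u that]] poincare_const(1)
    by simp_all
  have "L.nrm (nl (u t)) * sqrt poincare_const \<le> h x \<and> En.nrm (u t) \<le> h x" if "t \<in> {0..T}" for t
    using x(2)[OF that] p[OF that] unfolding h_def by linarith
  moreover have "0 \<le> h x" using p[OF x(1)] by (simp add: h_def)
  ultimately show ?thesis by blast
qed

text \<open>
  Both terms of \<open>time_deriv\<close> depend on time continuously in the dual norm, the energy by continuity of
  the curve and the reaction by \<open>nl_holder\<close>.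
\<close>
lemma classical_time_deriv_L2:
  assumes u: "classical M T u" and T: "0 \<le> T"
  shows "time_deriv u \<in> L2_X0s_dual \<Omega> s T"
proof (rule continuous_bochner_L2)
  note C = classicalD[OF u]
  obtain B where B: "0 \<le> B" "\<And>t. t \<in> {0..T} \<Longrightarrow> L.nrm (nl (u t)) * sqrt poincare_const \<le> B" "\<And>t. t \<in> {0..T} \<Longrightarrow> En.nrm (u t) \<le> B"
    using classical_bounds[OF u T] by blast
  have xn: "0 \<le> X0s_norm s v" if "v \<in> Vsp" for v using En.nrm_nonneg[OF that] by (simp only: En_nrm)
  have bd: "\<bar>time_deriv u t v\<bar> \<le> (2 * B) * X0s_norm s v" if t: "t \<in> {0..T}" and v: "v \<in> Vsp" for t v
  proof -
    have "\<bar>ip (nl (u t)) v\<bar> \<le> (L.nrm (nl (u t)) * sqrt poincare_const) * X0s_norm s v"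
      by (rule ip_bound_X0s[OF nl_Hsp[OF C(2)[OF t]] v])
    also have "\<dots> \<le> B * X0s_norm s v" by (rule mult_right_mono[OF B(2)[OF t] xn[OF v]])
    finally have a: "\<bar>ip (nl (u t)) v\<bar> \<le> B * X0s_norm s v" .
    have "\<bar>energy s (u t) v\<bar> \<le> En.nrm (u t) * X0s_norm s v" by (rule energy_bound_X0s[OF C(1)[OF t] v])
    also have "\<dots> \<le> B * X0s_norm s v" by (rule mult_right_mono[OF B(3)[OF t] xn[OF v]])
    finally show ?thesis using a unfolding time_deriv_def by linarith
  qed
  have db: "\<bar>time_deriv u r v - time_deriv u t v\<bar> \<le> (L.nrm (nl (u r) - nl (u t)) * sqrt poincare_const + En.nrm (u r - u t)) * X0s_norm s v"
    if r: "r \<in> {0..T}" and t: "t \<in> {0..T}" and v: "v \<in> Vsp" for r t v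
  proof -
    have nH: "nl (u r) \<in> Hsp" "nl (u t) \<in> Hsp" using nl_Hsp C(2) r t by auto
    have "time_deriv u r v - time_deriv u t v = ip (nl (u r) - nl (u t)) v - energy s (u r - u t) v"
      unfolding time_deriv_def L.diff_left[OF nH Vsp_Hsp[OF v]] En.diff_left[OF C(1)[OF r] C(1)[OF t] v] by simp
    moreover have "\<bar>ip (nl (u r) - nl (u t)) v\<bar> \<le> (L.nrm (nl (u r) - nl (u t)) * sqrt poincare_const) * X0s_norm s v"
      by (rule ip_bound_X0s[OF L.S_diff[OF nH] v])
    moreover have "\<bar>energy s (u r - u t) v\<bar> \<le> En.nrm (u r - u t) * X0s_norm s v"
      by (rule energy_bound_X0s[OF En.S_diff[OF C(1)[OF r] C(1)[OF t]] v])
    ultimately show ?thesis unfolding distrib_right by linarith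
  qed
  show "time_deriv u t \<in> X0s_dual \<Omega> s" if t: "t \<in> {0..T}" for t
    unfolding X0s_dual_def
  proof (intro CollectI conjI ballI allI exI[of _ "2 * B"])
    fix v w k assume v: "v \<in> Vsp"
    have nH: "nl (u t) \<in> Hsp" by (rule nl_Hsp[OF C(2)[OF t]])
    show "\<bar>time_deriv u t v\<bar> \<le> 2 * B * X0s_norm s v" by (rule bd[OF t v])
    show "time_deriv u t (\<lambda>x. k * v x) = k * time_deriv u t v"
      using L.scale_right[OF Vsp_Hsp[OF v] nH, of k] En.scale_right[OF v C(1)[OF t], of k]
      unfolding time_deriv_def scaleR_fun_def by (simp add: right_diff_distrib)
    assume w: "w \<in> Vsp"
    show "time_deriv u t (\<lambda>x. v x + w x) = time_deriv u t v + time_deriv u t w"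
      using L.add_right[OF Vsp_Hsp[OF v] Vsp_Hsp[OF w] nH] En.add_right[OF v w C(1)[OF t]]
      unfolding time_deriv_def plus_fun_def by linarith
  qed
  have B2: "0 \<le> 2 * B" using B(1) by simp
  have zV: "(0 :: real ^ 'n \<Rightarrow> real) \<in> Vsp" "X0s_norm s (0 :: real ^ 'n \<Rightarrow> real) \<le> 1"
    using En.S_zero En.nrm_zero unfolding En_nrm by auto
  show "0 \<le> X0s_dual_norm \<Omega> s (\<lambda>v. time_deriv u r v - time_deriv u t v)" if r: "r \<in> {0..T}" and t: "t \<in> {0..T}" for r t
  proof -
    have "\<bar>time_deriv u r 0 - time_deriv u t 0\<bar> \<le> X0s_dual_norm \<Omega> s (\<lambda>v. time_deriv u r v - time_deriv u t v)"
    proof (rule dual_norm_ge[where C="4 * B" and v=0, OF _ _ zV])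
      fix v assume v: "v \<in> Vsp"
      show "\<bar>time_deriv u r v - time_deriv u t v\<bar> \<le> 4 * B * X0s_norm s v" using bd[OF r v] bd[OF t v] by linarith
    qed (use B(1) in simp)
    thus ?thesis by linarith
  qed
  have tri: "X0s_dual_norm \<Omega> s (time_deriv u r) \<le> X0s_dual_norm \<Omega> s (time_deriv u t) + X0s_dual_norm \<Omega> s (\<lambda>v. time_deriv u r v - time_deriv u t v)"
    if "r \<in> {0..T}" "t \<in> {0..T}" for r t
    by (rule dual_norm_triangle[OF bd[OF that(1)] bd[OF that(2)] B2])
  have comm: "X0s_dual_norm \<Omega> s (\<lambda>v. time_deriv u t v - time_deriv u r v) = X0s_dual_norm \<Omega> s (\<lambda>v. time_deriv u r v - time_deriv u t v)" for r t
    unfolding X0s_dual_norm_def by (simp add: abs_minus_commute)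
  show "\<bar>X0s_dual_norm \<Omega> s (time_deriv u r) - X0s_dual_norm \<Omega> s (time_deriv u t)\<bar> \<le> X0s_dual_norm \<Omega> s (\<lambda>v. time_deriv u r v - time_deriv u t v)"
    if "r \<in> {0..T}" "t \<in> {0..T}" for r t
    using tri[OF that] tri[OF that(2,1)] comm[of t r] by linarith
  show "\<exists>\<delta>>0. \<forall>r\<in>{0..T}. \<forall>t\<in>{0..T}. \<bar>r - t\<bar> < \<delta> \<longrightarrow> X0s_dual_norm \<Omega> s (\<lambda>v. time_deriv u r v - time_deriv u t v) < \<epsilon>"
    if e: "0 < \<epsilon>" for \<epsilon>
  proof -
    define \<eta> where "\<eta> = \<epsilon> / (2 * (sqrt poincare_const + 1))"
    have P: "0 < sqrt poincare_const" using poincare_const(1) by simp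
    have P1: "0 < 2 * (sqrt poincare_const + 1)" by (intro mult_pos_pos add_pos_pos P) simp_all
    have eta: "0 < \<eta>" unfolding \<eta>_def by (rule divide_pos_pos[OF e P1])
    obtain d1 where d1: "0 < d1" "\<And>r t. \<lbrakk>r \<in> {0..T}; t \<in> {0..T}; \<bar>r - t\<bar> < d1\<rbrakk> \<Longrightarrow> L.nrm (nl (u r) - nl (u t)) < \<eta>"
      using classical_nl_continuous[OF u eta] by blast
    obtain d2 where d2: "0 < d2" "\<And>r t. \<lbrakk>r \<in> {0..T}; t \<in> {0..T}; \<bar>r - t\<bar> < d2\<rbrakk> \<Longrightarrow> En.nrm (u r - u t) < \<eta>"
      using C(3)[OF eta] by blast
    have "X0s_dual_norm \<Omega> s (\<lambda>v. time_deriv u r v - time_deriv u t v) < \<epsilon>"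
      if rt: "r \<in> {0..T}" "t \<in> {0..T}" "\<bar>r - t\<bar> < min d1 d2" for r t
    proof -
      have a: "L.nrm (nl (u r) - nl (u t)) * sqrt poincare_const \<le> \<eta> * sqrt poincare_const"
        using d1(2)[OF rt(1,2)] rt(3) P by (intro mult_right_mono) auto
      have b: "En.nrm (u r - u t) \<le> \<eta>" using d2(2)[OF rt(1,2)] rt(3) by simp
      have n1: "0 \<le> L.nrm (nl (u r) - nl (u t))" by (rule L.nrm_nonneg[OF L.S_diff[OF nl_Hsp[OF C(2)[OF rt(1)]] nl_Hsp[OF C(2)[OF rt(2)]]]])
      have n2: "0 \<le> En.nrm (u r - u t)" by (rule En.nrm_nonneg[OF En.S_diff[OF C(1)[OF rt(1)] C(1)[OF rt(2)]]])
      have "X0s_dual_norm \<Omega> s (\<lambda>v. time_deriv u r v - time_deriv u t v) \<le> L.nrm (nl (u r) - nl (u t)) * sqrt poincare_const + En.nrm (u r - u t)"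
        by (rule dual_norm_le[OF db[OF rt(1,2)]]) (use n1 n2 P in auto)
      also have "\<dots> \<le> \<eta> * sqrt poincare_const + \<eta>" using a b by linarith
      also have "\<dots> = \<epsilon> / 2"
      proof -
        have "\<eta> * (2 * (sqrt poincare_const + 1)) = \<epsilon>" using P1 unfolding \<eta>_def by simp
        thus ?thesis by (simp add: algebra_simps)
      qed
      finally show ?thesis using e by linarith
    qed
    thus ?thesis using d1(1) d2(1) by (intro exI[of _ "min d1 d2"]) auto
  qed
qed

lemma classical_L2_X0s:
  assumes u: "classical M T u" shows "u \<in> L2_X0s \<Omega> s T"
proof (rule continuous_bochner_L2)
  note C = classicalD[OF u]
  have fd: "(\<lambda>b. u r b - u t b) = u r - u t" for r t by (rule ext) simp
  show "u t \<in> Vsp" if "t \<in> {0..T}" for t by (rule C(1)[OF that])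
  show "0 \<le> X0s_norm s (\<lambda>b. u r b - u t b)" if "r \<in> {0..T}" "t \<in> {0..T}" for r t
    unfolding fd En_nrm[symmetric] by (rule En.nrm_nonneg[OF En.S_diff[OF C(1)[OF that(1)] C(1)[OF that(2)]]])
  show "\<bar>X0s_norm s (u r) - X0s_norm s (u t)\<bar> \<le> X0s_norm s (\<lambda>b. u r b - u t b)" if "r \<in> {0..T}" "t \<in> {0..T}" for r t
    unfolding fd En_nrm[symmetric] by (rule En.nrm_reverse[OF C(1)[OF that(1)] C(1)[OF that(2)]])
  show "\<exists>\<delta>>0. \<forall>r\<in>{0..T}. \<forall>t\<in>{0..T}. \<bar>r - t\<bar> < \<delta> \<longrightarrow> X0s_norm s (\<lambda>b. u r b - u t b) < \<epsilon>" if "0 < \<epsilon>" for \<epsilon>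
    unfolding fd En_nrm[symmetric] by (rule C(3)[OF that])
qed

lemma classical_continuous_tests:
  assumes u: "classical M T u" and v: "v \<in> Vsp"
  shows "continuous_on {0..T} (\<lambda>t. ip (nl (u t)) v)" "continuous_on {0..T} (\<lambda>t. energy s (u t) v)"
proof -
  show "continuous_on {0..T} (\<lambda>t. ip (nl (u t)) v)"
    by (rule L.continuous_on_inner_left[OF nl_Hsp[OF classicalD(2)[OF u]] Vsp_Hsp[OF v] classical_nl_continuous[OF u]])
  show "continuous_on {0..T} (\<lambda>t. energy s (u t) v)"
    by (rule En.continuous_on_inner_left[OF classicalD(1)[OF u] v classicalD(3)[OF u]])
qed

text \<open>
  The product of \<open>ip (u t) v\<close> with a test function is continuously differentiable and vanishes at the end
  points, so the fundamental theorem of calculus gives the integration by parts.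
\<close>
lemma classical_time_derivative:
  assumes u: "classical M T u" and T: "0 < T"
  shows "is_time_derivative \<Omega> s T u (time_deriv u)"
  unfolding is_time_derivative_def
proof (intro ballI)
  fix v \<phi> assume v: "v \<in> Vsp" and phi: "\<phi> \<in> test_functions T"
  define F where "F t = ip (u t) v" for t
  define g where "g t = time_deriv u t v" for t
  have gc: "continuous_on {0..T} g" unfolding g_def time_deriv_def
    by (intro continuous_on_diff classical_continuous_tests[OF u v])
  have Fd: "(F has_real_derivative g t) (at t within {0..T})" if "t \<in> {0..T}" for t
    unfolding F_def g_def time_deriv_def by (rule classicalD(5)[OF u v that])
  have Fc: "continuous_on {0..T} F" by (rule DERIV_continuous_on[OF Fd])
  have d0: "\<phi> differentiable at t" "deriv \<phi> differentiable at t" for t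
  proof -
    have "(deriv ^^ k) \<phi> differentiable at t" for k using phi unfolding test_functions_def by blast
    from this[of 0] this[of "Suc 0"] show "\<phi> differentiable at t" "deriv \<phi> differentiable at t"
      unfolding funpow.simps o_def id_def .
  qed
  have pd: "(\<phi> has_real_derivative deriv \<phi> t) (at t within {0..T})" for t
    by (rule has_field_derivative_at_within[OF iffD2[OF DERIV_deriv_iff_real_differentiable d0(1)]])
  have pc: "continuous_on {0..T} \<phi>" "continuous_on {0..T} (deriv \<phi>)"
    by (intro continuous_at_imp_continuous_on ballI differentiable_imp_continuous_within d0)+
  have "closure {t. \<phi> t \<noteq> 0} \<subseteq> {0<..<T}" using phi unfolding test_functions_def by blast
  hence "{t. \<phi> t \<noteq> 0} \<subseteq> {0<..<T}" by (rule order_trans[OF closure_subset])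
  hence p0: "\<phi> 0 = 0" "\<phi> T = 0" by auto
  have "((\<lambda>t. g t * \<phi> t + F t * deriv \<phi> t) has_integral (F T * \<phi> T - F 0 * \<phi> 0)) {0..T}"
  proof (rule fundamental_theorem_of_calculus)
    fix t assume t: "t \<in> {0..T}"
    have "((\<lambda>t. F t * \<phi> t) has_real_derivative g t * \<phi> t + F t * deriv \<phi> t) (at t within {0..T})"
      by (rule DERIV_cong[OF DERIV_mult[OF Fd[OF t] pd[of t]]]) simp
    thus "((\<lambda>t. F t * \<phi> t) has_vector_derivative g t * \<phi> t + F t * deriv \<phi> t) (at t within {0..T})"
      unfolding has_real_derivative_iff_has_vector_derivative .
  qed (use T in simp)
  hence "integral {0..T} (\<lambda>t. g t * \<phi> t + F t * deriv \<phi> t) = 0" using p0 by (simp add: integral_unique)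
  moreover have c1: "continuous_on {0..T} (\<lambda>t. g t * \<phi> t)" and c2: "continuous_on {0..T} (\<lambda>t. F t * deriv \<phi> t)"
    by (intro continuous_on_mult gc Fc pc)+
  moreover have "integral {0..T} (\<lambda>t. g t * \<phi> t + F t * deriv \<phi> t) = integral {0..T} (\<lambda>t. g t * \<phi> t) + integral {0..T} (\<lambda>t. F t * deriv \<phi> t)"
    by (intro Henstock_Kurzweil_Integration.integral_add integrable_continuous_real c1 c2)
  ultimately have "integral {0..T} (\<lambda>t. g t * \<phi> t) = - integral {0..T} (\<lambda>t. F t * deriv \<phi> t)" by linarith
  hence "(LINT t|lebesgue_on {0<..<T}. g t * \<phi> t) = - (LINT t|lebesgue_on {0<..<T}. F t * deriv \<phi> t)"
    by (simp only: continuous_integrable_open_interval(2)[OF c1] continuous_integrable_open_interval(2)[OF c2])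
  thus "(LINT t|lebesgue_on {0<..<T}. time_deriv u t v * \<phi> t) =
      - (LINT t|lebesgue_on {0<..<T}. (LINT x|lebesgue_on \<Omega>. u t x * v x) * deriv \<phi> t)"
    unfolding F_def g_def .
qed

text \<open>
  The weak identity holds for almost every time by the definition of \<open>time_deriv\<close>; only the
  integrability of its terms along a Bochner test function needs an argument.
\<close>
theorem classical_finite_energy:
  assumes u: "classical M T u" and T: "0 < T"
  shows "finite_energy_solution \<Omega> s \<alpha> q T u"
  unfolding finite_energy_solution_def
proof (intro conjI bexI[of _ "time_deriv u"] ballI)
  note C = classicalD[OF u]
  have T0: "0 \<le> T" using T by simp
  have z: "0 \<in> {0..T}" using T by simp
  show "u \<in> L2_X0s \<Omega> s T" by (rule classical_L2_X0s[OF u])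
  show "time_deriv u \<in> L2_X0s_dual \<Omega> s T" by (rule classical_time_deriv_L2[OF u T0])
  show "is_time_derivative \<Omega> s T u (time_deriv u)" by (rule classical_time_derivative[OF u T])
  have ev: "\<forall>\<^sub>F t in at_right 0. t \<in> {0<..<T}" by (rule eventually_at_right_real[OF T])
  show "\<forall>\<^sub>F t in at_right 0. u t \<in> L2 (lebesgue_on \<Omega>)"
    using ev by eventually_elim (use Vsp_Hsp[OF C(1)] in auto)
  show "((\<lambda>t. L2_norm (lebesgue_on \<Omega>) (u t)) \<longlongrightarrow> 0) (at_right 0)"
  proof (rule tendstoI)
    fix \<epsilon> :: real assume e: "0 < \<epsilon>"
    obtain \<delta> where d: "0 < \<delta>" "\<And>r t. \<lbrakk>r \<in> {0..T}; t \<in> {0..T}; \<bar>r - t\<bar> < \<delta>\<rbrakk> \<Longrightarrow> L.nrm (u r - u t) < \<epsilon>"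
      using classical_H_continuous[OF u e] by blast
    have "\<forall>\<^sub>F t in at_right 0. t \<in> {0<..<min T \<delta>}" using T d(1) by (intro eventually_at_right_real) simp
    thus "\<forall>\<^sub>F t in at_right 0. dist (L2_norm (lebesgue_on \<Omega>) (u t)) 0 < \<epsilon>"
    proof eventually_elim
      case (elim t)
      hence t: "t \<in> {0..T}" "\<bar>t - 0\<bar> < \<delta>" by auto
      have H: "u t \<in> Hsp" "u 0 \<in> Hsp" using Vsp_Hsp[OF C(1)] t(1) z by auto
      have "L.nrm (u 0) = 0" using C(4) by (simp add: L.nrm_def)
      moreover have "\<bar>L.nrm (u t) - L.nrm (u 0)\<bar> \<le> L.nrm (u t - u 0)" by (rule L.nrm_reverse[OF H])
      moreover have "L.nrm (u t - u 0) < \<epsilon>" by (rule d(2)[OF t(1) z t(2)])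
      ultimately have "\<bar>L.nrm (u t)\<bar> < \<epsilon>" by linarith
      thus ?case by (simp add: L_nrm dist_real_def)
    qed
  qed
  fix \<phi> assume phi: "\<phi> \<in> L2_X0s \<Omega> s T"
  obtain B where B: "0 \<le> B" "\<And>t. t \<in> {0..T} \<Longrightarrow> L.nrm (nl (u t)) * sqrt poincare_const \<le> B" "\<And>t. t \<in> {0..T} \<Longrightarrow> En.nrm (u t) \<le> B"
    using classical_bounds[OF u T0] by blast
  have fd: "(\<lambda>b. v b - w b) = v - w" for v w :: "real ^ 'n \<Rightarrow> real" by (rule ext) simp
  have xn: "0 \<le> X0s_norm s v" if "v \<in> Vsp" for v using En.nrm_nonneg[OF that] by (simp only: En_nrm)
  have b1: "\<bar>ip (nl (u t)) v\<bar> \<le> B * X0s_norm s v" if t: "t \<in> {0..T}" and v: "v \<in> Vsp" for t v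
    using ip_bound_X0s[OF nl_Hsp[OF C(2)[OF t]] v] mult_right_mono[OF B(2)[OF t] xn[OF v]] by linarith
  have b2: "\<bar>energy s (u t) v\<bar> \<le> B * X0s_norm s v" if t: "t \<in> {0..T}" and v: "v \<in> Vsp" for t v
    using energy_bound_X0s[OF C(1)[OF t] v] mult_right_mono[OF B(3)[OF t] xn[OF v]] by linarith
  have i1: "integrable (lebesgue_on {0<..<T}) (\<lambda>t. ip (nl (u t)) (\<phi> t))"
  proof (rule functional_integrable[OF phi, where F="\<lambda>t v. ip (nl (u t)) v" and C=B])
    fix t v w assume t: "t \<in> {0..T}" and v: "v \<in> Vsp" and w: "w \<in> Vsp"
    show "\<bar>ip (nl (u t)) v - ip (nl (u t)) w\<bar> \<le> B * X0s_norm s (\<lambda>b. v b - w b)"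
      unfolding fd L.diff_right[OF Vsp_Hsp[OF v] Vsp_Hsp[OF w] nl_Hsp[OF C(2)[OF t]], symmetric]
      by (rule b1[OF t En.S_diff[OF v w]])
  qed (use b1 B(1) classical_continuous_tests(1)[OF u] in auto)
  have i2: "integrable (lebesgue_on {0<..<T}) (\<lambda>t. energy s (u t) (\<phi> t))"
  proof (rule functional_integrable[OF phi, where F="\<lambda>t v. energy s (u t) v" and C=B])
    fix t v w assume t: "t \<in> {0..T}" and v: "v \<in> Vsp" and w: "w \<in> Vsp"
    show "\<bar>energy s (u t) v - energy s (u t) w\<bar> \<le> B * X0s_norm s (\<lambda>b. v b - w b)"
      unfolding fd En.diff_right[OF v w C(1)[OF t], symmetric]
      by (rule b2[OF t En.S_diff[OF v w]])
  qed (use b2 B(1) classical_continuous_tests(2)[OF u] in auto)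
  have "(LINT t|lebesgue_on {0<..<T}. time_deriv u t (\<phi> t)) + (LINT t|lebesgue_on {0<..<T}. energy s (u t) (\<phi> t))
      = (LINT t|lebesgue_on {0<..<T}. ip (nl (u t)) (\<phi> t))"
    unfolding time_deriv_def by (simp only: Bochner_Integration.integral_diff[OF i1 i2] diff_add_cancel)
  thus "(LINT t|lebesgue_on {0<..<T}. time_deriv u t (\<phi> t)) + (LINT t|lebesgue_on {0<..<T}. energy s (u t) (\<phi> t))
      = (LINT t|lebesgue_on {0<..<T}. LINT x|lebesgue_on \<Omega>. q x * (\<bar>u t x\<bar> powr (\<alpha> - 1) * u t x) * \<phi> t x)"
    unfolding nl_def .
qed

end

text \<open>
  The solution is constructed on the unit time interval and replaced by its jointly measurable representative,
  for which the classical formulation persists.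
\<close>
theorem theorem1p1:
  fixes \<Omega> O' :: "(real ^ 'n) set" and s \<alpha> q\<^sub>0 :: real and q :: "real ^ 'n \<Rightarrow> real"
  assumes "bounded_lipschitz_domain \<Omega>"
    and "0 < s" "s < 1"
    and "0 < \<alpha>" "\<alpha> < 1"
    and "q \<in> L_inf (lebesgue_on \<Omega>)"
    and "AE x in lebesgue_on \<Omega>. 0 \<le> q x"
    and "open O'" "O' \<noteq> {}" "O' \<subseteq> \<Omega>"
    and "0 < q\<^sub>0" "AE x in lebesgue_on O'. q\<^sub>0 \<le> q x"
  shows "\<exists>T>0. \<exists>u.
           (finite_energy_solution \<Omega> s \<alpha> q T u \<and> nontrivial_nonneg_bounded \<Omega> T u) \<and>
           (\<forall>\<tau>>0. finite_energy_solution \<Omega> s \<alpha> q (T + \<tau>) (time_shift \<tau> u) \<and>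
                  nontrivial_nonneg_bounded \<Omega> (T + \<tau>) (time_shift \<tau> u))"
proof -
  obtain Q' where q: "q \<in> borel_measurable (lebesgue_on \<Omega>)" "AE x in lebesgue_on \<Omega>. \<bar>q x\<bar> \<le> Q'"
    using assms(6) by (auto simp: L_inf_def)
  have O: "open \<Omega>" "bounded \<Omega>" using assms(1) by (auto simp: bounded_lipschitz_domain_def)
  have qb: "AE x in lebesgue_on \<Omega>. q x \<le> \<bar>Q'\<bar>" using q(2) by eventually_elim auto
  interpret frac_problem \<Omega> s \<alpha> q "\<bar>Q'\<bar>"
    by unfold_locales (use O assms(2-5,7) q(1) qb in auto)
  have "O' \<in> sets lebesgue" using assms(8) by auto
  hence q0: "AE x in lebesgue. x \<in> O' \<longrightarrow> q\<^sub>0 \<le> q x" using assms(12) by (simp add: AE_restrict_space_iff)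
  obtain M K v where M: "0 \<le> M" and st: "state M K v" and cl: "classical M 1 v"
    and nt: "\<And>t. t \<in> {0<..1} \<Longrightarrow> \<not> (AE x in lebesgue_on \<Omega>. v t x = 0)"
    using classical_solution_exists[OF assms(8-11) q0] by blast
  have vV: "v t \<in> Vsp" if "t \<in> {0..1}" for t by (rule classicalD(1)[OF cl that])
  define u where "u = joint_rep M v"
  have ae: "AE x in lebesgue. v t x = u t x" if "t \<in> {0..1}" for t unfolding u_def by (rule joint_rep_AE[OF st vV that])
  have clu: "classical M 1 u" by (rule classical_cong_AE[OF cl _ ae]) auto
  have ub: "0 \<le> u t x \<and> u t x \<le> M" for t x unfolding u_def by (rule joint_rep_bounds[OF M])
  have um: "(\<lambda>z. u (fst z - \<tau>) (snd z)) \<in> borel_measurable (lebesgue :: (real \<times> (real ^ 'n)) measure)" for \<tau>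
    unfolding u_def by (rule joint_rep_measurable[OF vV])
  have unt: "\<not> (AE x in lebesgue_on \<Omega>. u t x = 0)" if t: "t \<in> {0<..<1}" for t
  proof
    assume z: "AE x in lebesgue_on \<Omega>. u t x = 0"
    have "AE x in lebesgue_on \<Omega>. v t x = u t x" by (rule AE_dom_of_AE[OF ae]) (use t in auto)
    hence "AE x in lebesgue_on \<Omega>. v t x = 0" using z by eventually_elim simp
    thus False using nt[of t] t by simp
  qed
  show ?thesis
  proof (intro exI[of _ "1::real"] exI[of _ u] conjI allI impI)
    show "finite_energy_solution \<Omega> s \<alpha> q 1 u" by (rule classical_finite_energy[OF clu]) simp
    show "nontrivial_nonneg_bounded \<Omega> 1 u"
      by (rule nontrivial_nonneg_boundedI[where a=0 and b=1, OF O(1) _ ub]) (use um[of 0] unt in auto)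
    fix \<tau> :: real assume \<tau>: "0 < \<tau>"
    have "classical M (1 + \<tau>) (time_shift \<tau> u)" by (rule classical_shift[OF clu]) (use \<tau> in auto)
    thus "finite_energy_solution \<Omega> s \<alpha> q (1 + \<tau>) (time_shift \<tau> u)"
      by (rule classical_finite_energy) (use \<tau> in simp)
    show "nontrivial_nonneg_bounded \<Omega> (1 + \<tau>) (time_shift \<tau> u)"
    proof (rule nontrivial_nonneg_boundedI[where M=M and a=\<tau> and b="1 + \<tau>", OF O(1)])
      have f: "(\<lambda>z. fst z) \<in> borel_measurable (lebesgue :: (real \<times> (real ^ 'n)) measure)"
        by (intro borel_measurable_lebesgue_fst measurable_completion) simp
      have "(\<lambda>z. if fst z \<le> \<tau> then 0 else u (fst z - \<tau>) (snd z)) \<in> borel_measurable (lebesgue :: (real \<times> (real ^ 'n)) measure)"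
        using f um[of \<tau>] by measurable
      moreover have "(\<lambda>z. time_shift \<tau> u (fst z) (snd z)) = (\<lambda>z. if fst z \<le> \<tau> then 0 else u (fst z - \<tau>) (snd z))"
        by (auto simp: time_shift_def)
      ultimately show "(\<lambda>z. time_shift \<tau> u (fst z) (snd z)) \<in> borel_measurable (lebesgue :: (real \<times> (real ^ 'n)) measure)"
        by (simp only:)
      show "0 \<le> time_shift \<tau> u t x \<and> time_shift \<tau> u t x \<le> M" for t x
        using ub[of "t - \<tau>" x] M by (simp add: time_shift_def)
      show "\<not> (AE x in lebesgue_on \<Omega>. time_shift \<tau> u t x = 0)" if t: "t \<in> {\<tau><..<1 + \<tau>}" for t
        using unt[of "t - \<tau>"] t by (simp add: time_shift_def)
    qed (use \<tau> in auto)
  qed auto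
qed

end
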